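(* Let $R$ be a commutative ring, $Q$ a finite quiver with double $\overline{Q}$, $\mathcal{C}$ a $\otimes$-cocomplete $R$-linear symmetric monoidal category, and $c_i\in\mathcal{C}$ a dualisable object for each vertex $i$ of $\overline{Q}$. Put $h_a^\vee=c_{s(a)}\otimes c_{t(a)}^\vee$ for each arrow $a$ of $\overline{Q}$ and $h^\vee=\bigoplus_{a\in\overline{Q}_1}h_a^\vee$. Let $\{-,-\}^+:Sh^\vee\otimes Sh^\vee\to Sh^\vee$ be the unique bi-derivation whose restriction to $h_a^\vee\otimes h_b^\vee$, for all arrows $a,b$, is $\langle a,b\rangle\,\kappa_{ab}$ followed by the canonical map $h_a^\vee\otimes h_a^\vee\otimes h_b^\vee\otimes h_b^\vee\to Sh^\vee$. Then $(Sh^\vee,\{-,-\}^+)$ is a Poisson algebra in $\mathcal{C}$.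
   Context: The double $\overline{Q}$ of $Q=(s,t:Q_1\to Q_0)$ has the same vertices and arrows $Q_1\sqcup\{\overline{a}\mid a\in Q_1\}$, with $s(\overline{a})=t(a)$, $t(\overline{a})=s(a)$. The pairing on arrows is $\langle a,b\rangle=1$ if $a\in Q_1$, $b=\overline{a}$; $-1$ if $b\in Q_1$, $a=\overline{b}$; $0$ otherwise. Two arrows are in involution if one is the double of the other. $\otimes$-cocomplete: all small colimits exist and $\otimes$ preserves them in each variable. $Sx=\bigsqcup_n(x^{\otimes n})_{S_n}$ is the free commutative monoid on $x$. Duality data of $c$: $\mathrm{ev}:c^\vee\otimes c\to1$, $\mathrm{coev}:1\to c\otimes c^\vee$ satisfying the snake identities. For $a,b$ in involution, with $i=s(a)=t(b)$, $j=t(a)=s(b)$, so $h_a^\vee=c_i\otimes c_j^\vee$, $h_b^\vee=c_j\otimes c_i^\vee$, the map $\kappa_{ab}:h_a^\vee\otimes h_b^\vee\to h_a^\vee\otimes h_a^\vee\otimes h_b^\vee\otimes h_b^\vee$ is obtained by tensoring the identity of $h_a^\vee\otimes h_b^\vee$ with $\mathrm{coev}_{c_i}$ and $\mathrm{coev}_{c_j}$ and permuting by the symmetry as follows. Number the output factors $(c_i)_1\otimes(c_j^\vee)_2\otimes(c_i)_3\otimes(c_j^\vee)_4\otimes(c_j)_5\otimes(c_i^\vee)_6\otimes(c_j)_7\otimes(c_i^\vee)_8$. The input factors $c_i,c_j^\vee$ of $h_a^\vee$ go to positions $3,2$; the input factors $c_j,c_i^\vee$ of $h_b^\vee$ go to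 positions $7,6$; the legs $c_i,c_i^\vee$ of $\mathrm{coev}_{c_i}$ go to positions $1,8$; the legs $c_j,c_j^\vee$ of $\mathrm{coev}_{c_j}$ go to positions $5,4$. If $a,b$ are not in involution the component $\langle a,b\rangle\kappa_{ab}$ is $0$. For a commutative monoid $m$ in $\mathcal C$, a bi-derivation is a map $m\otimes m\to m$ satisfying the Leibniz rule in each variable separately and vanishing when the unit is inserted in either variable; bi-derivations on $Sx$ are in bijection, by restriction, with maps $x\otimes x\to Sx$. A Poisson algebra in $\mathcal{C}$ is a commutative monoid $m$ with a bi-derivation $\{-,-\}$ satisfying $\{-,-\}\circ\sigma_{m,m}=-\{-,-\}$ ($\sigma$ the symmetry) and $\{-,-\}\circ(\mathrm{id}\otimes\{-,-\})\circ\mathfrak{S}_3=0$, where $\mathfrak{S}_3$ is the sum of the three cyclic permutations of $m^{\otimes3}$. *)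

theory Defs
  imports
    "HOL-Algebra.Module"
    "HOL-Combinatorics.Multiset_Permutations"
    "Graph_Theory.Digraph"
begin

section \<open>Categories and colimits\<close>

record ('o, 'm) cat =
  Obj :: "'o set"
  Arr :: "'m set"
  Dom :: "'m \<Rightarrow> 'o"
  Cod :: "'m \<Rightarrow> 'o"
  Idn :: "'o \<Rightarrow> 'm"  ("id\<^sub>a\<index>")
  Comp :: "'m \<Rightarrow> 'm \<Rightarrow> 'm"  (infixr "\<cdot>\<index>" 65)

definition hom_set :: "('o, 'm, 'x) cat_scheme \<Rightarrow> 'o \<Rightarrow> 'o \<Rightarrow> 'm set" where
  "hom_set C A B = {f \<in> Arr C. Dom C f = A \<and> Cod C f = B}"

locale category =
  fixes C :: "('o, 'm, 'x) cat_scheme" (structure)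
  assumes Dom_Obj: "f \<in> Arr C \<Longrightarrow> Dom C f \<in> Obj C"
    and Cod_Obj: "f \<in> Arr C \<Longrightarrow> Cod C f \<in> Obj C"
    and Idn_hom: "A \<in> Obj C \<Longrightarrow> id\<^sub>a A \<in> hom_set C A A"
    and Comp_hom: "\<lbrakk>f \<in> hom_set C A B; g \<in> hom_set C B D\<rbrakk> \<Longrightarrow> g \<cdot> f \<in> hom_set C A D"
    and Comp_Idn_left: "f \<in> hom_set C A B \<Longrightarrow> id\<^sub>a B \<cdot> f = f"
    and Comp_Idn_right: "f \<in> hom_set C A B \<Longrightarrow> f \<cdot> id\<^sub>a A = f"
    and Comp_assoc:
      "\<lbrakk>f \<in> hom_set C A B; g \<in> hom_set C B D; k \<in> hom_set C D E\<rbrakk> \<Longrightarrow> (k \<cdot> g) \<cdot> f = k \<cdot> (g \<cdot> f)"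

definition inverse_arrows :: "('o, 'm, 'x) cat_scheme \<Rightarrow> 'm \<Rightarrow> 'm \<Rightarrow> bool" where
  "inverse_arrows C f g \<longleftrightarrow>
     f \<in> Arr C \<and> g \<in> hom_set C (Cod C f) (Dom C f) \<and>
     g \<cdot>\<^bsub>C\<^esub> f = id\<^sub>a\<^bsub>C\<^esub> (Dom C f) \<and> f \<cdot>\<^bsub>C\<^esub> g = id\<^sub>a\<^bsub>C\<^esub> (Cod C f)"

definition is_iso :: "('o, 'm, 'x) cat_scheme \<Rightarrow> 'm \<Rightarrow> bool" where
  "is_iso C f \<longleftrightarrow> (\<exists>g. inverse_arrows C f g)"

definition inverse_arrow :: "('o, 'm, 'x) cat_scheme \<Rightarrow> 'm \<Rightarrow> 'm"  ("inv\<^sub>a\<index> _" [90] 90) where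
  "inverse_arrow C f = (THE g. inverse_arrows C f g)"

definition is_diagram ::
  "('j, 'k, 'y) cat_scheme \<Rightarrow> ('o, 'm, 'x) cat_scheme \<Rightarrow> ('j \<Rightarrow> 'o) \<Rightarrow> ('k \<Rightarrow> 'm) \<Rightarrow> bool" where
  "is_diagram J C Fo Fa \<longleftrightarrow>
     category J \<and>
     (\<forall>j \<in> Obj J. Fo j \<in> Obj C) \<and>
     (\<forall>u \<in> Arr J. Fa u \<in> hom_set C (Fo (Dom J u)) (Fo (Cod J u))) \<and>
     (\<forall>j \<in> Obj J. Fa (id\<^sub>a\<^bsub>J\<^esub> j) = id\<^sub>a\<^bsub>C\<^esub> (Fo j)) \<and>
     (\<forall>u \<in> Arr J. \<forall>v \<in> Arr J. Cod J u = Dom J v \<longrightarrow> Fa (v \<cdot>\<^bsub>J\<^esub> u) = Fa v \<cdot>\<^bsub>C\<^esub> Fa u)"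

definition is_cocone ::
  "('j, 'k, 'y) cat_scheme \<Rightarrow> ('o, 'm, 'x) cat_scheme \<Rightarrow> ('j \<Rightarrow> 'o) \<Rightarrow> ('k \<Rightarrow> 'm) \<Rightarrow>
   'o \<Rightarrow> ('j \<Rightarrow> 'm) \<Rightarrow> bool" where
  "is_cocone J C Fo Fa L l \<longleftrightarrow>
     L \<in> Obj C \<and>
     (\<forall>j \<in> Obj J. l j \<in> hom_set C (Fo j) L) \<and>
     (\<forall>u \<in> Arr J. l (Cod J u) \<cdot>\<^bsub>C\<^esub> Fa u = l (Dom J u))"

definition is_colimit ::
  "('j, 'k, 'y) cat_scheme \<Rightarrow> ('o, 'm, 'x) cat_scheme \<Rightarrow> ('j \<Rightarrow> 'o) \<Rightarrow> ('k \<Rightarrow> 'm) \<Rightarrow>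
   'o \<Rightarrow> ('j \<Rightarrow> 'm) \<Rightarrow> bool" where
  "is_colimit J C Fo Fa L l \<longleftrightarrow>
     is_cocone J C Fo Fa L l \<and>
     (\<forall>M k. is_cocone J C Fo Fa M k \<longrightarrow>
        (\<exists>!f. f \<in> hom_set C L M \<and> (\<forall>j \<in> Obj J. f \<cdot>\<^bsub>C\<^esub> l j = k j)))"

definition is_coproduct ::
  "('o, 'm, 'x) cat_scheme \<Rightarrow> 'i set \<Rightarrow> ('i \<Rightarrow> 'o) \<Rightarrow> 'o \<Rightarrow> ('i \<Rightarrow> 'm) \<Rightarrow> bool" where
  "is_coproduct C I X S j \<longleftrightarrow>
     S \<in> Obj C \<and> (\<forall>i \<in> I. j i \<in> hom_set C (X i) S) \<and>
     (\<forall>Y g. Y \<in> Obj C \<and> (\<forall>i \<in> I. g i \<in> hom_set C (X i) Y) \<longrightarrow>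
        (\<exists>!f. f \<in> hom_set C S Y \<and> (\<forall>i \<in> I. f \<cdot>\<^bsub>C\<^esub> j i = g i)))"

section \<open>Symmetric monoidal categories\<close>

record ('o, 'm) smcat = "('o, 'm) cat" +
  TensO :: "'o \<Rightarrow> 'o \<Rightarrow> 'o"  (infixr "\<otimes>\<^sub>o\<index>" 70)
  TensA :: "'m \<Rightarrow> 'm \<Rightarrow> 'm"  (infixr "\<otimes>\<^sub>a\<index>" 70)
  Unt :: 'o  ("\<I>\<index>")
  Assoc :: "'o \<Rightarrow> 'o \<Rightarrow> 'o \<Rightarrow> 'm"  ("\<alpha>\<^sub>a\<index>")
  LUnit :: "'o \<Rightarrow> 'm"  ("\<lambda>\<^sub>u\<index>")
  RUnit :: "'o \<Rightarrow> 'm"  ("\<rho>\<^sub>u\<index>")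
  Symm :: "'o \<Rightarrow> 'o \<Rightarrow> 'm"  ("\<sigma>\<^sub>a\<index>")

locale symmetric_monoidal_category = category C
  for C :: "('o, 'm, 'x) smcat_scheme" (structure) +
  assumes TensO_Obj: "\<lbrakk>A \<in> Obj C; B \<in> Obj C\<rbrakk> \<Longrightarrow> A \<otimes>\<^sub>o B \<in> Obj C"
    and TensA_hom: "\<lbrakk>f \<in> hom_set C A B; g \<in> hom_set C A' B'\<rbrakk> \<Longrightarrow>
      f \<otimes>\<^sub>a g \<in> hom_set C (A \<otimes>\<^sub>o A') (B \<otimes>\<^sub>o B')"
    and TensA_Idn: "\<lbrakk>A \<in> Obj C; B \<in> Obj C\<rbrakk> \<Longrightarrow> id\<^sub>a A \<otimes>\<^sub>a id\<^sub>a B = id\<^sub>a (A \<otimes>\<^sub>o B)"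
    and TensA_Comp: "\<lbrakk>f \<in> hom_set C A B; g \<in> hom_set C B D; f' \<in> hom_set C A' B'; g' \<in> hom_set C B' D'\<rbrakk> \<Longrightarrow>
      (g \<cdot> f) \<otimes>\<^sub>a (g' \<cdot> f') = (g \<otimes>\<^sub>a g') \<cdot> (f \<otimes>\<^sub>a f')"
    and Unt_Obj: "\<I> \<in> Obj C"
    and Assoc_hom: "\<lbrakk>A \<in> Obj C; B \<in> Obj C; D \<in> Obj C\<rbrakk> \<Longrightarrow>
      \<alpha>\<^sub>a A B D \<in> hom_set C ((A \<otimes>\<^sub>o B) \<otimes>\<^sub>o D) (A \<otimes>\<^sub>o (B \<otimes>\<^sub>o D))"
    and Assoc_iso: "\<lbrakk>A \<in> Obj C; B \<in> Obj C; D \<in> Obj C\<rbrakk> \<Longrightarrow> is_iso C (\<alpha>\<^sub>a A B D)"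
    and Assoc_natural: "\<lbrakk>f \<in> hom_set C A A'; g \<in> hom_set C B B'; k \<in> hom_set C D D'\<rbrakk> \<Longrightarrow>
      \<alpha>\<^sub>a A' B' D' \<cdot> ((f \<otimes>\<^sub>a g) \<otimes>\<^sub>a k) = (f \<otimes>\<^sub>a (g \<otimes>\<^sub>a k)) \<cdot> \<alpha>\<^sub>a A B D"
    and LUnit_hom: "A \<in> Obj C \<Longrightarrow> \<lambda>\<^sub>u A \<in> hom_set C (\<I> \<otimes>\<^sub>o A) A"
    and LUnit_iso: "A \<in> Obj C \<Longrightarrow> is_iso C (\<lambda>\<^sub>u A)"
    and LUnit_natural: "f \<in> hom_set C A B \<Longrightarrow> \<lambda>\<^sub>u B \<cdot> (id\<^sub>a \<I> \<otimes>\<^sub>a f) = f \<cdot> \<lambda>\<^sub>u A"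
    and RUnit_hom: "A \<in> Obj C \<Longrightarrow> \<rho>\<^sub>u A \<in> hom_set C (A \<otimes>\<^sub>o \<I>) A"
    and RUnit_iso: "A \<in> Obj C \<Longrightarrow> is_iso C (\<rho>\<^sub>u A)"
    and RUnit_natural: "f \<in> hom_set C A B \<Longrightarrow> \<rho>\<^sub>u B \<cdot> (f \<otimes>\<^sub>a id\<^sub>a \<I>) = f \<cdot> \<rho>\<^sub>u A"
    and Symm_hom: "\<lbrakk>A \<in> Obj C; B \<in> Obj C\<rbrakk> \<Longrightarrow> \<sigma>\<^sub>a A B \<in> hom_set C (A \<otimes>\<^sub>o B) (B \<otimes>\<^sub>o A)"
    and Symm_natural: "\<lbrakk>f \<in> hom_set C A A'; g \<in> hom_set C B B'\<rbrakk> \<Longrightarrow>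
      \<sigma>\<^sub>a A' B' \<cdot> (f \<otimes>\<^sub>a g) = (g \<otimes>\<^sub>a f) \<cdot> \<sigma>\<^sub>a A B"
    and Symm_Symm: "\<lbrakk>A \<in> Obj C; B \<in> Obj C\<rbrakk> \<Longrightarrow> \<sigma>\<^sub>a B A \<cdot> \<sigma>\<^sub>a A B = id\<^sub>a (A \<otimes>\<^sub>o B)"
    and pentagon: "\<lbrakk>A \<in> Obj C; B \<in> Obj C; D \<in> Obj C; E \<in> Obj C\<rbrakk> \<Longrightarrow>
      (id\<^sub>a A \<otimes>\<^sub>a \<alpha>\<^sub>a B D E) \<cdot> \<alpha>\<^sub>a A (B \<otimes>\<^sub>o D) E \<cdot> (\<alpha>\<^sub>a A B D \<otimes>\<^sub>a id\<^sub>a E)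
        = \<alpha>\<^sub>a A B (D \<otimes>\<^sub>o E) \<cdot> \<alpha>\<^sub>a (A \<otimes>\<^sub>o B) D E"
    and triangle: "\<lbrakk>A \<in> Obj C; B \<in> Obj C\<rbrakk> \<Longrightarrow>
      (id\<^sub>a A \<otimes>\<^sub>a \<lambda>\<^sub>u B) \<cdot> \<alpha>\<^sub>a A \<I> B = \<rho>\<^sub>u A \<otimes>\<^sub>a id\<^sub>a B"
    and hexagon: "\<lbrakk>A \<in> Obj C; B \<in> Obj C; D \<in> Obj C\<rbrakk> \<Longrightarrow>
      \<alpha>\<^sub>a B D A \<cdot> \<sigma>\<^sub>a A (B \<otimes>\<^sub>o D) \<cdot> \<alpha>\<^sub>a A B D
        = (id\<^sub>a B \<otimes>\<^sub>a \<sigma>\<^sub>a A D) \<cdot> \<alpha>\<^sub>a B A D \<cdot> (\<sigma>\<^sub>a A B \<otimes>\<^sub>a id\<^sub>a D)"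

text \<open>
  HOL has no universe of small sets. Smallness is relative to a type \<open>'i\<close>: a category is
  small if its objects and arrows are elements of \<open>'i\<close>.
\<close>

definition tensor_cocomplete :: "'i itself \<Rightarrow> ('o, 'm, 'x) smcat_scheme \<Rightarrow> bool" where
  "tensor_cocomplete TYPE('i) C \<longleftrightarrow>
     (\<forall>(J :: ('i, 'i) cat) Fo Fa. is_diagram J C Fo Fa \<longrightarrow> (\<exists>L l. is_colimit J C Fo Fa L l)) \<and>
     (\<forall>(J :: ('i, 'i) cat) Fo Fa L l X. is_diagram J C Fo Fa \<and> is_colimit J C Fo Fa L l \<and> X \<in> Obj C \<longrightarrow>
        is_colimit J C (\<lambda>j. X \<otimes>\<^sub>o\<^bsub>C\<^esub> Fo j) (\<lambda>u. id\<^sub>a\<^bsub>C\<^esub> X \<otimes>\<^sub>a\<^bsub>C\<^esub> Fa u)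
          (X \<otimes>\<^sub>o\<^bsub>C\<^esub> L) (\<lambda>j. id\<^sub>a\<^bsub>C\<^esub> X \<otimes>\<^sub>a\<^bsub>C\<^esub> l j) \<and>
        is_colimit J C (\<lambda>j. Fo j \<otimes>\<^sub>o\<^bsub>C\<^esub> X) (\<lambda>u. Fa u \<otimes>\<^sub>a\<^bsub>C\<^esub> id\<^sub>a\<^bsub>C\<^esub> X)
          (L \<otimes>\<^sub>o\<^bsub>C\<^esub> X) (\<lambda>j. l j \<otimes>\<^sub>a\<^bsub>C\<^esub> id\<^sub>a\<^bsub>C\<^esub> X))"

definition duality_data :: "('o, 'm, 'x) smcat_scheme \<Rightarrow> 'o \<Rightarrow> 'o \<Rightarrow> 'm \<Rightarrow> 'm \<Rightarrow> bool" where
  "duality_data C c cd ev coev \<longleftrightarrow>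
     c \<in> Obj C \<and> cd \<in> Obj C \<and>
     ev \<in> hom_set C (cd \<otimes>\<^sub>o\<^bsub>C\<^esub> c) \<I>\<^bsub>C\<^esub> \<and>
     coev \<in> hom_set C \<I>\<^bsub>C\<^esub> (c \<otimes>\<^sub>o\<^bsub>C\<^esub> cd) \<and>
     \<rho>\<^sub>u\<^bsub>C\<^esub> c \<cdot>\<^bsub>C\<^esub> (id\<^sub>a\<^bsub>C\<^esub> c \<otimes>\<^sub>a\<^bsub>C\<^esub> ev) \<cdot>\<^bsub>C\<^esub> \<alpha>\<^sub>a\<^bsub>C\<^esub> c cd c \<cdot>\<^bsub>C\<^esub> (coev \<otimes>\<^sub>a\<^bsub>C\<^esub> id\<^sub>a\<^bsub>C\<^esub> c)
       = \<lambda>\<^sub>u\<^bsub>C\<^esub> c \<and>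
     \<lambda>\<^sub>u\<^bsub>C\<^esub> cd \<cdot>\<^bsub>C\<^esub> (ev \<otimes>\<^sub>a\<^bsub>C\<^esub> id\<^sub>a\<^bsub>C\<^esub> cd) \<cdot>\<^bsub>C\<^esub> inv\<^sub>a\<^bsub>C\<^esub> (\<alpha>\<^sub>a\<^bsub>C\<^esub> cd c cd) \<cdot>\<^bsub>C\<^esub> (id\<^sub>a\<^bsub>C\<^esub> cd \<otimes>\<^sub>a\<^bsub>C\<^esub> coev)
       = \<rho>\<^sub>u\<^bsub>C\<^esub> cd"

section \<open>Iterated tensor products and permutations of factors\<close>

text \<open>The factors are bracketed to the right, with a trailing unit object.\<close>

primrec tens :: "('o, 'm, 'x) smcat_scheme \<Rightarrow> 'o list \<Rightarrow> 'o" where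
  "tens C [] = \<I>\<^bsub>C\<^esub>"
| "tens C (x # xs) = x \<otimes>\<^sub>o\<^bsub>C\<^esub> tens C xs"

primrec tens_arrow :: "('o, 'm, 'x) smcat_scheme \<Rightarrow> 'm list \<Rightarrow> 'm" where
  "tens_arrow C [] = id\<^sub>a\<^bsub>C\<^esub> \<I>\<^bsub>C\<^esub>"
| "tens_arrow C (f # fs) = f \<otimes>\<^sub>a\<^bsub>C\<^esub> tens_arrow C fs"

text \<open>\<open>tens C xs \<otimes>\<^sub>o tens C ys \<rightarrow> tens C (xs @ ys)\<close>\<close>

primrec tens_append :: "('o, 'm, 'x) smcat_scheme \<Rightarrow> 'o list \<Rightarrow> 'o list \<Rightarrow> 'm" where
  "tens_append C [] ys = \<lambda>\<^sub>u\<^bsub>C\<^esub> (tens C ys)"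
| "tens_append C (x # xs) ys =
     (id\<^sub>a\<^bsub>C\<^esub> x \<otimes>\<^sub>a\<^bsub>C\<^esub> tens_append C xs ys) \<cdot>\<^bsub>C\<^esub> \<alpha>\<^sub>a\<^bsub>C\<^esub> x (tens C xs) (tens C ys)"

text \<open>\<open>(x\<^sub>1 \<otimes>\<^sub>o y\<^sub>1) \<otimes>\<^sub>o (x\<^sub>2 \<otimes>\<^sub>o y\<^sub>2) \<otimes>\<^sub>o \<dots> \<rightarrow> x\<^sub>1 \<otimes>\<^sub>o y\<^sub>1 \<otimes>\<^sub>o x\<^sub>2 \<otimes>\<^sub>o y\<^sub>2 \<otimes>\<^sub>o \<dots>\<close> and its inverse\<close>

fun unpair :: "('o, 'm, 'x) smcat_scheme \<Rightarrow> ('o \<times> 'o) list \<Rightarrow> 'm" where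
  "unpair C [] = id\<^sub>a\<^bsub>C\<^esub> \<I>\<^bsub>C\<^esub>"
| "unpair C ((x, y) # ps) =
     \<alpha>\<^sub>a\<^bsub>C\<^esub> x y (tens C (concat (map (\<lambda>(u, v). [u, v]) ps))) \<cdot>\<^bsub>C\<^esub>
     (id\<^sub>a\<^bsub>C\<^esub> (x \<otimes>\<^sub>o\<^bsub>C\<^esub> y) \<otimes>\<^sub>a\<^bsub>C\<^esub> unpair C ps)"

definition pair_up :: "('o, 'm, 'x) smcat_scheme \<Rightarrow> ('o \<times> 'o) list \<Rightarrow> 'm" where
  "pair_up C ps = inv\<^sub>a\<^bsub>C\<^esub> (unpair C ps)"

text \<open>\<open>x \<otimes>\<^sub>o (y \<otimes>\<^sub>o z) \<rightarrow> y \<otimes>\<^sub>o (x \<otimes>\<^sub>o z)\<close>\<close>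

definition swap_front :: "('o, 'm, 'x) smcat_scheme \<Rightarrow> 'o \<Rightarrow> 'o \<Rightarrow> 'o \<Rightarrow> 'm" where
  "swap_front C x y z =
     \<alpha>\<^sub>a\<^bsub>C\<^esub> y x z \<cdot>\<^bsub>C\<^esub> (\<sigma>\<^sub>a\<^bsub>C\<^esub> x y \<otimes>\<^sub>a\<^bsub>C\<^esub> id\<^sub>a\<^bsub>C\<^esub> z) \<cdot>\<^bsub>C\<^esub> inv\<^sub>a\<^bsub>C\<^esub> (\<alpha>\<^sub>a\<^bsub>C\<^esub> x y z)"

definition remove_nth :: "nat \<Rightarrow> 'a list \<Rightarrow> 'a list" where
  "remove_nth i xs = take i xs @ drop (Suc i) xs"

text \<open>
  \<open>pull C i xs\<close>, for \<open>i < length xs\<close>, moves factor \<open>i\<close> to the front, keeping the order of the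
  others: \<open>tens C xs \<rightarrow> tens C (xs ! i # remove_nth i xs)\<close>.
\<close>

primrec pull :: "('o, 'm, 'x) smcat_scheme \<Rightarrow> nat \<Rightarrow> 'o list \<Rightarrow> 'm" where
  "pull C 0 xs = id\<^sub>a\<^bsub>C\<^esub> (tens C xs)"
| "pull C (Suc i) xs =
     swap_front C (hd xs) (tl xs ! i) (tens C (remove_nth i (tl xs))) \<cdot>\<^bsub>C\<^esub>
     (id\<^sub>a\<^bsub>C\<^esub> (hd xs) \<otimes>\<^sub>a\<^bsub>C\<^esub> pull C i (tl xs))"

text \<open>
  The symmetry isomorphism \<open>tens C xs \<rightarrow> tens C (map ((!) xs) p)\<close> whose output factor \<open>k\<close> is the
  input factor \<open>p ! k\<close>, where \<open>p\<close> is an arrangement of the positions \<open>0, \<dots>, length xs - 1\<close>. After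
  the factor \<open>i\<close> has been pulled out, the positions behind it are renumbered.
\<close>

fun tens_perm :: "('o, 'm, 'x) smcat_scheme \<Rightarrow> 'o list \<Rightarrow> nat list \<Rightarrow> 'm" where
  "tens_perm C xs [] = id\<^sub>a\<^bsub>C\<^esub> (tens C xs)"
| "tens_perm C xs (i # p) =
     (id\<^sub>a\<^bsub>C\<^esub> (xs ! i) \<otimes>\<^sub>a\<^bsub>C\<^esub>
        tens_perm C (remove_nth i xs) (map (\<lambda>k. if i < k then k - 1 else k) p)) \<cdot>\<^bsub>C\<^esub>
     pull C i xs"

section \<open>The free commutative monoid\<close>

text \<open>\<open>q\<close> exhibits \<open>P\<close> as the coinvariants of the symmetric group on \<open>n\<close> letters acting on the
  \<open>n\<close>-th tensor power of \<open>x\<close>.\<close>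

definition is_coinvariants ::
  "('o, 'm, 'x) smcat_scheme \<Rightarrow> 'o \<Rightarrow> nat \<Rightarrow> 'o \<Rightarrow> 'm \<Rightarrow> bool" where
  "is_coinvariants C x n P q \<longleftrightarrow>
     P \<in> Obj C \<and> q \<in> hom_set C (tens C (replicate n x)) P \<and>
     (\<forall>p \<in> permutations_of_set {..<n}. q \<cdot>\<^bsub>C\<^esub> tens_perm C (replicate n x) p = q) \<and>
     (\<forall>Y g. g \<in> hom_set C (tens C (replicate n x)) Y \<and>
        (\<forall>p \<in> permutations_of_set {..<n}. g \<cdot>\<^bsub>C\<^esub> tens_perm C (replicate n x) p = g) \<longrightarrow>
        (\<exists>!f. f \<in> hom_set C P Y \<and> f \<cdot>\<^bsub>C\<^esub> q = g))"

text \<open>\<open>S\<close> is the coproduct of the coinvariants of the tensor powers of \<open>x\<close>, and \<open>\<iota> n\<close> is the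
  canonical map from the \<open>n\<close>-th tensor power to \<open>S\<close>.\<close>

definition is_free_comm_monoid ::
  "('o, 'm, 'x) smcat_scheme \<Rightarrow> 'o \<Rightarrow> 'o \<Rightarrow> (nat \<Rightarrow> 'm) \<Rightarrow> bool" where
  "is_free_comm_monoid C x S \<iota> \<longleftrightarrow>
     x \<in> Obj C \<and>
     (\<exists>P q u. (\<forall>n. is_coinvariants C x n (P n) (q n)) \<and>
        is_coproduct C UNIV P S u \<and> (\<forall>n. \<iota> n = u n \<cdot>\<^bsub>C\<^esub> q n))"

definition free_mult :: "('o, 'm, 'x) smcat_scheme \<Rightarrow> 'o \<Rightarrow> 'o \<Rightarrow> (nat \<Rightarrow> 'm) \<Rightarrow> 'm" where
  "free_mult C x S \<iota> =
     (THE \<mu>. \<mu> \<in> hom_set C (S \<otimes>\<^sub>o\<^bsub>C\<^esub> S) S \<and>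
        (\<forall>m n. \<mu> \<cdot>\<^bsub>C\<^esub> (\<iota> m \<otimes>\<^sub>a\<^bsub>C\<^esub> \<iota> n) =
           \<iota> (m + n) \<cdot>\<^bsub>C\<^esub> tens_append C (replicate m x) (replicate n x)))"

definition free_unit :: "(nat \<Rightarrow> 'm) \<Rightarrow> 'm" where
  "free_unit \<iota> = \<iota> 0"

definition free_incl :: "('o, 'm, 'x) smcat_scheme \<Rightarrow> 'o \<Rightarrow> (nat \<Rightarrow> 'm) \<Rightarrow> 'm" where
  "free_incl C x \<iota> = \<iota> 1 \<cdot>\<^bsub>C\<^esub> inv\<^sub>a\<^bsub>C\<^esub> (\<rho>\<^sub>u\<^bsub>C\<^esub> x)"

definition commutative_monoid :: "('o, 'm, 'x) smcat_scheme \<Rightarrow> 'o \<Rightarrow> 'm \<Rightarrow> 'm \<Rightarrow> bool" where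
  "commutative_monoid C S \<mu> \<eta> \<longleftrightarrow>
     S \<in> Obj C \<and> \<mu> \<in> hom_set C (S \<otimes>\<^sub>o\<^bsub>C\<^esub> S) S \<and> \<eta> \<in> hom_set C \<I>\<^bsub>C\<^esub> S \<and>
     \<mu> \<cdot>\<^bsub>C\<^esub> (\<mu> \<otimes>\<^sub>a\<^bsub>C\<^esub> id\<^sub>a\<^bsub>C\<^esub> S) = \<mu> \<cdot>\<^bsub>C\<^esub> (id\<^sub>a\<^bsub>C\<^esub> S \<otimes>\<^sub>a\<^bsub>C\<^esub> \<mu>) \<cdot>\<^bsub>C\<^esub> \<alpha>\<^sub>a\<^bsub>C\<^esub> S S S \<and>
     \<mu> \<cdot>\<^bsub>C\<^esub> (\<eta> \<otimes>\<^sub>a\<^bsub>C\<^esub> id\<^sub>a\<^bsub>C\<^esub> S) = \<lambda>\<^sub>u\<^bsub>C\<^esub> S \<and>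
     \<mu> \<cdot>\<^bsub>C\<^esub> (id\<^sub>a\<^bsub>C\<^esub> S \<otimes>\<^sub>a\<^bsub>C\<^esub> \<eta>) = \<rho>\<^sub>u\<^bsub>C\<^esub> S \<and>
     \<mu> \<cdot>\<^bsub>C\<^esub> \<sigma>\<^sub>a\<^bsub>C\<^esub> S S = \<mu>"

section \<open>Linear structure, bi-derivations and Poisson algebras\<close>

record ('r, 'o, 'm) lsmcat = "('o, 'm) smcat" +
  HZero :: "'o \<Rightarrow> 'o \<Rightarrow> 'm"
  HAdd :: "'m \<Rightarrow> 'm \<Rightarrow> 'm"  (infixl "+\<^sub>a\<index>" 60)
  HSmult :: "'r \<Rightarrow> 'm \<Rightarrow> 'm"

text \<open>The library's \<open>module\<close> record extends the ring record, whose \<open>mult\<close> and \<open>one\<close> play no role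
  for modules.\<close>

definition hom_module :: "('r, 'o, 'm, 'x) lsmcat_scheme \<Rightarrow> 'o \<Rightarrow> 'o \<Rightarrow> ('r, 'm) module" where
  "hom_module C A B =
     \<lparr>carrier = hom_set C A B, monoid.mult = undefined, one = undefined,
      zero = HZero C A B, add = HAdd C, smult = HSmult C\<rparr>"

locale linear_symmetric_monoidal_category = cring R + symmetric_monoidal_category C
  for R :: "('r, 'y) ring_scheme" (structure) and C :: "('r, 'o, 'm, 'x) lsmcat_scheme" (structure) +
  assumes hom_module: "\<lbrakk>A \<in> Obj C; B \<in> Obj C\<rbrakk> \<Longrightarrow> Module.module R (hom_module C A B)"
    and Comp_HAdd_left: "\<lbrakk>f \<in> hom_set C A B; g \<in> hom_set C B D; g' \<in> hom_set C B D\<rbrakk> \<Longrightarrow>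
      (g +\<^sub>a\<^bsub>C\<^esub> g') \<cdot>\<^bsub>C\<^esub> f = (g \<cdot>\<^bsub>C\<^esub> f) +\<^sub>a\<^bsub>C\<^esub> (g' \<cdot>\<^bsub>C\<^esub> f)"
    and Comp_HAdd_right: "\<lbrakk>f \<in> hom_set C A B; f' \<in> hom_set C A B; g \<in> hom_set C B D\<rbrakk> \<Longrightarrow>
      g \<cdot>\<^bsub>C\<^esub> (f +\<^sub>a\<^bsub>C\<^esub> f') = (g \<cdot>\<^bsub>C\<^esub> f) +\<^sub>a\<^bsub>C\<^esub> (g \<cdot>\<^bsub>C\<^esub> f')"
    and Comp_HSmult_left: "\<lbrakk>r \<in> carrier R; f \<in> hom_set C A B; g \<in> hom_set C B D\<rbrakk> \<Longrightarrow>
      HSmult C r g \<cdot>\<^bsub>C\<^esub> f = HSmult C r (g \<cdot>\<^bsub>C\<^esub> f)"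
    and Comp_HSmult_right: "\<lbrakk>r \<in> carrier R; f \<in> hom_set C A B; g \<in> hom_set C B D\<rbrakk> \<Longrightarrow>
      g \<cdot>\<^bsub>C\<^esub> HSmult C r f = HSmult C r (g \<cdot>\<^bsub>C\<^esub> f)"
    and TensA_HAdd_left: "\<lbrakk>f \<in> hom_set C A B; f' \<in> hom_set C A B; g \<in> hom_set C D E\<rbrakk> \<Longrightarrow>
      (f +\<^sub>a\<^bsub>C\<^esub> f') \<otimes>\<^sub>a\<^bsub>C\<^esub> g = (f \<otimes>\<^sub>a\<^bsub>C\<^esub> g) +\<^sub>a\<^bsub>C\<^esub> (f' \<otimes>\<^sub>a\<^bsub>C\<^esub> g)"
    and TensA_HAdd_right: "\<lbrakk>f \<in> hom_set C A B; g \<in> hom_set C D E; g' \<in> hom_set C D E\<rbrakk> \<Longrightarrow>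
      f \<otimes>\<^sub>a\<^bsub>C\<^esub> (g +\<^sub>a\<^bsub>C\<^esub> g') = (f \<otimes>\<^sub>a\<^bsub>C\<^esub> g) +\<^sub>a\<^bsub>C\<^esub> (f \<otimes>\<^sub>a\<^bsub>C\<^esub> g')"
    and TensA_HSmult_left: "\<lbrakk>r \<in> carrier R; f \<in> hom_set C A B; g \<in> hom_set C D E\<rbrakk> \<Longrightarrow>
      HSmult C r f \<otimes>\<^sub>a\<^bsub>C\<^esub> g = HSmult C r (f \<otimes>\<^sub>a\<^bsub>C\<^esub> g)"
    and TensA_HSmult_right: "\<lbrakk>r \<in> carrier R; f \<in> hom_set C A B; g \<in> hom_set C D E\<rbrakk> \<Longrightarrow>
      f \<otimes>\<^sub>a\<^bsub>C\<^esub> HSmult C r g = HSmult C r (f \<otimes>\<^sub>a\<^bsub>C\<^esub> g)"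

text \<open>
  In elements, the Leibniz rules are \<open>{xy, z} = x{y, z} + {x, z}y\<close> on \<open>(S \<otimes>\<^sub>o S) \<otimes>\<^sub>o S\<close> and
  \<open>{x, yz} = {x, y}z + y{x, z}\<close> on \<open>S \<otimes>\<^sub>o (S \<otimes>\<^sub>o S)\<close>.
\<close>

definition bi_derivation ::
  "('r, 'o, 'm, 'x) lsmcat_scheme \<Rightarrow> 'o \<Rightarrow> 'm \<Rightarrow> 'm \<Rightarrow> 'm \<Rightarrow> bool" where
  "bi_derivation C S \<mu> \<eta> d \<longleftrightarrow>
     d \<in> hom_set C (S \<otimes>\<^sub>o\<^bsub>C\<^esub> S) S \<and>
     d \<cdot>\<^bsub>C\<^esub> (\<mu> \<otimes>\<^sub>a\<^bsub>C\<^esub> id\<^sub>a\<^bsub>C\<^esub> S) =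
       (\<mu> \<cdot>\<^bsub>C\<^esub> (id\<^sub>a\<^bsub>C\<^esub> S \<otimes>\<^sub>a\<^bsub>C\<^esub> d) \<cdot>\<^bsub>C\<^esub> \<alpha>\<^sub>a\<^bsub>C\<^esub> S S S) +\<^sub>a\<^bsub>C\<^esub>
       (\<mu> \<cdot>\<^bsub>C\<^esub> (d \<otimes>\<^sub>a\<^bsub>C\<^esub> id\<^sub>a\<^bsub>C\<^esub> S) \<cdot>\<^bsub>C\<^esub> inv\<^sub>a\<^bsub>C\<^esub> (\<alpha>\<^sub>a\<^bsub>C\<^esub> S S S) \<cdot>\<^bsub>C\<^esub>
          (id\<^sub>a\<^bsub>C\<^esub> S \<otimes>\<^sub>a\<^bsub>C\<^esub> \<sigma>\<^sub>a\<^bsub>C\<^esub> S S) \<cdot>\<^bsub>C\<^esub> \<alpha>\<^sub>a\<^bsub>C\<^esub> S S S) \<and>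
     d \<cdot>\<^bsub>C\<^esub> (id\<^sub>a\<^bsub>C\<^esub> S \<otimes>\<^sub>a\<^bsub>C\<^esub> \<mu>) =
       (\<mu> \<cdot>\<^bsub>C\<^esub> (d \<otimes>\<^sub>a\<^bsub>C\<^esub> id\<^sub>a\<^bsub>C\<^esub> S) \<cdot>\<^bsub>C\<^esub> inv\<^sub>a\<^bsub>C\<^esub> (\<alpha>\<^sub>a\<^bsub>C\<^esub> S S S)) +\<^sub>a\<^bsub>C\<^esub>
       (\<mu> \<cdot>\<^bsub>C\<^esub> (id\<^sub>a\<^bsub>C\<^esub> S \<otimes>\<^sub>a\<^bsub>C\<^esub> d) \<cdot>\<^bsub>C\<^esub> \<alpha>\<^sub>a\<^bsub>C\<^esub> S S S \<cdot>\<^bsub>C\<^esub>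
          (\<sigma>\<^sub>a\<^bsub>C\<^esub> S S \<otimes>\<^sub>a\<^bsub>C\<^esub> id\<^sub>a\<^bsub>C\<^esub> S) \<cdot>\<^bsub>C\<^esub> inv\<^sub>a\<^bsub>C\<^esub> (\<alpha>\<^sub>a\<^bsub>C\<^esub> S S S)) \<and>
     d \<cdot>\<^bsub>C\<^esub> (\<eta> \<otimes>\<^sub>a\<^bsub>C\<^esub> id\<^sub>a\<^bsub>C\<^esub> S) = HZero C (\<I>\<^bsub>C\<^esub> \<otimes>\<^sub>o\<^bsub>C\<^esub> S) S \<and>
     d \<cdot>\<^bsub>C\<^esub> (id\<^sub>a\<^bsub>C\<^esub> S \<otimes>\<^sub>a\<^bsub>C\<^esub> \<eta>) = HZero C (S \<otimes>\<^sub>o\<^bsub>C\<^esub> \<I>\<^bsub>C\<^esub>) S"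

definition cyclic_perm :: "('o, 'm, 'x) smcat_scheme \<Rightarrow> 'o \<Rightarrow> 'm" where
  "cyclic_perm C S = \<alpha>\<^sub>a\<^bsub>C\<^esub> S S S \<cdot>\<^bsub>C\<^esub> \<sigma>\<^sub>a\<^bsub>C\<^esub> S (S \<otimes>\<^sub>o\<^bsub>C\<^esub> S)"

definition cyclic_sum :: "('r, 'o, 'm, 'x) lsmcat_scheme \<Rightarrow> 'o \<Rightarrow> 'm" where
  "cyclic_sum C S =
     id\<^sub>a\<^bsub>C\<^esub> (S \<otimes>\<^sub>o\<^bsub>C\<^esub> (S \<otimes>\<^sub>o\<^bsub>C\<^esub> S)) +\<^sub>a\<^bsub>C\<^esub> cyclic_perm C S +\<^sub>a\<^bsub>C\<^esub>
     (cyclic_perm C S \<cdot>\<^bsub>C\<^esub> cyclic_perm C S)"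

definition poisson_algebra ::
  "('r, 'o, 'm, 'x) lsmcat_scheme \<Rightarrow> 'o \<Rightarrow> 'm \<Rightarrow> 'm \<Rightarrow> 'm \<Rightarrow> bool" where
  "poisson_algebra C S \<mu> \<eta> d \<longleftrightarrow>
     commutative_monoid C S \<mu> \<eta> \<and> bi_derivation C S \<mu> \<eta> d \<and>
     d \<cdot>\<^bsub>C\<^esub> \<sigma>\<^sub>a\<^bsub>C\<^esub> S S = \<ominus>\<^bsub>hom_module C (S \<otimes>\<^sub>o\<^bsub>C\<^esub> S) S\<^esub> d \<and>
     d \<cdot>\<^bsub>C\<^esub> (id\<^sub>a\<^bsub>C\<^esub> S \<otimes>\<^sub>a\<^bsub>C\<^esub> d) \<cdot>\<^bsub>C\<^esub> cyclic_sum C S = HZero C (S \<otimes>\<^sub>o\<^bsub>C\<^esub> (S \<otimes>\<^sub>o\<^bsub>C\<^esub> S)) S"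

section \<open>The double quiver and the bracket\<close>

text \<open>In the double, \<open>Inl a\<close> is the arrow \<open>a\<close> of the quiver and \<open>Inr a\<close> is its double.\<close>

definition double_quiver :: "('v, 'e) pre_digraph \<Rightarrow> ('v, 'e + 'e) pre_digraph" where
  "double_quiver Q =
     \<lparr>verts = verts Q, arcs = arcs Q <+> arcs Q,
      tail = case_sum (tail Q) (head Q), head = case_sum (head Q) (tail Q)\<rparr>"

definition in_involution :: "'e + 'e \<Rightarrow> 'e + 'e \<Rightarrow> bool" where
  "in_involution a b \<longleftrightarrow> (\<exists>e. a = Inl e \<and> b = Inr e \<or> a = Inr e \<and> b = Inl e)"

definition arrow_pairing :: "('r, 'y) ring_scheme \<Rightarrow> 'e + 'e \<Rightarrow> 'e + 'e \<Rightarrow> 'r" where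
  "arrow_pairing R a b =
     (if \<exists>e. a = Inl e \<and> b = Inr e then \<one>\<^bsub>R\<^esub>
      else if \<exists>e. a = Inr e \<and> b = Inl e then \<ominus>\<^bsub>R\<^esub> \<one>\<^bsub>R\<^esub>
      else \<zero>\<^bsub>R\<^esub>)"

definition arrow_object ::
  "('o, 'm, 'x) smcat_scheme \<Rightarrow> ('v, 'e) pre_digraph \<Rightarrow> ('v \<Rightarrow> 'o) \<Rightarrow> ('v \<Rightarrow> 'o) \<Rightarrow> 'e + 'e \<Rightarrow> 'o" where
  "arrow_object C Q c cd a =
     c (tail (double_quiver Q) a) \<otimes>\<^sub>o\<^bsub>C\<^esub> cd (head (double_quiver Q) a)"

text \<open>
  For \<open>A = ci \<otimes>\<^sub>o cjd\<close> and \<open>B = cj \<otimes>\<^sub>o cid\<close>, this is a map \<open>A \<otimes>\<^sub>o B \<rightarrow> tens C [A, A, B, B]\<close>. Before the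
  permutation the factors are those of \<open>A\<close> (positions 0, 1) and of \<open>B\<close> (positions 2, 3), followed by
  the legs of \<open>coevi\<close> (positions 4, 5) and of \<open>coevj\<close> (positions 6, 7).
\<close>

definition kappa ::
  "('o, 'm, 'x) smcat_scheme \<Rightarrow> 'o \<Rightarrow> 'o \<Rightarrow> 'm \<Rightarrow> 'o \<Rightarrow> 'o \<Rightarrow> 'm \<Rightarrow> 'm" where
  "kappa C ci cid coevi cj cjd coevj =
     (let A = ci \<otimes>\<^sub>o\<^bsub>C\<^esub> cjd; B = cj \<otimes>\<^sub>o\<^bsub>C\<^esub> cid;
          insert_units = (id\<^sub>a\<^bsub>C\<^esub> \<I>\<^bsub>C\<^esub> \<otimes>\<^sub>a\<^bsub>C\<^esub> inv\<^sub>a\<^bsub>C\<^esub> (\<lambda>\<^sub>u\<^bsub>C\<^esub> \<I>\<^bsub>C\<^esub>)) \<cdot>\<^bsub>C\<^esub> inv\<^sub>a\<^bsub>C\<^esub> (\<lambda>\<^sub>u\<^bsub>C\<^esub> \<I>\<^bsub>C\<^esub>);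
          insert_coevs = tens_arrow C [coevi, coevj] \<cdot>\<^bsub>C\<^esub> insert_units
      in pair_up C [(ci, cjd), (ci, cjd), (cj, cid), (cj, cid)] \<cdot>\<^bsub>C\<^esub>
         tens_perm C [ci, cjd, cj, cid, ci, cid, cj, cjd] [4, 1, 0, 7, 6, 3, 2, 5] \<cdot>\<^bsub>C\<^esub>
         unpair C [(ci, cjd), (cj, cid), (ci, cid), (cj, cjd)] \<cdot>\<^bsub>C\<^esub>
         (id\<^sub>a\<^bsub>C\<^esub> A \<otimes>\<^sub>a\<^bsub>C\<^esub> (id\<^sub>a\<^bsub>C\<^esub> B \<otimes>\<^sub>a\<^bsub>C\<^esub> insert_coevs)) \<cdot>\<^bsub>C\<^esub>
         (id\<^sub>a\<^bsub>C\<^esub> A \<otimes>\<^sub>a\<^bsub>C\<^esub> inv\<^sub>a\<^bsub>C\<^esub> (\<rho>\<^sub>u\<^bsub>C\<^esub> B)))"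

definition kappa_component ::
  "('r, 'y) ring_scheme \<Rightarrow> ('r, 'o, 'm, 'x) lsmcat_scheme \<Rightarrow> ('v, 'e) pre_digraph \<Rightarrow>
   ('v \<Rightarrow> 'o) \<Rightarrow> ('v \<Rightarrow> 'o) \<Rightarrow> ('v \<Rightarrow> 'm) \<Rightarrow> 'e + 'e \<Rightarrow> 'e + 'e \<Rightarrow> 'm" where
  "kappa_component R C Q c cd coev a b =
     (let i = tail (double_quiver Q) a; j = head (double_quiver Q) a;
          A = arrow_object C Q c cd a; B = arrow_object C Q c cd b
      in if in_involution a b
         then HSmult C (arrow_pairing R a b) (kappa C (c i) (cd i) (coev i) (c j) (cd j) (coev j))
         else HZero C (A \<otimes>\<^sub>o\<^bsub>C\<^esub> B) (tens C [A, A, B, B]))"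

text \<open>Here \<open>h\<close> is the direct sum of the objects of the arrows, with inclusions \<open>inc\<close>.\<close>

definition is_plus_bracket ::
  "('r, 'y) ring_scheme \<Rightarrow> ('r, 'o, 'm, 'x) lsmcat_scheme \<Rightarrow> ('v, 'e) pre_digraph \<Rightarrow>
   ('v \<Rightarrow> 'o) \<Rightarrow> ('v \<Rightarrow> 'o) \<Rightarrow> ('v \<Rightarrow> 'm) \<Rightarrow> 'o \<Rightarrow> ('e + 'e \<Rightarrow> 'm) \<Rightarrow> 'o \<Rightarrow> (nat \<Rightarrow> 'm) \<Rightarrow> 'm \<Rightarrow> bool" where
  "is_plus_bracket R C Q c cd coev h inc S \<iota> d \<longleftrightarrow>
     bi_derivation C S (free_mult C h S \<iota>) (free_unit \<iota>) d \<and>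
     (\<forall>a \<in> arcs (double_quiver Q). \<forall>b \<in> arcs (double_quiver Q).
        d \<cdot>\<^bsub>C\<^esub> ((free_incl C h \<iota> \<cdot>\<^bsub>C\<^esub> inc a) \<otimes>\<^sub>a\<^bsub>C\<^esub> (free_incl C h \<iota> \<cdot>\<^bsub>C\<^esub> inc b)) =
        \<iota> 4 \<cdot>\<^bsub>C\<^esub> tens_arrow C [inc a, inc a, inc b, inc b] \<cdot>\<^bsub>C\<^esub> kappa_component R C Q c cd coev a b)"

definition plus_bracket ::
  "('r, 'y) ring_scheme \<Rightarrow> ('r, 'o, 'm, 'x) lsmcat_scheme \<Rightarrow> ('v, 'e) pre_digraph \<Rightarrow>
   ('v \<Rightarrow> 'o) \<Rightarrow> ('v \<Rightarrow> 'o) \<Rightarrow> ('v \<Rightarrow> 'm) \<Rightarrow> 'o \<Rightarrow> ('e + 'e \<Rightarrow> 'm) \<Rightarrow> 'o \<Rightarrow> (nat \<Rightarrow> 'm) \<Rightarrow> 'm" where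
  "plus_bracket R C Q c cd coev h inc S \<iota> = (THE d. is_plus_bracket R C Q c cd coev h inc S \<iota> d)"

end

theory Submission
  imports Defs
begin

text \<open>
  The identities are checked on generalised elements: an element of \<open>A\<close> is an arrow to \<open>A\<close> from a
  tensor product of objects named by a set of variables, elements with disjoint sets of variables
  can be tensored, and the coherence isomorphisms act on tensors of elements as they do on tensors
  of vectors. By the Leibniz rules, antisymmetry and the Jacobi identity need only be verified on
  the summands of \<open>h\<close>. For arrows \<open>a\<close>, \<open>b\<close> in involution let \<open>e\<^sub>a\<close>, \<open>e\<^sub>b\<close> be the inclusions of
  their objects into \<open>S\<close>. Contracting with the coevaluation \<open>\<Sum> f \<otimes> f'\<close> of \<open>c\<^sub>j\<close>, scaled by the
  pairing in the case of \<open>c\<^sub>i\<close>, is an associative ``matrix product'', and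
  \<open>{e\<^sub>a(v \<otimes> p), e\<^sub>b(w \<otimes> q)} = V(v \<otimes> q) U(w \<otimes> p)\<close>, where \<open>V\<close> is the product of \<open>e\<^sub>a\<close> and \<open>e\<^sub>b\<close> over
  \<open>c\<^sub>j\<close> and \<open>U\<close> is that of \<open>e\<^sub>b\<close> and \<open>e\<^sub>a\<close> over \<open>c\<^sub>i\<close>. Both \<open>{e\<^sub>a, U}\<close> and \<open>{e\<^sub>a, V}\<close> are expressed
  by the triple product of \<open>e\<^sub>a\<close>, \<open>e\<^sub>b\<close>, \<open>e\<^sub>a\<close>, so by associativity \<open>{x, {x', y}}\<close> is symmetric in \<open>x\<close>
  and \<open>x'\<close> for \<open>x\<close>, \<open>x'\<close> from \<open>a\<close> and \<open>y\<close> from \<open>b\<close>. By antisymmetry this is the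
  Jacobi identity for \<open>(a, a, b)\<close> and its rotations; for all other triples of arrows the three
  terms vanish.
\<close>

section \<open>Coherence in symmetric monoidal categories\<close>

text \<open>Three obstacles shape the development. First, \<open>kappa\<close> and the iterated
  symmetries are long composites of associators, unitors and symmetries. Comparing such composites
  arrow by arrow is unmanageable; on elements each comparison amounts to reading off the order of
  the letters. Second, a coevaluation is not itself a tensor of two elements, so the Leibniz rule
  cannot be expanded directly inside a contraction. The expansion is done with two fresh variables
  in its place, and the result is carried over to the coevaluation by linearity. Third,
  \<open>S\<close> is known only through colimits, and maps out of \<open>S\<close> tensored with
  another object are controlled only because tensoring preserves colimits of shapes living in the
  chosen type. The coinvariants and their coproduct are therefore merged into one countable shape,
  which any infinite type accommodates. The pairing is put into just one of the two contractions,
  since the bracket multiplies one contraction of each kind and should carry the scalar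
  once.\<close>

lemma hom_setI: "\<lbrakk>f \<in> Arr C; Dom C f = A; Cod C f = B\<rbrakk> \<Longrightarrow> f \<in> hom_set C A B"
  by (simp add: hom_set_def)

section \<open>Isomorphisms and cancellation in a category\<close>

context category
begin

lemma arr_self: "f \<in> Arr C \<Longrightarrow> f \<in> hom_set C (Dom C f) (Cod C f)"
  by (simp add: hom_set_def)

lemma arr_Idn [simp]:
  "A \<in> Obj C \<Longrightarrow> id\<^sub>a A \<in> Arr C" "A \<in> Obj C \<Longrightarrow> Dom C (id\<^sub>a A) = A" "A \<in> Obj C \<Longrightarrow> Cod C (id\<^sub>a A) = A"
  using Idn_hom[of A] by (auto simp: hom_set_def)

lemma arr_Comp [simp]:
  assumes "g \<in> Arr C" "f \<in> Arr C" "Dom C g = Cod C f"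
  shows "g \<cdot> f \<in> Arr C" "Dom C (g \<cdot> f) = Dom C f" "Cod C (g \<cdot> f) = Cod C g"
  using Comp_hom[OF arr_self[OF assms(2)], of g "Cod C g"] assms by (auto simp: hom_set_def)

lemma Comp_Idn [simp]:
  "\<lbrakk>f \<in> Arr C; Cod C f = B\<rbrakk> \<Longrightarrow> id\<^sub>a B \<cdot> f = f"
  "\<lbrakk>f \<in> Arr C; Dom C f = A\<rbrakk> \<Longrightarrow> f \<cdot> id\<^sub>a A = f"
  using Comp_Idn_left[OF arr_self, of f] Comp_Idn_right[OF arr_self, of f] by auto

lemma Comp_assoc' [simp]:
  "\<lbrakk>f \<in> Arr C; g \<in> Arr C; k \<in> Arr C; Cod C f = Dom C g; Cod C g = Dom C k\<rbrakk>
    \<Longrightarrow> (k \<cdot> g) \<cdot> f = k \<cdot> g \<cdot> f"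
  by (rule Comp_assoc[of f "Dom C f" "Dom C g" g "Dom C k" k "Cod C k"]) (auto simp: hom_set_def)

lemma Dom_Cod_Obj [simp]: "f \<in> Arr C \<Longrightarrow> Dom C f \<in> Obj C" "f \<in> Arr C \<Longrightarrow> Cod C f \<in> Obj C"
  by (simp_all add: Dom_Obj Cod_Obj)

text \<open>Composites are kept bracketed to the right, so an equation for
  \<open>f \<cdot> g\<close> matches inside a longer composite only in this form, with a tail
  \<open>t\<close>.\<close>

lemma Comp_tail:
  assumes "f \<cdot> g = k" "f \<in> Arr C" "g \<in> Arr C" "Dom C f = Cod C g" "t \<in> Arr C" "Cod C t = Dom C g"
  shows "f \<cdot> g \<cdot> t = k \<cdot> t"
  using Comp_assoc'[of t g f] assms by simp

lemma inverse_arrow_unique: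
  assumes "inverse_arrows C f g"
  shows "inv\<^sub>a f = g"
  unfolding inverse_arrow_def
proof (rule the_equality)
  show "inverse_arrows C f g" by (rule assms)
next
  fix k assume k: "inverse_arrows C f k"
  have "k = k \<cdot> f \<cdot> g" using assms k by (auto simp: inverse_arrows_def hom_set_def)
  also have "\<dots> = (k \<cdot> f) \<cdot> g"
    using assms k by (subst Comp_assoc') (auto simp: inverse_arrows_def hom_set_def)
  also have "\<dots> = g" using assms k by (auto simp: inverse_arrows_def hom_set_def)
  finally show "k = g" .
qed

lemma inverse_arrows_inv: "is_iso C f \<Longrightarrow> inverse_arrows C f (inv\<^sub>a f)"
  using inverse_arrow_unique by (auto simp: is_iso_def)

lemma inv_arr [simp]:
  assumes "is_iso C f"
  shows "inv\<^sub>a f \<in> Arr C" "Dom C (inv\<^sub>a f) = Cod C f" "Cod C (inv\<^sub>a f) = Dom C f"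
    "inv\<^sub>a f \<cdot> f = id\<^sub>a (Dom C f)" "f \<cdot> inv\<^sub>a f = id\<^sub>a (Cod C f)"
  using inverse_arrows_inv[OF assms] by (auto simp: inverse_arrows_def hom_set_def)

lemma iso_arr: "is_iso C f \<Longrightarrow> f \<in> Arr C"
  by (auto simp: is_iso_def inverse_arrows_def)

lemma inv_tail [simp]:
  assumes "is_iso C f" "t \<in> Arr C"
  shows "Cod C t = Dom C f \<Longrightarrow> inv\<^sub>a f \<cdot> f \<cdot> t = t" "Cod C t = Cod C f \<Longrightarrow> f \<cdot> inv\<^sub>a f \<cdot> t = t"
  using Comp_tail[OF inv_arr(4)[OF assms(1)]] Comp_tail[OF inv_arr(5)[OF assms(1)]] assms
  by (simp_all add: iso_arr)

lemma is_isoI: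
  assumes "f \<in> Arr C" "g \<in> Arr C" "Dom C g = Cod C f" "Cod C g = Dom C f"
    "g \<cdot> f = id\<^sub>a (Dom C f)" "f \<cdot> g = id\<^sub>a (Cod C f)"
  shows "is_iso C f"
  using assms by (auto simp: is_iso_def inverse_arrows_def hom_set_def)

lemma is_iso_inv [simp]: "is_iso C f \<Longrightarrow> is_iso C (inv\<^sub>a f)"
  by (rule is_isoI[where g = f]) (simp_all add: iso_arr)

lemma is_iso_Idn [simp]: "A \<in> Obj C \<Longrightarrow> is_iso C (id\<^sub>a A)"
  by (rule is_isoI[where g = "id\<^sub>a A"]) simp_all

lemma is_iso_Comp [simp]:
  assumes "is_iso C f" "is_iso C g" "Dom C g = Cod C f"
  shows "is_iso C (g \<cdot> f)"
  using assms by (intro is_isoI[where g = "inv\<^sub>a f \<cdot> inv\<^sub>a g"]) (simp_all add: iso_arr)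

lemma iso_cancel_right:
  assumes "f \<cdot> k = g \<cdot> k" "is_iso C k" "f \<in> Arr C" "g \<in> Arr C" "Dom C f = Cod C k" "Dom C g = Cod C k"
  shows "f = g"
proof -
  have "(f \<cdot> k) \<cdot> inv\<^sub>a k = (g \<cdot> k) \<cdot> inv\<^sub>a k" by (simp only: assms(1))
  then show ?thesis using assms(2-) by (simp add: iso_arr)
qed

lemma iso_cancel_left:
  assumes "k \<cdot> f = k \<cdot> g" "is_iso C k" "f \<in> Arr C" "g \<in> Arr C" "Cod C f = Dom C k" "Cod C g = Dom C k"
  shows "f = g"
proof -
  have "inv\<^sub>a k \<cdot> (k \<cdot> f) = inv\<^sub>a k \<cdot> (k \<cdot> g)" by (simp only: assms(1))
  then show ?thesis using assms(2-) by (simp add: iso_arr)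
qed

end

section \<open>Unit and symmetry coherence derived from the axioms\<close>

context symmetric_monoidal_category
begin

lemma Unt_Obj' [simp]: "\<I> \<in> Obj C"
  by (rule Unt_Obj)

lemma TensO_Obj' [simp]: "\<lbrakk>A \<in> Obj C; B \<in> Obj C\<rbrakk> \<Longrightarrow> A \<otimes>\<^sub>o B \<in> Obj C"
  by (rule TensO_Obj)

lemma arr_TensA [simp]:
  assumes "f \<in> Arr C" "g \<in> Arr C"
  shows "f \<otimes>\<^sub>a g \<in> Arr C" "Dom C (f \<otimes>\<^sub>a g) = Dom C f \<otimes>\<^sub>o Dom C g" "Cod C (f \<otimes>\<^sub>a g) = Cod C f \<otimes>\<^sub>o Cod C g"
  using TensA_hom[OF arr_self[OF assms(1)] arr_self[OF assms(2)]] by (auto simp: hom_set_def)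

lemma TensA_Idn' [simp]: "\<lbrakk>A \<in> Obj C; B \<in> Obj C\<rbrakk> \<Longrightarrow> id\<^sub>a A \<otimes>\<^sub>a id\<^sub>a B = id\<^sub>a (A \<otimes>\<^sub>o B)"
  by (rule TensA_Idn)

text \<open>The interchange law read against the direction of \<open>TensA_Comp\<close>: consecutive
  tensors are fused into one, whose two components simplify separately.\<close>

lemma TensA_merge:
  assumes "f \<in> Arr C" "g \<in> Arr C" "f' \<in> Arr C" "g' \<in> Arr C" "Dom C g = Cod C f" "Dom C g' = Cod C f'"
  shows "(g \<otimes>\<^sub>a g') \<cdot> (f \<otimes>\<^sub>a f') = (g \<cdot> f) \<otimes>\<^sub>a (g' \<cdot> f')"
  by (rule TensA_Comp[symmetric, OF arr_self[OF assms(1)] _ arr_self[OF assms(3)]])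
    (use assms in \<open>auto simp: hom_set_def\<close>)

lemma TensA_merge_tail:
  assumes "f \<in> Arr C" "g \<in> Arr C" "f' \<in> Arr C" "g' \<in> Arr C" "Dom C g = Cod C f" "Dom C g' = Cod C f'"
    "t \<in> Arr C" "Cod C t = Dom C f \<otimes>\<^sub>o Dom C f'"
  shows "(g \<otimes>\<^sub>a g') \<cdot> (f \<otimes>\<^sub>a f') \<cdot> t = ((g \<cdot> f) \<otimes>\<^sub>a (g' \<cdot> f')) \<cdot> t"
  using assms by (intro Comp_tail TensA_merge) simp_all

lemmas merge = TensA_merge TensA_merge_tail

lemma Assoc_arr [simp]:
  assumes "A \<in> Obj C" "B \<in> Obj C" "D \<in> Obj C"
  shows "\<alpha>\<^sub>a A B D \<in> Arr C" "Dom C (\<alpha>\<^sub>a A B D) = (A \<otimes>\<^sub>o B) \<otimes>\<^sub>o D" "Cod C (\<alpha>\<^sub>a A B D) = A \<otimes>\<^sub>o B \<otimes>\<^sub>o D"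
    "is_iso C (\<alpha>\<^sub>a A B D)"
  using Assoc_hom[OF assms] Assoc_iso[OF assms] by (auto simp: hom_set_def)

lemma LUnit_arr [simp]:
  assumes "A \<in> Obj C"
  shows "\<lambda>\<^sub>u A \<in> Arr C" "Dom C (\<lambda>\<^sub>u A) = \<I> \<otimes>\<^sub>o A" "Cod C (\<lambda>\<^sub>u A) = A" "is_iso C (\<lambda>\<^sub>u A)"
  using LUnit_hom[OF assms] LUnit_iso[OF assms] by (auto simp: hom_set_def)

lemma RUnit_arr [simp]:
  assumes "A \<in> Obj C"
  shows "\<rho>\<^sub>u A \<in> Arr C" "Dom C (\<rho>\<^sub>u A) = A \<otimes>\<^sub>o \<I>" "Cod C (\<rho>\<^sub>u A) = A" "is_iso C (\<rho>\<^sub>u A)"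
  using RUnit_hom[OF assms] RUnit_iso[OF assms] by (auto simp: hom_set_def)

lemma Symm_arr [simp]:
  assumes "A \<in> Obj C" "B \<in> Obj C"
  shows "\<sigma>\<^sub>a A B \<in> Arr C" "Dom C (\<sigma>\<^sub>a A B) = A \<otimes>\<^sub>o B" "Cod C (\<sigma>\<^sub>a A B) = B \<otimes>\<^sub>o A"
    "\<sigma>\<^sub>a B A \<cdot> \<sigma>\<^sub>a A B = id\<^sub>a (A \<otimes>\<^sub>o B)"
  using Symm_hom[OF assms] Symm_Symm[OF assms] by (auto simp: hom_set_def)

lemma Symm_iso [simp]:
  assumes "A \<in> Obj C" "B \<in> Obj C"
  shows "is_iso C (\<sigma>\<^sub>a A B)" "inv\<^sub>a (\<sigma>\<^sub>a A B) = \<sigma>\<^sub>a B A"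
proof -
  have "inverse_arrows C (\<sigma>\<^sub>a A B) (\<sigma>\<^sub>a B A)"
    using assms by (auto simp: inverse_arrows_def hom_set_def)
  then show "is_iso C (\<sigma>\<^sub>a A B)" "inv\<^sub>a (\<sigma>\<^sub>a A B) = \<sigma>\<^sub>a B A"
    by (auto simp: is_iso_def inverse_arrow_unique)
qed

lemma is_iso_TensA [simp]: "\<lbrakk>is_iso C f; is_iso C g\<rbrakk> \<Longrightarrow> is_iso C (f \<otimes>\<^sub>a g)"
  by (rule is_isoI[where g = "inv\<^sub>a f \<otimes>\<^sub>a inv\<^sub>a g"]) (simp_all add: iso_arr merge)

text \<open>The objects in the pattern are variables tied to the codomains by premises, so the rule
  matches also where a codomain is already displayed in evaluated form. The other naturality rules
  follow the same scheme.\<close>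

lemma Assoc_nat:
  assumes "f \<in> Arr C" "g \<in> Arr C" "k \<in> Arr C" "A' = Cod C f" "B' = Cod C g" "D' = Cod C k"
  shows "\<alpha>\<^sub>a A' B' D' \<cdot> ((f \<otimes>\<^sub>a g) \<otimes>\<^sub>a k) = (f \<otimes>\<^sub>a g \<otimes>\<^sub>a k) \<cdot> \<alpha>\<^sub>a (Dom C f) (Dom C g) (Dom C k)"
  using Assoc_natural[OF arr_self[OF assms(1)] arr_self[OF assms(2)] arr_self[OF assms(3)]] assms by simp

lemma Assoc_nat_tail:
  assumes "f \<in> Arr C" "g \<in> Arr C" "k \<in> Arr C" "A' = Cod C f" "B' = Cod C g" "D' = Cod C k"
    "t \<in> Arr C" "Cod C t = (Dom C f \<otimes>\<^sub>o Dom C g) \<otimes>\<^sub>o Dom C k"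
  shows "\<alpha>\<^sub>a A' B' D' \<cdot> ((f \<otimes>\<^sub>a g) \<otimes>\<^sub>a k) \<cdot> t = (f \<otimes>\<^sub>a g \<otimes>\<^sub>a k) \<cdot> \<alpha>\<^sub>a (Dom C f) (Dom C g) (Dom C k) \<cdot> t"
  by (subst Comp_tail[OF Assoc_nat]) (use assms in simp_all)

lemma Assoc_inv_nat:
  assumes "f \<in> Arr C" "g \<in> Arr C" "k \<in> Arr C" "A' = Cod C f" "B' = Cod C g" "D' = Cod C k"
  shows "inv\<^sub>a (\<alpha>\<^sub>a A' B' D') \<cdot> (f \<otimes>\<^sub>a g \<otimes>\<^sub>a k) = ((f \<otimes>\<^sub>a g) \<otimes>\<^sub>a k) \<cdot> inv\<^sub>a (\<alpha>\<^sub>a (Dom C f) (Dom C g) (Dom C k))"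
proof (rule iso_cancel_left)
  show "\<alpha>\<^sub>a A' B' D' \<cdot> inv\<^sub>a (\<alpha>\<^sub>a A' B' D') \<cdot> (f \<otimes>\<^sub>a g \<otimes>\<^sub>a k)
    = \<alpha>\<^sub>a A' B' D' \<cdot> ((f \<otimes>\<^sub>a g) \<otimes>\<^sub>a k) \<cdot> inv\<^sub>a (\<alpha>\<^sub>a (Dom C f) (Dom C g) (Dom C k))"
    using assms by (subst Assoc_nat_tail) simp_all
qed (use assms in simp_all)

lemma Assoc_inv_nat_tail:
  assumes "f \<in> Arr C" "g \<in> Arr C" "k \<in> Arr C" "A' = Cod C f" "B' = Cod C g" "D' = Cod C k"
    "t \<in> Arr C" "Cod C t = Dom C f \<otimes>\<^sub>o Dom C g \<otimes>\<^sub>o Dom C k"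
  shows "inv\<^sub>a (\<alpha>\<^sub>a A' B' D') \<cdot> (f \<otimes>\<^sub>a g \<otimes>\<^sub>a k) \<cdot> t = ((f \<otimes>\<^sub>a g) \<otimes>\<^sub>a k) \<cdot> inv\<^sub>a (\<alpha>\<^sub>a (Dom C f) (Dom C g) (Dom C k)) \<cdot> t"
  by (subst Comp_tail[OF Assoc_inv_nat]) (use assms in simp_all)

lemma Symm_nat:
  assumes "f \<in> Arr C" "g \<in> Arr C" "A' = Cod C f" "B' = Cod C g"
  shows "\<sigma>\<^sub>a A' B' \<cdot> (f \<otimes>\<^sub>a g) = (g \<otimes>\<^sub>a f) \<cdot> \<sigma>\<^sub>a (Dom C f) (Dom C g)"
  using Symm_natural[OF arr_self[OF assms(1)] arr_self[OF assms(2)]] assms by simp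

lemma Symm_nat_tail:
  assumes "f \<in> Arr C" "g \<in> Arr C" "A' = Cod C f" "B' = Cod C g" "t \<in> Arr C" "Cod C t = Dom C f \<otimes>\<^sub>o Dom C g"
  shows "\<sigma>\<^sub>a A' B' \<cdot> (f \<otimes>\<^sub>a g) \<cdot> t = (g \<otimes>\<^sub>a f) \<cdot> \<sigma>\<^sub>a (Dom C f) (Dom C g) \<cdot> t"
  by (subst Comp_tail[OF Symm_nat]) (use assms in simp_all)

lemma LUnit_nat:
  assumes "f \<in> Arr C" "B = Cod C f"
  shows "\<lambda>\<^sub>u B \<cdot> (id\<^sub>a \<I> \<otimes>\<^sub>a f) = f \<cdot> \<lambda>\<^sub>u (Dom C f)"
  using LUnit_natural[OF arr_self[OF assms(1)]] assms by simp

lemma RUnit_nat: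
  assumes "f \<in> Arr C" "B = Cod C f"
  shows "\<rho>\<^sub>u B \<cdot> (f \<otimes>\<^sub>a id\<^sub>a \<I>) = f \<cdot> \<rho>\<^sub>u (Dom C f)"
  using RUnit_natural[OF arr_self[OF assms(1)]] assms by simp

lemma pentagon_tail:
  assumes "A \<in> Obj C" "B \<in> Obj C" "D \<in> Obj C" "E \<in> Obj C"
    "t \<in> Arr C" "Cod C t = ((A \<otimes>\<^sub>o B) \<otimes>\<^sub>o D) \<otimes>\<^sub>o E"
  shows "(id\<^sub>a A \<otimes>\<^sub>a \<alpha>\<^sub>a B D E) \<cdot> \<alpha>\<^sub>a A (B \<otimes>\<^sub>o D) E \<cdot> (\<alpha>\<^sub>a A B D \<otimes>\<^sub>a id\<^sub>a E) \<cdot> t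
        = \<alpha>\<^sub>a A B (D \<otimes>\<^sub>o E) \<cdot> \<alpha>\<^sub>a (A \<otimes>\<^sub>o B) D E \<cdot> t"
proof -
  have "((id\<^sub>a A \<otimes>\<^sub>a \<alpha>\<^sub>a B D E) \<cdot> \<alpha>\<^sub>a A (B \<otimes>\<^sub>o D) E \<cdot> (\<alpha>\<^sub>a A B D \<otimes>\<^sub>a id\<^sub>a E)) \<cdot> t
        = (\<alpha>\<^sub>a A B (D \<otimes>\<^sub>o E) \<cdot> \<alpha>\<^sub>a (A \<otimes>\<^sub>o B) D E) \<cdot> t"
    by (simp only: pentagon[OF assms(1-4)])
  then show ?thesis using assms by simp
qed

text \<open>Tensoring with the unit is faithful, because the left unitor is a natural isomorphism to
  the identity functor.\<close>

lemma unit_cancel_left: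
  assumes "id\<^sub>a \<I> \<otimes>\<^sub>a f = id\<^sub>a \<I> \<otimes>\<^sub>a g" "f \<in> Arr C" "g \<in> Arr C" "Dom C f = Dom C g" "Cod C f = Cod C g"
  shows "f = g"
proof (rule iso_cancel_right)
  have "f \<cdot> \<lambda>\<^sub>u (Dom C f) = \<lambda>\<^sub>u (Cod C f) \<cdot> (id\<^sub>a \<I> \<otimes>\<^sub>a f)"
    using assms by (subst LUnit_nat) simp_all
  also have "\<dots> = g \<cdot> \<lambda>\<^sub>u (Dom C f)"
    using assms(2-) by (subst assms(1), subst LUnit_nat) simp_all
  finally show "f \<cdot> \<lambda>\<^sub>u (Dom C f) = g \<cdot> \<lambda>\<^sub>u (Dom C f)" .
qed (use assms in simp_all)

lemma unit_cancel_right: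
  assumes "f \<otimes>\<^sub>a id\<^sub>a \<I> = g \<otimes>\<^sub>a id\<^sub>a \<I>" "f \<in> Arr C" "g \<in> Arr C" "Dom C f = Dom C g" "Cod C f = Cod C g"
  shows "f = g"
proof (rule iso_cancel_right)
  have "f \<cdot> \<rho>\<^sub>u (Dom C f) = \<rho>\<^sub>u (Cod C f) \<cdot> (f \<otimes>\<^sub>a id\<^sub>a \<I>)"
    using assms by (subst RUnit_nat) simp_all
  also have "\<dots> = g \<cdot> \<rho>\<^sub>u (Dom C f)"
    using assms(2-) by (subst assms(1), subst RUnit_nat) simp_all
  finally show "f \<cdot> \<rho>\<^sub>u (Dom C f) = g \<cdot> \<rho>\<^sub>u (Dom C f)" .
qed (use assms in simp_all)

text \<open>Kelly's argument: after tensoring with the unit and composing with an isomorphism, both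
  sides agree by the pentagon, two triangles and naturality of the associator;
  \<open>unit_cancel_left\<close> removes the extra unit.\<close>

lemma LUnit_TensO:
  assumes [simp]: "A \<in> Obj C" "B \<in> Obj C"
  shows "\<lambda>\<^sub>u (A \<otimes>\<^sub>o B) \<cdot> \<alpha>\<^sub>a \<I> A B = \<lambda>\<^sub>u A \<otimes>\<^sub>a id\<^sub>a B"
proof (rule unit_cancel_left)
  let ?k = "\<alpha>\<^sub>a \<I> (\<I> \<otimes>\<^sub>o A) B \<cdot> (\<alpha>\<^sub>a \<I> \<I> A \<otimes>\<^sub>a id\<^sub>a B)"
  have "(id\<^sub>a \<I> \<otimes>\<^sub>a (\<lambda>\<^sub>u (A \<otimes>\<^sub>o B) \<cdot> \<alpha>\<^sub>a \<I> A B)) \<cdot> ?k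
      = (id\<^sub>a \<I> \<otimes>\<^sub>a \<lambda>\<^sub>u (A \<otimes>\<^sub>o B)) \<cdot> (id\<^sub>a \<I> \<otimes>\<^sub>a \<alpha>\<^sub>a \<I> A B) \<cdot> ?k"
    by (simp add: merge)
  also have "\<dots> = (id\<^sub>a \<I> \<otimes>\<^sub>a \<lambda>\<^sub>u (A \<otimes>\<^sub>o B)) \<cdot> \<alpha>\<^sub>a \<I> \<I> (A \<otimes>\<^sub>o B) \<cdot> \<alpha>\<^sub>a (\<I> \<otimes>\<^sub>o \<I>) A B"
    by (subst pentagon) simp_all
  also have "\<dots> = (\<rho>\<^sub>u \<I> \<otimes>\<^sub>a id\<^sub>a (A \<otimes>\<^sub>o B)) \<cdot> \<alpha>\<^sub>a (\<I> \<otimes>\<^sub>o \<I>) A B"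
    by (subst Comp_tail[OF triangle]) simp_all
  also have "\<dots> = \<alpha>\<^sub>a \<I> A B \<cdot> ((\<rho>\<^sub>u \<I> \<otimes>\<^sub>a id\<^sub>a A) \<otimes>\<^sub>a id\<^sub>a B)"
    by (subst Assoc_nat) simp_all
  also have "\<dots> = \<alpha>\<^sub>a \<I> A B \<cdot> (((id\<^sub>a \<I> \<otimes>\<^sub>a \<lambda>\<^sub>u A) \<cdot> \<alpha>\<^sub>a \<I> \<I> A) \<otimes>\<^sub>a id\<^sub>a B)"
    by (subst triangle) simp_all
  also have "\<dots> = \<alpha>\<^sub>a \<I> A B \<cdot> ((id\<^sub>a \<I> \<otimes>\<^sub>a \<lambda>\<^sub>u A) \<otimes>\<^sub>a id\<^sub>a B) \<cdot> (\<alpha>\<^sub>a \<I> \<I> A \<otimes>\<^sub>a id\<^sub>a B)"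
    by (simp add: merge)
  also have "\<dots> = (id\<^sub>a \<I> \<otimes>\<^sub>a \<lambda>\<^sub>u A \<otimes>\<^sub>a id\<^sub>a B) \<cdot> ?k"
    by (subst Assoc_nat_tail) simp_all
  finally show "id\<^sub>a \<I> \<otimes>\<^sub>a (\<lambda>\<^sub>u (A \<otimes>\<^sub>o B) \<cdot> \<alpha>\<^sub>a \<I> A B) = id\<^sub>a \<I> \<otimes>\<^sub>a \<lambda>\<^sub>u A \<otimes>\<^sub>a id\<^sub>a B"
    by (rule iso_cancel_right) simp_all
qed simp_all

text \<open>Naturality of the left unitor at its own component on the unit object identifies two
  arrows out of a triple of units; the triangle then compares left and right unitors.\<close>

lemma LUnit_eq_RUnit_Unt: "\<lambda>\<^sub>u \<I> = \<rho>\<^sub>u \<I>"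
proof (rule unit_cancel_right)
  have "\<lambda>\<^sub>u \<I> \<cdot> \<lambda>\<^sub>u (\<I> \<otimes>\<^sub>o \<I>) = \<lambda>\<^sub>u \<I> \<cdot> (id\<^sub>a \<I> \<otimes>\<^sub>a \<lambda>\<^sub>u \<I>)"
    by (subst LUnit_nat) simp_all
  then have "\<lambda>\<^sub>u (\<I> \<otimes>\<^sub>o \<I>) = id\<^sub>a \<I> \<otimes>\<^sub>a \<lambda>\<^sub>u \<I>"
    by (rule iso_cancel_left) simp_all
  then show "\<lambda>\<^sub>u \<I> \<otimes>\<^sub>a id\<^sub>a \<I> = \<rho>\<^sub>u \<I> \<otimes>\<^sub>a id\<^sub>a \<I>"
    using LUnit_TensO[of \<I> \<I>] triangle[of \<I> \<I>] by simp
qed simp_all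

text \<open>This comes from the hexagon at \<open>A\<close> and two unit objects, in which all
  associators are absorbed by \<open>LUnit_TensO\<close> and the triangle.\<close>

lemma LUnit_Symm:
  assumes [simp]: "A \<in> Obj C"
  shows "\<lambda>\<^sub>u A \<cdot> \<sigma>\<^sub>a A \<I> = \<rho>\<^sub>u A"
proof (rule unit_cancel_right)
  have "\<sigma>\<^sub>a A \<I> \<cdot> (\<rho>\<^sub>u A \<otimes>\<^sub>a id\<^sub>a \<I>) = \<sigma>\<^sub>a A \<I> \<cdot> (id\<^sub>a A \<otimes>\<^sub>a \<lambda>\<^sub>u \<I>) \<cdot> \<alpha>\<^sub>a A \<I> \<I>"
    by (simp add: triangle)
  also have "\<dots> = (\<lambda>\<^sub>u \<I> \<otimes>\<^sub>a id\<^sub>a A) \<cdot> \<sigma>\<^sub>a A (\<I> \<otimes>\<^sub>o \<I>) \<cdot> \<alpha>\<^sub>a A \<I> \<I>"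
    by (subst Symm_nat_tail) simp_all
  also have "\<dots> = \<lambda>\<^sub>u (\<I> \<otimes>\<^sub>o A) \<cdot> \<alpha>\<^sub>a \<I> \<I> A \<cdot> \<sigma>\<^sub>a A (\<I> \<otimes>\<^sub>o \<I>) \<cdot> \<alpha>\<^sub>a A \<I> \<I>"
    by (subst LUnit_TensO[symmetric]) simp_all
  also have "\<dots> = \<lambda>\<^sub>u (\<I> \<otimes>\<^sub>o A) \<cdot> (id\<^sub>a \<I> \<otimes>\<^sub>a \<sigma>\<^sub>a A \<I>) \<cdot> \<alpha>\<^sub>a \<I> A \<I> \<cdot> (\<sigma>\<^sub>a A \<I> \<otimes>\<^sub>a id\<^sub>a \<I>)"
    by (subst hexagon) simp_all
  also have "\<dots> = \<sigma>\<^sub>a A \<I> \<cdot> \<lambda>\<^sub>u (A \<otimes>\<^sub>o \<I>) \<cdot> \<alpha>\<^sub>a \<I> A \<I> \<cdot> (\<sigma>\<^sub>a A \<I> \<otimes>\<^sub>a id\<^sub>a \<I>)"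
    by (subst Comp_tail[OF LUnit_nat]) simp_all
  also have "\<dots> = \<sigma>\<^sub>a A \<I> \<cdot> (\<lambda>\<^sub>u A \<otimes>\<^sub>a id\<^sub>a \<I>) \<cdot> (\<sigma>\<^sub>a A \<I> \<otimes>\<^sub>a id\<^sub>a \<I>)"
    by (subst Comp_tail[OF LUnit_TensO]) simp_all
  also have "\<dots> = \<sigma>\<^sub>a A \<I> \<cdot> ((\<lambda>\<^sub>u A \<cdot> \<sigma>\<^sub>a A \<I>) \<otimes>\<^sub>a id\<^sub>a \<I>)"
    by (simp add: merge)
  finally show "(\<lambda>\<^sub>u A \<cdot> \<sigma>\<^sub>a A \<I>) \<otimes>\<^sub>a id\<^sub>a \<I> = \<rho>\<^sub>u A \<otimes>\<^sub>a id\<^sub>a \<I>"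
    by (rule iso_cancel_left[OF sym]) simp_all
qed simp_all

lemma swap_front_arr [simp]:
  assumes "A \<in> Obj C" "B \<in> Obj C" "D \<in> Obj C"
  shows "swap_front C A B D \<in> Arr C" "Dom C (swap_front C A B D) = A \<otimes>\<^sub>o B \<otimes>\<^sub>o D"
    "Cod C (swap_front C A B D) = B \<otimes>\<^sub>o A \<otimes>\<^sub>o D" "is_iso C (swap_front C A B D)"
  using assms by (simp_all add: swap_front_def)

lemma swap_front_nat:
  assumes "f \<in> Arr C" "g \<in> Arr C" "k \<in> Arr C" "A' = Cod C f" "B' = Cod C g" "D' = Cod C k"
  shows "swap_front C A' B' D' \<cdot> (f \<otimes>\<^sub>a g \<otimes>\<^sub>a k) = (g \<otimes>\<^sub>a f \<otimes>\<^sub>a k) \<cdot> swap_front C (Dom C f) (Dom C g) (Dom C k)"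
proof -
  have "swap_front C A' B' D' \<cdot> (f \<otimes>\<^sub>a g \<otimes>\<^sub>a k)
      = \<alpha>\<^sub>a B' A' D' \<cdot> (\<sigma>\<^sub>a A' B' \<otimes>\<^sub>a id\<^sub>a D') \<cdot> ((f \<otimes>\<^sub>a g) \<otimes>\<^sub>a k) \<cdot> inv\<^sub>a (\<alpha>\<^sub>a (Dom C f) (Dom C g) (Dom C k))"
    using assms by (simp add: swap_front_def Assoc_inv_nat)
  also have "\<dots> = \<alpha>\<^sub>a B' A' D' \<cdot> ((g \<otimes>\<^sub>a f) \<otimes>\<^sub>a k) \<cdot> (\<sigma>\<^sub>a (Dom C f) (Dom C g) \<otimes>\<^sub>a id\<^sub>a (Dom C k)) \<cdot>
      inv\<^sub>a (\<alpha>\<^sub>a (Dom C f) (Dom C g) (Dom C k))"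
    using assms by (simp add: merge Symm_nat)
  also have "\<dots> = (g \<otimes>\<^sub>a f \<otimes>\<^sub>a k) \<cdot> swap_front C (Dom C f) (Dom C g) (Dom C k)"
    using assms by (simp add: swap_front_def Assoc_nat_tail)
  finally show ?thesis .
qed

lemma swap_front_nat_tail:
  assumes "f \<in> Arr C" "g \<in> Arr C" "k \<in> Arr C" "A' = Cod C f" "B' = Cod C g" "D' = Cod C k"
    "t \<in> Arr C" "Cod C t = Dom C f \<otimes>\<^sub>o Dom C g \<otimes>\<^sub>o Dom C k"
  shows "swap_front C A' B' D' \<cdot> (f \<otimes>\<^sub>a g \<otimes>\<^sub>a k) \<cdot> t = (g \<otimes>\<^sub>a f \<otimes>\<^sub>a k) \<cdot> swap_front C (Dom C f) (Dom C g) (Dom C k) \<cdot> t"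
  by (subst Comp_tail[OF swap_front_nat]) (use assms in simp_all)

text \<open>The other hexagon, for a symmetry whose first argument is a tensor product. It is the
  axiom at \<open>D\<close>, \<open>A\<close>, \<open>B\<close> read backwards, since the symmetry
  is its own inverse.\<close>

lemma Symm_swap_front:
  assumes [simp]: "A \<in> Obj C" "B \<in> Obj C" "D \<in> Obj C"
  shows "\<sigma>\<^sub>a (A \<otimes>\<^sub>o B) D \<cdot> inv\<^sub>a (\<alpha>\<^sub>a A B D) = swap_front C A D B \<cdot> (id\<^sub>a A \<otimes>\<^sub>a \<sigma>\<^sub>a B D)"
proof (rule iso_cancel_right)
  have *: "(\<sigma>\<^sub>a A D \<otimes>\<^sub>a id\<^sub>a B) \<cdot> (\<sigma>\<^sub>a D A \<otimes>\<^sub>a id\<^sub>a B) = id\<^sub>a ((D \<otimes>\<^sub>o A) \<otimes>\<^sub>o B)"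
    by (simp add: merge)
  let ?k = "\<alpha>\<^sub>a A B D \<cdot> \<sigma>\<^sub>a D (A \<otimes>\<^sub>o B) \<cdot> \<alpha>\<^sub>a D A B"
  have "(\<sigma>\<^sub>a (A \<otimes>\<^sub>o B) D \<cdot> inv\<^sub>a (\<alpha>\<^sub>a A B D)) \<cdot> ?k = \<alpha>\<^sub>a D A B"
    by (simp add: Comp_tail[OF Symm_arr(4)])
  also have "\<dots> = \<alpha>\<^sub>a D A B \<cdot> (\<sigma>\<^sub>a A D \<otimes>\<^sub>a id\<^sub>a B) \<cdot> (\<sigma>\<^sub>a D A \<otimes>\<^sub>a id\<^sub>a B)"
    by (simp add: *)
  also have "\<dots> = swap_front C A D B \<cdot> \<alpha>\<^sub>a A D B \<cdot> (\<sigma>\<^sub>a D A \<otimes>\<^sub>a id\<^sub>a B)"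
    by (simp add: swap_front_def)
  also have "\<dots> = swap_front C A D B \<cdot> (id\<^sub>a A \<otimes>\<^sub>a \<sigma>\<^sub>a B D) \<cdot> (id\<^sub>a A \<otimes>\<^sub>a \<sigma>\<^sub>a D B) \<cdot> \<alpha>\<^sub>a A D B \<cdot> (\<sigma>\<^sub>a D A \<otimes>\<^sub>a id\<^sub>a B)"
    by (simp add: merge)
  also have "\<dots> = (swap_front C A D B \<cdot> (id\<^sub>a A \<otimes>\<^sub>a \<sigma>\<^sub>a B D)) \<cdot> ?k"
    by (simp add: hexagon)
  finally show "(\<sigma>\<^sub>a (A \<otimes>\<^sub>o B) D \<cdot> inv\<^sub>a (\<alpha>\<^sub>a A B D)) \<cdot> ?k = (swap_front C A D B \<cdot> (id\<^sub>a A \<otimes>\<^sub>a \<sigma>\<^sub>a B D)) \<cdot> ?k" .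
qed simp_all

text \<open>One pentagon on each side reduces both composites to the same symmetry of
  \<open>X\<close> and \<open>A\<close> next to an untouched \<open>B\<close> and
  \<open>D\<close>.\<close>

lemma swap_front_Assoc_middle:
  assumes [simp]: "X \<in> Obj C" "A \<in> Obj C" "B \<in> Obj C" "D \<in> Obj C"
  shows "(id\<^sub>a A \<otimes>\<^sub>a \<alpha>\<^sub>a X B D) \<cdot> \<alpha>\<^sub>a A (X \<otimes>\<^sub>o B) D \<cdot> (swap_front C X A B \<otimes>\<^sub>a id\<^sub>a D)
    = swap_front C X A (B \<otimes>\<^sub>o D) \<cdot> (id\<^sub>a X \<otimes>\<^sub>a \<alpha>\<^sub>a A B D) \<cdot> \<alpha>\<^sub>a X (A \<otimes>\<^sub>o B) D"
proof (rule iso_cancel_right)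
  let ?k = "\<alpha>\<^sub>a X A B \<otimes>\<^sub>a id\<^sub>a D"
  have s: "(swap_front C X A B \<otimes>\<^sub>a id\<^sub>a D) \<cdot> ?k = (\<alpha>\<^sub>a A X B \<otimes>\<^sub>a id\<^sub>a D) \<cdot> ((\<sigma>\<^sub>a X A \<otimes>\<^sub>a id\<^sub>a B) \<otimes>\<^sub>a id\<^sub>a D)"
    by (simp add: merge swap_front_def)
  have "((id\<^sub>a A \<otimes>\<^sub>a \<alpha>\<^sub>a X B D) \<cdot> \<alpha>\<^sub>a A (X \<otimes>\<^sub>o B) D \<cdot> (swap_front C X A B \<otimes>\<^sub>a id\<^sub>a D)) \<cdot> ?k
      = (id\<^sub>a A \<otimes>\<^sub>a \<alpha>\<^sub>a X B D) \<cdot> \<alpha>\<^sub>a A (X \<otimes>\<^sub>o B) D \<cdot> (\<alpha>\<^sub>a A X B \<otimes>\<^sub>a id\<^sub>a D) \<cdot> ((\<sigma>\<^sub>a X A \<otimes>\<^sub>a id\<^sub>a B) \<otimes>\<^sub>a id\<^sub>a D)"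
    by (simp add: s)
  also have "\<dots> = \<alpha>\<^sub>a A X (B \<otimes>\<^sub>o D) \<cdot> \<alpha>\<^sub>a (A \<otimes>\<^sub>o X) B D \<cdot> ((\<sigma>\<^sub>a X A \<otimes>\<^sub>a id\<^sub>a B) \<otimes>\<^sub>a id\<^sub>a D)"
    by (subst pentagon_tail) simp_all
  also have "\<dots> = \<alpha>\<^sub>a A X (B \<otimes>\<^sub>o D) \<cdot> (\<sigma>\<^sub>a X A \<otimes>\<^sub>a id\<^sub>a (B \<otimes>\<^sub>o D)) \<cdot> \<alpha>\<^sub>a (X \<otimes>\<^sub>o A) B D"
    by (subst Assoc_nat) simp_all
  also have "\<dots> = swap_front C X A (B \<otimes>\<^sub>o D) \<cdot> \<alpha>\<^sub>a X A (B \<otimes>\<^sub>o D) \<cdot> \<alpha>\<^sub>a (X \<otimes>\<^sub>o A) B D"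
    by (simp add: swap_front_def)
  also have "\<dots> = swap_front C X A (B \<otimes>\<^sub>o D) \<cdot> (id\<^sub>a X \<otimes>\<^sub>a \<alpha>\<^sub>a A B D) \<cdot> \<alpha>\<^sub>a X (A \<otimes>\<^sub>o B) D \<cdot> ?k"
    by (subst pentagon) simp_all
  also have "\<dots> = (swap_front C X A (B \<otimes>\<^sub>o D) \<cdot> (id\<^sub>a X \<otimes>\<^sub>a \<alpha>\<^sub>a A B D) \<cdot> \<alpha>\<^sub>a X (A \<otimes>\<^sub>o B) D) \<cdot> ?k"
    by simp
  finally show "((id\<^sub>a A \<otimes>\<^sub>a \<alpha>\<^sub>a X B D) \<cdot> \<alpha>\<^sub>a A (X \<otimes>\<^sub>o B) D \<cdot> (swap_front C X A B \<otimes>\<^sub>a id\<^sub>a D)) \<cdot> ?k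
    = (swap_front C X A (B \<otimes>\<^sub>o D) \<cdot> (id\<^sub>a X \<otimes>\<^sub>a \<alpha>\<^sub>a A B D) \<cdot> \<alpha>\<^sub>a X (A \<otimes>\<^sub>o B) D) \<cdot> ?k" .
qed simp_all

text \<open>Carrying \<open>X\<close> past a tensor product in one step or in two is the hexagon;
  the pentagons only adjust the brackets around it.\<close>

lemma swap_front_TensO:
  assumes [simp]: "X \<in> Obj C" "A \<in> Obj C" "B \<in> Obj C" "D \<in> Obj C"
  shows "\<alpha>\<^sub>a A B (X \<otimes>\<^sub>o D) \<cdot> swap_front C X (A \<otimes>\<^sub>o B) D
    = (id\<^sub>a A \<otimes>\<^sub>a swap_front C X B D) \<cdot> swap_front C X A (B \<otimes>\<^sub>o D) \<cdot> (id\<^sub>a X \<otimes>\<^sub>a \<alpha>\<^sub>a A B D)"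
proof (rule iso_cancel_right)
  let ?k = "\<alpha>\<^sub>a X (A \<otimes>\<^sub>o B) D \<cdot> (\<alpha>\<^sub>a X A B \<otimes>\<^sub>a id\<^sub>a D)"
  let ?s = "(\<sigma>\<^sub>a X A \<otimes>\<^sub>a id\<^sub>a B) \<otimes>\<^sub>a id\<^sub>a D"
  have "(\<alpha>\<^sub>a A B (X \<otimes>\<^sub>o D) \<cdot> swap_front C X (A \<otimes>\<^sub>o B) D) \<cdot> ?k
      = \<alpha>\<^sub>a A B (X \<otimes>\<^sub>o D) \<cdot> \<alpha>\<^sub>a (A \<otimes>\<^sub>o B) X D \<cdot> ((\<sigma>\<^sub>a X (A \<otimes>\<^sub>o B) \<cdot> \<alpha>\<^sub>a X A B) \<otimes>\<^sub>a id\<^sub>a D)"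
    by (simp add: swap_front_def merge)
  also have "\<dots> = (id\<^sub>a A \<otimes>\<^sub>a \<alpha>\<^sub>a B X D) \<cdot> \<alpha>\<^sub>a A (B \<otimes>\<^sub>o X) D \<cdot>
      ((\<alpha>\<^sub>a A B X \<cdot> \<sigma>\<^sub>a X (A \<otimes>\<^sub>o B) \<cdot> \<alpha>\<^sub>a X A B) \<otimes>\<^sub>a id\<^sub>a D)"
    by (subst pentagon_tail[symmetric]) (simp_all add: merge)
  also have "\<dots> = (id\<^sub>a A \<otimes>\<^sub>a \<alpha>\<^sub>a B X D) \<cdot> \<alpha>\<^sub>a A (B \<otimes>\<^sub>o X) D \<cdot>
      ((id\<^sub>a A \<otimes>\<^sub>a \<sigma>\<^sub>a X B) \<otimes>\<^sub>a id\<^sub>a D) \<cdot> (\<alpha>\<^sub>a A X B \<otimes>\<^sub>a id\<^sub>a D) \<cdot> ?s"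
    by (subst hexagon) (simp_all add: merge)
  also have "\<dots> = (id\<^sub>a A \<otimes>\<^sub>a \<alpha>\<^sub>a B X D) \<cdot> (id\<^sub>a A \<otimes>\<^sub>a \<sigma>\<^sub>a X B \<otimes>\<^sub>a id\<^sub>a D) \<cdot>
      \<alpha>\<^sub>a A (X \<otimes>\<^sub>o B) D \<cdot> (\<alpha>\<^sub>a A X B \<otimes>\<^sub>a id\<^sub>a D) \<cdot> ?s"
    by (subst Assoc_nat_tail) simp_all
  also have "\<dots> = (id\<^sub>a A \<otimes>\<^sub>a swap_front C X B D) \<cdot> (id\<^sub>a A \<otimes>\<^sub>a \<alpha>\<^sub>a X B D) \<cdot>
      \<alpha>\<^sub>a A (X \<otimes>\<^sub>o B) D \<cdot> (\<alpha>\<^sub>a A X B \<otimes>\<^sub>a id\<^sub>a D) \<cdot> ?s"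
    by (simp add: merge swap_front_def)
  also have "\<dots> = (id\<^sub>a A \<otimes>\<^sub>a swap_front C X B D) \<cdot> \<alpha>\<^sub>a A X (B \<otimes>\<^sub>o D) \<cdot> \<alpha>\<^sub>a (A \<otimes>\<^sub>o X) B D \<cdot> ?s"
    by (subst pentagon_tail) simp_all
  also have "\<dots> = (id\<^sub>a A \<otimes>\<^sub>a swap_front C X B D) \<cdot> \<alpha>\<^sub>a A X (B \<otimes>\<^sub>o D) \<cdot> (\<sigma>\<^sub>a X A \<otimes>\<^sub>a id\<^sub>a (B \<otimes>\<^sub>o D)) \<cdot> \<alpha>\<^sub>a (X \<otimes>\<^sub>o A) B D"
    by (subst Assoc_nat) simp_all
  also have "\<dots> = (id\<^sub>a A \<otimes>\<^sub>a swap_front C X B D) \<cdot> swap_front C X A (B \<otimes>\<^sub>o D) \<cdot> \<alpha>\<^sub>a X A (B \<otimes>\<^sub>o D) \<cdot> \<alpha>\<^sub>a (X \<otimes>\<^sub>o A) B D"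
    by (simp add: swap_front_def)
  also have "\<dots> = (id\<^sub>a A \<otimes>\<^sub>a swap_front C X B D) \<cdot> swap_front C X A (B \<otimes>\<^sub>o D) \<cdot> (id\<^sub>a X \<otimes>\<^sub>a \<alpha>\<^sub>a A B D) \<cdot> ?k"
    by (subst pentagon) simp_all
  also have "\<dots> = ((id\<^sub>a A \<otimes>\<^sub>a swap_front C X B D) \<cdot> swap_front C X A (B \<otimes>\<^sub>o D) \<cdot> (id\<^sub>a X \<otimes>\<^sub>a \<alpha>\<^sub>a A B D)) \<cdot> ?k"
    by simp
  finally show "(\<alpha>\<^sub>a A B (X \<otimes>\<^sub>o D) \<cdot> swap_front C X (A \<otimes>\<^sub>o B) D) \<cdot> ?k
    = ((id\<^sub>a A \<otimes>\<^sub>a swap_front C X B D) \<cdot> swap_front C X A (B \<otimes>\<^sub>o D) \<cdot> (id\<^sub>a X \<otimes>\<^sub>a \<alpha>\<^sub>a A B D)) \<cdot> ?k" .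
qed simp_all

end

section \<open>Elements in a context\<close>

text \<open>The set of variables is stored next to the arrow because the arrow does not determine
  it: different sets of variables can have the same tensor product as domain.\<close>

definition dj :: "nat set \<times> 'm \<Rightarrow> nat set \<times> 'm \<Rightarrow> bool" where
  "dj a b \<longleftrightarrow> fst a \<inter> fst b = {}"

lemma dj_sym: "dj a b \<Longrightarrow> dj b a"
  by (auto simp: dj_def)

primrec djl :: "(nat set \<times> 'm) list \<Rightarrow> bool" where
  "djl [] = True"
| "djl (a # as) = ((\<forall>b \<in> set as. dj a b) \<and> djl as)"

lemma djl_append: "djl (as @ bs) \<longleftrightarrow> djl as \<and> djl bs \<and> (\<forall>a \<in> set as. \<forall>b \<in> set bs. dj a b)"
  by (induction as) auto

lemma djl_nth: "djl as \<longleftrightarrow> (\<forall>i < length as. \<forall>j < length as. i \<noteq> j \<longrightarrow> dj (as ! i) (as ! j))"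
proof (induction as)
  case (Cons a as)
  have "(\<forall>i < length (a # as). \<forall>j < length (a # as). i \<noteq> j \<longrightarrow> dj ((a # as) ! i) ((a # as) ! j))
    \<longleftrightarrow> (\<forall>j < length as. dj a (as ! j)) \<and> (\<forall>i < length as. \<forall>j < length as. i \<noteq> j \<longrightarrow> dj (as ! i) (as ! j))"
    by (auto simp: All_less_Suc2 dj_sym)
  then show ?case using Cons by (auto simp: all_set_conv_all_nth)
qed simp

context category
begin

definition ap :: "'m \<Rightarrow> nat set \<times> 'm \<Rightarrow> nat set \<times> 'm" where
  "ap f a = (fst a, f \<cdot> snd a)"

lemma fst_ap [simp]: "fst (ap f a) = fst a"
  by (simp add: ap_def)

lemma dj_ap [simp]: "dj (ap f a) b = dj a b" "dj b (ap f a) = dj b a"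
  by (simp_all add: dj_def)

end

context symmetric_monoidal_category
begin

lemma pentagon_inv:
  assumes [simp]: "A \<in> Obj C" "B \<in> Obj C" "D \<in> Obj C" "E \<in> Obj C"
  shows "\<alpha>\<^sub>a (A \<otimes>\<^sub>o B) D E \<cdot> (inv\<^sub>a (\<alpha>\<^sub>a A B D) \<otimes>\<^sub>a id\<^sub>a E) \<cdot> inv\<^sub>a (\<alpha>\<^sub>a A (B \<otimes>\<^sub>o D) E)
    = inv\<^sub>a (\<alpha>\<^sub>a A B (D \<otimes>\<^sub>o E)) \<cdot> (id\<^sub>a A \<otimes>\<^sub>a \<alpha>\<^sub>a B D E)" (is "?l = ?r")
proof (rule iso_cancel_right)
  let ?k = "\<alpha>\<^sub>a A (B \<otimes>\<^sub>o D) E \<cdot> (\<alpha>\<^sub>a A B D \<otimes>\<^sub>a id\<^sub>a E)"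
  have "?l \<cdot> ?k = \<alpha>\<^sub>a (A \<otimes>\<^sub>o B) D E" by (simp add: merge)
  also have "\<dots> = ?r \<cdot> ?k" by (simp add: pentagon)
  finally show "?l \<cdot> ?k = ?r \<cdot> ?k" .
qed simp_all

lemma swap_front_Assoc_middle':
  assumes [simp]: "X \<in> Obj C" "A \<in> Obj C" "B \<in> Obj C" "D \<in> Obj C"
  shows "\<alpha>\<^sub>a A (X \<otimes>\<^sub>o B) D \<cdot> (swap_front C X A B \<otimes>\<^sub>a id\<^sub>a D) \<cdot> inv\<^sub>a (\<alpha>\<^sub>a X (A \<otimes>\<^sub>o B) D)
    = (id\<^sub>a A \<otimes>\<^sub>a inv\<^sub>a (\<alpha>\<^sub>a X B D)) \<cdot> swap_front C X A (B \<otimes>\<^sub>o D) \<cdot> (id\<^sub>a X \<otimes>\<^sub>a \<alpha>\<^sub>a A B D)" (is "?l = ?r")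
proof (rule iso_cancel_right)
  let ?k = "\<alpha>\<^sub>a X (A \<otimes>\<^sub>o B) D"
  let ?i = "id\<^sub>a A \<otimes>\<^sub>a inv\<^sub>a (\<alpha>\<^sub>a X B D)"
  have "?l \<cdot> ?k = ?i \<cdot> (id\<^sub>a A \<otimes>\<^sub>a \<alpha>\<^sub>a X B D) \<cdot> \<alpha>\<^sub>a A (X \<otimes>\<^sub>o B) D \<cdot> (swap_front C X A B \<otimes>\<^sub>a id\<^sub>a D)"
    by (simp add: merge)
  also have "\<dots> = ?r \<cdot> ?k" by (simp add: swap_front_Assoc_middle)
  finally show "?l \<cdot> ?k = ?r \<cdot> ?k" .
qed simp_all

lemma LUnit_swap_front:
  assumes [simp]: "A \<in> Obj C" "B \<in> Obj C"
  shows "\<lambda>\<^sub>u (A \<otimes>\<^sub>o B) \<cdot> swap_front C A \<I> B = id\<^sub>a A \<otimes>\<^sub>a \<lambda>\<^sub>u B"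
proof -
  have "\<lambda>\<^sub>u (A \<otimes>\<^sub>o B) \<cdot> swap_front C A \<I> B = (\<lambda>\<^sub>u A \<otimes>\<^sub>a id\<^sub>a B) \<cdot> (\<sigma>\<^sub>a A \<I> \<otimes>\<^sub>a id\<^sub>a B) \<cdot> inv\<^sub>a (\<alpha>\<^sub>a A \<I> B)"
    by (simp add: swap_front_def Comp_tail[OF LUnit_TensO])
  also have "\<dots> = (\<rho>\<^sub>u A \<otimes>\<^sub>a id\<^sub>a B) \<cdot> inv\<^sub>a (\<alpha>\<^sub>a A \<I> B)"
    by (simp add: merge LUnit_Symm)
  also have "\<dots> = id\<^sub>a A \<otimes>\<^sub>a \<lambda>\<^sub>u B"
    by (subst triangle[symmetric]) simp_all
  finally show ?thesis .
qed

text \<open>The three inductive steps in the proof of \<open>separate_assoc\<close>, according to which part the new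
  factor \<open>X\<close> belongs to.\<close>

context
  fixes X A B D P Q m\<^sub>1 m\<^sub>2 m\<^sub>3 m\<^sub>4
  assumes obj [simp]: "X \<in> Obj C" "A \<in> Obj C" "B \<in> Obj C" "D \<in> Obj C"
    and m\<^sub>1 [simp]: "m\<^sub>1 \<in> Arr C" "Dom C m\<^sub>1 = P" "Cod C m\<^sub>1 = A \<otimes>\<^sub>o B"
    and m\<^sub>2 [simp]: "m\<^sub>2 \<in> Arr C" "Cod C m\<^sub>2 = P \<otimes>\<^sub>o D"
    and m\<^sub>3 [simp]: "m\<^sub>3 \<in> Arr C" "Dom C m\<^sub>3 = Q" "Cod C m\<^sub>3 = B \<otimes>\<^sub>o D"
    and m\<^sub>4 [simp]: "m\<^sub>4 \<in> Arr C" "Cod C m\<^sub>4 = A \<otimes>\<^sub>o Q" "Dom C m\<^sub>4 = Dom C m\<^sub>2"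
    and eq: "\<alpha>\<^sub>a A B D \<cdot> (m\<^sub>1 \<otimes>\<^sub>a id\<^sub>a D) \<cdot> m\<^sub>2 = (id\<^sub>a A \<otimes>\<^sub>a m\<^sub>3) \<cdot> m\<^sub>4"
begin

private lemma PQ: "P \<in> Obj C" "Q \<in> Obj C"
  using Dom_Cod_Obj(1)[of m\<^sub>1] Dom_Cod_Obj(1)[of m\<^sub>3] by simp_all

private lemma shift:
  "((id\<^sub>a X \<otimes>\<^sub>a m\<^sub>1) \<otimes>\<^sub>a id\<^sub>a D) \<cdot> inv\<^sub>a (\<alpha>\<^sub>a X P D) \<cdot> (id\<^sub>a X \<otimes>\<^sub>a m\<^sub>2)
    = inv\<^sub>a (\<alpha>\<^sub>a X (A \<otimes>\<^sub>o B) D) \<cdot> (id\<^sub>a X \<otimes>\<^sub>a ((m\<^sub>1 \<otimes>\<^sub>a id\<^sub>a D) \<cdot> m\<^sub>2))"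
proof -
  note PQ [simp]
  have "inv\<^sub>a (\<alpha>\<^sub>a X (A \<otimes>\<^sub>o B) D) \<cdot> (id\<^sub>a X \<otimes>\<^sub>a ((m\<^sub>1 \<otimes>\<^sub>a id\<^sub>a D) \<cdot> m\<^sub>2))
      = inv\<^sub>a (\<alpha>\<^sub>a X (A \<otimes>\<^sub>o B) D) \<cdot> (id\<^sub>a X \<otimes>\<^sub>a m\<^sub>1 \<otimes>\<^sub>a id\<^sub>a D) \<cdot> (id\<^sub>a X \<otimes>\<^sub>a m\<^sub>2)"
    by (simp add: merge)
  then show ?thesis by (simp add: Assoc_inv_nat_tail)
qed

lemma separate_assoc_step_left:
  "\<alpha>\<^sub>a (X \<otimes>\<^sub>o A) B D \<cdot> ((inv\<^sub>a (\<alpha>\<^sub>a X A B) \<cdot> (id\<^sub>a X \<otimes>\<^sub>a m\<^sub>1)) \<otimes>\<^sub>a id\<^sub>a D) \<cdot> inv\<^sub>a (\<alpha>\<^sub>a X P D) \<cdot> (id\<^sub>a X \<otimes>\<^sub>a m\<^sub>2)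
    = (id\<^sub>a (X \<otimes>\<^sub>o A) \<otimes>\<^sub>a m\<^sub>3) \<cdot> inv\<^sub>a (\<alpha>\<^sub>a X A Q) \<cdot> (id\<^sub>a X \<otimes>\<^sub>a m\<^sub>4)" (is "?l = ?r")
proof -
  note PQ [simp]
  have "?l = \<alpha>\<^sub>a (X \<otimes>\<^sub>o A) B D \<cdot> (inv\<^sub>a (\<alpha>\<^sub>a X A B) \<otimes>\<^sub>a id\<^sub>a D) \<cdot>
      ((id\<^sub>a X \<otimes>\<^sub>a m\<^sub>1) \<otimes>\<^sub>a id\<^sub>a D) \<cdot> inv\<^sub>a (\<alpha>\<^sub>a X P D) \<cdot> (id\<^sub>a X \<otimes>\<^sub>a m\<^sub>2)"
    by (simp add: merge)
  also have "\<dots> = (\<alpha>\<^sub>a (X \<otimes>\<^sub>o A) B D \<cdot> (inv\<^sub>a (\<alpha>\<^sub>a X A B) \<otimes>\<^sub>a id\<^sub>a D) \<cdot> inv\<^sub>a (\<alpha>\<^sub>a X (A \<otimes>\<^sub>o B) D)) \<cdot>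
      (id\<^sub>a X \<otimes>\<^sub>a ((m\<^sub>1 \<otimes>\<^sub>a id\<^sub>a D) \<cdot> m\<^sub>2))"
    by (simp add: shift)
  also have "\<dots> = inv\<^sub>a (\<alpha>\<^sub>a X A (B \<otimes>\<^sub>o D)) \<cdot> (id\<^sub>a X \<otimes>\<^sub>a (\<alpha>\<^sub>a A B D \<cdot> (m\<^sub>1 \<otimes>\<^sub>a id\<^sub>a D) \<cdot> m\<^sub>2))"
    by (subst pentagon_inv) (simp_all add: merge)
  also have "\<dots> = inv\<^sub>a (\<alpha>\<^sub>a X A (B \<otimes>\<^sub>o D)) \<cdot> (id\<^sub>a X \<otimes>\<^sub>a id\<^sub>a A \<otimes>\<^sub>a m\<^sub>3) \<cdot> (id\<^sub>a X \<otimes>\<^sub>a m\<^sub>4)"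
    by (simp add: merge eq)
  also have "\<dots> = ?r" by (simp add: Assoc_inv_nat_tail)
  finally show ?thesis .
qed

lemma separate_assoc_step_middle:
  "\<alpha>\<^sub>a A (X \<otimes>\<^sub>o B) D \<cdot> ((swap_front C X A B \<cdot> (id\<^sub>a X \<otimes>\<^sub>a m\<^sub>1)) \<otimes>\<^sub>a id\<^sub>a D) \<cdot> inv\<^sub>a (\<alpha>\<^sub>a X P D) \<cdot> (id\<^sub>a X \<otimes>\<^sub>a m\<^sub>2)
    = (id\<^sub>a A \<otimes>\<^sub>a (inv\<^sub>a (\<alpha>\<^sub>a X B D) \<cdot> (id\<^sub>a X \<otimes>\<^sub>a m\<^sub>3))) \<cdot> swap_front C X A Q \<cdot> (id\<^sub>a X \<otimes>\<^sub>a m\<^sub>4)" (is "?l = ?r")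
proof -
  note PQ [simp]
  have "?l = \<alpha>\<^sub>a A (X \<otimes>\<^sub>o B) D \<cdot> (swap_front C X A B \<otimes>\<^sub>a id\<^sub>a D) \<cdot>
      ((id\<^sub>a X \<otimes>\<^sub>a m\<^sub>1) \<otimes>\<^sub>a id\<^sub>a D) \<cdot> inv\<^sub>a (\<alpha>\<^sub>a X P D) \<cdot> (id\<^sub>a X \<otimes>\<^sub>a m\<^sub>2)"
    by (simp add: merge)
  also have "\<dots> = (\<alpha>\<^sub>a A (X \<otimes>\<^sub>o B) D \<cdot> (swap_front C X A B \<otimes>\<^sub>a id\<^sub>a D) \<cdot> inv\<^sub>a (\<alpha>\<^sub>a X (A \<otimes>\<^sub>o B) D)) \<cdot>
      (id\<^sub>a X \<otimes>\<^sub>a ((m\<^sub>1 \<otimes>\<^sub>a id\<^sub>a D) \<cdot> m\<^sub>2))"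
    by (simp add: shift)
  also have "\<dots> = (id\<^sub>a A \<otimes>\<^sub>a inv\<^sub>a (\<alpha>\<^sub>a X B D)) \<cdot> swap_front C X A (B \<otimes>\<^sub>o D) \<cdot>
      (id\<^sub>a X \<otimes>\<^sub>a (\<alpha>\<^sub>a A B D \<cdot> (m\<^sub>1 \<otimes>\<^sub>a id\<^sub>a D) \<cdot> m\<^sub>2))"
    by (subst swap_front_Assoc_middle') (simp_all add: merge)
  also have "\<dots> = (id\<^sub>a A \<otimes>\<^sub>a inv\<^sub>a (\<alpha>\<^sub>a X B D)) \<cdot> swap_front C X A (B \<otimes>\<^sub>o D) \<cdot>
      (id\<^sub>a X \<otimes>\<^sub>a id\<^sub>a A \<otimes>\<^sub>a m\<^sub>3) \<cdot> (id\<^sub>a X \<otimes>\<^sub>a m\<^sub>4)"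
    by (simp add: merge eq)
  also have "\<dots> = (id\<^sub>a A \<otimes>\<^sub>a inv\<^sub>a (\<alpha>\<^sub>a X B D)) \<cdot> (id\<^sub>a A \<otimes>\<^sub>a id\<^sub>a X \<otimes>\<^sub>a m\<^sub>3) \<cdot> swap_front C X A Q \<cdot> (id\<^sub>a X \<otimes>\<^sub>a m\<^sub>4)"
    by (subst swap_front_nat_tail) simp_all
  also have "\<dots> = ?r" by (simp add: merge)
  finally show ?thesis .
qed

lemma separate_assoc_step_right:
  "\<alpha>\<^sub>a A B (X \<otimes>\<^sub>o D) \<cdot> (m\<^sub>1 \<otimes>\<^sub>a id\<^sub>a (X \<otimes>\<^sub>o D)) \<cdot> swap_front C X P D \<cdot> (id\<^sub>a X \<otimes>\<^sub>a m\<^sub>2)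
    = (id\<^sub>a A \<otimes>\<^sub>a (swap_front C X B D \<cdot> (id\<^sub>a X \<otimes>\<^sub>a m\<^sub>3))) \<cdot> swap_front C X A Q \<cdot> (id\<^sub>a X \<otimes>\<^sub>a m\<^sub>4)" (is "?l = ?r")
proof -
  note PQ [simp]
  have nat: "(m\<^sub>1 \<otimes>\<^sub>a id\<^sub>a (X \<otimes>\<^sub>o D)) \<cdot> swap_front C X P D = swap_front C X (A \<otimes>\<^sub>o B) D \<cdot> (id\<^sub>a X \<otimes>\<^sub>a m\<^sub>1 \<otimes>\<^sub>a id\<^sub>a D)"
    by (subst swap_front_nat) simp_all
  have "?l = \<alpha>\<^sub>a A B (X \<otimes>\<^sub>o D) \<cdot> (swap_front C X (A \<otimes>\<^sub>o B) D \<cdot> (id\<^sub>a X \<otimes>\<^sub>a m\<^sub>1 \<otimes>\<^sub>a id\<^sub>a D)) \<cdot> (id\<^sub>a X \<otimes>\<^sub>a m\<^sub>2)"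
    by (simp add: Comp_tail[OF nat])
  also have "\<dots> = (\<alpha>\<^sub>a A B (X \<otimes>\<^sub>o D) \<cdot> swap_front C X (A \<otimes>\<^sub>o B) D) \<cdot> (id\<^sub>a X \<otimes>\<^sub>a ((m\<^sub>1 \<otimes>\<^sub>a id\<^sub>a D) \<cdot> m\<^sub>2))"
    by (simp add: merge)
  also have "\<dots> = (id\<^sub>a A \<otimes>\<^sub>a swap_front C X B D) \<cdot> swap_front C X A (B \<otimes>\<^sub>o D) \<cdot>
      (id\<^sub>a X \<otimes>\<^sub>a (\<alpha>\<^sub>a A B D \<cdot> (m\<^sub>1 \<otimes>\<^sub>a id\<^sub>a D) \<cdot> m\<^sub>2))"
    by (subst swap_front_TensO) (simp_all add: merge)
  also have "\<dots> = (id\<^sub>a A \<otimes>\<^sub>a swap_front C X B D) \<cdot> swap_front C X A (B \<otimes>\<^sub>o D) \<cdot>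
      (id\<^sub>a X \<otimes>\<^sub>a id\<^sub>a A \<otimes>\<^sub>a m\<^sub>3) \<cdot> (id\<^sub>a X \<otimes>\<^sub>a m\<^sub>4)"
    by (simp add: merge eq)
  also have "\<dots> = (id\<^sub>a A \<otimes>\<^sub>a swap_front C X B D) \<cdot> (id\<^sub>a A \<otimes>\<^sub>a id\<^sub>a X \<otimes>\<^sub>a m\<^sub>3) \<cdot> swap_front C X A Q \<cdot> (id\<^sub>a X \<otimes>\<^sub>a m\<^sub>4)"
    by (subst swap_front_nat_tail) simp_all
  also have "\<dots> = ?r" by (simp add: merge)
  finally show ?thesis .
qed

end

end

text \<open>A context is a list of objects, whose positions serve as names of variables. An element of
  \<open>A\<close> is a pair of a set \<open>L\<close> of variables and an arrow to \<open>A\<close> from the tensor product of the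
  factors in \<open>L\<close>; elements with disjoint sets of variables can be tensored. The maps \<open>separate\<close>
  hide all reorderings of factors, so that the structure isomorphisms act on tensors of elements
  as they do on tensors of vectors.\<close>

locale ctx = symmetric_monoidal_category C
  for C :: "('o, 'm, 'x) smcat_scheme" (structure) +
  fixes \<Gamma> :: "'o list"
  assumes ctx_Obj: "set \<Gamma> \<subseteq> Obj C"
begin

text \<open>The factors are ordered by their names, largest first, independently of how an element
  was assembled; this is why \<open>separate\<close> can absorb every reordering. The bound
  \<open>n\<close> serves induction, and elements use \<open>length \<Gamma>\<close>.\<close>

primrec var_tens :: "nat \<Rightarrow> nat set \<Rightarrow> 'o" where
  "var_tens 0 L = \<I>"
| "var_tens (Suc n) L = (if n \<in> L then \<Gamma> ! n \<otimes>\<^sub>o var_tens n L else var_tens n L)"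

text \<open>The unshuffle isomorphism from \<open>var_tens n (L \<union> L')\<close> to the tensor
  product of \<open>var_tens n L\<close> and \<open>var_tens n L'\<close>. A factor of the first
  part is already in place up to an associator; a factor of the second part has to cross the whole
  first part.\<close>

primrec separate :: "nat \<Rightarrow> nat set \<Rightarrow> nat set \<Rightarrow> 'm" where
  "separate 0 L L' = inv\<^sub>a (\<lambda>\<^sub>u \<I>)"
| "separate (Suc n) L L' =
     (if n \<in> L then inv\<^sub>a (\<alpha>\<^sub>a (\<Gamma> ! n) (var_tens n L) (var_tens n L')) \<cdot> (id\<^sub>a (\<Gamma> ! n) \<otimes>\<^sub>a separate n L L')
      else if n \<in> L' then swap_front C (\<Gamma> ! n) (var_tens n L) (var_tens n L') \<cdot> (id\<^sub>a (\<Gamma> ! n) \<otimes>\<^sub>a separate n L L')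
      else separate n L L')"

lemma nth_Obj [simp]: "i < length \<Gamma> \<Longrightarrow> \<Gamma> ! i \<in> Obj C"
  using ctx_Obj by auto

lemma var_tens_Obj [simp]: "n \<le> length \<Gamma> \<Longrightarrow> var_tens n L \<in> Obj C"
  by (induction n) auto

lemma separate_arr [simp]:
  assumes "n \<le> length \<Gamma>" "L \<inter> L' = {}"
  shows "separate n L L' \<in> Arr C" "Dom C (separate n L L') = var_tens n (L \<union> L')"
    "Cod C (separate n L L') = var_tens n L \<otimes>\<^sub>o var_tens n L'" "is_iso C (separate n L L')"
proof -
  have "is_iso C (separate n L L') \<and> separate n L L' \<in> Arr C \<and> Dom C (separate n L L') = var_tens n (L \<union> L') \<and>
    Cod C (separate n L L') = var_tens n L \<otimes>\<^sub>o var_tens n L'"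
    using assms by (induction n) (auto simp: disjoint_iff)
  then show "separate n L L' \<in> Arr C" "Dom C (separate n L L') = var_tens n (L \<union> L')"
    "Cod C (separate n L L') = var_tens n L \<otimes>\<^sub>o var_tens n L'" "is_iso C (separate n L L')"
    by auto
qed

text \<open>Coassociativity of unshuffling. By disjointness the new factor of the induction step
  lies in at most one of the three parts, and each possibility is one of the step lemmas.\<close>

lemma separate_assoc:
  assumes "n \<le> length \<Gamma>" "L \<inter> L' = {}" "L \<inter> L'' = {}" "L' \<inter> L'' = {}"
  shows "\<alpha>\<^sub>a (var_tens n L) (var_tens n L') (var_tens n L'') \<cdot> (separate n L L' \<otimes>\<^sub>a id\<^sub>a (var_tens n L'')) \<cdot>
      separate n (L \<union> L') L''
    = (id\<^sub>a (var_tens n L) \<otimes>\<^sub>a separate n L' L'') \<cdot> separate n L (L' \<union> L'')"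
  using assms
proof (induction n)
  case 0
  \<comment> \<open>With no factors left, the claim is about inverse unitors of the unit object
    only, and it holds because its left and right unitors coincide.\<close>
  have "\<lambda>\<^sub>u \<I> \<otimes>\<^sub>a id\<^sub>a \<I> = (id\<^sub>a \<I> \<otimes>\<^sub>a \<lambda>\<^sub>u \<I>) \<cdot> \<alpha>\<^sub>a \<I> \<I> \<I>"
    using triangle[of \<I> \<I>] by (simp add: LUnit_eq_RUnit_Unt)
  then have "(id\<^sub>a \<I> \<otimes>\<^sub>a \<lambda>\<^sub>u \<I>) \<cdot> \<alpha>\<^sub>a \<I> \<I> \<I> \<cdot> (inv\<^sub>a (\<lambda>\<^sub>u \<I>) \<otimes>\<^sub>a id\<^sub>a \<I>)
      = (\<lambda>\<^sub>u \<I> \<otimes>\<^sub>a id\<^sub>a \<I>) \<cdot> (inv\<^sub>a (\<lambda>\<^sub>u \<I>) \<otimes>\<^sub>a id\<^sub>a \<I>)"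
    by simp
  also have "\<dots> = (id\<^sub>a \<I> \<otimes>\<^sub>a \<lambda>\<^sub>u \<I>) \<cdot> (id\<^sub>a \<I> \<otimes>\<^sub>a inv\<^sub>a (\<lambda>\<^sub>u \<I>))"
    by (simp add: merge)
  finally have base: "\<alpha>\<^sub>a \<I> \<I> \<I> \<cdot> (inv\<^sub>a (\<lambda>\<^sub>u \<I>) \<otimes>\<^sub>a id\<^sub>a \<I>) = id\<^sub>a \<I> \<otimes>\<^sub>a inv\<^sub>a (\<lambda>\<^sub>u \<I>)"
    by (rule iso_cancel_left) simp_all
  then show ?case by (simp add: Comp_tail[OF base])
next
  case (Suc n)
  let ?X = "\<Gamma> ! n" and ?A = "var_tens n L" and ?B = "var_tens n L'" and ?D = "var_tens n L''"
  \<comment> \<open>The premises of the three step lemmas in their order; the slots left open are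
    the four objects.\<close>
  note step = _ _ _ _ separate_arr(1-3)[of n L L'] separate_arr(1)[of n "L \<union> L'" L'']
    separate_arr(3)[of n "L \<union> L'" L''] separate_arr(1-3)[of n L' L'']
    separate_arr(1)[of n L "L' \<union> L''"] separate_arr(3)[of n L "L' \<union> L''"]
  have IH: "\<alpha>\<^sub>a ?A ?B ?D \<cdot> (separate n L L' \<otimes>\<^sub>a id\<^sub>a ?D) \<cdot> separate n (L \<union> L') L''
    = (id\<^sub>a ?A \<otimes>\<^sub>a separate n L' L'') \<cdot> separate n L (L' \<union> L'')"
    using Suc by simp
  have [simp]: "n < length \<Gamma>" "n \<le> length \<Gamma>" using Suc.prems by auto
  have d [simp]: "(L \<union> L') \<inter> L'' = {}" "L \<inter> (L' \<union> L'') = {}" using Suc.prems by auto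
  have dm: "Dom C (separate n L (L' \<union> L'')) = Dom C (separate n (L \<union> L') L'')"
    using d by (simp add: Un_assoc)
  consider (1) "n \<in> L" "n \<notin> L'" "n \<notin> L''" | (2) "n \<notin> L" "n \<in> L'" "n \<notin> L''"
    | (3) "n \<notin> L" "n \<notin> L'" "n \<in> L''" | (4) "n \<notin> L" "n \<notin> L'" "n \<notin> L''"
    using Suc.prems by auto
  then show ?case
  proof cases
    case 1
    then show ?thesis
      using separate_assoc_step_left[OF step dm IH] Suc.prems by simp
  next
    case 2
    then show ?thesis
      using separate_assoc_step_middle[OF step dm IH] Suc.prems by simp
  next
    case 3
    then show ?thesis
      using separate_assoc_step_right[OF step dm IH] Suc.prems by simp
  next
    case 4
    then show ?thesis using IH by simp
  qed
qed

text \<open>Cocommutativity of unshuffling: the two branches of \<open>separate\<close> for a new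
  factor are exchanged by the symmetry, which is what \<open>Symm_swap_front\<close> says.\<close>

lemma separate_Symm:
  assumes "n \<le> length \<Gamma>" "L \<inter> L' = {}"
  shows "\<sigma>\<^sub>a (var_tens n L) (var_tens n L') \<cdot> separate n L L' = separate n L' L"
  using assms
proof (induction n)
  case 0
  have unit: "\<lambda>\<^sub>u \<I> \<cdot> \<sigma>\<^sub>a \<I> \<I> = \<lambda>\<^sub>u \<I>" using LUnit_Symm[of \<I>] by (simp add: LUnit_eq_RUnit_Unt)
  have "\<lambda>\<^sub>u \<I> \<cdot> \<sigma>\<^sub>a \<I> \<I> \<cdot> inv\<^sub>a (\<lambda>\<^sub>u \<I>) = \<lambda>\<^sub>u \<I> \<cdot> inv\<^sub>a (\<lambda>\<^sub>u \<I>)"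
    by (subst Comp_tail[OF unit]) simp_all
  then have "\<sigma>\<^sub>a \<I> \<I> \<cdot> inv\<^sub>a (\<lambda>\<^sub>u \<I>) = inv\<^sub>a (\<lambda>\<^sub>u \<I>)"
    by (rule iso_cancel_left) simp_all
  then show ?case by simp
next
  case (Suc n)
  let ?X = "\<Gamma> ! n" and ?A = "var_tens n L" and ?B = "var_tens n L'"
  have [simp]: "n < length \<Gamma>" "n \<le> length \<Gamma>" using Suc.prems by auto
  have IH: "\<sigma>\<^sub>a ?A ?B \<cdot> separate n L L' = separate n L' L"
    using Suc by simp
  consider (1) "n \<in> L" "n \<notin> L'" | (2) "n \<notin> L" "n \<in> L'" | (3) "n \<notin> L" "n \<notin> L'"
    using Suc.prems by auto
  note cases = this
  note [simp] = Suc.prems(2) trans[OF Int_commute Suc.prems(2)]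
  from cases show ?case
  proof cases
    case 1
    then show ?thesis
      by (simp add: Comp_tail[OF Symm_swap_front] merge IH)
  next
    case 2
    \<comment> \<open>This is the previous case with the two parts exchanged; composing with the
      inverse symmetry then gives the present case.\<close>
    have "\<sigma>\<^sub>a (?X \<otimes>\<^sub>o ?B) ?A \<cdot> inv\<^sub>a (\<alpha>\<^sub>a ?X ?B ?A) \<cdot> (id\<^sub>a ?X \<otimes>\<^sub>a separate n L' L)
        = swap_front C ?X ?A ?B \<cdot> (id\<^sub>a ?X \<otimes>\<^sub>a (\<sigma>\<^sub>a ?B ?A \<cdot> \<sigma>\<^sub>a ?A ?B \<cdot> separate n L L'))"
      by (simp add: Comp_tail[OF Symm_swap_front] merge IH)
    also have "\<dots> = swap_front C ?X ?A ?B \<cdot> (id\<^sub>a ?X \<otimes>\<^sub>a separate n L L')"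
      by (subst Comp_tail[OF Symm_arr(4)]) simp_all
    finally have *: "\<sigma>\<^sub>a (?X \<otimes>\<^sub>o ?B) ?A \<cdot> inv\<^sub>a (\<alpha>\<^sub>a ?X ?B ?A) \<cdot> (id\<^sub>a ?X \<otimes>\<^sub>a separate n L' L)
      = swap_front C ?X ?A ?B \<cdot> (id\<^sub>a ?X \<otimes>\<^sub>a separate n L L')" .
    have "\<sigma>\<^sub>a ?A (?X \<otimes>\<^sub>o ?B) \<cdot> swap_front C ?X ?A ?B \<cdot> (id\<^sub>a ?X \<otimes>\<^sub>a separate n L L')
        = inv\<^sub>a (\<alpha>\<^sub>a ?X ?B ?A) \<cdot> (id\<^sub>a ?X \<otimes>\<^sub>a separate n L' L)"
      by (subst *[symmetric], subst Comp_tail[OF Symm_arr(4)]) simp_all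
    then show ?thesis using 2 by simp
  next
    case 3
    then show ?thesis using IH by simp
  qed
qed

lemma var_tens_empty [simp]: "var_tens n {} = \<I>"
  by (induction n) auto

lemma var_tens_single: "var_tens n {i} = (if i < n then \<Gamma> ! i \<otimes>\<^sub>o \<I> else \<I>)"
  by (induction n) (auto simp: less_Suc_eq)

lemma separate_empty:
  assumes "n \<le> length \<Gamma>"
  shows "\<lambda>\<^sub>u (var_tens n L) \<cdot> separate n {} L = id\<^sub>a (var_tens n L)"
  using assms
proof (induction n)
  case (Suc n)
  then show ?case
    by (auto simp: Comp_tail[OF LUnit_swap_front] merge)
qed simp

end

section \<open>Elements, and the action of the structure isomorphisms on them\<close>

context ctx
begin

definition el :: "'o \<Rightarrow> nat set \<times> 'm \<Rightarrow> bool" where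
  "el A a \<longleftrightarrow> snd a \<in> Arr C \<and> Dom C (snd a) = var_tens (length \<Gamma>) (fst a) \<and> Cod C (snd a) = A"

definition eprod :: "nat set \<times> 'm \<Rightarrow> nat set \<times> 'm \<Rightarrow> nat set \<times> 'm"  (infixr "\<bowtie>" 70) where
  "a \<bowtie> b = (fst a \<union> fst b, (snd a \<otimes>\<^sub>a snd b) \<cdot> separate (length \<Gamma>) (fst a) (fst b))"

definition eunit :: "nat set \<times> 'm" where
  "eunit = ({}, id\<^sub>a \<I>)"

text \<open>The variable named \<open>i\<close> as an element: the tensor product over a single name
  still ends in a unit object, which the right unitor removes.\<close>

definition gen :: "nat \<Rightarrow> nat set \<times> 'm" where
  "gen i = ({i}, \<rho>\<^sub>u (\<Gamma> ! i))"

text \<open>Elements that are invertible as arrows play the role of generic elements: by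
  \<open>isoE_cancel\<close> one of them suffices to test equality of arrows.\<close>

definition isoE :: "nat set \<times> 'm \<Rightarrow> bool" where
  "isoE a \<longleftrightarrow> is_iso C (snd a)"

lemma fst_eprod [simp]: "fst (a \<bowtie> b) = fst a \<union> fst b"
  by (simp add: eprod_def)

lemma dj_eprod [simp]: "dj (a \<bowtie> b) c \<longleftrightarrow> dj a c \<and> dj b c" "dj c (a \<bowtie> b) \<longleftrightarrow> dj c a \<and> dj c b"
  by (auto simp: dj_def)

lemma fst_eunit [simp]: "fst eunit = {}"
  by (simp add: eunit_def)

lemma dj_eunit [simp]: "dj eunit a" "dj a eunit"
  by (simp_all add: dj_def)

lemma fst_gen [simp]: "fst (gen i) = {i}"
  by (simp add: gen_def)

lemma dj_gen [simp]: "dj (gen i) (gen j) \<longleftrightarrow> i \<noteq> j"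
  by (auto simp: dj_def)

lemma el_Obj: "el A a \<Longrightarrow> A \<in> Obj C"
  by (auto simp: el_def)

lemma el_ap [simp]: "\<lbrakk>f \<in> Arr C; Cod C f = B; el (Dom C f) a\<rbrakk> \<Longrightarrow> el B (ap f a)"
  by (simp add: el_def ap_def)

lemma el_eprod [simp]: "\<lbrakk>el A a; el B b; dj a b\<rbrakk> \<Longrightarrow> el (A \<otimes>\<^sub>o B) (a \<bowtie> b)"
  by (simp add: el_def eprod_def dj_def)

lemma el_eunit [simp]: "el \<I> eunit"
  by (simp add: el_def eunit_def)

lemma el_gen [simp]: "\<lbrakk>i < length \<Gamma>; A = \<Gamma> ! i\<rbrakk> \<Longrightarrow> el A (gen i)"
  by (simp add: el_def gen_def var_tens_single)

lemma isoE_gen [simp]: "i < length \<Gamma> \<Longrightarrow> isoE (gen i)"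
  by (simp add: isoE_def gen_def)

lemma isoE_eunit [simp]: "isoE eunit"
  by (simp add: isoE_def eunit_def)

lemma isoE_eprod: "\<lbrakk>isoE a; isoE b; el A a; el B b; dj a b\<rbrakk> \<Longrightarrow> isoE (a \<bowtie> b)"
  by (simp add: isoE_def eprod_def el_def dj_def)

lemma ap_Comp [simp]:
  "\<lbrakk>f \<in> Arr C; g \<in> Arr C; Dom C g = Cod C f; el (Dom C f) a\<rbrakk> \<Longrightarrow> ap (g \<cdot> f) a = ap g (ap f a)"
  by (simp add: ap_def el_def)

lemma ap_Idn [simp]: "el A a \<Longrightarrow> ap (id\<^sub>a A) a = a"
  by (auto simp: ap_def el_def intro: prod_eqI)

lemma ap_inv: "\<lbrakk>is_iso C f; ap f a = b; el (Dom C f) a\<rbrakk> \<Longrightarrow> ap (inv\<^sub>a f) b = a"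
  by (auto simp: ap_def el_def iso_arr intro: prod_eqI)

lemma ap_TensA [simp]:
  assumes "f \<in> Arr C" "g \<in> Arr C" "el (Dom C f) a" "el (Dom C g) b" "dj a b"
  shows "ap (f \<otimes>\<^sub>a g) (a \<bowtie> b) = ap f a \<bowtie> ap g b"
  using assms by (simp add: ap_def eprod_def el_def dj_def merge)

text \<open>Naturality moves the associator onto the separated variables, where
  \<open>separate_assoc\<close> removes it.\<close>

lemma ap_Assoc [simp]:
  assumes "el A a" "el B b" "el D c" "dj a b" "dj a c" "dj b c"
  shows "ap (\<alpha>\<^sub>a A B D) ((a \<bowtie> b) \<bowtie> c) = a \<bowtie> b \<bowtie> c"
proof -
  let ?n = "length \<Gamma>"
  let ?T = "\<lambda>x. var_tens ?n (fst x)"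
  have [simp]: "A \<in> Obj C" "B \<in> Obj C" "D \<in> Obj C" using assms by (auto simp: el_Obj)
  have [simp]: "fst a \<inter> fst b = {}" "fst a \<inter> fst c = {}" "fst b \<inter> fst c = {}"
    "(fst a \<union> fst b) \<inter> fst c = {}" "fst a \<inter> (fst b \<union> fst c) = {}"
    using assms by (auto simp: dj_def)
  have e [simp]: "snd a \<in> Arr C" "Dom C (snd a) = ?T a" "Cod C (snd a) = A"
    "snd b \<in> Arr C" "Dom C (snd b) = ?T b" "Cod C (snd b) = B"
    "snd c \<in> Arr C" "Dom C (snd c) = ?T c" "Cod C (snd c) = D"
    using assms by (auto simp: el_def)
  have "\<alpha>\<^sub>a A B D \<cdot> (((snd a \<otimes>\<^sub>a snd b) \<cdot> separate ?n (fst a) (fst b)) \<otimes>\<^sub>a snd c) \<cdot>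
      separate ?n (fst a \<union> fst b) (fst c)
    = \<alpha>\<^sub>a A B D \<cdot> ((snd a \<otimes>\<^sub>a snd b) \<otimes>\<^sub>a snd c) \<cdot> (separate ?n (fst a) (fst b) \<otimes>\<^sub>a id\<^sub>a (?T c)) \<cdot>
      separate ?n (fst a \<union> fst b) (fst c)"
    by (simp add: merge)
  also have "\<dots> = (snd a \<otimes>\<^sub>a snd b \<otimes>\<^sub>a snd c) \<cdot> \<alpha>\<^sub>a (?T a) (?T b) (?T c) \<cdot>
      (separate ?n (fst a) (fst b) \<otimes>\<^sub>a id\<^sub>a (?T c)) \<cdot> separate ?n (fst a \<union> fst b) (fst c)"
    by (subst Assoc_nat_tail) simp_all
  also have "\<dots> = (snd a \<otimes>\<^sub>a snd b \<otimes>\<^sub>a snd c) \<cdot> (id\<^sub>a (?T a) \<otimes>\<^sub>a separate ?n (fst b) (fst c)) \<cdot>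
      separate ?n (fst a) (fst b \<union> fst c)"
    by (subst separate_assoc) simp_all
  also have "\<dots> = (snd a \<otimes>\<^sub>a ((snd b \<otimes>\<^sub>a snd c) \<cdot> separate ?n (fst b) (fst c))) \<cdot>
      separate ?n (fst a) (fst b \<union> fst c)"
    by (simp add: merge)
  finally show ?thesis
    by (simp add: ap_def eprod_def Un_assoc)
qed

lemma ap_Symm [simp]:
  assumes "el A a" "el B b" "dj a b"
  shows "ap (\<sigma>\<^sub>a A B) (a \<bowtie> b) = b \<bowtie> a"
proof -
  let ?n = "length \<Gamma>"
  let ?T = "\<lambda>x. var_tens ?n (fst x)"
  have [simp]: "A \<in> Obj C" "B \<in> Obj C" using assms by (auto simp: el_Obj)
  have [simp]: "fst a \<inter> fst b = {}" "fst b \<inter> fst a = {}"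
    using assms by (auto simp: dj_def)
  have [simp]: "snd a \<in> Arr C" "Dom C (snd a) = ?T a" "Cod C (snd a) = A"
    "snd b \<in> Arr C" "Dom C (snd b) = ?T b" "Cod C (snd b) = B"
    using assms by (auto simp: el_def)
  have "\<sigma>\<^sub>a A B \<cdot> (snd a \<otimes>\<^sub>a snd b) \<cdot> separate ?n (fst a) (fst b)
      = (snd b \<otimes>\<^sub>a snd a) \<cdot> \<sigma>\<^sub>a (?T a) (?T b) \<cdot> separate ?n (fst a) (fst b)"
    by (subst Symm_nat_tail) simp_all
  then show ?thesis
    by (simp add: ap_def eprod_def Un_commute separate_Symm)
qed

lemma ap_LUnit [simp]:
  assumes "el A a"
  shows "ap (\<lambda>\<^sub>u A) (eunit \<bowtie> a) = a"
proof -
  let ?n = "length \<Gamma>"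
  have [simp]: "A \<in> Obj C" "snd a \<in> Arr C" "Dom C (snd a) = var_tens ?n (fst a)" "Cod C (snd a) = A"
    using assms by (auto simp: el_def)
  have "\<lambda>\<^sub>u A \<cdot> (id\<^sub>a \<I> \<otimes>\<^sub>a snd a) \<cdot> separate ?n {} (fst a) = snd a \<cdot> \<lambda>\<^sub>u (var_tens ?n (fst a)) \<cdot> separate ?n {} (fst a)"
    using Comp_tail[OF LUnit_nat[of "snd a" A], of "separate ?n {} (fst a)"] by simp
  then show ?thesis
    by (simp add: ap_def eprod_def eunit_def separate_empty)
qed

lemma ap_RUnit [simp]:
  assumes "el A a"
  shows "ap (\<rho>\<^sub>u A) (a \<bowtie> eunit) = a"
proof -
  have [simp]: "A \<in> Obj C" using assms by (rule el_Obj)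
  have "ap (\<rho>\<^sub>u A) (a \<bowtie> eunit) = ap (\<lambda>\<^sub>u A \<cdot> \<sigma>\<^sub>a A \<I>) (a \<bowtie> eunit)"
    by (simp add: LUnit_Symm)
  also have "\<dots> = a" using assms by (subst ap_Comp) simp_all
  finally show ?thesis .
qed

lemma ap_Assoc_inv [simp]:
  "\<lbrakk>el A a; el B b; el D c; dj a b; dj a c; dj b c\<rbrakk>
    \<Longrightarrow> ap (inv\<^sub>a (\<alpha>\<^sub>a A B D)) (a \<bowtie> b \<bowtie> c) = (a \<bowtie> b) \<bowtie> c"
  by (rule ap_inv) (simp_all add: el_Obj)

lemma ap_LUnit_inv [simp]: "el A a \<Longrightarrow> ap (inv\<^sub>a (\<lambda>\<^sub>u A)) a = eunit \<bowtie> a"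
  by (rule ap_inv) (simp_all add: el_Obj)

lemma ap_RUnit_inv [simp]: "el A a \<Longrightarrow> ap (inv\<^sub>a (\<rho>\<^sub>u A)) a = a \<bowtie> eunit"
  by (rule ap_inv) (simp_all add: el_Obj)

lemma ap_swap_front [simp]:
  "\<lbrakk>el A a; el B b; el D c; dj a b; dj a c; dj b c\<rbrakk> \<Longrightarrow> ap (swap_front C A B D) (a \<bowtie> b \<bowtie> c) = b \<bowtie> a \<bowtie> c"
  by (simp add: swap_front_def el_Obj dj_sym)

lemma isoE_cancel:
  assumes "ap f a = ap g a" "isoE a" "el A a" "f \<in> Arr C" "g \<in> Arr C" "Dom C f = A" "Dom C g = A"
  shows "f = g"
  by (rule iso_cancel_right[of f "snd a" g]) (use assms in \<open>auto simp: ap_def isoE_def el_def\<close>)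

definition tensE :: "(nat set \<times> 'm) list \<Rightarrow> nat set \<times> 'm" where
  "tensE as = foldr eprod as eunit"

lemma tensE_simps [simp]: "tensE [] = eunit" "tensE (a # as) = a \<bowtie> tensE as"
  by (simp_all add: tensE_def)

lemma dj_tensE [simp]:
  "dj b (tensE as) \<longleftrightarrow> (\<forall>a \<in> set as. dj b a)" "dj (tensE as) b \<longleftrightarrow> (\<forall>a \<in> set as. dj a b)"
  by (induction as) auto

lemma fst_tensE: "fst (tensE as) = (\<Union>a \<in> set as. fst a)"
  by (induction as) auto

definition els :: "'o list \<Rightarrow> (nat set \<times> 'm) list \<Rightarrow> bool" where
  "els Xs as \<longleftrightarrow> list_all2 el Xs as \<and> djl as"

lemma els_simps [simp]:
  "els [] as \<longleftrightarrow> as = []"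
  "els Xs [] \<longleftrightarrow> Xs = []"
  "els (X # Xs) (a # as) \<longleftrightarrow> el X a \<and> (\<forall>b \<in> set as. dj a b) \<and> els Xs as"
  by (auto simp: els_def)

lemma els_length: "els Xs as \<Longrightarrow> length Xs = length as"
  by (auto simp: els_def list_all2_lengthD)

lemma els_Obj: "els Xs as \<Longrightarrow> set Xs \<subseteq> Obj C"
  unfolding els_def list_all2_conv_all_nth using el_Obj by (metis in_set_conv_nth subsetI)

lemma els_Cons: "els (X # Xs) as \<longleftrightarrow> (\<exists>b bs. as = b # bs \<and> el X b \<and> (\<forall>c \<in> set bs. dj b c) \<and> els Xs bs)"
  by (cases as) auto

lemma els_append:
  assumes "length Xs = length as"
  shows "els (Xs @ Ys) (as @ bs) \<longleftrightarrow> els Xs as \<and> els Ys bs \<and> (\<forall>a \<in> set as. \<forall>b \<in> set bs. dj a b)"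
  using assms by (auto simp: els_def list_all2_append djl_append)

lemma els_replicate:
  "els (replicate n A) as \<longleftrightarrow> length as = n \<and> (\<forall>a \<in> set as. el A a) \<and> djl as"
  by (auto simp: els_def list_all2_conv_all_nth all_set_conv_all_nth)

lemma els_map_nth:
  assumes "els Xs as" "distinct p" "set p \<subseteq> {..<length as}"
  shows "els (map ((!) Xs) p) (map ((!) as) p)"
proof -
  have "p ! i < length as" if "i < length p" for i using assms(3) that nth_mem by blast
  then show ?thesis
    using assms els_length[OF assms(1)]
    by (auto simp: els_def list_all2_conv_all_nth djl_nth nth_eq_iff_index_eq)
qed

lemma el_tensE [simp]: "els Xs as \<Longrightarrow> el (tens C Xs) (tensE as)"
  by (induction as arbitrary: Xs) (auto simp: els_def list_all2_Cons2)

lemma isoE_tensE: "\<lbrakk>els Xs as; \<forall>a \<in> set as. isoE a\<rbrakk> \<Longrightarrow> isoE (tensE as)"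
proof (induction as arbitrary: Xs)
  case (Cons a as)
  then obtain Y Ys where "Xs = Y # Ys" by (cases Xs) auto
  then show ?case using Cons by (auto intro!: isoE_eprod[OF _ _ _ el_tensE])
qed simp

lemma els_gen: "els \<Gamma> (map gen [0..<length \<Gamma>])"
  by (auto simp: els_def list_all2_conv_all_nth djl_nth)

end

subsection \<open>Permutations of factors\<close>

lemma length_remove_nth [simp]: "i < length xs \<Longrightarrow> length (remove_nth i xs) = length xs - 1"
  by (auto simp: remove_nth_def)

lemma nth_remove_nth:
  "\<lbrakk>i < length xs; k < length xs - 1\<rbrakk> \<Longrightarrow> remove_nth i xs ! k = (if k < i then xs ! k else xs ! Suc k)"
  by (auto simp: remove_nth_def nth_append)

lemma remove_nth_Cons [simp]: "remove_nth 0 (x # xs) = xs" "remove_nth (Suc i) (x # xs) = x # remove_nth i xs"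
  by (auto simp: remove_nth_def)

lemma set_remove_nth: "set (remove_nth i xs) \<subseteq> set xs"
  by (auto simp: remove_nth_def dest: in_set_takeD in_set_dropD)

definition is_arrangement :: "nat \<Rightarrow> nat list \<Rightarrow> bool" where
  "is_arrangement n p \<longleftrightarrow> distinct p \<and> set p = {..<n}"

abbreviation renumber :: "nat \<Rightarrow> nat list \<Rightarrow> nat list" where
  "renumber i p \<equiv> map (\<lambda>k. if i < k then k - 1 else k) p"

lemma is_arrangement_length: "is_arrangement n p \<Longrightarrow> length p = n"
  unfolding is_arrangement_def using distinct_card by fastforce

text \<open>Closing the gap left by \<open>i\<close> shifts the larger positions down by one. This
  is injective only away from \<open>i\<close>, and it translates positions in \<open>xs\<close>
  into positions in \<open>remove_nth i xs\<close>, as the recursion of \<open>tens_perm\<close>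
  requires.\<close>

lemma is_arrangement_Cons:
  assumes "is_arrangement n (i # p)"
  shows "i < n" "is_arrangement (n - 1) (renumber i p)" "\<And>k. k \<in> set p \<Longrightarrow> k < n \<and> k \<noteq> i"
    "length xs = n \<Longrightarrow> map ((!) (remove_nth i xs)) (renumber i p) = map ((!) xs) p"
proof -
  have d: "distinct p" "i \<notin> set p" and s: "insert i (set p) = {..<n}"
    using assms by (auto simp: is_arrangement_def)
  show i: "i < n" using s by blast
  show k: "k < n \<and> k \<noteq> i" if "k \<in> set p" for k using that s d by blast
  have "inj_on (\<lambda>k. if i < k then k - 1 else k) (set p)"
  proof (rule inj_onI)
    fix x y
    assume "x \<in> set p" "y \<in> set p" and eq: "(if i < x then x - 1 else x) = (if i < y then y - 1 else y)"
    then have "x \<noteq> i" "y \<noteq> i" using d by auto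
    then show "x = y" using eq by (auto split: if_splits)
  qed
  moreover have "(\<lambda>k. if i < k then k - 1 else k) ` set p = {..<n - 1}"
  proof
    show "(\<lambda>k. if i < k then k - 1 else k) ` set p \<subseteq> {..<n - 1}"
      using k i by fastforce
    show "{..<n - 1} \<subseteq> (\<lambda>k. if i < k then k - 1 else k) ` set p"
    proof
      fix l assume l: "l \<in> {..<n - 1}"
      \<comment> \<open>The position that is renumbered to \<open>l\<close>; it never equals
        \<open>i\<close>.\<close>
      let ?k = "if l < i then l else Suc l"
      have "?k \<in> insert i (set p)" unfolding s using l by auto
      then have "?k \<in> set p" by (auto split: if_splits)
      moreover have "l = (if i < ?k then ?k - 1 else ?k)" by auto
      ultimately show "l \<in> (\<lambda>k. if i < k then k - 1 else k) ` set p" by blast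
    qed
  qed
  ultimately show "is_arrangement (n - 1) (renumber i p)"
    using d by (simp add: is_arrangement_def distinct_map)
  show "map ((!) (remove_nth i xs)) (renumber i p) = map ((!) xs) p" if xs: "length xs = n"
    unfolding map_map
  proof (rule map_cong[OF refl])
    fix x assume "x \<in> set p"
    then have "x < n" "x \<noteq> i" using k by auto
    then show "((!) (remove_nth i xs) \<circ> (\<lambda>k. if i < k then k - 1 else k)) x = xs ! x"
      using xs i by (auto simp: nth_remove_nth)
  qed
qed

context symmetric_monoidal_category
begin

lemma tens_Obj [simp]: "set Xs \<subseteq> Obj C \<Longrightarrow> tens C Xs \<in> Obj C"
  by (induction Xs) auto

lemma pull_arr [simp]:
  assumes "i < length Xs" "set Xs \<subseteq> Obj C"
  shows "pull C i Xs \<in> Arr C" "Dom C (pull C i Xs) = tens C Xs"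
    "Cod C (pull C i Xs) = tens C (Xs ! i # remove_nth i Xs)"
proof -
  have "pull C i Xs \<in> Arr C \<and> Dom C (pull C i Xs) = tens C Xs \<and>
    Cod C (pull C i Xs) = tens C (Xs ! i # remove_nth i Xs)"
    using assms
  proof (induction i arbitrary: Xs)
    case 0
    then show ?case by (cases Xs) simp_all
  next
    case (Suc i)
    then obtain Y Ys where [simp]: "Xs = Y # Ys" by (cases Xs) auto
    have [simp]: "i < length Ys" "set Ys \<subseteq> Obj C" "Y \<in> Obj C" using Suc.prems by auto
    then have "Ys ! i \<in> Obj C" "set (remove_nth i Ys) \<subseteq> Obj C"
      using set_remove_nth[of i Ys] nth_mem[of i Ys] by blast+
    then show ?case using Suc.IH[of Ys] by simp
  qed
  then show "pull C i Xs \<in> Arr C" "Dom C (pull C i Xs) = tens C Xs"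
    "Cod C (pull C i Xs) = tens C (Xs ! i # remove_nth i Xs)" by blast+
qed

lemma tens_perm_arr [simp]:
  assumes "is_arrangement (length Xs) p" "set Xs \<subseteq> Obj C"
  shows "tens_perm C Xs p \<in> Arr C" "Dom C (tens_perm C Xs p) = tens C Xs"
    "Cod C (tens_perm C Xs p) = tens C (map ((!) Xs) p)"
proof -
  have "tens_perm C Xs p \<in> Arr C \<and> Dom C (tens_perm C Xs p) = tens C Xs \<and>
    Cod C (tens_perm C Xs p) = tens C (map ((!) Xs) p)"
    using assms
  proof (induction "length p" arbitrary: p Xs)
    case 0
    then have "p = []" "Xs = []" using is_arrangement_length by fastforce+
    then show ?case by simp
  next
    case (Suc n)
    then obtain i q where p [simp]: "p = i # q" by (cases p) auto
    note ar = is_arrangement_Cons[OF Suc.prems(1)[unfolded p]]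
    have [simp]: "Xs ! i \<in> Obj C" "set (remove_nth i Xs) \<subseteq> Obj C"
      using set_remove_nth[of i Xs] nth_mem[of i Xs] ar(1) Suc.prems(2) by blast+
    show ?case
      using Suc.hyps(1)[of "renumber i q" "remove_nth i Xs"] Suc.hyps(2) Suc.prems(2) ar(1,2) ar(4)[OF refl]
      by (simp del: map_map)
  qed
  then show "tens_perm C Xs p \<in> Arr C" "Dom C (tens_perm C Xs p) = tens C Xs"
    "Cod C (tens_perm C Xs p) = tens C (map ((!) Xs) p)" by blast+
qed

lemma tens_append_arr [simp]:
  assumes "set Xs \<subseteq> Obj C" "set Ys \<subseteq> Obj C"
  shows "tens_append C Xs Ys \<in> Arr C" "Dom C (tens_append C Xs Ys) = tens C Xs \<otimes>\<^sub>o tens C Ys"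
    "Cod C (tens_append C Xs Ys) = tens C (Xs @ Ys)"
  using assms by (induction Xs) simp_all

end

context ctx
begin

lemma els_remove_nth:
  assumes "els Xs as" "i < length as"
  shows "els (remove_nth i Xs) (remove_nth i as)"
  using assms
proof (induction i arbitrary: Xs as)
  case 0
  then show ?case by (cases as; cases Xs) auto
next
  case (Suc i)
  then obtain Y Ys b bs where [simp]: "Xs = Y # Ys" "as = b # bs" by (cases as; cases Xs) auto
  show ?case using Suc set_remove_nth[of i bs] by auto
qed

lemma els_nth: "\<lbrakk>els Xs as; i < length as\<rbrakk> \<Longrightarrow> el (Xs ! i) (as ! i)"
  by (simp add: els_def list_all2_conv_all_nth)

lemma dj_remove_nth:
  assumes "djl as" "i < length as" "b \<in> set (remove_nth i as)"
  shows "dj (as ! i) b"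
  using assms
proof (induction i arbitrary: as)
  case 0
  then show ?case by (cases as) auto
next
  case (Suc i)
  then obtain c cs where [simp]: "as = c # cs" by (cases as) auto
  show ?case using Suc nth_mem[of i cs] by (auto intro: dj_sym)
qed

lemma ap_pull [simp]:
  assumes "els Xs as" "i < length as"
  shows "ap (pull C i Xs) (tensE as) = tensE (as ! i # remove_nth i as)"
  using assms
proof (induction i arbitrary: Xs as)
  case 0
  then show ?case by (cases as; cases Xs) (simp_all add: el_Obj els_Obj)
next
  case (Suc i)
  then obtain Y Ys b bs where [simp]: "Xs = Y # Ys" "as = b # bs" by (cases as; cases Xs) auto
  have e: "els Ys bs" "i < length bs" "el Y b" "\<forall>c \<in> set bs. dj b c" using Suc.prems by auto
  note [simp] = els_length[OF e(1)] els_Obj[OF e(1)] el_Obj[OF e(3)]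
  have o [simp]: "Ys ! i \<in> Obj C" "set (remove_nth i Ys) \<subseteq> Obj C"
    using el_Obj els_nth els_Obj els_remove_nth e by blast+
  have "\<forall>c \<in> set (remove_nth i bs). dj b c" "dj b (bs ! i)"
    using e set_remove_nth[of i bs] by auto
  moreover have "\<forall>c \<in> set (remove_nth i bs). dj (bs ! i) c"
    using dj_remove_nth e by (auto simp: els_def)
  ultimately show ?case
    using e Suc.IH[of Ys bs] els_nth[of Ys bs i] els_remove_nth[of Ys bs i] by (simp add: els_Obj)
qed

text \<open>On elements the symmetry isomorphism just permutes a list, so that composing
  permutations and comparing different decompositions of them never becomes an issue.\<close>

lemma ap_tens_perm [simp]:
  assumes "els Xs as" "is_arrangement (length as) p"
  shows "ap (tens_perm C Xs p) (tensE as) = tensE (map ((!) as) p)"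
  using assms
proof (induction "length p" arbitrary: p Xs as)
  case 0
  then have "p = []" "as = []" using is_arrangement_length by fastforce+
  then show ?case using 0 by simp
next
  case (Suc n)
  then obtain i q where p [simp]: "p = i # q" by (cases p) auto
  note ar = is_arrangement_Cons[OF Suc.prems(2)[unfolded p]]
  note [simp] = els_length[OF Suc.prems(1)] els_Obj[OF Suc.prems(1)]
  have e: "els (remove_nth i Xs) (remove_nth i as)" "el (Xs ! i) (as ! i)"
    using els_remove_nth[OF Suc.prems(1) ar(1)] els_nth[OF Suc.prems(1) ar(1)] .
  note [simp] = els_length[OF e(1)] els_Obj[OF e(1)] el_Obj[OF e(2)]
  have "\<forall>c \<in> set (remove_nth i as). dj (as ! i) c"
    using dj_remove_nth[OF _ ar(1)] Suc.prems(1) by (auto simp: els_def)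
  then show ?case
    using Suc.hyps(1)[OF _ e(1), of "renumber i q"] Suc.hyps(2) e ar(1,2) ar(4)[of as] ar(4)[of Xs] Suc.prems(1)
    by (simp del: map_map)
qed

lemma ap_tens_append [simp]:
  assumes "els Xs as" "els Ys bs" "\<forall>a \<in> set as. \<forall>b \<in> set bs. dj a b"
  shows "ap (tens_append C Xs Ys) (tensE as \<bowtie> tensE bs) = tensE (as @ bs)"
  using assms
proof (induction Xs arbitrary: as)
  case Nil
  then show ?case by (simp add: els_Obj)
next
  case (Cons X Xs)
  then obtain a as' where [simp]: "as = a # as'" by (cases as) auto
  have e: "el X a" "els Xs as'" "\<forall>b \<in> set as'. dj a b" "\<forall>b \<in> set bs. dj a b" "\<forall>a \<in> set as'. \<forall>b \<in> set bs. dj a b"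
    using Cons.prems by auto
  note [simp] = els_Obj[OF e(2)] els_Obj[OF Cons.prems(2)] el_Obj[OF e(1)]
  show ?case using e Cons.prems(2) Cons.IH[of as'] by simp
qed

end

section \<open>Linear structure\<close>

text \<open>The same assumptions, with \<open>C\<close> as the default structure, so that the
  categorical notation needs no subscript.\<close>

locale lsmc = linear_symmetric_monoidal_category R C
  for C :: "('r, 'o, 'm, 'x) lsmcat_scheme" (structure) and R :: "('r, 'y) ring_scheme"
begin

lemma hom_module_simps:
  "carrier (hom_module C A B) = hom_set C A B" "\<zero>\<^bsub>hom_module C A B\<^esub> = HZero C A B"
  "f \<oplus>\<^bsub>hom_module C A B\<^esub> g = f +\<^sub>a g" "r \<odot>\<^bsub>hom_module C A B\<^esub> f = HSmult C r f"
  by (simp_all add: hom_module_def)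

lemma HZero_arr [simp]:
  assumes "A \<in> Obj C" "B \<in> Obj C"
  shows "HZero C A B \<in> Arr C" "Dom C (HZero C A B) = A" "Cod C (HZero C A B) = B"
proof -
  interpret M: Module.module R "hom_module C A B" by (rule hom_module[OF assms])
  show "HZero C A B \<in> Arr C" "Dom C (HZero C A B) = A" "Cod C (HZero C A B) = B"
    using M.M.zero_closed by (auto simp: hom_module_simps hom_set_def)
qed

lemma HAdd_arr [simp]:
  assumes "f \<in> Arr C" "g \<in> Arr C" "Dom C f = Dom C g" "Cod C f = Cod C g"
  shows "f +\<^sub>a g \<in> Arr C" "Dom C (f +\<^sub>a g) = Dom C g" "Cod C (f +\<^sub>a g) = Cod C g"
proof -
  interpret M: Module.module R "hom_module C (Dom C g) (Cod C g)"
    by (rule hom_module) (use assms in simp_all)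
  have "f +\<^sub>a g \<in> hom_set C (Dom C g) (Cod C g)"
    using M.M.add.m_closed[of f g] assms by (auto simp: hom_module_simps hom_set_def)
  then show "f +\<^sub>a g \<in> Arr C" "Dom C (f +\<^sub>a g) = Dom C g" "Cod C (f +\<^sub>a g) = Cod C g"
    by (auto simp: hom_set_def)
qed

lemma HSmult_arr [simp]:
  assumes "r \<in> carrier R" "f \<in> Arr C"
  shows "HSmult C r f \<in> Arr C" "Dom C (HSmult C r f) = Dom C f" "Cod C (HSmult C r f) = Cod C f"
proof -
  interpret M: Module.module R "hom_module C (Dom C f) (Cod C f)"
    by (rule hom_module) (use assms in simp_all)
  have "HSmult C r f \<in> hom_set C (Dom C f) (Cod C f)"
    using M.smult_closed[of r f] assms by (auto simp: hom_module_simps hom_set_def)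
  then show "HSmult C r f \<in> Arr C" "Dom C (HSmult C r f) = Dom C f" "Cod C (HSmult C r f) = Cod C f"
    by (auto simp: hom_set_def)
qed

lemma HAdd_assoc:
  assumes "f \<in> Arr C" "g \<in> Arr C" "k \<in> Arr C"
    "Dom C f = Dom C k" "Cod C f = Cod C k" "Dom C g = Dom C k" "Cod C g = Cod C k"
  shows "f +\<^sub>a g +\<^sub>a k = f +\<^sub>a (g +\<^sub>a k)"
proof -
  interpret M: Module.module R "hom_module C (Dom C k) (Cod C k)"
    by (rule hom_module) (use assms in simp_all)
  show ?thesis using M.M.a_assoc[of f g k] assms by (auto simp: hom_module_simps hom_set_def)
qed

lemma HAdd_comm:
  assumes "f \<in> Arr C" "g \<in> Arr C" "Dom C f = Dom C g" "Cod C f = Cod C g"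
  shows "f +\<^sub>a g = g +\<^sub>a f"
proof -
  interpret M: Module.module R "hom_module C (Dom C g) (Cod C g)"
    by (rule hom_module) (use assms in simp_all)
  show ?thesis using M.M.a_comm[of f g] assms by (auto simp: hom_module_simps hom_set_def)
qed

lemma HAdd_HZero:
  assumes "f \<in> Arr C" "Dom C f = A" "Cod C f = B"
  shows "f +\<^sub>a HZero C A B = f" "HZero C A B +\<^sub>a f = f"
proof -
  interpret M: Module.module R "hom_module C (Dom C f) (Cod C f)"
    by (rule hom_module) (use assms in auto)
  show "f +\<^sub>a HZero C A B = f" "HZero C A B +\<^sub>a f = f"
    using M.M.r_zero[of f] M.M.l_zero[of f] assms by (auto simp: hom_module_simps hom_set_def)
qed

lemma HSmult_zero:
  assumes "f \<in> Arr C"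
  shows "HSmult C \<zero>\<^bsub>R\<^esub> f = HZero C (Dom C f) (Cod C f)"
proof -
  interpret M: Module.module R "hom_module C (Dom C f) (Cod C f)"
    by (rule hom_module) (use assms in simp_all)
  show ?thesis
    using M.smult_l_null[of f] assms by (auto simp: hom_module_simps hom_set_def)
qed

lemma HSmult_add:
  assumes "f \<in> Arr C" "r \<in> carrier R" "s \<in> carrier R"
  shows "HSmult C (r \<oplus>\<^bsub>R\<^esub> s) f = HSmult C r f +\<^sub>a HSmult C s f"
proof -
  interpret M: Module.module R "hom_module C (Dom C f) (Cod C f)"
    by (rule hom_module) (use assms in simp_all)
  show ?thesis
    using M.smult_l_distr[of r s f] assms by (auto simp: hom_module_simps hom_set_def)
qed

text \<open>The bridge from the form in which antisymmetry is proved, a vanishing sum, to the form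
  with the additive inverse of the hom module in \<open>poisson_algebra\<close>.\<close>

lemma eq_minusI:
  assumes "f +\<^sub>a g = HZero C A B" "f \<in> hom_set C A B" "g \<in> hom_set C A B"
  shows "f = \<ominus>\<^bsub>hom_module C A B\<^esub> g"
proof -
  have "A \<in> Obj C" "B \<in> Obj C" using assms(2) by (auto simp: hom_set_def)
  then interpret M: Module.module R "hom_module C A B" by (rule hom_module)
  show ?thesis using M.M.minus_equality[of f g] assms by (simp add: hom_module_simps)
qed

lemma Comp_HAdd [simp]:
  "\<lbrakk>f \<in> Arr C; g \<in> Arr C; g' \<in> Arr C; Dom C g = Cod C f; Dom C g' = Cod C f; Cod C g = Cod C g'\<rbrakk>
    \<Longrightarrow> (g +\<^sub>a g') \<cdot> f = (g \<cdot> f) +\<^sub>a (g' \<cdot> f)"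
  "\<lbrakk>f \<in> Arr C; f' \<in> Arr C; g \<in> Arr C; Dom C g = Cod C f; Cod C f' = Cod C f; Dom C f = Dom C f'\<rbrakk>
    \<Longrightarrow> g \<cdot> (f +\<^sub>a f') = (g \<cdot> f) +\<^sub>a (g \<cdot> f')"
  by (rule Comp_HAdd_left Comp_HAdd_right; auto simp: hom_set_def)+

lemma Comp_HSmult [simp]:
  "\<lbrakk>r \<in> carrier R; f \<in> Arr C; g \<in> Arr C; Dom C g = Cod C f\<rbrakk> \<Longrightarrow> HSmult C r g \<cdot> f = HSmult C r (g \<cdot> f)"
  "\<lbrakk>r \<in> carrier R; f \<in> Arr C; g \<in> Arr C; Dom C g = Cod C f\<rbrakk> \<Longrightarrow> g \<cdot> HSmult C r f = HSmult C r (g \<cdot> f)"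
  by (rule Comp_HSmult_left Comp_HSmult_right; auto simp: hom_set_def)+

lemma TensA_HAdd [simp]:
  "\<lbrakk>f \<in> Arr C; f' \<in> Arr C; g \<in> Arr C; Dom C f = Dom C f'; Cod C f = Cod C f'\<rbrakk>
    \<Longrightarrow> (f +\<^sub>a f') \<otimes>\<^sub>a g = (f \<otimes>\<^sub>a g) +\<^sub>a (f' \<otimes>\<^sub>a g)"
  "\<lbrakk>f \<in> Arr C; g \<in> Arr C; g' \<in> Arr C; Dom C g = Dom C g'; Cod C g = Cod C g'\<rbrakk>
    \<Longrightarrow> f \<otimes>\<^sub>a (g +\<^sub>a g') = (f \<otimes>\<^sub>a g) +\<^sub>a (f \<otimes>\<^sub>a g')"
  by (rule TensA_HAdd_left TensA_HAdd_right; auto simp: hom_set_def)+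

lemma TensA_HSmult [simp]:
  "\<lbrakk>r \<in> carrier R; f \<in> Arr C; g \<in> Arr C\<rbrakk> \<Longrightarrow> HSmult C r f \<otimes>\<^sub>a g = HSmult C r (f \<otimes>\<^sub>a g)"
  "\<lbrakk>r \<in> carrier R; f \<in> Arr C; g \<in> Arr C\<rbrakk> \<Longrightarrow> f \<otimes>\<^sub>a HSmult C r g = HSmult C r (f \<otimes>\<^sub>a g)"
  by (rule TensA_HSmult_left TensA_HSmult_right; auto simp: hom_set_def)+

text \<open>Written as a zero multiple of an arrow, a zero arrow is annihilated in composites and
  tensors by the scalar laws alone.\<close>

lemma HZero_eq: "\<lbrakk>f \<in> Arr C; Dom C f = A; Cod C f = B\<rbrakk> \<Longrightarrow> HZero C A B = HSmult C \<zero>\<^bsub>R\<^esub> f"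
  by (simp add: HSmult_zero)

lemma Comp_HZero [simp]:
  assumes "B \<in> Obj C" "D \<in> Obj C" "f \<in> Arr C"
  shows "Cod C f = B \<Longrightarrow> HZero C B D \<cdot> f = HZero C (Dom C f) D"
    "Dom C f = B \<Longrightarrow> f \<cdot> HZero C D B = HZero C D (Cod C f)"
proof -
  show "HZero C B D \<cdot> f = HZero C (Dom C f) D" if "Cod C f = B"
    using HZero_eq[of "HZero C B D" B D] HSmult_zero[of "HZero C B D \<cdot> f"]
      Comp_HSmult(1)[of "\<zero>\<^bsub>R\<^esub>" f "HZero C B D"] assms that by simp
  show "f \<cdot> HZero C D B = HZero C D (Cod C f)" if "Dom C f = B"
    using HZero_eq[of "HZero C D B" D B] HSmult_zero[of "f \<cdot> HZero C D B"]
      Comp_HSmult(2)[of "\<zero>\<^bsub>R\<^esub>" "HZero C D B" f] assms that by simp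
qed

lemma TensA_HZero [simp]:
  assumes "A \<in> Obj C" "B \<in> Obj C" "f \<in> Arr C"
  shows "HZero C A B \<otimes>\<^sub>a f = HZero C (A \<otimes>\<^sub>o Dom C f) (B \<otimes>\<^sub>o Cod C f)"
    "f \<otimes>\<^sub>a HZero C A B = HZero C (Dom C f \<otimes>\<^sub>o A) (Cod C f \<otimes>\<^sub>o B)"
  using HZero_eq[of "HZero C A B" A B] HSmult_zero[of "HZero C A B \<otimes>\<^sub>a f"] HSmult_zero[of "f \<otimes>\<^sub>a HZero C A B"]
    TensA_HSmult(1)[of "\<zero>\<^bsub>R\<^esub>" "HZero C A B" f] TensA_HSmult(2)[of "\<zero>\<^bsub>R\<^esub>" f "HZero C A B"] assms
  by simp_all

text \<open>Only elements with the same variables are ever added, so the set of the first summand is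
  also that of the second.\<close>

definition eadd :: "nat set \<times> 'm \<Rightarrow> nat set \<times> 'm \<Rightarrow> nat set \<times> 'm"  (infixl "\<boxplus>" 60) where
  "a \<boxplus> b = (fst a, snd a +\<^sub>a snd b)"

lemma fst_eadd [simp]: "fst (a \<boxplus> b) = fst a"
  by (simp add: eadd_def)

lemma dj_eadd [simp]: "dj (a \<boxplus> b) c = dj a c" "dj c (a \<boxplus> b) = dj c a"
  by (simp_all add: dj_def)

end

locale lctx = lsmc C R + ctx C \<Gamma>
  for C :: "('r, 'o, 'm, 'x) lsmcat_scheme" (structure) and R :: "('r, 'y) ring_scheme" and \<Gamma> :: "'o list"
begin

text \<open>A zero element keeps its set of variables, which determines the domain of the zero
  arrow; hence the bookkeeping of unions in all vanishing statements.\<close>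

definition ezero :: "'o \<Rightarrow> nat set \<Rightarrow> nat set \<times> 'm" where
  "ezero A L = (L, HZero C (var_tens (length \<Gamma>) L) A)"

lemma fst_ezero [simp]: "fst (ezero A L) = L"
  by (simp add: ezero_def)

lemma el_ezero [simp]: "A \<in> Obj C \<Longrightarrow> el A (ezero A L)"
  by (simp add: el_def ezero_def)

lemma el_eadd [simp]: "\<lbrakk>el A a; el A b; fst a = fst b\<rbrakk> \<Longrightarrow> el A (a \<boxplus> b)"
  by (simp add: el_def eadd_def)

lemma ap_eadd [simp]:
  "\<lbrakk>f \<in> Arr C; el (Dom C f) a; el (Dom C f) b; fst a = fst b\<rbrakk> \<Longrightarrow> ap f (a \<boxplus> b) = ap f a \<boxplus> ap f b"
  by (simp add: el_def eadd_def ap_def)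

lemma ap_ezero [simp]:
  "\<lbrakk>f \<in> Arr C; Dom C f = A\<rbrakk> \<Longrightarrow> ap f (ezero A L) = ezero (Cod C f) L"
  by (auto simp: ezero_def ap_def)

lemma ap_HAdd [simp]:
  "\<lbrakk>f \<in> Arr C; g \<in> Arr C; Dom C f = Dom C g; Cod C f = Cod C g; el (Dom C g) a\<rbrakk>
    \<Longrightarrow> ap (f +\<^sub>a g) a = ap f a \<boxplus> ap g a"
  by (simp add: el_def eadd_def ap_def)

lemma ap_HZero [simp]: "\<lbrakk>el A a; B \<in> Obj C\<rbrakk> \<Longrightarrow> ap (HZero C A B) a = ezero B (fst a)"
  by (auto simp: el_def ezero_def ap_def)

lemma eprod_eadd:
  "\<lbrakk>el A a; el A a'; el B b; fst a = fst a'; dj a b\<rbrakk> \<Longrightarrow> (a \<boxplus> a') \<bowtie> b = (a \<bowtie> b) \<boxplus> (a' \<bowtie> b)"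
  "\<lbrakk>el A a; el A a'; el B b; fst a = fst a'; dj b a\<rbrakk> \<Longrightarrow> b \<bowtie> (a \<boxplus> a') = (b \<bowtie> a) \<boxplus> (b \<bowtie> a')"
  by (auto simp: el_def eadd_def eprod_def dj_def)

lemma eprod_ezero:
  "\<lbrakk>A \<in> Obj C; el B b; L \<inter> fst b = {}\<rbrakk> \<Longrightarrow> ezero A L \<bowtie> b = ezero (A \<otimes>\<^sub>o B) (L \<union> fst b)"
  "\<lbrakk>A \<in> Obj C; el B b; fst b \<inter> L = {}\<rbrakk> \<Longrightarrow> b \<bowtie> ezero A L = ezero (B \<otimes>\<^sub>o A) (fst b \<union> L)"
  by (auto simp: el_def ezero_def eprod_def)

lemma eadd_comm: "\<lbrakk>el A a; el A b; fst a = fst b\<rbrakk> \<Longrightarrow> a \<boxplus> b = b \<boxplus> a"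
  by (auto simp: el_def eadd_def intro: HAdd_comm)

lemma eadd_assoc: "\<lbrakk>el A a; el A b; el A c; fst a = fst b; fst b = fst c\<rbrakk> \<Longrightarrow> a \<boxplus> b \<boxplus> c = a \<boxplus> (b \<boxplus> c)"
  by (auto simp: el_def eadd_def intro: HAdd_assoc)

lemma eadd_left_comm:
  assumes "el A a" "el A b" "el A c" "fst a = fst b" "fst b = fst c"
  shows "a \<boxplus> (b \<boxplus> c) = b \<boxplus> (a \<boxplus> c)"
  using eadd_assoc[of A a b c] eadd_assoc[of A b a c] eadd_comm[of A a b] assms by simp

lemma eadd_ezero: "\<lbrakk>el A a; fst a = L\<rbrakk> \<Longrightarrow> a \<boxplus> ezero A L = a" "\<lbrakk>el A a; fst a = L\<rbrakk> \<Longrightarrow> ezero A L \<boxplus> a = a"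
  by (auto simp: el_def eadd_def ezero_def HAdd_HZero intro: prod_eqI)

end

section \<open>Colimits and the tensor product\<close>

text \<open>One notion for two situations: without endomorphisms \<open>r\<close> it is a coproduct,
  and with the permutations of tensor powers as \<open>r\<close> it is the coproduct of their
  coinvariants.\<close>

definition univ_family ::
  "('o, 'm, 'x) cat_scheme \<Rightarrow> nat set \<Rightarrow> (nat \<Rightarrow> 'o) \<Rightarrow> (nat \<Rightarrow> nat set) \<Rightarrow> (nat \<Rightarrow> nat \<Rightarrow> 'm) \<Rightarrow>
   'o \<Rightarrow> (nat \<Rightarrow> 'm) \<Rightarrow> bool" where
  "univ_family C I X K r S l \<longleftrightarrow>
     S \<in> Obj C \<and> (\<forall>i \<in> I. X i \<in> Obj C \<and> l i \<in> hom_set C (X i) S \<and>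
       (\<forall>k \<in> K i. r i k \<in> hom_set C (X i) (X i) \<and> l i \<cdot>\<^bsub>C\<^esub> r i k = l i)) \<and>
     (\<forall>Y g. Y \<in> Obj C \<and> (\<forall>i \<in> I. g i \<in> hom_set C (X i) Y \<and> (\<forall>k \<in> K i. g i \<cdot>\<^bsub>C\<^esub> r i k = g i)) \<longrightarrow>
       (\<exists>!f. f \<in> hom_set C S Y \<and> (\<forall>i \<in> I. f \<cdot>\<^bsub>C\<^esub> l i = g i)))"

text \<open>For each \<open>i\<close> the shape has objects \<open>(0, i, 0)\<close> and \<open>(1, i, 0)\<close>, identified with their
  identities, and parallel arrows \<open>(2, i, k)\<close> from the first to the second. In the diagram below
  \<open>(2, i, 0)\<close> is an identity and \<open>(2, i, Suc k)\<close> is \<open>r i k\<close>.\<close>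

definition shape_dom :: "nat \<times> nat \<times> nat \<Rightarrow> nat \<times> nat \<times> nat" where
  "shape_dom = (\<lambda>(t, i, k). if t = 1 then (1, i, 0) else (0, i, 0))"

definition shape_cod :: "nat \<times> nat \<times> nat \<Rightarrow> nat \<times> nat \<times> nat" where
  "shape_cod = (\<lambda>(t, i, k). if t = 0 then (0, i, 0) else (1, i, 0))"

definition shape_obj :: "nat set \<Rightarrow> (nat \<times> nat \<times> nat) set" where
  "shape_obj I = {(t, i, k). (t = 0 \<or> t = 1) \<and> i \<in> I \<and> k = 0}"

definition shape_arr :: "nat set \<Rightarrow> (nat \<Rightarrow> nat set) \<Rightarrow> (nat \<times> nat \<times> nat) set" where
  "shape_arr I K = shape_obj I \<union> {(t, i, k). t = 2 \<and> i \<in> I \<and> (k = 0 \<or> k - 1 \<in> K i)}"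

text \<open>Every composable pair contains an identity: an arrow of the third kind is followed only
  by an identity, and every other arrow is an identity. This explains the composition.\<close>

definition shape :: "(nat \<times> nat \<times> nat \<Rightarrow> 'i) \<Rightarrow> nat set \<Rightarrow> (nat \<Rightarrow> nat set) \<Rightarrow> ('i, 'i) cat" where
  "shape e I K =
     \<lparr>Obj = e ` shape_obj I, Arr = e ` shape_arr I K,
      Dom = (\<lambda>u. e (shape_dom (inv_into UNIV e u))), Cod = (\<lambda>u. e (shape_cod (inv_into UNIV e u))),
      Idn = (\<lambda>x. x), Comp = (\<lambda>v u. if fst (inv_into UNIV e u) = 2 then u else v)\<rparr>"

lemma category_shape:
  assumes e: "inj e"
  shows "category (shape e I K)"
  by unfold_locales
    (auto simp: shape_def hom_set_def shape_arr_def shape_obj_def shape_dom_def shape_cod_def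
      inv_f_f[OF e] inj_eq[OF e] split: if_splits)

context symmetric_monoidal_category
begin

context
  fixes e :: "nat \<times> nat \<times> nat \<Rightarrow> 'i"
    and I :: "nat set" and X :: "nat \<Rightarrow> 'o" and K :: "nat \<Rightarrow> nat set" and r :: "nat \<Rightarrow> nat \<Rightarrow> 'm"
  assumes e: "inj e"
begin

abbreviation (input) index :: "'i \<Rightarrow> nat" where
  "index u \<equiv> fst (snd (inv_into UNIV e u))"

definition diag_arr :: "'i \<Rightarrow> 'm" where
  "diag_arr u = (case inv_into UNIV e u of (t, i, k) \<Rightarrow> if t = 2 \<and> k \<noteq> 0 then r i (k - 1) else id\<^sub>a (X i))"

lemma is_diagram_shape:
  assumes "\<forall>i \<in> I. X i \<in> Obj C \<and> (\<forall>k \<in> K i. r i k \<in> hom_set C (X i) (X i))"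
  shows "is_diagram (shape e I K) C (\<lambda>j. X (index j)) diag_arr"
  unfolding is_diagram_def using assms category_shape[OF e]
  by (auto simp: shape_def hom_set_def shape_arr_def shape_obj_def shape_dom_def shape_cod_def
      inv_f_f[OF e] inj_eq[OF e] diag_arr_def split: if_splits)

text \<open>For each index the arrow that the diagram sends to an identity makes the two legs of a
  cocone equal. The remaining arrows then say that this common leg is invariant under the
  endomorphisms, so cocones are exactly invariant families.\<close>

lemma univ_family_imp_colimit:
  assumes "univ_family C I X K r S l"
  shows "is_colimit (shape e I K) C (\<lambda>j. X (index j)) diag_arr S (\<lambda>j. l (index j))"
  unfolding is_colimit_def
proof (intro conjI allI impI)
  have l: "S \<in> Obj C" "i \<in> I \<Longrightarrow> X i \<in> Obj C" "i \<in> I \<Longrightarrow> l i \<in> hom_set C (X i) S"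
    "\<lbrakk>i \<in> I; k \<in> K i\<rbrakk> \<Longrightarrow> l i \<cdot> r i k = l i" for i k
    using assms by (auto simp: univ_family_def)
  show "is_cocone (shape e I K) C (\<lambda>j. X (index j)) diag_arr S (\<lambda>j. l (index j))"
    using l by (auto simp: is_cocone_def shape_def shape_arr_def shape_obj_def shape_dom_def
        shape_cod_def inv_f_f[OF e] diag_arr_def hom_set_def)
  fix M c
  assume c: "is_cocone (shape e I K) C (\<lambda>j. X (index j)) diag_arr M c"
  define g where "g i = c (e (1, i, 0))" for i
  have g: "M \<in> Obj C" "i \<in> I \<Longrightarrow> g i \<in> hom_set C (X i) M" for i
    using c by (auto simp: is_cocone_def shape_def shape_obj_def inv_f_f[OF e] g_def)
  have a: "u \<in> shape_arr I K \<Longrightarrow> c (e (shape_cod u)) \<cdot> diag_arr (e u) = c (e (shape_dom u))" for u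
    using c by (auto simp: is_cocone_def shape_def inv_f_f[OF e])
  have s: "c (e (0, i, 0)) = g i" if "i \<in> I" for i
    using a[of "(2, i, 0)"] that g(2)[of i]
    by (simp add: shape_arr_def shape_dom_def shape_cod_def diag_arr_def inv_f_f[OF e] g_def hom_set_def)
  have "g i \<cdot> r i k = g i" if "i \<in> I" "k \<in> K i" for i k
    using a[of "(2, i, Suc k)"] that s[of i]
    by (simp add: shape_arr_def shape_dom_def shape_cod_def diag_arr_def inv_f_f[OF e] g_def)
  then have "\<exists>!f. f \<in> hom_set C S M \<and> (\<forall>i \<in> I. f \<cdot> l i = g i)"
    using assms g unfolding univ_family_def by blast
  moreover have "(\<forall>j \<in> Obj (shape e I K). f \<cdot> l (index j) = c j) \<longleftrightarrow> (\<forall>i \<in> I. f \<cdot> l i = g i)" for f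
    using s by (auto simp: shape_def shape_obj_def inv_f_f[OF e] g_def)
  ultimately show "\<exists>!f. f \<in> hom_set C S M \<and> (\<forall>j \<in> Obj (shape e I K). f \<cdot> l (index j) = c j)"
    by simp
qed

lemma univ_family_TensO_aux:
  assumes u: "univ_family C I X K r S l" and Z: "Z \<in> Obj C"
    and col: "is_colimit (shape e I K) C (\<lambda>j. X (index j) \<otimes>\<^sub>o Z) (\<lambda>u. diag_arr u \<otimes>\<^sub>a id\<^sub>a Z)
      (S \<otimes>\<^sub>o Z) (\<lambda>j. l (index j) \<otimes>\<^sub>a id\<^sub>a Z)"
  shows "univ_family C I (\<lambda>i. X i \<otimes>\<^sub>o Z) K (\<lambda>i k. r i k \<otimes>\<^sub>a id\<^sub>a Z) (S \<otimes>\<^sub>o Z) (\<lambda>i. l i \<otimes>\<^sub>a id\<^sub>a Z)"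
  unfolding univ_family_def
proof (intro conjI allI impI ballI)
  have l: "S \<in> Obj C" "i \<in> I \<Longrightarrow> X i \<in> Obj C" "i \<in> I \<Longrightarrow> l i \<in> hom_set C (X i) S"
    "\<lbrakk>i \<in> I; k \<in> K i\<rbrakk> \<Longrightarrow> r i k \<in> hom_set C (X i) (X i)"
    "\<lbrakk>i \<in> I; k \<in> K i\<rbrakk> \<Longrightarrow> l i \<cdot> r i k = l i" for i k
    using u by (auto simp: univ_family_def)
  show "S \<otimes>\<^sub>o Z \<in> Obj C" using l Z by simp
  fix i assume i: "i \<in> I"
  show "X i \<otimes>\<^sub>o Z \<in> Obj C" "l i \<otimes>\<^sub>a id\<^sub>a Z \<in> hom_set C (X i \<otimes>\<^sub>o Z) (S \<otimes>\<^sub>o Z)"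
    using l Z i by (auto simp: hom_set_def)
  fix k assume k: "k \<in> K i"
  show "r i k \<otimes>\<^sub>a id\<^sub>a Z \<in> hom_set C (X i \<otimes>\<^sub>o Z) (X i \<otimes>\<^sub>o Z)"
    "(l i \<otimes>\<^sub>a id\<^sub>a Z) \<cdot> (r i k \<otimes>\<^sub>a id\<^sub>a Z) = l i \<otimes>\<^sub>a id\<^sub>a Z"
    using l(3,4)[of i] l(5)[OF i k] Z i k by (auto simp: hom_set_def merge)
next
  have l: "i \<in> I \<Longrightarrow> X i \<in> Obj C" for i using u by (auto simp: univ_family_def)
  fix Y g
  assume "Y \<in> Obj C \<and> (\<forall>i \<in> I. g i \<in> hom_set C (X i \<otimes>\<^sub>o Z) Y \<and>
    (\<forall>k \<in> K i. g i \<cdot> (r i k \<otimes>\<^sub>a id\<^sub>a Z) = g i))"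
  then have g: "Y \<in> Obj C" "i \<in> I \<Longrightarrow> g i \<in> hom_set C (X i \<otimes>\<^sub>o Z) Y"
    "\<lbrakk>i \<in> I; k \<in> K i\<rbrakk> \<Longrightarrow> g i \<cdot> (r i k \<otimes>\<^sub>a id\<^sub>a Z) = g i" for i k by auto
  have "is_cocone (shape e I K) C (\<lambda>j. X (index j) \<otimes>\<^sub>o Z) (\<lambda>u. diag_arr u \<otimes>\<^sub>a id\<^sub>a Z) Y (\<lambda>j. g (index j))"
    using g l Z by (auto simp: is_cocone_def shape_def shape_arr_def shape_obj_def shape_dom_def
        shape_cod_def inv_f_f[OF e] diag_arr_def hom_set_def)
  then have "\<exists>!f. f \<in> hom_set C (S \<otimes>\<^sub>o Z) Y \<and>
      (\<forall>j \<in> Obj (shape e I K). f \<cdot> (l (index j) \<otimes>\<^sub>a id\<^sub>a Z) = g (index j))"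
    using col by (auto simp: is_colimit_def)
  moreover have "(\<forall>j \<in> Obj (shape e I K). f \<cdot> (l (index j) \<otimes>\<^sub>a id\<^sub>a Z) = g (index j)) \<longleftrightarrow>
      (\<forall>i \<in> I. f \<cdot> (l i \<otimes>\<^sub>a id\<^sub>a Z) = g i)" for f
    by (auto simp: shape_def shape_obj_def inv_f_f[OF e])
  ultimately show "\<exists>!f. f \<in> hom_set C (S \<otimes>\<^sub>o Z) Y \<and> (\<forall>i \<in> I. f \<cdot> (l i \<otimes>\<^sub>a id\<^sub>a Z) = g i)"
    by simp
qed

end

text \<open>An infinite type contains a copy of the triples of naturals, so the shape can be
  realised in it. There the tensor product preserves the colimit, which is read back as a universal
  family.\<close>

lemma univ_family_TensO:
  assumes inf: "infinite (UNIV :: 'i set)" and cc: "tensor_cocomplete TYPE('i) C"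
    and u: "univ_family C I X K r S l" and Z: "Z \<in> Obj C"
  shows "univ_family C I (\<lambda>i. X i \<otimes>\<^sub>o Z) K (\<lambda>i k. r i k \<otimes>\<^sub>a id\<^sub>a Z) (S \<otimes>\<^sub>o Z) (\<lambda>i. l i \<otimes>\<^sub>a id\<^sub>a Z)"
proof -
  obtain f :: "nat \<Rightarrow> 'i" where f: "inj f"
    using infinite_countable_subset[OF inf] by blast
  define e :: "nat \<times> nat \<times> nat \<Rightarrow> 'i" where "e = f \<circ> to_nat"
  have e: "inj e" unfolding e_def by (rule inj_compose[OF f inj_to_nat])
  have "is_diagram (shape e I K) C (\<lambda>j. X (fst (snd (inv_into UNIV e j)))) (diag_arr e X r)"
    by (rule is_diagram_shape[OF e]) (use u in \<open>auto simp: univ_family_def\<close>)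
  then have "is_colimit (shape e I K) C (\<lambda>j. X (fst (snd (inv_into UNIV e j))) \<otimes>\<^sub>o Z)
      (\<lambda>u. diag_arr e X r u \<otimes>\<^sub>a id\<^sub>a Z) (S \<otimes>\<^sub>o Z) (\<lambda>j. l (fst (snd (inv_into UNIV e j))) \<otimes>\<^sub>a id\<^sub>a Z)"
    using cc univ_family_imp_colimit[OF e u] Z unfolding tensor_cocomplete_def by blast
  then show ?thesis by (rule univ_family_TensO_aux[OF e u Z])
qed

end

section \<open>The free commutative monoid\<close>

text \<open>The universal property of \<open>S\<close> is assumed with an arbitrary further factor
  \<open>Z\<close>. Multiplication and brackets have several arguments in \<open>S\<close> and are
  built one argument at a time, with the others as parameters.\<close>

locale free_cm = lsmc C R
  for C :: "('r, 'o, 'm, 'x) lsmcat_scheme" (structure) and R :: "('r, 'y) ring_scheme" +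
  fixes h S :: 'o and \<iota> :: "nat \<Rightarrow> 'm"
  assumes h_Obj [simp]: "h \<in> Obj C"
    and \<iota>_hom: "\<iota> n \<in> hom_set C (tens C (replicate n h)) S"
    and \<iota>_perm: "is_arrangement n p \<Longrightarrow> \<iota> n \<cdot> tens_perm C (replicate n h) p = \<iota> n"
    and S_univ: "\<lbrakk>Z \<in> Obj C; Y \<in> Obj C; \<And>n. g n \<in> hom_set C (tens C (replicate n h) \<otimes>\<^sub>o Z) Y;
      \<And>n p. is_arrangement n p \<Longrightarrow> g n \<cdot> (tens_perm C (replicate n h) p \<otimes>\<^sub>a id\<^sub>a Z) = g n\<rbrakk>
      \<Longrightarrow> \<exists>!f. f \<in> hom_set C (S \<otimes>\<^sub>o Z) Y \<and> (\<forall>n. f \<cdot> (\<iota> n \<otimes>\<^sub>a id\<^sub>a Z) = g n)"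
begin

abbreviation T\<^sub>h :: "nat \<Rightarrow> 'o" where
  "T\<^sub>h n \<equiv> tens C (replicate n h)"

lemma set_replicate_Obj [simp]: "set (replicate n h) \<subseteq> Obj C"
  by (auto simp: set_replicate_conv_if)

lemma \<iota>_arr [simp]: "\<iota> n \<in> Arr C" "Dom C (\<iota> n) = T\<^sub>h n" "Cod C (\<iota> n) = S"
  using \<iota>_hom[of n] by (auto simp: hom_set_def)

lemma S_Obj [simp]: "S \<in> Obj C"
  using Dom_Cod_Obj(2)[OF \<iota>_arr(1)] by simp

text \<open>When all factors are equal the codomain is again \<open>T\<^sub>h n\<close>; the general
  rule would display it as the tensor of a permuted list.\<close>

declare tens_perm_arr(3) [simp del]

lemma tens_perm_replicate [simp]:
  assumes "is_arrangement n p"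
  shows "tens_perm C (replicate n h) p \<in> Arr C" "Dom C (tens_perm C (replicate n h) p) = T\<^sub>h n"
    "Cod C (tens_perm C (replicate n h) p) = T\<^sub>h n"
proof -
  have "map ((!) (replicate n h)) p = map (\<lambda>_. h) p"
    using assms by (intro map_cong) (auto simp: is_arrangement_def)
  then have "map ((!) (replicate n h)) p = replicate n h"
    by (simp add: map_replicate_const is_arrangement_length[OF assms])
  then show "tens_perm C (replicate n h) p \<in> Arr C" "Dom C (tens_perm C (replicate n h) p) = T\<^sub>h n"
    "Cod C (tens_perm C (replicate n h) p) = T\<^sub>h n"
    using assms tens_perm_arr(3)[of "replicate n h" p] by simp_all
qed

text \<open>The restrictions of \<open>f\<close> to the tensor powers form an invariant family, and
  the uniqueness half of \<open>S_univ\<close> applies to it.\<close>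

lemma S_ext:
  assumes "\<And>n. f \<cdot> (\<iota> n \<otimes>\<^sub>a id\<^sub>a Z) = g \<cdot> (\<iota> n \<otimes>\<^sub>a id\<^sub>a Z)" "f \<in> Arr C" "g \<in> Arr C"
    "Dom C f = S \<otimes>\<^sub>o Z" "Dom C g = S \<otimes>\<^sub>o Z" "Cod C f = Cod C g" "Z \<in> Obj C"
  shows "f = g"
proof -
  have inv: "(f \<cdot> (\<iota> n \<otimes>\<^sub>a id\<^sub>a Z)) \<cdot> (tens_perm C (replicate n h) p \<otimes>\<^sub>a id\<^sub>a Z) = f \<cdot> (\<iota> n \<otimes>\<^sub>a id\<^sub>a Z)"
    if p: "is_arrangement n p" for n p
    using p assms(2-) by (simp add: merge \<iota>_perm)
  have "\<exists>!k. k \<in> hom_set C (S \<otimes>\<^sub>o Z) (Cod C f) \<and> (\<forall>n. k \<cdot> (\<iota> n \<otimes>\<^sub>a id\<^sub>a Z) = f \<cdot> (\<iota> n \<otimes>\<^sub>a id\<^sub>a Z))"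
    by (rule S_univ) (use assms inv in \<open>auto simp: hom_set_def\<close>)
  then show ?thesis using assms unfolding hom_set_def by auto
qed

text \<open>A symmetry moves \<open>S\<close> to the front, and naturality carries the test maps
  along. The same device handles \<open>S\<close> in a middle position.\<close>

lemma S_ext_right:
  assumes "\<And>n. f \<cdot> (id\<^sub>a Z \<otimes>\<^sub>a \<iota> n) = g \<cdot> (id\<^sub>a Z \<otimes>\<^sub>a \<iota> n)" "f \<in> Arr C" "g \<in> Arr C"
    "Dom C f = Z \<otimes>\<^sub>o S" "Dom C g = Z \<otimes>\<^sub>o S" "Cod C f = Cod C g" "Z \<in> Obj C"
  shows "f = g"
proof -
  have nat: "(k \<cdot> \<sigma>\<^sub>a S Z) \<cdot> (\<iota> n \<otimes>\<^sub>a id\<^sub>a Z) = (k \<cdot> (id\<^sub>a Z \<otimes>\<^sub>a \<iota> n)) \<cdot> \<sigma>\<^sub>a (T\<^sub>h n) Z"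
    if "k \<in> Arr C" "Dom C k = Z \<otimes>\<^sub>o S" for k n
    using that assms(7) by (simp add: Symm_nat)
  have "f \<cdot> \<sigma>\<^sub>a S Z = g \<cdot> \<sigma>\<^sub>a S Z"
  proof (rule S_ext[where Z = Z])
    fix n
    show "(f \<cdot> \<sigma>\<^sub>a S Z) \<cdot> (\<iota> n \<otimes>\<^sub>a id\<^sub>a Z) = (g \<cdot> \<sigma>\<^sub>a S Z) \<cdot> (\<iota> n \<otimes>\<^sub>a id\<^sub>a Z)"
      by (simp only: nat assms)
  qed (use assms in simp_all)
  then show ?thesis by (rule iso_cancel_right) (use assms in simp_all)
qed

lemma S_ext_middle:
  assumes "\<And>n. f \<cdot> (id\<^sub>a Z \<otimes>\<^sub>a \<iota> n \<otimes>\<^sub>a id\<^sub>a W) = g \<cdot> (id\<^sub>a Z \<otimes>\<^sub>a \<iota> n \<otimes>\<^sub>a id\<^sub>a W)" "f \<in> Arr C" "g \<in> Arr C"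
    "Dom C f = Z \<otimes>\<^sub>o S \<otimes>\<^sub>o W" "Dom C g = Z \<otimes>\<^sub>o S \<otimes>\<^sub>o W" "Cod C f = Cod C g" "Z \<in> Obj C" "W \<in> Obj C"
  shows "f = g"
proof -
  have nat: "(k \<cdot> swap_front C S Z W) \<cdot> (\<iota> n \<otimes>\<^sub>a id\<^sub>a (Z \<otimes>\<^sub>o W)) = (k \<cdot> (id\<^sub>a Z \<otimes>\<^sub>a \<iota> n \<otimes>\<^sub>a id\<^sub>a W)) \<cdot> swap_front C (T\<^sub>h n) Z W"
    if "k \<in> Arr C" "Dom C k = Z \<otimes>\<^sub>o S \<otimes>\<^sub>o W" for k n
    using that assms(7,8) swap_front_nat[of "\<iota> n" "id\<^sub>a Z" "id\<^sub>a W" S Z W] by simp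
  have "f \<cdot> swap_front C S Z W = g \<cdot> swap_front C S Z W"
  proof (rule S_ext[where Z = "Z \<otimes>\<^sub>o W"])
    fix n
    show "(f \<cdot> swap_front C S Z W) \<cdot> (\<iota> n \<otimes>\<^sub>a id\<^sub>a (Z \<otimes>\<^sub>o W))
      = (g \<cdot> swap_front C S Z W) \<cdot> (\<iota> n \<otimes>\<^sub>a id\<^sub>a (Z \<otimes>\<^sub>o W))"
      by (simp only: nat assms)
  qed (use assms in simp_all)
  then show ?thesis by (rule iso_cancel_right) (use assms in simp_all)
qed

lemma S_ext2:
  assumes "\<And>m n. f \<cdot> (\<iota> m \<otimes>\<^sub>a \<iota> n) = g \<cdot> (\<iota> m \<otimes>\<^sub>a \<iota> n)" "f \<in> Arr C" "g \<in> Arr C"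
    "Dom C f = S \<otimes>\<^sub>o S" "Dom C g = S \<otimes>\<^sub>o S" "Cod C f = Cod C g"
  shows "f = g"
proof (rule S_ext[where Z = S])
  fix m
  show "f \<cdot> (\<iota> m \<otimes>\<^sub>a id\<^sub>a S) = g \<cdot> (\<iota> m \<otimes>\<^sub>a id\<^sub>a S)"
    by (rule S_ext_right[where Z = "T\<^sub>h m"]) (use assms in \<open>simp_all add: merge\<close>)
qed (use assms in simp_all)

lemma S_ext3:
  assumes "\<And>m n. f \<cdot> (\<iota> m \<otimes>\<^sub>a \<iota> n \<otimes>\<^sub>a id\<^sub>a Z) = g \<cdot> (\<iota> m \<otimes>\<^sub>a \<iota> n \<otimes>\<^sub>a id\<^sub>a Z)" "f \<in> Arr C" "g \<in> Arr C"
    "Dom C f = S \<otimes>\<^sub>o S \<otimes>\<^sub>o Z" "Dom C g = S \<otimes>\<^sub>o S \<otimes>\<^sub>o Z" "Cod C f = Cod C g" "Z \<in> Obj C"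
  shows "f = g"
proof (rule S_ext[where Z = "S \<otimes>\<^sub>o Z"])
  fix m
  show "f \<cdot> (\<iota> m \<otimes>\<^sub>a id\<^sub>a (S \<otimes>\<^sub>o Z)) = g \<cdot> (\<iota> m \<otimes>\<^sub>a id\<^sub>a (S \<otimes>\<^sub>o Z))"
    by (rule S_ext_middle[where Z = "T\<^sub>h m" and W = Z]) (use assms in \<open>simp_all add: merge\<close>)
qed (use assms in simp_all)

end

section \<open>Monomials in the free commutative monoid\<close>

locale fctx = free_cm C R h S \<iota> + lctx C R \<Gamma>
  for C :: "('r, 'o, 'm, 'x) lsmcat_scheme" (structure) and R :: "('r, 'y) ring_scheme"
    and h S \<iota> \<Gamma>
begin

definition hs :: "(nat set \<times> 'm) list \<Rightarrow> bool" where
  "hs xs \<longleftrightarrow> els (replicate (length xs) h) xs"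

text \<open>The monomial of a list: the product in \<open>S\<close> of its entries, before
  multiplication on \<open>S\<close> is available.\<close>

definition mon :: "(nat set \<times> 'm) list \<Rightarrow> nat set \<times> 'm" where
  "mon xs = ap (\<iota> (length xs)) (tensE xs)"

lemma hs_simps [simp]: "hs []" "hs (x # xs) \<longleftrightarrow> el h x \<and> (\<forall>y \<in> set xs. dj x y) \<and> hs xs"
  by (auto simp: hs_def)

lemma hs_alt: "hs xs \<longleftrightarrow> (\<forall>x \<in> set xs. el h x) \<and> djl xs"
  by (auto simp: hs_def els_replicate)

lemma hs_append [simp]: "hs (xs @ ys) \<longleftrightarrow> hs xs \<and> hs ys \<and> (\<forall>x \<in> set xs. \<forall>y \<in> set ys. dj x y)"
  by (auto simp: hs_alt djl_append)

lemma djl_mset: "mset xs = mset ys \<Longrightarrow> djl xs \<Longrightarrow> djl ys"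
proof (induction xs arbitrary: ys)
  case (Cons x xs)
  then obtain ys1 ys2 where [simp]: "ys = ys1 @ x # ys2"
    by (metis list.set_intros(1) mset_eq_setD split_list)
  have m: "mset xs = mset (ys1 @ ys2)" using Cons.prems(1) by simp
  have "djl (ys1 @ ys2)" using Cons.IH[OF m] Cons.prems(2) by simp
  moreover have "\<forall>y \<in> set (ys1 @ ys2). dj x y"
    using Cons.prems(2) mset_eq_setD[OF m] by auto
  ultimately show ?case using dj_sym[of x] by (simp add: djl_append)
qed simp

lemma hs_mset: "mset xs = mset ys \<Longrightarrow> hs xs \<Longrightarrow> hs ys"
  using djl_mset[of xs ys] mset_eq_setD[of xs ys] by (simp add: hs_alt)

lemma el_tensE_hs [simp]: "\<lbrakk>hs xs; n = length xs\<rbrakk> \<Longrightarrow> el (T\<^sub>h n) (tensE xs)"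
  by (simp add: hs_def)

lemma el_mon [simp]: "hs xs \<Longrightarrow> el S (mon xs)"
  by (simp add: mon_def)

lemma fst_mon: "fst (mon xs) = (\<Union>x \<in> set xs. fst x)"
  by (simp add: mon_def fst_tensE)

lemma dj_mon [simp]: "dj b (mon xs) \<longleftrightarrow> (\<forall>a \<in> set xs. dj b a)" "dj (mon xs) b \<longleftrightarrow> (\<forall>a \<in> set xs. dj a b)"
  by (simp_all add: mon_def)

lemma ap_\<iota> [simp]: "n = length xs \<Longrightarrow> ap (\<iota> n) (tensE xs) = mon xs"
  by (simp add: mon_def)

text \<open>Rearranging the list is a permutation of tensor factors, which \<open>\<iota>\<close>
  absorbs because it factors through the coinvariants.\<close>

lemma mon_mset:
  assumes "hs xs" "mset xs = mset ys"
  shows "mon xs = mon ys"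
proof -
  obtain f where f: "f permutes {..<length xs}" "permute_list f xs = ys"
    using mset_eq_permutation[OF assms(2)[symmetric]] by metis
  \<comment> \<open>Both \<open>permute_list\<close> and \<open>tens_perm\<close> put the input
    entry \<open>f k\<close> at output position \<open>k\<close>, so no inverse of \<open>f\<close>
    appears.\<close>
  let ?p = "map f [0..<length xs]"
  have p: "is_arrangement (length xs) ?p"
    using f(1) permutes_inj_on[OF f(1)] permutes_image[OF f(1)]
    by (auto simp: is_arrangement_def distinct_map inj_on_subset atLeast0LessThan)
  have ys: "map ((!) xs) ?p = ys"
    using f(2) by (simp add: permute_list_def comp_def)
  have "mon xs = ap (\<iota> (length xs) \<cdot> tens_perm C (replicate (length xs) h) ?p) (tensE xs)"
    using p by (simp add: \<iota>_perm)
  also have "\<dots> = ap (\<iota> (length xs)) (ap (tens_perm C (replicate (length xs) h) ?p) (tensE xs))"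
    by (rule ap_Comp) (use p assms(1) in simp_all)
  also have "\<dots> = ap (\<iota> (length xs)) (tensE ys)"
    using p assms(1) ys by (simp only: ap_tens_perm hs_def)
  also have "\<dots> = mon ys"
    using mset_eq_length[OF assms(2)] by simp
  finally show ?thesis .
qed

end

subsection \<open>Equality of arrows can be tested on elements\<close>

context ctx
begin

lemma els_gen_all: "els \<Gamma> (map gen [0..<length \<Gamma>])" "isoE (tensE (map gen [0..<length \<Gamma>]))"
  using isoE_tensE[OF els_gen] els_gen by auto

lemma els_appendE:
  assumes "els (Xs @ Ys) cs"
  obtains as bs where "cs = as @ bs" "els Xs as" "els Ys bs" "\<forall>a \<in> set as. \<forall>b \<in> set bs. dj a b"
proof -
  let ?as = "take (length Xs) cs" and ?bs = "drop (length Xs) cs"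
  have "els (Xs @ Ys) (?as @ ?bs)" "length Xs = length ?as"
    using assms els_length[OF assms] by auto
  then show thesis using that[of ?as ?bs] els_append[of Xs ?as Ys ?bs] by simp
qed

end

context symmetric_monoidal_category
begin

lemma is_iso_tens_append [simp]: "\<lbrakk>set Xs \<subseteq> Obj C; set Ys \<subseteq> Obj C\<rbrakk> \<Longrightarrow> is_iso C (tens_append C Xs Ys)"
  by (induction Xs) simp_all

lemma ext_tens:
  assumes eq: "\<And>\<Gamma> as. \<lbrakk>ctx C \<Gamma>; ctx.els C \<Gamma> Xs as\<rbrakk> \<Longrightarrow> ap f (ctx.tensE C \<Gamma> as) = ap g (ctx.tensE C \<Gamma> as)"
    and "f \<in> Arr C" "g \<in> Arr C" "Dom C f = tens C Xs" "Dom C g = tens C Xs" and Xs: "set Xs \<subseteq> Obj C"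
  shows "f = g"
proof -
  interpret G: ctx C Xs by unfold_locales (rule Xs)
  show ?thesis
    by (rule G.isoE_cancel[OF eq[OF G.ctx_axioms G.els_gen_all(1)] G.els_gen_all(2) G.el_tensE[OF G.els_gen_all(1)]])
      (use assms in simp_all)
qed

lemma ext_tens2:
  assumes eq: "\<And>\<Gamma> as bs. \<lbrakk>ctx C \<Gamma>; ctx.els C \<Gamma> Xs as; ctx.els C \<Gamma> Ys bs; \<forall>a \<in> set as. \<forall>b \<in> set bs. dj a b\<rbrakk>
      \<Longrightarrow> ap f (ctx.eprod C \<Gamma> (ctx.tensE C \<Gamma> as) (ctx.tensE C \<Gamma> bs)) = ap g (ctx.eprod C \<Gamma> (ctx.tensE C \<Gamma> as) (ctx.tensE C \<Gamma> bs))"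
    and f: "f \<in> Arr C" "g \<in> Arr C" "Dom C f = tens C Xs \<otimes>\<^sub>o tens C Ys" "Dom C g = tens C Xs \<otimes>\<^sub>o tens C Ys"
    and XY: "set Xs \<subseteq> Obj C" "set Ys \<subseteq> Obj C"
  shows "f = g"
proof -
  let ?k = "inv\<^sub>a (tens_append C Xs Ys)"
  have "f \<cdot> ?k = g \<cdot> ?k"
  proof (rule ext_tens)
    fix \<Gamma> cs
    assume \<Gamma>: "ctx C \<Gamma>" and cs: "ctx.els C \<Gamma> (Xs @ Ys) cs"
    interpret G: ctx C \<Gamma> by (rule \<Gamma>)
    obtain as bs where ab: "cs = as @ bs" "G.els Xs as" "G.els Ys bs" "\<forall>a \<in> set as. \<forall>b \<in> set bs. dj a b"
      using cs by (rule G.els_appendE)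
    then have "ap ?k (G.tensE cs) = G.eprod (G.tensE as) (G.tensE bs)"
      by (intro G.ap_inv) (use XY in simp_all)
    moreover have "G.el (tens C (Xs @ Ys)) (G.tensE cs)" using cs by (rule G.el_tensE)
    ultimately show "ap (f \<cdot> ?k) (G.tensE cs) = ap (g \<cdot> ?k) (G.tensE cs)"
      using eq[OF \<Gamma> ab(2-4)] f XY by simp
  qed (use f XY in simp_all)
  then show ?thesis by (rule iso_cancel_right) (use f XY in simp_all)
qed

lemma ext_tens3:
  assumes eq: "\<And>\<Gamma> as bs cs. \<lbrakk>ctx C \<Gamma>; ctx.els C \<Gamma> Xs as; ctx.els C \<Gamma> Ys bs; ctx.els C \<Gamma> Zs cs;
      \<forall>a \<in> set as. \<forall>b \<in> set bs. dj a b; \<forall>a \<in> set as. \<forall>c \<in> set cs. dj a c; \<forall>b \<in> set bs. \<forall>c \<in> set cs. dj b c\<rbrakk>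
      \<Longrightarrow> ap f (ctx.eprod C \<Gamma> (ctx.tensE C \<Gamma> as) (ctx.eprod C \<Gamma> (ctx.tensE C \<Gamma> bs) (ctx.tensE C \<Gamma> cs)))
        = ap g (ctx.eprod C \<Gamma> (ctx.tensE C \<Gamma> as) (ctx.eprod C \<Gamma> (ctx.tensE C \<Gamma> bs) (ctx.tensE C \<Gamma> cs)))"
    and f: "f \<in> Arr C" "g \<in> Arr C" "Dom C f = tens C Xs \<otimes>\<^sub>o tens C Ys \<otimes>\<^sub>o tens C Zs"
      "Dom C g = tens C Xs \<otimes>\<^sub>o tens C Ys \<otimes>\<^sub>o tens C Zs"
    and XY: "set Xs \<subseteq> Obj C" "set Ys \<subseteq> Obj C" "set Zs \<subseteq> Obj C"
  shows "f = g"
proof -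
  let ?i = "inv\<^sub>a (tens_append C Ys Zs)"
  let ?k = "id\<^sub>a (tens C Xs) \<otimes>\<^sub>a ?i"
  have "f \<cdot> ?k = g \<cdot> ?k"
  proof (rule ext_tens2)
    fix \<Gamma> as ds
    assume \<Gamma>: "ctx C \<Gamma>" and as: "ctx.els C \<Gamma> Xs as" and ds: "ctx.els C \<Gamma> (Ys @ Zs) ds"
      and ad: "\<forall>a \<in> set as. \<forall>d \<in> set ds. dj a d"
    interpret G: ctx C \<Gamma> by (rule \<Gamma>)
    obtain bs cs where bc: "ds = bs @ cs" "G.els Ys bs" "G.els Zs cs" "\<forall>b \<in> set bs. \<forall>c \<in> set cs. dj b c"
      using ds by (rule G.els_appendE)
    have ad': "\<forall>a \<in> set as. \<forall>b \<in> set bs. dj a b" "\<forall>a \<in> set as. \<forall>c \<in> set cs. dj a c"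
      using ad bc(1) by auto
    have "ap ?i (G.tensE ds) = G.eprod (G.tensE bs) (G.tensE cs)"
      using bc by (intro G.ap_inv) (use XY in simp_all)
    moreover have "G.el (tens C (Ys @ Zs)) (G.tensE ds)" "G.el (tens C Xs) (G.tensE as)"
      using ds as by (auto intro: G.el_tensE)
    ultimately have k: "ap ?k (G.eprod (G.tensE as) (G.tensE ds)) = G.eprod (G.tensE as) (G.eprod (G.tensE bs) (G.tensE cs))"
      using ad XY by simp
    have "G.el (tens C Xs \<otimes>\<^sub>o tens C (Ys @ Zs)) (G.eprod (G.tensE as) (G.tensE ds))"
      using as ds ad by (intro G.el_eprod G.el_tensE) auto
    then have "ap (q \<cdot> ?k) (G.eprod (G.tensE as) (G.tensE ds)) = ap q (G.eprod (G.tensE as) (G.eprod (G.tensE bs) (G.tensE cs)))"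
      if "q \<in> Arr C" "Dom C q = tens C Xs \<otimes>\<^sub>o tens C Ys \<otimes>\<^sub>o tens C Zs" for q
      using that XY by (subst G.ap_Comp) (simp_all add: k)
    then show "ap (f \<cdot> ?k) (G.eprod (G.tensE as) (G.tensE ds)) = ap (g \<cdot> ?k) (G.eprod (G.tensE as) (G.tensE ds))"
      using eq[OF \<Gamma> as bc(2,3) ad' bc(4)] f by simp
  qed (use f XY in simp_all)
  then show ?thesis by (rule iso_cancel_right) (use f XY in simp_all)
qed

end

context free_cm
begin

lemma fctxI: "ctx C \<Gamma> \<Longrightarrow> fctx C R h S \<iota> \<Gamma>"
  by (simp add: fctx_def lctx_def free_cm_axioms lsmc_axioms)

lemma ext_hhh:
  assumes eq: "\<And>\<Gamma> xs ys zs. \<lbrakk>fctx C R h S \<iota> \<Gamma>; fctx.hs C h \<Gamma> (xs @ ys @ zs); length xs = l; length ys = m; length zs = n\<rbrakk>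
      \<Longrightarrow> ap f (ctx.eprod C \<Gamma> (ctx.tensE C \<Gamma> xs) (ctx.eprod C \<Gamma> (ctx.tensE C \<Gamma> ys) (ctx.tensE C \<Gamma> zs)))
        = ap g (ctx.eprod C \<Gamma> (ctx.tensE C \<Gamma> xs) (ctx.eprod C \<Gamma> (ctx.tensE C \<Gamma> ys) (ctx.tensE C \<Gamma> zs)))"
    and f: "f \<in> Arr C" "g \<in> Arr C" "Dom C f = T\<^sub>h l \<otimes>\<^sub>o T\<^sub>h m \<otimes>\<^sub>o T\<^sub>h n" "Dom C g = T\<^sub>h l \<otimes>\<^sub>o T\<^sub>h m \<otimes>\<^sub>o T\<^sub>h n"
  shows "f = g"
proof (rule ext_tens3)
  fix \<Gamma> xs ys zs
  assume a: "ctx C \<Gamma>" "ctx.els C \<Gamma> (replicate l h) xs" "ctx.els C \<Gamma> (replicate m h) ys" "ctx.els C \<Gamma> (replicate n h) zs"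
    "\<forall>a \<in> set xs. \<forall>b \<in> set ys. dj a b" "\<forall>a \<in> set xs. \<forall>c \<in> set zs. dj a c" "\<forall>b \<in> set ys. \<forall>c \<in> set zs. dj b c"
  interpret G: fctx C R h S \<iota> \<Gamma> by (rule fctxI[OF a(1)])
  show "ap f (G.eprod (G.tensE xs) (G.eprod (G.tensE ys) (G.tensE zs))) = ap g (G.eprod (G.tensE xs) (G.eprod (G.tensE ys) (G.tensE zs)))"
    by (rule eq[OF G.fctx_axioms]) (use a in \<open>auto simp: G.els_replicate G.hs_alt djl_append\<close>)
qed (use f in simp_all)

lemma ext_hh:
  assumes eq: "\<And>\<Gamma> xs ys. \<lbrakk>fctx C R h S \<iota> \<Gamma>; fctx.hs C h \<Gamma> (xs @ ys); length xs = m; length ys = n\<rbrakk>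
      \<Longrightarrow> ap f (ctx.eprod C \<Gamma> (ctx.tensE C \<Gamma> xs) (ctx.tensE C \<Gamma> ys)) = ap g (ctx.eprod C \<Gamma> (ctx.tensE C \<Gamma> xs) (ctx.tensE C \<Gamma> ys))"
    and f: "f \<in> Arr C" "g \<in> Arr C" "Dom C f = T\<^sub>h m \<otimes>\<^sub>o T\<^sub>h n" "Dom C g = T\<^sub>h m \<otimes>\<^sub>o T\<^sub>h n"
  shows "f = g"
proof (rule ext_tens2)
  fix \<Gamma> xs ys
  assume a: "ctx C \<Gamma>" "ctx.els C \<Gamma> (replicate m h) xs" "ctx.els C \<Gamma> (replicate n h) ys"
    "\<forall>a \<in> set xs. \<forall>b \<in> set ys. dj a b"
  interpret G: fctx C R h S \<iota> \<Gamma> by (rule fctxI[OF a(1)])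
  show "ap f (G.eprod (G.tensE xs) (G.tensE ys)) = ap g (G.eprod (G.tensE xs) (G.tensE ys))"
    by (rule eq[OF G.fctx_axioms]) (use a in \<open>auto simp: G.els_replicate G.hs_alt djl_append\<close>)
qed (use f in simp_all)

text \<open>The arbitrary object \<open>Z\<close> is the tensor product of a one-element list up to
  the right unitor, which \<open>?k\<close> takes into account.\<close>

lemma ext_hhZ:
  assumes eq: "\<And>\<Gamma> xs ys z. \<lbrakk>fctx C R h S \<iota> \<Gamma>; fctx.hs C h \<Gamma> (xs @ ys); ctx.el C \<Gamma> Z z;
      \<forall>x \<in> set (xs @ ys). dj x z; length xs = m; length ys = n\<rbrakk>
      \<Longrightarrow> ap f (ctx.eprod C \<Gamma> (ctx.tensE C \<Gamma> xs) (ctx.eprod C \<Gamma> (ctx.tensE C \<Gamma> ys) z))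
        = ap g (ctx.eprod C \<Gamma> (ctx.tensE C \<Gamma> xs) (ctx.eprod C \<Gamma> (ctx.tensE C \<Gamma> ys) z))"
    and f: "f \<in> Arr C" "g \<in> Arr C" "Dom C f = T\<^sub>h m \<otimes>\<^sub>o T\<^sub>h n \<otimes>\<^sub>o Z" "Dom C g = T\<^sub>h m \<otimes>\<^sub>o T\<^sub>h n \<otimes>\<^sub>o Z" and Z: "Z \<in> Obj C"
  shows "f = g"
proof -
  let ?k = "id\<^sub>a (T\<^sub>h m) \<otimes>\<^sub>a id\<^sub>a (T\<^sub>h n) \<otimes>\<^sub>a \<rho>\<^sub>u Z"
  have "f \<cdot> ?k = g \<cdot> ?k"
  proof (rule ext_tens3)
    fix \<Gamma> xs ys zs
    assume a: "ctx C \<Gamma>" "ctx.els C \<Gamma> (replicate m h) xs" "ctx.els C \<Gamma> (replicate n h) ys" "ctx.els C \<Gamma> [Z] zs"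
      "\<forall>a \<in> set xs. \<forall>b \<in> set ys. dj a b" "\<forall>a \<in> set xs. \<forall>c \<in> set zs. dj a c" "\<forall>b \<in> set ys. \<forall>c \<in> set zs. dj b c"
    interpret G: fctx C R h S \<iota> \<Gamma> by (rule fctxI[OF a(1)])
    obtain z where z: "zs = [z]" "G.el Z z" using a(4) by (auto simp: G.els_Cons)
    have hs: "G.hs (xs @ ys)" "length xs = m" "length ys = n" "\<forall>x \<in> set (xs @ ys). dj x z"
      using a z by (auto simp: G.els_replicate G.hs_alt djl_append)
    then have hs': "G.hs xs" "G.hs ys" "\<forall>x \<in> set xs. \<forall>y \<in> set ys. dj x y" "\<forall>x \<in> set xs. dj x z" "\<forall>y \<in> set ys. dj y z"
      by auto
    have "ap (q \<cdot> ?k) (G.eprod (G.tensE xs) (G.eprod (G.tensE ys) (G.tensE zs)))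
        = ap q (G.eprod (G.tensE xs) (G.eprod (G.tensE ys) z))"
      if "q \<in> Arr C" "Dom C q = T\<^sub>h m \<otimes>\<^sub>o T\<^sub>h n \<otimes>\<^sub>o Z" for q
      using that z Z hs' hs(2,3) by simp
    then show "ap (f \<cdot> ?k) (G.eprod (G.tensE xs) (G.eprod (G.tensE ys) (G.tensE zs)))
        = ap (g \<cdot> ?k) (G.eprod (G.tensE xs) (G.eprod (G.tensE ys) (G.tensE zs)))"
      using eq[OF G.fctx_axioms hs(1) z(2) hs(4,2,3)] f by simp
  qed (use f Z in simp_all)
  then show ?thesis by (rule iso_cancel_right) (use f Z in simp_all)
qed

lemma ext_hZ:
  assumes eq: "\<And>\<Gamma> xs z. \<lbrakk>fctx C R h S \<iota> \<Gamma>; fctx.hs C h \<Gamma> xs; ctx.el C \<Gamma> Z z; \<forall>x \<in> set xs. dj x z; length xs = n\<rbrakk>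
      \<Longrightarrow> ap f (ctx.eprod C \<Gamma> (ctx.tensE C \<Gamma> xs) z) = ap g (ctx.eprod C \<Gamma> (ctx.tensE C \<Gamma> xs) z)"
    and f: "f \<in> Arr C" "g \<in> Arr C" "Dom C f = T\<^sub>h n \<otimes>\<^sub>o Z" "Dom C g = T\<^sub>h n \<otimes>\<^sub>o Z" and Z: "Z \<in> Obj C"
  shows "f = g"
proof -
  let ?k = "id\<^sub>a (T\<^sub>h n) \<otimes>\<^sub>a \<rho>\<^sub>u Z"
  have "f \<cdot> ?k = g \<cdot> ?k"
  proof (rule ext_tens2)
    fix \<Gamma> xs zs
    assume a: "ctx C \<Gamma>" "ctx.els C \<Gamma> (replicate n h) xs" "ctx.els C \<Gamma> [Z] zs" "\<forall>a \<in> set xs. \<forall>c \<in> set zs. dj a c"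
    interpret G: fctx C R h S \<iota> \<Gamma> by (rule fctxI[OF a(1)])
    obtain z where z: "zs = [z]" "G.el Z z" using a(3) by (auto simp: G.els_Cons)
    have hs: "G.hs xs" "length xs = n" "\<forall>x \<in> set xs. dj x z"
      using a z by (auto simp: G.els_replicate G.hs_alt)
    then have "ap (q \<cdot> ?k) (G.eprod (G.tensE xs) (G.tensE zs)) = ap q (G.eprod (G.tensE xs) z)"
      if "q \<in> Arr C" "Dom C q = T\<^sub>h n \<otimes>\<^sub>o Z" for q
      using that z Z by simp
    then show "ap (f \<cdot> ?k) (G.eprod (G.tensE xs) (G.tensE zs)) = ap (g \<cdot> ?k) (G.eprod (G.tensE xs) (G.tensE zs))"
      using eq[OF G.fctx_axioms hs(1) z(2) hs(3,2)] f by simp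
  qed (use f Z in simp_all)
  then show ?thesis by (rule iso_cancel_right) (use f Z in simp_all)
qed

subsection \<open>Multiplication\<close>

lemma tens_append_replicate [simp]:
  "Cod C (tens_append C (replicate m h) (replicate n h)) = T\<^sub>h (m + n)"
  by (simp add: replicate_add)

declare tens_append_arr(3) [simp del]

end

context fctx
begin

lemma ap_append_hs [simp]:
  "\<lbrakk>hs xs; hs ys; \<forall>x \<in> set xs. \<forall>y \<in> set ys. dj x y; m = length xs; n = length ys\<rbrakk>
    \<Longrightarrow> ap (tens_append C (replicate m h) (replicate n h)) (tensE xs \<bowtie> tensE ys) = tensE (xs @ ys)"
  by (simp add: hs_def)

lemma ap_tens_perm_hs:
  assumes "hs xs" "is_arrangement n p" "n = length xs"
  obtains ys where "ap (tens_perm C (replicate n h) p) (tensE xs) = tensE ys" "mset ys = mset xs"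
proof
  show "ap (tens_perm C (replicate n h) p) (tensE xs) = tensE (map ((!) xs) p)"
    using assms by (simp add: hs_def)
  have "mset p = mset [0..<n]"
    using assms(2) by (intro set_eq_iff_mset_eq_distinct[THEN iffD1]) (auto simp: is_arrangement_def atLeast0LessThan)
  then have "mset (map ((!) xs) p) = mset (map ((!) xs) [0..<n])" by (simp only: mset_map)
  then show "mset (map ((!) xs) p) = mset xs" using assms(3) by (simp only: map_nth)
qed

end

context free_cm
begin

text \<open>Multiplication is extended to \<open>S\<close> in one argument at a time. The invariance
  needed for the first extension holds because permuting the first list permutes the concatenation,
  hence does not change its monomial.\<close>

lemma mult_left_ex:
  "\<exists>!f. f \<in> hom_set C (S \<otimes>\<^sub>o T\<^sub>h n) S \<and>
    (\<forall>m. f \<cdot> (\<iota> m \<otimes>\<^sub>a id\<^sub>a (T\<^sub>h n)) = \<iota> (m + n) \<cdot> tens_append C (replicate m h) (replicate n h))"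
proof (rule S_univ)
  fix m p
  assume p: "is_arrangement m p"
  show "(\<iota> (m + n) \<cdot> tens_append C (replicate m h) (replicate n h)) \<cdot> (tens_perm C (replicate m h) p \<otimes>\<^sub>a id\<^sub>a (T\<^sub>h n))
    = \<iota> (m + n) \<cdot> tens_append C (replicate m h) (replicate n h)" (is "?l = ?r")
  proof (rule ext_hh)
    fix \<Gamma> xs ys
    assume a: "fctx C R h S \<iota> \<Gamma>" "fctx.hs C h \<Gamma> (xs @ ys)" "length xs = m" "length ys = n"
    interpret G: fctx C R h S \<iota> \<Gamma> by (rule a(1))
    have hs: "G.hs xs" "G.hs ys" "\<forall>x \<in> set xs. \<forall>y \<in> set ys. dj x y" using a(2) by auto
    obtain xs' where xs': "ap (tens_perm C (replicate m h) p) (G.tensE xs) = G.tensE xs'" "mset xs' = mset xs"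
      using G.ap_tens_perm_hs[OF hs(1) p] a(3) by metis
    have hs': "G.hs xs'" "length xs' = m" "set xs' = set xs"
      using G.hs_mset[OF xs'(2)[symmetric] hs(1)] mset_eq_length[OF xs'(2)] mset_eq_setD[OF xs'(2)] a(3) by auto
    have "G.mon (xs' @ ys) = G.mon (xs @ ys)"
      by (rule G.mon_mset) (use hs hs' xs' in auto)
    then show "ap ?l (G.eprod (G.tensE xs) (G.tensE ys)) = ap ?r (G.eprod (G.tensE xs) (G.tensE ys))"
      using hs hs' p a(3,4) by (simp add: xs'(1))
  qed (use p in simp_all)
qed (simp_all add: hom_set_def)

definition mult_left :: "nat \<Rightarrow> 'm" where
  "mult_left n = (THE f. f \<in> hom_set C (S \<otimes>\<^sub>o T\<^sub>h n) S \<and>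
    (\<forall>m. f \<cdot> (\<iota> m \<otimes>\<^sub>a id\<^sub>a (T\<^sub>h n)) = \<iota> (m + n) \<cdot> tens_append C (replicate m h) (replicate n h)))"

lemma mult_left [simp]:
  "mult_left n \<in> Arr C" "Dom C (mult_left n) = S \<otimes>\<^sub>o T\<^sub>h n" "Cod C (mult_left n) = S"
  "mult_left n \<cdot> (\<iota> m \<otimes>\<^sub>a id\<^sub>a (T\<^sub>h n)) = \<iota> (m + n) \<cdot> tens_append C (replicate m h) (replicate n h)"
  using theI'[OF mult_left_ex[of n], folded mult_left_def] by (auto simp: hom_set_def)

text \<open>The invariance needed for the second extension; it may be checked on monomials in the
  first argument.\<close>

lemma mult_left_perm:
  assumes p: "is_arrangement n p"
  shows "mult_left n \<cdot> (id\<^sub>a S \<otimes>\<^sub>a tens_perm C (replicate n h) p) = mult_left n"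
proof (rule S_ext[where Z = "T\<^sub>h n"])
  fix m
  let ?P = "tens_perm C (replicate n h) p"
  have "(mult_left n \<cdot> (id\<^sub>a S \<otimes>\<^sub>a ?P)) \<cdot> (\<iota> m \<otimes>\<^sub>a id\<^sub>a (T\<^sub>h n)) = mult_left n \<cdot> (\<iota> m \<otimes>\<^sub>a id\<^sub>a (T\<^sub>h n)) \<cdot> (id\<^sub>a (T\<^sub>h m) \<otimes>\<^sub>a ?P)"
    using p by (simp add: merge)
  also have "\<dots> = \<iota> (m + n) \<cdot> tens_append C (replicate m h) (replicate n h) \<cdot> (id\<^sub>a (T\<^sub>h m) \<otimes>\<^sub>a ?P)" (is "_ = ?l")
    using p by (subst Comp_tail[OF mult_left(4)]) simp_all
  also have "\<dots> = \<iota> (m + n) \<cdot> tens_append C (replicate m h) (replicate n h)" (is "_ = ?r")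
  proof (rule ext_hh)
    fix \<Gamma> xs ys
    assume a: "fctx C R h S \<iota> \<Gamma>" "fctx.hs C h \<Gamma> (xs @ ys)" "length xs = m" "length ys = n"
    interpret G: fctx C R h S \<iota> \<Gamma> by (rule a(1))
    have hs: "G.hs xs" "G.hs ys" "\<forall>x \<in> set xs. \<forall>y \<in> set ys. dj x y" using a(2) by auto
    obtain ys' where ys': "ap ?P (G.tensE ys) = G.tensE ys'" "mset ys' = mset ys"
      using G.ap_tens_perm_hs[OF hs(2) p] a(4) by metis
    have hs': "G.hs ys'" "length ys' = n" "set ys' = set ys"
      using G.hs_mset[OF ys'(2)[symmetric] hs(2)] mset_eq_length[OF ys'(2)] mset_eq_setD[OF ys'(2)] a(4) by auto
    have "G.mon (xs @ ys') = G.mon (xs @ ys)"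
      by (rule G.mon_mset) (use hs hs' ys' in auto)
    then show "ap ?l (G.eprod (G.tensE xs) (G.tensE ys)) = ap ?r (G.eprod (G.tensE xs) (G.tensE ys))"
      using hs hs' p a(3,4) by (simp add: ys'(1))
  qed (use p in simp_all)
  finally show "(mult_left n \<cdot> (id\<^sub>a S \<otimes>\<^sub>a ?P)) \<cdot> (\<iota> m \<otimes>\<^sub>a id\<^sub>a (T\<^sub>h n)) = mult_left n \<cdot> (\<iota> m \<otimes>\<^sub>a id\<^sub>a (T\<^sub>h n))" by simp
qed (use p in simp_all)

text \<open>Since \<open>S_univ\<close> extends only in the front factor, the second argument is
  moved there by a symmetry, and a second symmetry restores the order afterwards.\<close>

lemma mult_ex:
  "\<exists>!\<mu>. \<mu> \<in> hom_set C (S \<otimes>\<^sub>o S) S \<and>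
    (\<forall>m n. \<mu> \<cdot> (\<iota> m \<otimes>\<^sub>a \<iota> n) = \<iota> (m + n) \<cdot> tens_append C (replicate m h) (replicate n h))"
proof (rule ex_ex1I)
  have "\<exists>!f. f \<in> hom_set C (S \<otimes>\<^sub>o S) S \<and> (\<forall>n. f \<cdot> (\<iota> n \<otimes>\<^sub>a id\<^sub>a S) = mult_left n \<cdot> \<sigma>\<^sub>a (T\<^sub>h n) S)"
  proof (rule S_univ)
    fix n p
    assume p: "is_arrangement n p"
    have "(mult_left n \<cdot> \<sigma>\<^sub>a (T\<^sub>h n) S) \<cdot> (tens_perm C (replicate n h) p \<otimes>\<^sub>a id\<^sub>a S)
        = (mult_left n \<cdot> (id\<^sub>a S \<otimes>\<^sub>a tens_perm C (replicate n h) p)) \<cdot> \<sigma>\<^sub>a (T\<^sub>h n) S"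
      using p by (simp add: Symm_nat)
    then show "(mult_left n \<cdot> \<sigma>\<^sub>a (T\<^sub>h n) S) \<cdot> (tens_perm C (replicate n h) p \<otimes>\<^sub>a id\<^sub>a S) = mult_left n \<cdot> \<sigma>\<^sub>a (T\<^sub>h n) S"
      by (simp only: mult_left_perm[OF p])
  qed (simp_all add: hom_set_def)
  then obtain f where f [simp]: "f \<in> Arr C" "Dom C f = S \<otimes>\<^sub>o S" "Cod C f = S"
    and fn: "f \<cdot> (\<iota> n \<otimes>\<^sub>a id\<^sub>a S) = mult_left n \<cdot> \<sigma>\<^sub>a (T\<^sub>h n) S" for n
    by (auto simp: hom_set_def)
  have "(f \<cdot> \<sigma>\<^sub>a S S) \<cdot> (\<iota> m \<otimes>\<^sub>a \<iota> n) = \<iota> (m + n) \<cdot> tens_append C (replicate m h) (replicate n h)" for m n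
  proof -
    have "(f \<cdot> \<sigma>\<^sub>a S S) \<cdot> (\<iota> m \<otimes>\<^sub>a \<iota> n) = f \<cdot> (\<iota> n \<otimes>\<^sub>a id\<^sub>a S) \<cdot> (id\<^sub>a (T\<^sub>h n) \<otimes>\<^sub>a \<iota> m) \<cdot> \<sigma>\<^sub>a (T\<^sub>h m) (T\<^sub>h n)"
      by (simp add: Symm_nat merge)
    also have "\<dots> = mult_left n \<cdot> \<sigma>\<^sub>a (T\<^sub>h n) S \<cdot> (id\<^sub>a (T\<^sub>h n) \<otimes>\<^sub>a \<iota> m) \<cdot> \<sigma>\<^sub>a (T\<^sub>h m) (T\<^sub>h n)"
      by (subst Comp_tail[OF fn]) simp_all
    also have "\<dots> = mult_left n \<cdot> (\<iota> m \<otimes>\<^sub>a id\<^sub>a (T\<^sub>h n)) \<cdot> \<sigma>\<^sub>a (T\<^sub>h n) (T\<^sub>h m) \<cdot> \<sigma>\<^sub>a (T\<^sub>h m) (T\<^sub>h n)"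
      by (subst Symm_nat_tail) simp_all
    finally show ?thesis by simp
  qed
  then show "\<exists>\<mu>. \<mu> \<in> hom_set C (S \<otimes>\<^sub>o S) S \<and>
    (\<forall>m n. \<mu> \<cdot> (\<iota> m \<otimes>\<^sub>a \<iota> n) = \<iota> (m + n) \<cdot> tens_append C (replicate m h) (replicate n h))"
    by (intro exI[of _ "f \<cdot> \<sigma>\<^sub>a S S"]) (simp add: hom_set_def)
  show "\<mu> = \<mu>'"
    if "\<mu> \<in> hom_set C (S \<otimes>\<^sub>o S) S \<and>
        (\<forall>m n. \<mu> \<cdot> (\<iota> m \<otimes>\<^sub>a \<iota> n) = \<iota> (m + n) \<cdot> tens_append C (replicate m h) (replicate n h))"
      "\<mu>' \<in> hom_set C (S \<otimes>\<^sub>o S) S \<and>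
        (\<forall>m n. \<mu>' \<cdot> (\<iota> m \<otimes>\<^sub>a \<iota> n) = \<iota> (m + n) \<cdot> tens_append C (replicate m h) (replicate n h))" for \<mu> \<mu>'
    by (rule S_ext2) (use that in \<open>auto simp: hom_set_def\<close>)
qed

abbreviation \<mu> :: 'm where
  "\<mu> \<equiv> free_mult C h S \<iota>"

lemma mult_arr [simp]: "\<mu> \<in> Arr C" "Dom C \<mu> = S \<otimes>\<^sub>o S" "Cod C \<mu> = S"
    "\<mu> \<cdot> (\<iota> m \<otimes>\<^sub>a \<iota> n) = \<iota> (m + n) \<cdot> tens_append C (replicate m h) (replicate n h)"
  using theI'[OF mult_ex, folded free_mult_def] by (auto simp: hom_set_def)

abbreviation gencl :: 'm where
  "gencl \<equiv> free_incl C h \<iota>"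

lemma gencl_arr [simp]: "gencl \<in> Arr C" "Dom C gencl = h" "Cod C gencl = S"
  using \<iota>_arr[of 1] by (simp_all add: free_incl_def)

lemma free_unit_arr [simp]: "free_unit \<iota> \<in> Arr C" "Dom C (free_unit \<iota>) = \<I>" "Cod C (free_unit \<iota>) = S"
  using \<iota>_arr[of 0] by (simp_all add: free_unit_def)

end

context free_cm
begin

text \<open>After rebracketing, the last \<open>S\<close> is the right factor of a binary tensor
  product, where \<open>S_ext_right\<close> applies.\<close>

lemma S_ext3':
  assumes "\<And>k m n. f \<cdot> (\<iota> k \<otimes>\<^sub>a \<iota> m \<otimes>\<^sub>a \<iota> n) = g \<cdot> (\<iota> k \<otimes>\<^sub>a \<iota> m \<otimes>\<^sub>a \<iota> n)" "f \<in> Arr C" "g \<in> Arr C"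
    "Dom C f = S \<otimes>\<^sub>o S \<otimes>\<^sub>o S" "Dom C g = S \<otimes>\<^sub>o S \<otimes>\<^sub>o S" "Cod C f = Cod C g"
  shows "f = g"
proof (rule S_ext3[where Z = S])
  fix k m
  let ?\<alpha> = "\<alpha>\<^sub>a (T\<^sub>h k) (T\<^sub>h m) S"
  have nat: "((q \<cdot> (\<iota> k \<otimes>\<^sub>a \<iota> m \<otimes>\<^sub>a id\<^sub>a S)) \<cdot> ?\<alpha>) \<cdot> (id\<^sub>a (T\<^sub>h k \<otimes>\<^sub>o T\<^sub>h m) \<otimes>\<^sub>a \<iota> n)
      = (q \<cdot> (\<iota> k \<otimes>\<^sub>a \<iota> m \<otimes>\<^sub>a \<iota> n)) \<cdot> \<alpha>\<^sub>a (T\<^sub>h k) (T\<^sub>h m) (T\<^sub>h n)"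
    if "q \<in> Arr C" "Dom C q = S \<otimes>\<^sub>o S \<otimes>\<^sub>o S" for q n
  proof -
    have "((q \<cdot> (\<iota> k \<otimes>\<^sub>a \<iota> m \<otimes>\<^sub>a id\<^sub>a S)) \<cdot> ?\<alpha>) \<cdot> (id\<^sub>a (T\<^sub>h k \<otimes>\<^sub>o T\<^sub>h m) \<otimes>\<^sub>a \<iota> n)
      = q \<cdot> (\<iota> k \<otimes>\<^sub>a \<iota> m \<otimes>\<^sub>a id\<^sub>a S) \<cdot> ?\<alpha> \<cdot> ((id\<^sub>a (T\<^sub>h k) \<otimes>\<^sub>a id\<^sub>a (T\<^sub>h m)) \<otimes>\<^sub>a \<iota> n)"
      using that by simp
    also have "\<dots> = q \<cdot> (\<iota> k \<otimes>\<^sub>a \<iota> m \<otimes>\<^sub>a id\<^sub>a S) \<cdot> (id\<^sub>a (T\<^sub>h k) \<otimes>\<^sub>a id\<^sub>a (T\<^sub>h m) \<otimes>\<^sub>a \<iota> n) \<cdot> \<alpha>\<^sub>a (T\<^sub>h k) (T\<^sub>h m) (T\<^sub>h n)"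
      by (subst Assoc_nat) simp_all
    also have "\<dots> = (q \<cdot> (\<iota> k \<otimes>\<^sub>a \<iota> m \<otimes>\<^sub>a \<iota> n)) \<cdot> \<alpha>\<^sub>a (T\<^sub>h k) (T\<^sub>h m) (T\<^sub>h n)"
      using that by (simp add: merge)
    finally show ?thesis .
  qed
  have "(f \<cdot> (\<iota> k \<otimes>\<^sub>a \<iota> m \<otimes>\<^sub>a id\<^sub>a S)) \<cdot> ?\<alpha> = (g \<cdot> (\<iota> k \<otimes>\<^sub>a \<iota> m \<otimes>\<^sub>a id\<^sub>a S)) \<cdot> ?\<alpha>"
  proof (rule S_ext_right[where Z = "T\<^sub>h k \<otimes>\<^sub>o T\<^sub>h m"])
    fix n
    show "((f \<cdot> (\<iota> k \<otimes>\<^sub>a \<iota> m \<otimes>\<^sub>a id\<^sub>a S)) \<cdot> ?\<alpha>) \<cdot> (id\<^sub>a (T\<^sub>h k \<otimes>\<^sub>o T\<^sub>h m) \<otimes>\<^sub>a \<iota> n)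
      = ((g \<cdot> (\<iota> k \<otimes>\<^sub>a \<iota> m \<otimes>\<^sub>a id\<^sub>a S)) \<cdot> ?\<alpha>) \<cdot> (id\<^sub>a (T\<^sub>h k \<otimes>\<^sub>o T\<^sub>h m) \<otimes>\<^sub>a \<iota> n)"
      by (simp only: nat assms)
  qed (use assms in simp_all)
  then show "f \<cdot> (\<iota> k \<otimes>\<^sub>a \<iota> m \<otimes>\<^sub>a id\<^sub>a S) = g \<cdot> (\<iota> k \<otimes>\<^sub>a \<iota> m \<otimes>\<^sub>a id\<^sub>a S)"
    by (rule iso_cancel_right) (use assms in simp_all)
qed (use assms in simp_all)

end

context fctx
begin

definition mul :: "nat set \<times> 'm \<Rightarrow> nat set \<times> 'm \<Rightarrow> nat set \<times> 'm"  (infixr "\<star>" 75) where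
  "s \<star> t = ap \<mu> (s \<bowtie> t)"

lemma el_mul [simp]: "\<lbrakk>el S s; el S t; dj s t\<rbrakk> \<Longrightarrow> el S (s \<star> t)"
  by (simp add: mul_def)

lemma fst_mul [simp]: "fst (s \<star> t) = fst s \<union> fst t"
  by (simp add: mul_def)

lemma dj_mul [simp]: "dj (s \<star> t) u \<longleftrightarrow> dj s u \<and> dj t u" "dj u (s \<star> t) \<longleftrightarrow> dj u s \<and> dj u t"
  by (simp_all add: mul_def)

lemma mon_mul [simp]:
  assumes "hs xs" "hs ys" "\<forall>x \<in> set xs. \<forall>y \<in> set ys. dj x y"
  shows "mon xs \<star> mon ys = mon (xs @ ys)"
proof -
  have "mon xs \<star> mon ys = ap (\<mu> \<cdot> (\<iota> (length xs) \<otimes>\<^sub>a \<iota> (length ys))) (tensE xs \<bowtie> tensE ys)"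
    using assms by (subst ap_Comp) (simp_all add: mul_def)
  then show ?thesis using assms by simp
qed

lemma ap_gencl: "el h x \<Longrightarrow> ap gencl x = mon [x]"
  using ap_\<iota>[of 1 "[x]"] \<iota>_arr[of 1] by (simp add: free_incl_def del: ap_\<iota> \<iota>_arr)

lemma mon_Cons: "hs (x # xs) \<Longrightarrow> mon (x # xs) = ap gencl x \<star> mon xs"
  by (simp add: ap_gencl)

lemma ap_free_unit: "ap (free_unit \<iota>) eunit = mon []"
  using ap_\<iota>[of 0 "[]"] by (simp add: free_unit_def)

end

section \<open>The commutative monoid laws\<close>

context free_cm
begin

lemma mult_assoc: "\<mu> \<cdot> (\<mu> \<otimes>\<^sub>a id\<^sub>a S) = \<mu> \<cdot> (id\<^sub>a S \<otimes>\<^sub>a \<mu>) \<cdot> \<alpha>\<^sub>a S S S"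
proof -
  have "(\<mu> \<cdot> (\<mu> \<otimes>\<^sub>a id\<^sub>a S)) \<cdot> inv\<^sub>a (\<alpha>\<^sub>a S S S) = \<mu> \<cdot> (id\<^sub>a S \<otimes>\<^sub>a \<mu>)" (is "?f = ?g")
  proof (rule S_ext3')
    fix k m n
    show "?f \<cdot> (\<iota> k \<otimes>\<^sub>a \<iota> m \<otimes>\<^sub>a \<iota> n) = ?g \<cdot> (\<iota> k \<otimes>\<^sub>a \<iota> m \<otimes>\<^sub>a \<iota> n)" (is "?l = ?r")
    proof (rule ext_hhh)
      fix \<Gamma> xs ys zs
      assume a: "fctx C R h S \<iota> \<Gamma>" "fctx.hs C h \<Gamma> (xs @ ys @ zs)" "length xs = k" "length ys = m" "length zs = n"
      interpret G: fctx C R h S \<iota> \<Gamma> by (rule a(1))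
      have hs: "G.hs xs" "G.hs ys" "G.hs zs" "\<forall>x \<in> set xs. \<forall>y \<in> set ys. dj x y"
        "\<forall>x \<in> set xs. \<forall>z \<in> set zs. dj x z" "\<forall>y \<in> set ys. \<forall>z \<in> set zs. dj y z" using a(2) by auto
      show "ap ?l (G.eprod (G.tensE xs) (G.eprod (G.tensE ys) (G.tensE zs)))
        = ap ?r (G.eprod (G.tensE xs) (G.eprod (G.tensE ys) (G.tensE zs)))"
        using hs a(3-5) by (simp add: G.mul_def[symmetric] ball_Un)
    qed simp_all
  qed simp_all
  then have "?f \<cdot> \<alpha>\<^sub>a S S S = ?g \<cdot> \<alpha>\<^sub>a S S S" by simp
  then show ?thesis by simp
qed

lemma mult_comm: "\<mu> \<cdot> \<sigma>\<^sub>a S S = \<mu>"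
proof (rule S_ext2)
  fix m n
  show "(\<mu> \<cdot> \<sigma>\<^sub>a S S) \<cdot> (\<iota> m \<otimes>\<^sub>a \<iota> n) = \<mu> \<cdot> (\<iota> m \<otimes>\<^sub>a \<iota> n)" (is "?l = ?r")
  proof (rule ext_hh)
    fix \<Gamma> xs ys
    assume a: "fctx C R h S \<iota> \<Gamma>" "fctx.hs C h \<Gamma> (xs @ ys)" "length xs = m" "length ys = n"
    interpret G: fctx C R h S \<iota> \<Gamma> by (rule a(1))
    have hs: "G.hs xs" "G.hs ys" "\<forall>x \<in> set xs. \<forall>y \<in> set ys. dj x y" using a(2) by auto
    then have hs': "\<forall>x \<in> set ys. \<forall>y \<in> set xs. dj x y" by (auto intro: dj_sym)
    have "G.mon (ys @ xs) = G.mon (xs @ ys)"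
      by (rule G.mon_mset) (use hs hs' in auto)
    then have "ap ?l (G.eprod (G.tensE xs) (G.tensE ys)) = G.mon (xs @ ys)"
      using hs hs' a(3,4) by (simp add: G.mul_def[symmetric])
    then show "ap ?l (G.eprod (G.tensE xs) (G.tensE ys)) = ap ?r (G.eprod (G.tensE xs) (G.tensE ys))"
      using hs a(3,4) by simp
  qed simp_all
qed simp_all

lemma mult_unit_right: "\<mu> \<cdot> (id\<^sub>a S \<otimes>\<^sub>a free_unit \<iota>) = \<rho>\<^sub>u S"
proof (rule S_ext[where Z = \<I>])
  fix n
  show "(\<mu> \<cdot> (id\<^sub>a S \<otimes>\<^sub>a free_unit \<iota>)) \<cdot> (\<iota> n \<otimes>\<^sub>a id\<^sub>a \<I>) = \<rho>\<^sub>u S \<cdot> (\<iota> n \<otimes>\<^sub>a id\<^sub>a \<I>)" (is "?l = ?r")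
  proof -
    have "?l \<cdot> (id\<^sub>a (T\<^sub>h n) \<otimes>\<^sub>a id\<^sub>a \<I>) = ?r \<cdot> (id\<^sub>a (T\<^sub>h n) \<otimes>\<^sub>a id\<^sub>a \<I>)"
    \<comment> \<open>The unit object is \<open>T\<^sub>h 0\<close>, so the second argument is
      tested on the empty list.\<close>
    proof (rule ext_hh[where n = 0])
      fix \<Gamma> xs ys
      assume a: "fctx C R h S \<iota> \<Gamma>" "fctx.hs C h \<Gamma> (xs @ ys)" "length xs = n" "length ys = 0"
      interpret G: fctx C R h S \<iota> \<Gamma> by (rule a(1))
      have hs: "G.hs xs" "ys = []" using a(2,4) by auto
      show "ap (?l \<cdot> (id\<^sub>a (T\<^sub>h n) \<otimes>\<^sub>a id\<^sub>a \<I>)) (G.eprod (G.tensE xs) (G.tensE ys)) = ap (?r \<cdot> (id\<^sub>a (T\<^sub>h n) \<otimes>\<^sub>a id\<^sub>a \<I>)) (G.eprod (G.tensE xs) (G.tensE ys))"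
        using hs a(3) by (simp add: G.mul_def[symmetric] G.ap_free_unit)
    qed simp_all
    then show ?thesis by simp
  qed
qed simp_all

lemma mult_unit_left: "\<mu> \<cdot> (free_unit \<iota> \<otimes>\<^sub>a id\<^sub>a S) = \<lambda>\<^sub>u S"
proof (rule iso_cancel_right)
  have "(\<mu> \<cdot> (free_unit \<iota> \<otimes>\<^sub>a id\<^sub>a S)) \<cdot> \<sigma>\<^sub>a S \<I> = (\<mu> \<cdot> \<sigma>\<^sub>a S S) \<cdot> (id\<^sub>a S \<otimes>\<^sub>a free_unit \<iota>)"
    by (simp add: Symm_nat)
  also have "\<dots> = \<lambda>\<^sub>u S \<cdot> \<sigma>\<^sub>a S \<I>"
    by (simp only: mult_comm mult_unit_right LUnit_Symm S_Obj)
  finally show "(\<mu> \<cdot> (free_unit \<iota> \<otimes>\<^sub>a id\<^sub>a S)) \<cdot> \<sigma>\<^sub>a S \<I> = \<lambda>\<^sub>u S \<cdot> \<sigma>\<^sub>a S \<I>" .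
qed simp_all

lemma commutative_monoid_S: "commutative_monoid C S \<mu> (free_unit \<iota>)"
  by (simp add: commutative_monoid_def hom_setI mult_assoc mult_comm mult_unit_left mult_unit_right)

end

context fctx
begin

lemma mul_assoc:
  assumes "el S s" "el S t" "el S u" "dj s t" "dj s u" "dj t u"
  shows "(s \<star> t) \<star> u = s \<star> t \<star> u"
proof -
  have "ap (\<mu> \<cdot> (\<mu> \<otimes>\<^sub>a id\<^sub>a S)) ((s \<bowtie> t) \<bowtie> u) = ap (\<mu> \<cdot> (id\<^sub>a S \<otimes>\<^sub>a \<mu>) \<cdot> \<alpha>\<^sub>a S S S) ((s \<bowtie> t) \<bowtie> u)"
    by (simp only: mult_assoc)
  then show ?thesis using assms by (simp add: mul_def)
qed

lemma mul_comm:
  assumes "el S s" "el S t" "dj s t"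
  shows "s \<star> t = t \<star> s"
proof -
  have "ap (\<mu> \<cdot> \<sigma>\<^sub>a S S) (s \<bowtie> t) = ap \<mu> (s \<bowtie> t)"
    by (simp only: mult_comm)
  then show ?thesis using assms by (simp add: mul_def)
qed

lemma mul_left_comm:
  assumes "el S s" "el S t" "el S u" "dj s t" "dj s u" "dj t u"
  shows "s \<star> t \<star> u = t \<star> s \<star> u"
  using mul_assoc[OF assms] mul_assoc[of t s u] mul_comm[of s t] assms by (simp add: dj_sym)

lemma mul_mon_Nil [simp]: "el S s \<Longrightarrow> s \<star> mon [] = s" "el S s \<Longrightarrow> mon [] \<star> s = s"
proof -
  show *: "s \<star> mon [] = s" if "el S s"
  proof -
    have "ap (\<mu> \<cdot> (id\<^sub>a S \<otimes>\<^sub>a free_unit \<iota>)) (s \<bowtie> eunit) = ap (\<rho>\<^sub>u S) (s \<bowtie> eunit)"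
      by (simp only: mult_unit_right)
    then show ?thesis using that by (simp add: mul_def ap_free_unit)
  qed
  show "mon [] \<star> s = s" if "el S s"
    using *[OF that] mul_comm[of s "mon []"] that by simp
qed

lemma mul_eadd:
  "\<lbrakk>el S a; el S a'; el S b; fst a = fst a'; dj a b\<rbrakk> \<Longrightarrow> (a \<boxplus> a') \<star> b = (a \<star> b) \<boxplus> (a' \<star> b)"
  "\<lbrakk>el S a; el S a'; el S b; fst a = fst a'; dj b a\<rbrakk> \<Longrightarrow> b \<star> (a \<boxplus> a') = (b \<star> a) \<boxplus> (b \<star> a')"
  by (simp_all add: mul_def eprod_eadd[of S _ _ S] dj_def)

lemma mul_ezero:
  "\<lbrakk>el S b; L \<inter> fst b = {}\<rbrakk> \<Longrightarrow> ezero S L \<star> b = ezero S (L \<union> fst b)"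
  "\<lbrakk>el S b; fst b \<inter> L = {}\<rbrakk> \<Longrightarrow> b \<star> ezero S L = ezero S (fst b \<union> L)"
  by (simp_all add: mul_def eprod_ezero[of S S] dj_def)

lemmas mul_ac = mul_assoc mul_comm mul_left_comm
lemmas eadd_ac = eadd_assoc[of S] eadd_comm[of S] eadd_left_comm[of S]

end

subsection \<open>Derivations\<close>

context free_cm
begin

text \<open>The Leibniz rule forces \<open>der_step Z \<beta> n\<close> to be the restriction to \<open>n\<close> generators of the
  derivation extending \<open>\<beta> : h \<otimes> Z \<rightarrow> S\<close>, where \<open>Z\<close> is an object of parameters.\<close>

primrec der_step :: "'o \<Rightarrow> 'm \<Rightarrow> nat \<Rightarrow> 'm" where
  "der_step Z \<beta> 0 = HZero C (\<I> \<otimes>\<^sub>o Z) S"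
| "der_step Z \<beta> (Suc n) =
     (\<mu> \<cdot> (gencl \<otimes>\<^sub>a der_step Z \<beta> n) \<cdot> \<alpha>\<^sub>a h (T\<^sub>h n) Z) +\<^sub>a
     (\<mu> \<cdot> (\<iota> n \<otimes>\<^sub>a \<beta>) \<cdot> swap_front C h (T\<^sub>h n) Z \<cdot> \<alpha>\<^sub>a h (T\<^sub>h n) Z)"

lemma der_step_arr [simp]:
  assumes "\<beta> \<in> Arr C" "Dom C \<beta> = h \<otimes>\<^sub>o Z" "Cod C \<beta> = S" "Z \<in> Obj C"
  shows "der_step Z \<beta> n \<in> Arr C" "Dom C (der_step Z \<beta> n) = T\<^sub>h n \<otimes>\<^sub>o Z" "Cod C (der_step Z \<beta> n) = S"
proof -
  have "der_step Z \<beta> n \<in> Arr C \<and> Dom C (der_step Z \<beta> n) = T\<^sub>h n \<otimes>\<^sub>o Z \<and> Cod C (der_step Z \<beta> n) = S"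
    using assms by (induction n) simp_all
  then show "der_step Z \<beta> n \<in> Arr C" "Dom C (der_step Z \<beta> n) = T\<^sub>h n \<otimes>\<^sub>o Z" "Cod C (der_step Z \<beta> n) = S"
    by blast+
qed

end

context fctx
begin

text \<open>Unrolled, this is the Leibniz sum in which each entry in turn is replaced by its value
  under \<open>\<beta>\<close> with parameter \<open>z\<close>. Being a function of lists, it allows
  symmetry to be proved by list induction.\<close>

primrec dl :: "'m \<Rightarrow> (nat set \<times> 'm) list \<Rightarrow> nat set \<times> 'm \<Rightarrow> nat set \<times> 'm" where
  "dl \<beta> [] z = ezero S (fst z)"
| "dl \<beta> (x # xs) z = (ap gencl x \<star> dl \<beta> xs z) \<boxplus> (mon xs \<star> ap \<beta> (x \<bowtie> z))"

lemma fst_dl [simp]: "fst (dl \<beta> xs z) = (\<Union>x \<in> set xs. fst x) \<union> fst z"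
  by (induction xs) auto

lemma dj_dl [simp]:
  "dj (dl \<beta> xs z) u \<longleftrightarrow> (\<forall>x \<in> set xs. dj x u) \<and> dj z u" "dj u (dl \<beta> xs z) \<longleftrightarrow> (\<forall>x \<in> set xs. dj u x) \<and> dj u z"
  by (auto simp: dj_def)

context
  fixes \<beta> Z
  assumes \<beta> [simp]: "\<beta> \<in> Arr C" "Dom C \<beta> = h \<otimes>\<^sub>o Z" "Cod C \<beta> = S" and Z [simp]: "Z \<in> Obj C"
begin

lemma el_dl [simp]: "\<lbrakk>hs xs; el Z z; \<forall>x \<in> set xs. dj x z\<rbrakk> \<Longrightarrow> el S (dl \<beta> xs z)"
proof (induction xs)
  case (Cons x xs)
  have "\<forall>y \<in> set xs. dj y x" using Cons.prems by (auto intro: dj_sym)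
  then show ?case using Cons by (simp add: fst_mon Un_ac)
qed simp

lemma ap_der_step:
  "\<lbrakk>hs xs; el Z z; \<forall>x \<in> set xs. dj x z\<rbrakk> \<Longrightarrow> ap (der_step Z \<beta> (length xs)) (tensE xs \<bowtie> z) = dl \<beta> xs z"
proof (induction xs)
  case (Cons x xs)
  have e: "el h x" "\<forall>y \<in> set xs. dj x y" "\<forall>y \<in> set xs. dj y x" "hs xs" "el Z z" "dj x z" "\<forall>x \<in> set xs. dj x z"
    using Cons.prems by (auto intro: dj_sym)
  then show ?case using Cons.IH by (simp add: mul_def)
qed simp

text \<open>Exchanging two adjacent entries exchanges the two summands in which one of them is
  differentiated; the third summand only needs commutativity of the product.\<close>

lemma dl_swap:
  assumes "hs (x # y # xs)" "el Z z" "\<forall>w \<in> set (x # y # xs). dj w z"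
  shows "dl \<beta> (x # y # xs) z = dl \<beta> (y # x # xs) z"
proof -
  let ?x = "ap gencl x" and ?y = "ap gencl y" and ?D = "dl \<beta> xs z" and ?m = "mon xs"
    and ?bx = "ap \<beta> (x \<bowtie> z)" and ?by = "ap \<beta> (y \<bowtie> z)"
  have e: "el h x" "el h y" "dj x y" "dj y x" "\<forall>w \<in> set xs. dj x w" "\<forall>w \<in> set xs. dj w x"
    "\<forall>w \<in> set xs. dj y w" "\<forall>w \<in> set xs. dj w y" "hs xs" "el Z z" "dj x z" "dj z x" "dj y z" "dj z y"
    "\<forall>w \<in> set xs. dj w z" "\<forall>w \<in> set xs. dj z w"
    using assms by (auto intro: dj_sym)
  have s: "el S ?x" "el S ?y" "el S ?D" "el S ?m" "el S ?bx" "el S ?by"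
    using e by simp_all
  have "dl \<beta> (x # y # xs) z = ?x \<star> ((?y \<star> ?D) \<boxplus> (?m \<star> ?by)) \<boxplus> (?y \<star> ?m) \<star> ?bx"
    using e mon_Cons[of y xs] by simp
  also have "\<dots> = (?x \<star> ?y \<star> ?D) \<boxplus> (?x \<star> ?m \<star> ?by) \<boxplus> (?y \<star> ?m \<star> ?bx)"
    using e s by (simp add: mul_eadd mul_assoc fst_mon Un_ac)
  also have "\<dots> = (?y \<star> ?x \<star> ?D) \<boxplus> (?y \<star> ?m \<star> ?bx) \<boxplus> (?x \<star> ?m \<star> ?by)"
    using e s by (simp add: mul_left_comm[of ?x ?y ?D] eadd_ac fst_mon Un_ac)
  also have "\<dots> = ?y \<star> ((?x \<star> ?D) \<boxplus> (?m \<star> ?bx)) \<boxplus> (?x \<star> ?m) \<star> ?by"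
    using e s by (simp add: mul_eadd mul_assoc fst_mon Un_ac)
  also have "\<dots> = dl \<beta> (y # x # xs) z"
    using e mon_Cons[of x xs] by simp
  finally show ?thesis .
qed

lemma dl_move:
  "\<lbrakk>hs (xs @ x # ys); el Z z; \<forall>w \<in> set (xs @ x # ys). dj w z\<rbrakk> \<Longrightarrow> dl \<beta> (xs @ x # ys) z = dl \<beta> (x # xs @ ys) z"
proof (induction xs)
  case (Cons v xs)
  have hs: "hs (xs @ x # ys)" "hs (v # x # xs @ ys)" "hs (x # xs @ ys)"
    using Cons.prems(1) by (auto intro: dj_sym)
  have "mon (xs @ x # ys) = mon (x # xs @ ys)" by (rule mon_mset[OF hs(1)]) simp
  then have "dl \<beta> ((v # xs) @ x # ys) z = dl \<beta> (v # x # xs @ ys) z"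
    using Cons hs by simp
  also have "\<dots> = dl \<beta> (x # v # xs @ ys) z"
    by (rule dl_swap[OF hs(2)]) (use Cons.prems in auto)
  finally show ?case by simp
qed simp

text \<open>The head of one list is moved to the front of the other by adjacent exchanges, and the
  tails are compared by induction. This is the invariance that lets the Leibniz sum descend to
  \<open>S\<close>.\<close>

lemma dl_mset:
  "\<lbrakk>hs xs; mset xs = mset ys; el Z z; \<forall>w \<in> set xs. dj w z\<rbrakk> \<Longrightarrow> dl \<beta> xs z = dl \<beta> ys z"
proof (induction xs arbitrary: ys)
  case (Cons x xs)
  then obtain ys1 ys2 where ys: "ys = ys1 @ x # ys2"
    by (metis list.set_intros(1) mset_eq_setD split_list)
  have m: "mset xs = mset (ys1 @ ys2)" using Cons.prems(2) ys by simp
  have hs: "hs ys" using hs_mset[OF Cons.prems(2,1)] .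
  have hxs: "hs xs" "\<forall>w \<in> set xs. dj w z" using Cons.prems by auto
  have s: "set ys = set (x # xs)" using mset_eq_setD[OF Cons.prems(2)] by simp
  have "dl \<beta> ys z = dl \<beta> (x # ys1 @ ys2) z"
    unfolding ys by (rule dl_move) (use hs s Cons.prems ys in auto)
  also have "\<dots> = dl \<beta> (x # xs) z"
    using Cons.IH[OF hxs(1) m Cons.prems(3) hxs(2)] mon_mset[OF hxs(1) m] by simp
  finally show ?case by simp
qed simp

text \<open>As concatenation is multiplication of monomials, this is the Leibniz rule for
  \<open>der\<close>, before it is stated on \<open>S\<close>.\<close>

lemma dl_append:
  assumes "hs (xs @ ys)" "el Z z" "\<forall>w \<in> set (xs @ ys). dj w z"
  shows "dl \<beta> (xs @ ys) z = (mon xs \<star> dl \<beta> ys z) \<boxplus> (dl \<beta> xs z \<star> mon ys)"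
  using assms
proof (induction xs)
  case Nil
  then have "fst z \<inter> fst (mon ys) = {}" "\<forall>w \<in> set ys. dj w z"
    by (auto simp: fst_mon dj_def)
  then show ?case using Nil by (simp add: mul_ezero fst_mon eadd_ezero Un_ac)
next
  case (Cons x xs)
  let ?x = "ap gencl x" and ?D = "dl \<beta> xs z" and ?D' = "dl \<beta> ys z" and ?m = "mon xs" and ?m' = "mon ys"
    and ?b = "ap \<beta> (x \<bowtie> z)"
  have e: "el h x" "\<forall>w \<in> set xs. dj x w" "\<forall>w \<in> set xs. dj w x" "\<forall>w \<in> set ys. dj x w" "\<forall>w \<in> set ys. dj w x"
    "hs xs" "hs ys" "\<forall>v \<in> set xs. \<forall>w \<in> set ys. dj v w" "\<forall>v \<in> set ys. \<forall>w \<in> set xs. dj v w" "el Z z" "dj x z" "dj z x"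
    "\<forall>w \<in> set xs. dj w z" "\<forall>w \<in> set xs. dj z w" "\<forall>w \<in> set ys. dj w z" "\<forall>w \<in> set ys. dj z w"
    using Cons.prems by (auto intro: dj_sym)
  have s: "el S ?x" "el S ?D" "el S ?D'" "el S ?m" "el S ?m'" "el S ?b"
    using e by simp_all
  have "dl \<beta> ((x # xs) @ ys) z = ?x \<star> ((?m \<star> ?D') \<boxplus> (?D \<star> ?m')) \<boxplus> (?m \<star> ?m') \<star> ?b"
    using Cons e by simp
  also have "\<dots> = ((?x \<star> ?m) \<star> ?D') \<boxplus> (((?x \<star> ?D) \<boxplus> (?m \<star> ?b)) \<star> ?m')"
    using e s by (simp add: mul_eadd mul_assoc fst_mon Un_ac eadd_assoc[of S] mul_comm[of ?m' ?b] del: mon_mul)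
  also have "?x \<star> ?m = mon (x # xs)" using e mon_Cons[of x xs] by simp
  finally show ?case by simp
qed

end

end

context free_cm
begin

lemma der_ex:
  assumes \<beta> [simp]: "\<beta> \<in> Arr C" "Dom C \<beta> = h \<otimes>\<^sub>o Z" "Cod C \<beta> = S" and Z [simp]: "Z \<in> Obj C"
  shows "\<exists>!D. D \<in> hom_set C (S \<otimes>\<^sub>o Z) S \<and> (\<forall>n. D \<cdot> (\<iota> n \<otimes>\<^sub>a id\<^sub>a Z) = der_step Z \<beta> n)"
proof (rule S_univ)
  fix n p
  assume p: "is_arrangement n p"
  show "der_step Z \<beta> n \<cdot> (tens_perm C (replicate n h) p \<otimes>\<^sub>a id\<^sub>a Z) = der_step Z \<beta> n" (is "?l = ?r")
  proof (rule ext_hZ)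
    fix \<Gamma> xs z
    assume a: "fctx C R h S \<iota> \<Gamma>" "fctx.hs C h \<Gamma> xs" "ctx.el C \<Gamma> Z z" "\<forall>x \<in> set xs. dj x z" "length xs = n"
    interpret G: fctx C R h S \<iota> \<Gamma> by (rule a(1))
    obtain xs' where xs': "ap (tens_perm C (replicate n h) p) (G.tensE xs) = G.tensE xs'" "mset xs' = mset xs"
      using G.ap_tens_perm_hs[OF a(2) p] a(5) by metis
    have hs': "G.hs xs'" "length xs' = n" "\<forall>x \<in> set xs'. dj x z"
      using G.hs_mset[OF xs'(2)[symmetric] a(2)] mset_eq_length[OF xs'(2)] mset_eq_setD[OF xs'(2)] a(4,5) by auto
    have "ap ?l (G.eprod (G.tensE xs) z) = G.dl \<beta> xs' z"
      using a(2-5) p xs'(1) hs' G.ap_der_step[of \<beta> Z xs' z] by simp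
    also have "\<dots> = ap ?r (G.eprod (G.tensE xs) z)"
      using a G.ap_der_step[of \<beta> Z xs z] G.dl_mset[of \<beta> Z xs xs' z] xs'(2) by simp
    finally show "ap ?l (G.eprod (G.tensE xs) z) = ap ?r (G.eprod (G.tensE xs) z)" .
  qed (use p in simp_all)
qed (simp_all add: hom_set_def)

definition der :: "'o \<Rightarrow> 'm \<Rightarrow> 'm" where
  "der Z \<beta> = (THE D. D \<in> hom_set C (S \<otimes>\<^sub>o Z) S \<and> (\<forall>n. D \<cdot> (\<iota> n \<otimes>\<^sub>a id\<^sub>a Z) = der_step Z \<beta> n))"

context
  fixes \<beta> Z
  assumes \<beta> [simp]: "\<beta> \<in> Arr C" "Dom C \<beta> = h \<otimes>\<^sub>o Z" "Cod C \<beta> = S" and Z [simp]: "Z \<in> Obj C"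
begin

lemma der_arr [simp]: "der Z \<beta> \<in> Arr C" "Dom C (der Z \<beta>) = S \<otimes>\<^sub>o Z" "Cod C (der Z \<beta>) = S"
  and der_\<iota>: "der Z \<beta> \<cdot> (\<iota> n \<otimes>\<^sub>a id\<^sub>a Z) = der_step Z \<beta> n"
  using theI'[OF der_ex[OF \<beta> Z], folded der_def] by (auto simp: hom_set_def)

end

end

context fctx
begin

context
  fixes \<beta> Z
  assumes \<beta> [simp]: "\<beta> \<in> Arr C" "Dom C \<beta> = h \<otimes>\<^sub>o Z" "Cod C \<beta> = S" and Z [simp]: "Z \<in> Obj C"
begin

lemma ap_der_mon:
  assumes "hs xs" "el Z z" "\<forall>x \<in> set xs. dj x z"
  shows "ap (der Z \<beta>) (mon xs \<bowtie> z) = dl \<beta> xs z"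
proof -
  have "ap (der Z \<beta> \<cdot> (\<iota> (length xs) \<otimes>\<^sub>a id\<^sub>a Z)) (tensE xs \<bowtie> z) = dl \<beta> xs z"
    using assms by (simp add: der_\<iota> ap_der_step del: ap_Comp)
  then show ?thesis using assms by simp
qed

lemma ap_der_gencl:
  assumes "el h x" "el Z z" "dj x z"
  shows "ap (der Z \<beta>) (ap gencl x \<bowtie> z) = ap \<beta> (x \<bowtie> z)"
  using ap_der_mon[of "[x]" z] assms
  by (simp add: ap_gencl mul_ezero eadd_ezero dj_def fst_mon)

end

end

context free_cm
begin

lemma der_mult:
  assumes \<beta> [simp]: "\<beta> \<in> Arr C" "Dom C \<beta> = h \<otimes>\<^sub>o Z" "Cod C \<beta> = S" and Z [simp]: "Z \<in> Obj C"
  defines "D \<equiv> der Z \<beta>"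
  shows "D \<cdot> (\<mu> \<otimes>\<^sub>a id\<^sub>a Z) \<cdot> inv\<^sub>a (\<alpha>\<^sub>a S S Z) =
    (\<mu> \<cdot> (id\<^sub>a S \<otimes>\<^sub>a D)) +\<^sub>a (\<mu> \<cdot> (D \<otimes>\<^sub>a id\<^sub>a S) \<cdot> inv\<^sub>a (\<alpha>\<^sub>a S Z S) \<cdot> (id\<^sub>a S \<otimes>\<^sub>a \<sigma>\<^sub>a S Z))" (is "?f = ?g")
proof -
  have D [simp]: "D \<in> Arr C" "Dom C D = S \<otimes>\<^sub>o Z" "Cod C D = S" by (simp_all add: D_def)
  show ?thesis
  proof (rule S_ext3[where Z = Z])
    fix m n
    show "?f \<cdot> (\<iota> m \<otimes>\<^sub>a \<iota> n \<otimes>\<^sub>a id\<^sub>a Z) = ?g \<cdot> (\<iota> m \<otimes>\<^sub>a \<iota> n \<otimes>\<^sub>a id\<^sub>a Z)" (is "?l = ?r")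
    proof (rule ext_hhZ)
      fix \<Gamma> xs ys z
      assume a: "fctx C R h S \<iota> \<Gamma>" "fctx.hs C h \<Gamma> (xs @ ys)" "ctx.el C \<Gamma> Z z"
        "\<forall>x \<in> set (xs @ ys). dj x z" "length xs = m" "length ys = n"
      interpret G: fctx C R h S \<iota> \<Gamma> by (rule a(1))
      have hs: "G.hs xs" "G.hs ys" "\<forall>x \<in> set xs. \<forall>y \<in> set ys. dj x y" "\<forall>x \<in> set xs. dj x z" "\<forall>y \<in> set ys. dj y z" "\<forall>y \<in> set ys. dj z y"
        using a(2,4) by (auto intro: dj_sym)
      have d: "ap D (G.eprod (G.mon xs) z) = G.dl \<beta> xs z" "ap D (G.eprod (G.mon ys) z) = G.dl \<beta> ys z"
        "ap D (G.eprod (G.mon (xs @ ys)) z) = G.dl \<beta> (xs @ ys) z"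
        unfolding D_def by (rule G.ap_der_mon; use hs a in auto)+
      show "ap ?l (G.eprod (G.tensE xs) (G.eprod (G.tensE ys) z)) = ap ?r (G.eprod (G.tensE xs) (G.eprod (G.tensE ys) z))"
        using hs a(3,5,6) G.dl_append[of \<beta> Z xs ys z] a(2,4) d
        by (simp add: G.mul_def[symmetric] Un_ac)
    qed simp_all
  qed simp_all
qed

end

context fctx
begin

lemma ap_der_mul:
  assumes \<beta> [simp]: "\<beta> \<in> Arr C" "Dom C \<beta> = h \<otimes>\<^sub>o Z" "Cod C \<beta> = S" and Z [simp]: "Z \<in> Obj C"
    and e: "el S s" "el S t" "el Z z" "dj s t" "dj s z" "dj t z"
  shows "ap (der Z \<beta>) ((s \<star> t) \<bowtie> z) = (s \<star> ap (der Z \<beta>) (t \<bowtie> z)) \<boxplus> (ap (der Z \<beta>) (s \<bowtie> z) \<star> t)"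
proof -
  have "ap (der Z \<beta> \<cdot> (\<mu> \<otimes>\<^sub>a id\<^sub>a Z) \<cdot> inv\<^sub>a (\<alpha>\<^sub>a S S Z)) (s \<bowtie> t \<bowtie> z) = ap ((\<mu> \<cdot> (id\<^sub>a S \<otimes>\<^sub>a der Z \<beta>)) +\<^sub>a
      (\<mu> \<cdot> (der Z \<beta> \<otimes>\<^sub>a id\<^sub>a S) \<cdot> inv\<^sub>a (\<alpha>\<^sub>a S Z S) \<cdot> (id\<^sub>a S \<otimes>\<^sub>a \<sigma>\<^sub>a S Z))) (s \<bowtie> t \<bowtie> z)"
    by (simp only: der_mult[OF \<beta> Z])
  then show ?thesis using e by (simp add: mul_def dj_sym)
qed

end

subsection \<open>Bi-derivations\<close>

context symmetric_monoidal_category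
begin

lemma ext_el3:
  assumes eq: "\<And>\<Gamma> a b c. \<lbrakk>ctx C \<Gamma>; ctx.el C \<Gamma> A a; ctx.el C \<Gamma> B b; ctx.el C \<Gamma> D c; dj a b; dj a c; dj b c\<rbrakk>
      \<Longrightarrow> ap f (ctx.eprod C \<Gamma> a (ctx.eprod C \<Gamma> b c)) = ap g (ctx.eprod C \<Gamma> a (ctx.eprod C \<Gamma> b c))"
    and f: "f \<in> Arr C" "g \<in> Arr C" "Dom C f = A \<otimes>\<^sub>o B \<otimes>\<^sub>o D" "Dom C g = A \<otimes>\<^sub>o B \<otimes>\<^sub>o D"
    and [simp]: "A \<in> Obj C" "B \<in> Obj C" "D \<in> Obj C"
  shows "f = g"
proof -
  let ?k = "id\<^sub>a A \<otimes>\<^sub>a id\<^sub>a B \<otimes>\<^sub>a \<rho>\<^sub>u D"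
  have "f \<cdot> ?k = g \<cdot> ?k"
  proof (rule ext_tens[where Xs = "[A, B, D]"])
    fix \<Gamma> as
    assume a: "ctx C \<Gamma>" "ctx.els C \<Gamma> [A, B, D] as"
    interpret G: ctx C \<Gamma> by (rule a(1))
    obtain x y z where "as = [x, y, z]" "G.el A x" "G.el B y" "G.el D z" "dj x y" "dj x z" "dj y z"
      using a(2) by (auto simp: G.els_Cons)
    then show "ap (f \<cdot> ?k) (G.tensE as) = ap (g \<cdot> ?k) (G.tensE as)"
      using eq[OF a(1), of x y z] f by simp
  qed (use f in simp_all)
  then show ?thesis by (rule iso_cancel_right) (use f in simp_all)
qed

lemma ext_el2:
  assumes eq: "\<And>\<Gamma> a b. \<lbrakk>ctx C \<Gamma>; ctx.el C \<Gamma> A a; ctx.el C \<Gamma> B b; dj a b\<rbrakk>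
      \<Longrightarrow> ap f (ctx.eprod C \<Gamma> a b) = ap g (ctx.eprod C \<Gamma> a b)"
    and f: "f \<in> Arr C" "g \<in> Arr C" "Dom C f = A \<otimes>\<^sub>o B" "Dom C g = A \<otimes>\<^sub>o B"
    and [simp]: "A \<in> Obj C" "B \<in> Obj C"
  shows "f = g"
proof -
  let ?k = "id\<^sub>a A \<otimes>\<^sub>a \<rho>\<^sub>u B"
  have "f \<cdot> ?k = g \<cdot> ?k"
  proof (rule ext_tens[where Xs = "[A, B]"])
    fix \<Gamma> as
    assume a: "ctx C \<Gamma>" "ctx.els C \<Gamma> [A, B] as"
    interpret G: ctx C \<Gamma> by (rule a(1))
    obtain x y where "as = [x, y]" "G.el A x" "G.el B y" "dj x y"
      using a(2) by (auto simp: G.els_Cons)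
    then show "ap (f \<cdot> ?k) (G.tensE as) = ap (g \<cdot> ?k) (G.tensE as)"
      using eq[OF a(1), of x y] f by simp
  qed (use f in simp_all)
  then show ?thesis by (rule iso_cancel_right) (use f in simp_all)
qed

end

context fctx
begin

context
  fixes \<beta>
  assumes \<beta> [simp]: "\<beta> \<in> Arr C" "Dom C \<beta> = h \<otimes>\<^sub>o h" "Cod C \<beta> = S"
begin

private abbreviation (input) "\<beta>' \<equiv> der h \<beta> \<cdot> \<sigma>\<^sub>a h S"

text \<open>The arrow \<open>\<beta>'\<close> is already a derivation in its argument from
  \<open>S\<close>, which is the parameter of the outer derivation. Differentiating in the first
  argument preserves this property, so the result is a derivation in both.\<close>

lemma dl_mult_right:
  "\<lbrakk>hs xs; el S t; el S u; dj t u; \<forall>x \<in> set xs. dj x t; \<forall>x \<in> set xs. dj x u\<rbrakk>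
    \<Longrightarrow> dl \<beta>' xs (t \<star> u) = (dl \<beta>' xs t \<star> u) \<boxplus> (t \<star> dl \<beta>' xs u)"
proof (induction xs)
  case Nil
  then show ?case by (simp add: mul_ezero dj_def Int_commute eadd_ezero)
next
  case (Cons x xs)
  let ?x = "ap gencl x" and ?m = "mon xs"
  let ?Dt = "dl \<beta>' xs t" and ?Du = "dl \<beta>' xs u" and ?bt = "ap (der h \<beta>) (t \<bowtie> x)" and ?bu = "ap (der h \<beta>) (u \<bowtie> x)"
  have e: "el h x" "\<forall>w \<in> set xs. dj x w" "\<forall>w \<in> set xs. dj w x" "hs xs" "el S t" "el S u" "dj t u" "dj u t"
    "dj x t" "dj t x" "dj x u" "dj u x"
    "\<forall>w \<in> set xs. dj w t" "\<forall>w \<in> set xs. dj t w" "\<forall>w \<in> set xs. dj w u" "\<forall>w \<in> set xs. dj u w"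
    using Cons.prems by (auto intro: dj_sym)
  have s: "el S ?x" "el S ?Dt" "el S ?Du" "el S ?m" "el S ?bt" "el S ?bu"
    using e el_dl[of \<beta>' S xs] by (simp_all add: dj_sym)
  have "dl \<beta>' (x # xs) (t \<star> u) = ?x \<star> ((?Dt \<star> u) \<boxplus> (t \<star> ?Du)) \<boxplus> ?m \<star> ((t \<star> ?bu) \<boxplus> (?bt \<star> u))"
    using e Cons by (simp add: ap_der_mul)
  also have "\<dots> = (((?x \<star> ?Dt) \<boxplus> (?m \<star> ?bt)) \<star> u) \<boxplus> (t \<star> ((?x \<star> ?Du) \<boxplus> (?m \<star> ?bu)))"
    using e s by (simp add: mul_eadd mul_assoc eadd_ac fst_mon Un_ac mul_left_comm[of ?x t] mul_left_comm[of ?m t])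
  also have "\<dots> = (dl \<beta>' (x # xs) t \<star> u) \<boxplus> (t \<star> dl \<beta>' (x # xs) u)"
    using e by simp
  finally show ?case .
qed

lemma dl_unit_right:
  "\<lbrakk>hs xs; el \<I> z; \<forall>x \<in> set xs. dj x z\<rbrakk> \<Longrightarrow> dl \<beta>' xs (ap (free_unit \<iota>) z) = ezero S ((\<Union>x \<in> set xs. fst x) \<union> fst z)"
proof (induction xs)
  case (Cons x xs)
  have e: "el h x" "\<forall>w \<in> set xs. dj x w" "\<forall>w \<in> set xs. dj w x" "hs xs" "el \<I> z" "dj x z" "dj z x"
    "\<forall>w \<in> set xs. dj w z" "\<forall>w \<in> set xs. dj z w"
    using Cons.prems by (auto intro: dj_sym)
  \<comment> \<open>The unit of \<open>S\<close> is the restriction to zero generators, where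
    \<open>der_step\<close> is a zero arrow by definition.\<close>
  have "ap (der h \<beta> \<cdot> (\<iota> 0 \<otimes>\<^sub>a id\<^sub>a h)) (z \<bowtie> x) = ezero S (fst z \<union> fst x)"
    using e by (simp add: der_\<iota> del: ap_Comp)
  then have *: "ap (der h \<beta>) (ap (free_unit \<iota>) z \<bowtie> x) = ezero S (fst z \<union> fst x)"
    using e \<iota>_arr[of 0] by (simp add: free_unit_def)
  have d: "fst x \<inter> ((\<Union>x \<in> set xs. fst x) \<union> fst z) = {}" "(\<Union>x \<in> set xs. fst x) \<inter> (fst z \<union> fst x) = {}"
    using e by (auto simp: dj_def)
  show ?case
    using Cons.IH e d by (simp add: * mul_ezero fst_mon eadd_ezero Un_ac)
qed simp

end

end

context free_cm
begin

text \<open>Extends \<open>\<beta>\<close> first in its second argument, with parameter in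
  \<open>h\<close>, then in its first, with parameter in \<open>S\<close>. The symmetries are there
  because \<open>der\<close> always acts on the left factor.\<close>

definition bider :: "'m \<Rightarrow> 'm" where
  "bider \<beta> = der S (der h (\<beta> \<cdot> \<sigma>\<^sub>a h h) \<cdot> \<sigma>\<^sub>a h S)"

lemma bi_derivation_bider:
  assumes \<beta> [simp]: "\<beta> \<in> Arr C" "Dom C \<beta> = h \<otimes>\<^sub>o h" "Cod C \<beta> = S"
  shows "bi_derivation C S \<mu> (free_unit \<iota>) (bider \<beta>)" "bider \<beta> \<cdot> (gencl \<otimes>\<^sub>a gencl) = \<beta>"
proof -
  let ?d = "bider \<beta>" and ?\<beta>' = "der h (\<beta> \<cdot> \<sigma>\<^sub>a h h) \<cdot> \<sigma>\<^sub>a h S"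
  have d [simp]: "?d \<in> Arr C" "Dom C ?d = S \<otimes>\<^sub>o S" "Cod C ?d = S"
    by (simp_all add: bider_def)
  have "(?d \<cdot> (\<mu> \<otimes>\<^sub>a id\<^sub>a S) \<cdot> inv\<^sub>a (\<alpha>\<^sub>a S S S)) \<cdot> \<alpha>\<^sub>a S S S =
      ((\<mu> \<cdot> (id\<^sub>a S \<otimes>\<^sub>a ?d)) +\<^sub>a (\<mu> \<cdot> (?d \<otimes>\<^sub>a id\<^sub>a S) \<cdot> inv\<^sub>a (\<alpha>\<^sub>a S S S) \<cdot> (id\<^sub>a S \<otimes>\<^sub>a \<sigma>\<^sub>a S S))) \<cdot> \<alpha>\<^sub>a S S S"
    using der_mult[of ?\<beta>' S] by (simp only: bider_def) simp
  then have 1: "?d \<cdot> (\<mu> \<otimes>\<^sub>a id\<^sub>a S) = (\<mu> \<cdot> (id\<^sub>a S \<otimes>\<^sub>a ?d) \<cdot> \<alpha>\<^sub>a S S S) +\<^sub>a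
       (\<mu> \<cdot> (?d \<otimes>\<^sub>a id\<^sub>a S) \<cdot> inv\<^sub>a (\<alpha>\<^sub>a S S S) \<cdot> (id\<^sub>a S \<otimes>\<^sub>a \<sigma>\<^sub>a S S) \<cdot> \<alpha>\<^sub>a S S S)"
    by simp
  have 2: "?d \<cdot> (id\<^sub>a S \<otimes>\<^sub>a \<mu>) = (\<mu> \<cdot> (?d \<otimes>\<^sub>a id\<^sub>a S) \<cdot> inv\<^sub>a (\<alpha>\<^sub>a S S S)) +\<^sub>a
       (\<mu> \<cdot> (id\<^sub>a S \<otimes>\<^sub>a ?d) \<cdot> \<alpha>\<^sub>a S S S \<cdot> (\<sigma>\<^sub>a S S \<otimes>\<^sub>a id\<^sub>a S) \<cdot> inv\<^sub>a (\<alpha>\<^sub>a S S S))" (is "?f = ?g")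
  proof (rule S_ext3[where Z = S])
    fix m n
    show "?f \<cdot> (\<iota> m \<otimes>\<^sub>a \<iota> n \<otimes>\<^sub>a id\<^sub>a S) = ?g \<cdot> (\<iota> m \<otimes>\<^sub>a \<iota> n \<otimes>\<^sub>a id\<^sub>a S)" (is "?l = ?r")
    proof (rule ext_hhZ)
      fix \<Gamma> xs ys z
      assume a: "fctx C R h S \<iota> \<Gamma>" "fctx.hs C h \<Gamma> (xs @ ys)" "ctx.el C \<Gamma> S z"
        "\<forall>x \<in> set (xs @ ys). dj x z" "length xs = m" "length ys = n"
      interpret G: fctx C R h S \<iota> \<Gamma> by (rule a(1))
      have hs: "G.hs xs" "G.hs ys" "\<forall>x \<in> set xs. \<forall>y \<in> set ys. dj x y" "\<forall>x \<in> set xs. \<forall>y \<in> set ys. dj y x"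
        "\<forall>x \<in> set xs. dj x z" "\<forall>y \<in> set ys. dj y z"
        using a(2,4) by (auto intro: dj_sym)
      have ap: "ap ?d (G.eprod (G.mon xs) w) = G.dl ?\<beta>' xs w" if "G.el S w" "\<forall>x \<in> set xs. dj x w" for w
        unfolding bider_def by (rule G.ap_der_mon) (use hs that in simp_all)
      show "ap ?l (G.eprod (G.tensE xs) (G.eprod (G.tensE ys) z)) = ap ?r (G.eprod (G.tensE xs) (G.eprod (G.tensE ys) z))"
        using hs a(3,5,6) G.dl_mult_right[of "\<beta> \<cdot> \<sigma>\<^sub>a h h" xs "G.mon ys" z] ap
        by (simp add: G.mul_def[symmetric] dj_sym ball_Un)
    qed simp_all
  qed simp_all
  have 3: "?d \<cdot> (free_unit \<iota> \<otimes>\<^sub>a id\<^sub>a S) = HZero C (\<I> \<otimes>\<^sub>o S) S"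
    using der_\<iota>[of ?\<beta>' S 0] by (simp add: bider_def free_unit_def)
  have 4: "?d \<cdot> (id\<^sub>a S \<otimes>\<^sub>a free_unit \<iota>) = HZero C (S \<otimes>\<^sub>o \<I>) S" (is "?f = ?g")
  proof (rule S_ext[where Z = \<I>])
    fix n
    show "?f \<cdot> (\<iota> n \<otimes>\<^sub>a id\<^sub>a \<I>) = ?g \<cdot> (\<iota> n \<otimes>\<^sub>a id\<^sub>a \<I>)" (is "?l = ?r")
    proof (rule ext_hZ)
      fix \<Gamma> xs z
      assume a: "fctx C R h S \<iota> \<Gamma>" "fctx.hs C h \<Gamma> xs" "ctx.el C \<Gamma> \<I> z" "\<forall>x \<in> set xs. dj x z" "length xs = n"
      interpret G: fctx C R h S \<iota> \<Gamma> by (rule a(1))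
      have "ap ?d (G.eprod (G.mon xs) (ap (free_unit \<iota>) z)) = G.dl ?\<beta>' xs (ap (free_unit \<iota>) z)"
        unfolding bider_def by (rule G.ap_der_mon) (use a in simp_all)
      then show "ap ?l (G.eprod (G.tensE xs) z) = ap ?r (G.eprod (G.tensE xs) z)"
        using a(2-5) G.dl_unit_right[of "\<beta> \<cdot> \<sigma>\<^sub>a h h" xs z] by (simp add: G.fst_tensE)
    qed simp_all
  qed simp_all
  show "bi_derivation C S \<mu> (free_unit \<iota>) ?d"
    unfolding bi_derivation_def using 1 2 3 4 by (auto intro: hom_setI)
  show "?d \<cdot> (gencl \<otimes>\<^sub>a gencl) = \<beta>"
  proof (rule ext_el2)
    fix \<Gamma> x y
    assume a: "ctx C \<Gamma>" "ctx.el C \<Gamma> h x" "ctx.el C \<Gamma> h y" "dj x y"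
    interpret G: fctx C R h S \<iota> \<Gamma> by (rule fctxI[OF a(1)])
    have "dj y x" using a(4) by (rule dj_sym)
    then show "ap (?d \<cdot> (gencl \<otimes>\<^sub>a gencl)) (G.eprod x y) = ap \<beta> (G.eprod x y)"
      using a(2-4) by (simp add: bider_def G.ap_der_gencl)
  qed simp_all
qed

lemma bi_derivation_arr:
  assumes "bi_derivation C S \<mu> (free_unit \<iota>) d"
  shows "d \<in> Arr C" "Dom C d = S \<otimes>\<^sub>o S" "Cod C d = S"
  using assms by (auto simp: bi_derivation_def hom_set_def)

end

section \<open>Element calculus of a fixed bi-derivation\<close>

locale bctx = fctx C R h S \<iota> \<Gamma>
  for C :: "('r, 'o, 'm, 'x) lsmcat_scheme" (structure) and R :: "('r, 'y) ring_scheme"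
    and h S \<iota> \<Gamma> +
  fixes d
  assumes bider: "bi_derivation C S \<mu> (free_unit \<iota>) d"
begin

lemma d_arr [simp]: "d \<in> Arr C" "Dom C d = S \<otimes>\<^sub>o S" "Cod C d = S"
  using bi_derivation_arr[OF bider] .

definition br :: "nat set \<times> 'm \<Rightarrow> nat set \<times> 'm \<Rightarrow> nat set \<times> 'm" where
  "br s t = ap d (s \<bowtie> t)"

lemma el_br [simp]: "\<lbrakk>el S s; el S t; dj s t\<rbrakk> \<Longrightarrow> el S (br s t)"
  by (simp add: br_def)

lemma fst_br [simp]: "fst (br s t) = fst s \<union> fst t"
  by (simp add: br_def)

lemma dj_br [simp]: "dj (br s t) u \<longleftrightarrow> dj s u \<and> dj t u" "dj u (br s t) \<longleftrightarrow> dj u s \<and> dj u t"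
  by (simp_all add: br_def)

lemma br_mul_left:
  assumes "el S s" "el S t" "el S u" "dj s t" "dj s u" "dj t u"
  shows "br (s \<star> t) u = (s \<star> br t u) \<boxplus> (br s u \<star> t)"
proof -
  have "ap (d \<cdot> (\<mu> \<otimes>\<^sub>a id\<^sub>a S)) ((s \<bowtie> t) \<bowtie> u) = ap ((\<mu> \<cdot> (id\<^sub>a S \<otimes>\<^sub>a d) \<cdot> \<alpha>\<^sub>a S S S) +\<^sub>a
       (\<mu> \<cdot> (d \<otimes>\<^sub>a id\<^sub>a S) \<cdot> inv\<^sub>a (\<alpha>\<^sub>a S S S) \<cdot> (id\<^sub>a S \<otimes>\<^sub>a \<sigma>\<^sub>a S S) \<cdot> \<alpha>\<^sub>a S S S)) ((s \<bowtie> t) \<bowtie> u)"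
    using bider unfolding bi_derivation_def by simp
  then show ?thesis using assms by (simp add: mul_def br_def dj_sym)
qed

lemma br_mul_right:
  assumes "el S s" "el S t" "el S u" "dj s t" "dj s u" "dj t u"
  shows "br s (t \<star> u) = (br s t \<star> u) \<boxplus> (t \<star> br s u)"
proof -
  have "ap (d \<cdot> (id\<^sub>a S \<otimes>\<^sub>a \<mu>)) (s \<bowtie> t \<bowtie> u) = ap ((\<mu> \<cdot> (d \<otimes>\<^sub>a id\<^sub>a S) \<cdot> inv\<^sub>a (\<alpha>\<^sub>a S S S)) +\<^sub>a
       (\<mu> \<cdot> (id\<^sub>a S \<otimes>\<^sub>a d) \<cdot> \<alpha>\<^sub>a S S S \<cdot> (\<sigma>\<^sub>a S S \<otimes>\<^sub>a id\<^sub>a S) \<cdot> inv\<^sub>a (\<alpha>\<^sub>a S S S))) (s \<bowtie> t \<bowtie> u)"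
    using bider unfolding bi_derivation_def by simp
  then show ?thesis using assms by (simp add: mul_def br_def dj_sym)
qed

lemma br_mon_Nil [simp]:
  assumes "el S s"
  shows "br (mon []) s = ezero S (fst s)" "br s (mon []) = ezero S (fst s)"
proof -
  have "ap (d \<cdot> (free_unit \<iota> \<otimes>\<^sub>a id\<^sub>a S)) (eunit \<bowtie> s) = ap (HZero C (\<I> \<otimes>\<^sub>o S) S) (eunit \<bowtie> s)"
    "ap (d \<cdot> (id\<^sub>a S \<otimes>\<^sub>a free_unit \<iota>)) (s \<bowtie> eunit) = ap (HZero C (S \<otimes>\<^sub>o \<I>) S) (s \<bowtie> eunit)"
    using bider unfolding bi_derivation_def by simp_all
  then show "br (mon []) s = ezero S (fst s)" "br s (mon []) = ezero S (fst s)"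
    using assms by (simp_all add: br_def ap_free_unit)
qed

lemma br_eadd:
  "\<lbrakk>el S a; el S a'; el S b; fst a = fst a'; dj a b\<rbrakk> \<Longrightarrow> br (a \<boxplus> a') b = br a b \<boxplus> br a' b"
  "\<lbrakk>el S a; el S a'; el S b; fst a = fst a'; dj b a\<rbrakk> \<Longrightarrow> br b (a \<boxplus> a') = br b a \<boxplus> br b a'"
  by (simp_all add: br_def eprod_eadd[of S _ _ S] dj_def)

lemma br_ezero:
  "\<lbrakk>el S b; L \<inter> fst b = {}\<rbrakk> \<Longrightarrow> br (ezero S L) b = ezero S (L \<union> fst b)"
  "\<lbrakk>el S b; fst b \<inter> L = {}\<rbrakk> \<Longrightarrow> br b (ezero S L) = ezero S (fst b \<union> L)"
  by (simp_all add: br_def eprod_ezero[of S S] dj_def)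

end

context free_cm
begin

lemma bctxI: "\<lbrakk>ctx C \<Gamma>; bi_derivation C S \<mu> (free_unit \<iota>) d\<rbrakk> \<Longrightarrow> bctx C R h S \<iota> \<Gamma> d"
  by (simp add: bctx_def bctx_axioms_def fctxI)

text \<open>The Leibniz rules determine the value on a pair of monomials from the values on pairs of
  generators, first by induction on the second list and then on the first. Monomials are jointly
  epic.\<close>

lemma bi_derivation_unique:
  assumes d: "bi_derivation C S \<mu> (free_unit \<iota>) d" "bi_derivation C S \<mu> (free_unit \<iota>) d'"
    and eq: "d \<cdot> (gencl \<otimes>\<^sub>a gencl) = d' \<cdot> (gencl \<otimes>\<^sub>a gencl)"
  shows "d = d'"
proof (rule S_ext2)
  note [simp] = bi_derivation_arr[OF d(1)] bi_derivation_arr[OF d(2)]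
  fix m n
  show "d \<cdot> (\<iota> m \<otimes>\<^sub>a \<iota> n) = d' \<cdot> (\<iota> m \<otimes>\<^sub>a \<iota> n)" (is "?l = ?r")
  proof (rule ext_hh)
    fix \<Gamma> xs ys
    assume a: "fctx C R h S \<iota> \<Gamma>" "fctx.hs C h \<Gamma> (xs @ ys)" "length xs = m" "length ys = n"
    interpret G: fctx C R h S \<iota> \<Gamma> by (rule a(1))
    interpret D: bctx C R h S \<iota> \<Gamma> d by (rule bctxI[OF G.ctx_axioms d(1)])
    interpret D': bctx C R h S \<iota> \<Gamma> d' by (rule bctxI[OF G.ctx_axioms d(2)])
    have gg: "D.br (ap gencl x) (ap gencl y) = D'.br (ap gencl x) (ap gencl y)" if "G.el h x" "G.el h y" "dj x y" for x y
    proof -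
      have "ap (d \<cdot> (gencl \<otimes>\<^sub>a gencl)) (G.eprod x y) = ap (d' \<cdot> (gencl \<otimes>\<^sub>a gencl)) (G.eprod x y)"
        by (simp only: eq)
      then show ?thesis using that by (simp add: D.br_def D'.br_def)
    qed
    have gm: "D.br (ap gencl x) (G.mon zs) = D'.br (ap gencl x) (G.mon zs)"
      if "G.hs zs" "G.el h x" "\<forall>z \<in> set zs. dj x z" for x zs
      using that
    proof (induction zs)
      case (Cons z zs)
      then show ?case using gg[of x z] by (simp add: G.mon_Cons D.br_mul_right D'.br_mul_right)
    qed simp
    have "D.br (G.mon ws) (G.mon zs) = D'.br (G.mon ws) (G.mon zs)"
      if "G.hs ws" "G.hs zs" "\<forall>w \<in> set ws. \<forall>z \<in> set zs. dj w z" for ws zs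
      using that
    proof (induction ws)
      case (Cons w ws)
      then show ?case using gm[of zs w] by (simp add: G.mon_Cons D.br_mul_left D'.br_mul_left)
    qed simp
    then have "D.br (G.mon xs) (G.mon ys) = D'.br (G.mon xs) (G.mon ys)"
      using a(2) by simp
    then show "ap ?l (G.eprod (G.tensE xs) (G.tensE ys)) = ap ?r (G.eprod (G.tensE xs) (G.tensE ys))"
      using a(2-4) by (simp add: D.br_def D'.br_def)
  qed simp_all
qed (use bi_derivation_arr[OF d(1)] bi_derivation_arr[OF d(2)] in simp_all)

end

subsection \<open>Antisymmetry and the Jacobi identity\<close>

context bctx
begin

text \<open>Formulated as a vanishing sum, so that the Leibniz rule and additivity carry it through
  products without negatives.\<close>

definition anti :: "nat set \<times> 'm \<Rightarrow> nat set \<times> 'm \<Rightarrow> bool" where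
  "anti s t \<longleftrightarrow> br s t \<boxplus> br t s = ezero S (fst s \<union> fst t)"

lemma anti_sym:
  assumes "anti s t" "el S s" "el S t" "dj s t"
  shows "anti t s"
proof -
  have "br t s \<boxplus> br s t = br s t \<boxplus> br t s"
    by (rule eadd_comm[of S]) (use assms in \<open>simp_all add: dj_sym Un_ac\<close>)
  then show ?thesis using assms(1) by (simp add: anti_def Un_ac)
qed

lemma anti_mul:
  assumes "anti s u" "anti t u" "el S s" "el S t" "el S u" "dj s t" "dj s u" "dj t u"
  shows "anti (s \<star> t) u"
proof -
  note e [simp] = assms(3-8) assms(6-8)[THEN dj_sym]
  have d: "fst s \<inter> (fst t \<union> fst u) = {}" "(fst s \<union> fst u) \<inter> fst t = {}"
    using assms(6-8) by (auto simp: dj_def)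
  have "br (s \<star> t) u \<boxplus> br u (s \<star> t) = ((s \<star> br t u) \<boxplus> (br s u \<star> t)) \<boxplus> ((br u s \<star> t) \<boxplus> (s \<star> br u t))"
    by (simp add: br_mul_left br_mul_right)
  also have "\<dots> = (s \<star> (br t u \<boxplus> br u t)) \<boxplus> ((br s u \<boxplus> br u s) \<star> t)"
    by (simp add: mul_eadd Un_ac eadd_ac)
  also have "\<dots> = ezero S (fst (s \<star> t) \<union> fst u)"
    using assms(1,2) d by (simp add: anti_def mul_ezero eadd_ezero Un_ac)
  finally show ?thesis by (simp add: anti_def)
qed

lemma anti_mon:
  "\<lbrakk>hs xs; el S u; \<forall>x \<in> set xs. dj x u; \<forall>x \<in> set xs. anti (ap gencl x) u\<rbrakk> \<Longrightarrow> anti (mon xs) u"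
proof (induction xs)
  case Nil
  then show ?case by (simp add: anti_def eadd_ezero fst_mon)
next
  case (Cons x xs)
  then show ?case by (simp add: mon_Cons anti_mul)
qed

text \<open>On elements \<open>cyclic_perm\<close> takes s, t, u to t, u, s; hence the order of the
  arguments in the three terms.\<close>

definition jac :: "nat set \<times> 'm \<Rightarrow> nat set \<times> 'm \<Rightarrow> nat set \<times> 'm \<Rightarrow> nat set \<times> 'm" where
  "jac s t u = br s (br t u) \<boxplus> br t (br u s) \<boxplus> br u (br s t)"

lemma jac_rotate:
  assumes "el S s" "el S t" "el S u" "dj s t" "dj s u" "dj t u"
  shows "jac s t u = jac t u s"
  using assms assms(4-6)[THEN dj_sym] by (simp add: jac_def eadd_ac Un_ac)

lemma ap_jac:
  assumes "el S s" "el S t" "el S u" "dj s t" "dj s u" "dj t u"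
  shows "ap (d \<cdot> (id\<^sub>a S \<otimes>\<^sub>a d) \<cdot> cyclic_sum C S) (s \<bowtie> t \<bowtie> u) = jac s t u"
  using assms assms(4-6)[THEN dj_sym]
  by (simp add: cyclic_sum_def cyclic_perm_def jac_def br_def Un_ac)

text \<open>The Jacobiator of an antisymmetric bi-derivation is a derivation in its first argument:
  iterated brackets satisfy the Leibniz rule up to products of two simple brackets, and these
  cancel.\<close>

lemma jac_mul:
  assumes anti: "anti t s" "anti t s'" and e: "el S s" "el S s'" "el S t" "el S u"
    "dj s s'" "dj s t" "dj s u" "dj s' t" "dj s' u" "dj t u"
  shows "jac (s \<star> s') t u = (s \<star> jac s' t u) \<boxplus> (jac s t u \<star> s')"
proof -
  note [simp] = e e(5-10)[THEN dj_sym]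
  have d: "(fst u \<union> fst s) \<inter> (fst t \<union> fst s') = {}" "(fst t \<union> fst s) \<inter> (fst u \<union> fst s') = {}"
    using e(5-10) by (auto simp: dj_def)
  \<comment> \<open>The four products of two simple brackets, paired so that antisymmetry with
    \<open>t\<close> makes each pair vanish.\<close>
  have p: "(br u s \<star> br t s') \<boxplus> (br u s \<star> br s' t) = ezero S (fst s \<union> fst s' \<union> fst t \<union> fst u)"
    "(br t s \<star> br u s') \<boxplus> (br s t \<star> br u s') = ezero S (fst s \<union> fst s' \<union> fst t \<union> fst u)"
    using anti mul_eadd(2)[of "br t s'" "br s' t" "br u s"] mul_eadd(1)[of "br t s" "br s t" "br u s'"] d
    by (simp_all add: anti_def mul_ezero Un_ac)
  have "jac (s \<star> s') t u =
      ((s \<star> br s' (br t u)) \<boxplus> (br s (br t u) \<star> s')) \<boxplus>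
      (((br t (br u s) \<star> s') \<boxplus> (br u s \<star> br t s')) \<boxplus> ((br t s \<star> br u s') \<boxplus> (s \<star> br t (br u s')))) \<boxplus>
      (((br u s \<star> br s' t) \<boxplus> (s \<star> br u (br s' t))) \<boxplus> ((br u (br s t) \<star> s') \<boxplus> (br s t \<star> br u s')))"
    by (simp add: jac_def br_mul_left br_mul_right br_eadd Un_ac)
  also have "\<dots> = ((br u s \<star> br t s') \<boxplus> (br u s \<star> br s' t)) \<boxplus> (((br t s \<star> br u s') \<boxplus> (br s t \<star> br u s')) \<boxplus>
      (((s \<star> br s' (br t u)) \<boxplus> (s \<star> br t (br u s')) \<boxplus> (s \<star> br u (br s' t))) \<boxplus>
       ((br s (br t u) \<star> s') \<boxplus> (br t (br u s) \<star> s') \<boxplus> (br u (br s t) \<star> s'))))"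
    by (simp add: eadd_ac Un_ac)
  also have "\<dots> = (s \<star> jac s' t u) \<boxplus> (jac s t u \<star> s')"
    unfolding p by (simp add: jac_def mul_eadd eadd_ezero Un_ac)
  finally show ?thesis .
qed

lemma jac_mon:
  assumes all: "\<And>s t. \<lbrakk>el S s; el S t; dj s t\<rbrakk> \<Longrightarrow> anti s t"
  shows "\<lbrakk>hs xs; el S t; el S u; dj t u; \<forall>x \<in> set xs. dj x t; \<forall>x \<in> set xs. dj x u;
    \<forall>x \<in> set xs. jac (ap gencl x) t u = ezero S (fst x \<union> fst t \<union> fst u)\<rbrakk>
    \<Longrightarrow> jac (mon xs) t u = ezero S (fst (mon xs) \<union> fst t \<union> fst u)"
proof (induction xs)
  case Nil
  then show ?case by (simp add: jac_def br_ezero eadd_ezero fst_mon Un_ac dj_def Int_commute)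
next
  case (Cons x xs)
  have e: "el h x" "\<forall>w \<in> set xs. dj x w" "\<forall>w \<in> set xs. dj w x" "hs xs" "dj x t" "dj t x" "dj x u" "dj u x"
    "\<forall>w \<in> set xs. dj w t" "\<forall>w \<in> set xs. dj t w" "\<forall>w \<in> set xs. dj w u" "\<forall>w \<in> set xs. dj u w" "dj t u" "dj u t"
    using Cons.prems by (auto intro: dj_sym)
  have d: "fst x \<inter> (fst (mon xs) \<union> fst t \<union> fst u) = {}" "(fst x \<union> fst t \<union> fst u) \<inter> fst (mon xs) = {}"
    using e by (auto simp: dj_def fst_mon)
  have "jac (mon (x # xs)) t u = (ap gencl x \<star> jac (mon xs) t u) \<boxplus> (jac (ap gencl x) t u \<star> mon xs)"
    unfolding mon_Cons[OF Cons.prems(1)]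
    by (rule jac_mul) (use e Cons.prems in \<open>simp_all add: all\<close>)
  also have "\<dots> = ezero S (fst (mon (x # xs)) \<union> fst t \<union> fst u)"
    using Cons e d by (simp add: mul_ezero eadd_ezero Un_ac fst_mon)
  finally show ?case .
qed

end

context free_cm
begin

text \<open>Antisymmetry passes to monomials in the first argument by \<open>anti_mon\<close>;
  flipping the arguments with \<open>anti_sym\<close> makes the second argument accessible in the
  same way.\<close>

lemma antisymmetric_from_generators:
  assumes d: "bi_derivation C S \<mu> (free_unit \<iota>) d"
    and gens: "(d +\<^sub>a d \<cdot> \<sigma>\<^sub>a S S) \<cdot> (gencl \<otimes>\<^sub>a gencl) = HZero C (h \<otimes>\<^sub>o h) S"
  shows "d +\<^sub>a d \<cdot> \<sigma>\<^sub>a S S = HZero C (S \<otimes>\<^sub>o S) S"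
proof (rule S_ext2)
  note [simp] = bi_derivation_arr[OF d]
  fix m n
  show "(d +\<^sub>a d \<cdot> \<sigma>\<^sub>a S S) \<cdot> (\<iota> m \<otimes>\<^sub>a \<iota> n) = HZero C (S \<otimes>\<^sub>o S) S \<cdot> (\<iota> m \<otimes>\<^sub>a \<iota> n)" (is "?l = ?r")
  proof (rule ext_hh)
    fix \<Gamma> xs ys
    assume a: "fctx C R h S \<iota> \<Gamma>" "fctx.hs C h \<Gamma> (xs @ ys)" "length xs = m" "length ys = n"
    interpret G: fctx C R h S \<iota> \<Gamma> by (rule a(1))
    interpret D: bctx C R h S \<iota> \<Gamma> d by (rule bctxI[OF G.ctx_axioms d])
    have hs: "G.hs xs" "G.hs ys" "\<forall>x \<in> set xs. \<forall>y \<in> set ys. dj x y" "\<forall>x \<in> set ys. \<forall>y \<in> set xs. dj x y"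
      using a(2) by (auto intro: dj_sym)
    have el: "x \<in> set xs \<Longrightarrow> G.el h x" "y \<in> set ys \<Longrightarrow> G.el h y" for x y
      using hs by (auto simp: G.hs_alt)
    have gg: "D.anti (ap gencl x) (ap gencl y)" if "G.el h x" "G.el h y" "dj x y" for x y
    proof -
      have "ap ((d +\<^sub>a d \<cdot> \<sigma>\<^sub>a S S) \<cdot> (gencl \<otimes>\<^sub>a gencl)) (G.eprod x y) = ap (HZero C (h \<otimes>\<^sub>o h) S) (G.eprod x y)"
        by (simp only: gens)
      then show ?thesis using that by (simp add: D.anti_def D.br_def dj_sym)
    qed
    have mg: "D.anti (G.mon xs) (ap gencl y)" if "y \<in> set ys" for y
      using that hs el gg by (intro D.anti_mon) auto
    have gm: "D.anti (ap gencl y) (G.mon xs)" if "y \<in> set ys" for y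
      by (rule D.anti_sym[OF mg[OF that]]) (use that hs el in auto)
    have "D.anti (G.mon ys) (G.mon xs)"
      using hs gm by (intro D.anti_mon) auto
    then have "D.anti (G.mon xs) (G.mon ys)"
      by (rule D.anti_sym) (use hs in auto)
    then show "ap ?l (G.eprod (G.tensE xs) (G.tensE ys)) = ap ?r (G.eprod (G.tensE xs) (G.tensE ys))"
      using hs a(3,4) by (simp add: D.anti_def D.br_def G.fst_mon G.fst_tensE)
  qed simp_all
qed (use bi_derivation_arr[OF d] in simp_all)

text \<open>Generators are replaced by monomials in one argument at a time, rotating the Jacobiator
  so that the argument in question comes first. Antisymmetry must be available on all of
  \<open>S\<close> beforehand, because the cancellation in \<open>jac_mul\<close> uses it for
  monomials.\<close>

lemma jacobi_from_generators:
  assumes d: "bi_derivation C S \<mu> (free_unit \<iota>) d"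
    and anti: "d +\<^sub>a d \<cdot> \<sigma>\<^sub>a S S = HZero C (S \<otimes>\<^sub>o S) S"
    and gens: "(d \<cdot> (id\<^sub>a S \<otimes>\<^sub>a d) \<cdot> cyclic_sum C S) \<cdot> (gencl \<otimes>\<^sub>a gencl \<otimes>\<^sub>a gencl) = HZero C (h \<otimes>\<^sub>o h \<otimes>\<^sub>o h) S"
  shows "d \<cdot> (id\<^sub>a S \<otimes>\<^sub>a d) \<cdot> cyclic_sum C S = HZero C (S \<otimes>\<^sub>o S \<otimes>\<^sub>o S) S"
proof (rule S_ext3')
  note [simp] = bi_derivation_arr[OF d]
  have cyc [simp]: "cyclic_sum C S \<in> Arr C" "Dom C (cyclic_sum C S) = S \<otimes>\<^sub>o S \<otimes>\<^sub>o S"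
    "Cod C (cyclic_sum C S) = S \<otimes>\<^sub>o S \<otimes>\<^sub>o S"
    by (simp_all add: cyclic_sum_def cyclic_perm_def)
  fix k m n
  show "(d \<cdot> (id\<^sub>a S \<otimes>\<^sub>a d) \<cdot> cyclic_sum C S) \<cdot> (\<iota> k \<otimes>\<^sub>a \<iota> m \<otimes>\<^sub>a \<iota> n)
    = HZero C (S \<otimes>\<^sub>o S \<otimes>\<^sub>o S) S \<cdot> (\<iota> k \<otimes>\<^sub>a \<iota> m \<otimes>\<^sub>a \<iota> n)" (is "?l = ?r")
  proof (rule ext_hhh)
    fix \<Gamma> xs ys zs
    assume a: "fctx C R h S \<iota> \<Gamma>" "fctx.hs C h \<Gamma> (xs @ ys @ zs)" "length xs = k" "length ys = m" "length zs = n"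
    interpret G: fctx C R h S \<iota> \<Gamma> by (rule a(1))
    interpret D: bctx C R h S \<iota> \<Gamma> d by (rule bctxI[OF G.ctx_axioms d])
    have hs: "G.hs xs" "G.hs ys" "G.hs zs" "\<forall>x \<in> set xs. \<forall>y \<in> set ys. dj x y" "\<forall>x \<in> set ys. \<forall>y \<in> set xs. dj x y"
      "\<forall>x \<in> set xs. \<forall>y \<in> set zs. dj x y" "\<forall>x \<in> set zs. \<forall>y \<in> set xs. dj x y"
      "\<forall>x \<in> set ys. \<forall>y \<in> set zs. dj x y" "\<forall>x \<in> set zs. \<forall>y \<in> set ys. dj x y"
      using a(2) by (auto intro: dj_sym)
    have el: "x \<in> set xs \<Longrightarrow> G.el h x" "y \<in> set ys \<Longrightarrow> G.el h y" "z \<in> set zs \<Longrightarrow> G.el h z" for x y z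
      using hs by (auto simp: G.hs_alt)
    have all: "D.anti s t" if "G.el S s" "G.el S t" "dj s t" for s t
    proof -
      have "ap (d +\<^sub>a d \<cdot> \<sigma>\<^sub>a S S) (G.eprod s t) = ap (HZero C (S \<otimes>\<^sub>o S) S) (G.eprod s t)"
        by (simp only: anti)
      then show ?thesis using that by (simp add: D.anti_def D.br_def)
    qed
    have ggg: "D.jac (ap gencl x) (ap gencl y) (ap gencl z) = G.ezero S (fst x \<union> fst y \<union> fst z)"
      if "G.el h x" "G.el h y" "G.el h z" "dj x y" "dj x z" "dj y z" for x y z
    proof -
      have "ap ((d \<cdot> (id\<^sub>a S \<otimes>\<^sub>a d) \<cdot> cyclic_sum C S) \<cdot> (gencl \<otimes>\<^sub>a gencl \<otimes>\<^sub>a gencl)) (G.eprod x (G.eprod y z))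
          = ap (HZero C (h \<otimes>\<^sub>o h \<otimes>\<^sub>o h) S) (G.eprod x (G.eprod y z))"
        by (simp only: gens)
      moreover have "ap ((d \<cdot> (id\<^sub>a S \<otimes>\<^sub>a d) \<cdot> cyclic_sum C S) \<cdot> (gencl \<otimes>\<^sub>a gencl \<otimes>\<^sub>a gencl)) (G.eprod x (G.eprod y z))
          = ap (d \<cdot> (id\<^sub>a S \<otimes>\<^sub>a d) \<cdot> cyclic_sum C S) (G.eprod (ap gencl x) (G.eprod (ap gencl y) (ap gencl z)))"
        using that by (subst G.ap_Comp) simp_all
      ultimately show ?thesis
        using that D.ap_jac[of "ap gencl x" "ap gencl y" "ap gencl z"] by (simp add: Un_assoc)
    qed
    have 1: "D.jac (G.mon xs) (ap gencl y) (ap gencl z) = G.ezero S (fst (G.mon xs) \<union> fst y \<union> fst z)"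
      if "y \<in> set ys" "z \<in> set zs" for y z
      using D.jac_mon[OF all hs(1), of "ap gencl y" "ap gencl z"] that hs el ggg by auto
    have 2: "D.jac (G.mon ys) (ap gencl z) (G.mon xs) = G.ezero S (fst (G.mon ys) \<union> fst z \<union> fst (G.mon xs))"
      if z: "z \<in> set zs" for z
    proof -
      have "D.jac (ap gencl y) (ap gencl z) (G.mon xs) = G.ezero S (fst y \<union> fst z \<union> fst (G.mon xs))" if y: "y \<in> set ys" for y
        using 1[OF y z] D.jac_rotate[of "G.mon xs" "ap gencl y" "ap gencl z"] y z hs el by (simp add: Un_ac)
      then show ?thesis
        using D.jac_mon[OF all hs(2), of "ap gencl z" "G.mon xs"] z hs el by auto
    qed
    have "D.jac (ap gencl z) (G.mon xs) (G.mon ys) = G.ezero S (fst z \<union> fst (G.mon xs) \<union> fst (G.mon ys))"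
      if z: "z \<in> set zs" for z
      using 2[OF z] D.jac_rotate[of "G.mon ys" "ap gencl z" "G.mon xs"] z hs el by (simp add: Un_ac)
    then have "D.jac (G.mon zs) (G.mon xs) (G.mon ys) = G.ezero S (fst (G.mon zs) \<union> fst (G.mon xs) \<union> fst (G.mon ys))"
      using D.jac_mon[OF all hs(3), of "G.mon xs" "G.mon ys"] hs by auto
    then have "D.jac (G.mon xs) (G.mon ys) (G.mon zs) = G.ezero S (fst (G.mon xs) \<union> fst (G.mon ys) \<union> fst (G.mon zs))"
      using D.jac_rotate[of "G.mon zs" "G.mon xs" "G.mon ys"] hs by (simp add: Un_ac)
    moreover have "ap ?l (G.eprod (G.tensE xs) (G.eprod (G.tensE ys) (G.tensE zs))) =
        ap (d \<cdot> (id\<^sub>a S \<otimes>\<^sub>a d) \<cdot> cyclic_sum C S) (G.eprod (G.mon xs) (G.eprod (G.mon ys) (G.mon zs)))"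
      using hs a(3-5) by (subst G.ap_Comp) simp_all
    moreover have "ap ?r (G.eprod (G.tensE xs) (G.eprod (G.tensE ys) (G.tensE zs)))
        = G.ezero S (fst (G.mon xs) \<union> fst (G.mon ys) \<union> fst (G.mon zs))"
      using hs a(3-5) by (simp add: G.fst_mon G.fst_tensE Un_assoc)
    ultimately show "ap ?l (G.eprod (G.tensE xs) (G.eprod (G.tensE ys) (G.tensE zs)))
      = ap ?r (G.eprod (G.tensE xs) (G.eprod (G.tensE ys) (G.tensE zs)))"
      using D.ap_jac[of "G.mon xs" "G.mon ys" "G.mon zs"] hs by simp
  qed simp_all
qed (use bi_derivation_arr[OF d] in \<open>simp_all add: cyclic_sum_def cyclic_perm_def\<close>)

end

section \<open>Contraction with coevaluations\<close>

context ctx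
begin

text \<open>A function of elements counts as linear if it is represented by an arrow together with a
  fixed parameter \<open>z\<close>, whose variables form \<open>M\<close>. Such a representation is
  what allows the variable argument to be replaced.\<close>

definition lin :: "nat set \<Rightarrow> 'o \<Rightarrow> 'o \<Rightarrow> (nat set \<times> 'm \<Rightarrow> nat set \<times> 'm) \<Rightarrow> bool" where
  "lin M A B F \<longleftrightarrow> (\<exists>Z z f. el Z z \<and> fst z = M \<and> f \<in> Arr C \<and> Dom C f = Z \<otimes>\<^sub>o A \<and> Cod C f = B \<and>
     (\<forall>p. el A p \<and> M \<inter> fst p = {} \<longrightarrow> F p = ap f (z \<bowtie> p)))"

lemma lin_id: "A \<in> Obj C \<Longrightarrow> lin {} A A (\<lambda>p. p)"
  unfolding lin_def by (intro exI[of _ \<I>] exI[of _ eunit] exI[of _ "\<lambda>\<^sub>u A"]) simp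

lemma lin_ap_right:
  assumes "lin M A B F" "el D t" "fst t \<inter> M = {}" "f \<in> Arr C" "Dom C f = D \<otimes>\<^sub>o B" "Cod C f = Y" "A \<in> Obj C"
  shows "lin (fst t \<union> M) A Y (\<lambda>p. ap f (t \<bowtie> F p))"
proof -
  obtain Z z k where z: "el Z z" "fst z = M" and k: "k \<in> Arr C" "Dom C k = Z \<otimes>\<^sub>o A" "Cod C k = B"
    and F: "\<And>p. \<lbrakk>el A p; M \<inter> fst p = {}\<rbrakk> \<Longrightarrow> F p = ap k (z \<bowtie> p)"
    using assms(1) unfolding lin_def by blast
  note [simp] = el_Obj[OF z(1)] el_Obj[OF assms(2)]
  have "ap f (t \<bowtie> F p) = ap (f \<cdot> (id\<^sub>a D \<otimes>\<^sub>a k) \<cdot> \<alpha>\<^sub>a D Z A) ((t \<bowtie> z) \<bowtie> p)"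
    if "el A p" "(fst t \<union> M) \<inter> fst p = {}" for p
  proof -
    have d: "dj t z" "dj t p" "dj z p" using that(2) z(2) assms(3) by (auto simp: dj_def)
    have "F p = ap k (z \<bowtie> p)" using that by (intro F) auto
    then show ?thesis
      using d z(1) k assms(2-7) that(1) by simp
  qed
  moreover have "el (D \<otimes>\<^sub>o Z) (t \<bowtie> z)" using z assms by (auto simp: dj_def)
  ultimately show ?thesis
    unfolding lin_def using z k assms
    by (intro exI[of _ "D \<otimes>\<^sub>o Z"] exI[of _ "t \<bowtie> z"] exI[of _ "f \<cdot> (id\<^sub>a D \<otimes>\<^sub>a k) \<cdot> \<alpha>\<^sub>a D Z A"]) simp
qed

lemma lin_el:
  assumes "lin M A B F" "el A p" "M \<inter> fst p = {}"
  shows "el B (F p)" "fst (F p) = M \<union> fst p"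
proof -
  obtain Z z k where z: "el Z z" "fst z = M" "k \<in> Arr C" "Dom C k = Z \<otimes>\<^sub>o A" "Cod C k = B" "F p = ap k (z \<bowtie> p)"
    using assms unfolding lin_def by blast
  moreover have "dj z p" using z(2) assms(3) by (simp add: dj_def)
  ultimately show "el B (F p)" "fst (F p) = M \<union> fst p"
    using assms(2) by simp_all
qed

lemma lin_cong:
  assumes "lin M A B F" "M = M'" "\<And>p. \<lbrakk>el A p; M \<inter> fst p = {}\<rbrakk> \<Longrightarrow> F p = F' p"
  shows "lin M' A B F'"
proof -
  obtain Z z k where "el Z z" "fst z = M" "k \<in> Arr C" "Dom C k = Z \<otimes>\<^sub>o A" "Cod C k = B"
    "\<And>p. \<lbrakk>el A p; M \<inter> fst p = {}\<rbrakk> \<Longrightarrow> F p = ap k (z \<bowtie> p)"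
    using assms(1) unfolding lin_def by blast
  then show ?thesis
    unfolding lin_def using assms(2,3)
    by (intro exI[of _ Z] exI[of _ z] exI[of _ k]) force
qed

lemma lin_ap_left:
  assumes "lin M A B F" "el D t" "fst t \<inter> M = {}" "f \<in> Arr C" "Dom C f = B \<otimes>\<^sub>o D" "Cod C f = Y" "A \<in> Obj C" "B \<in> Obj C"
  shows "lin (fst t \<union> M) A Y (\<lambda>p. ap f (F p \<bowtie> t))"
proof -
  note [simp] = el_Obj[OF assms(2)]
  have "lin (fst t \<union> M) A Y (\<lambda>p. ap (f \<cdot> \<sigma>\<^sub>a D B) (t \<bowtie> F p))"
    by (rule lin_ap_right[OF assms(1-3)]) (use assms in simp_all)
  then show ?thesis
  proof (rule lin_cong[OF _ refl])
    fix p
    assume p: "el A p" "(fst t \<union> M) \<inter> fst p = {}"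
    have "M \<inter> fst p = {}" using p by auto
    note F = lin_el[OF assms(1) p(1) this]
    have "dj t (F p)" using F p assms(3) by (auto simp: dj_def)
    then show "ap (f \<cdot> \<sigma>\<^sub>a D B) (t \<bowtie> F p) = ap f (F p \<bowtie> t)"
      using F assms by (simp add: dj_sym)
  qed
qed

text \<open>A generic element \<open>g\<close> can be replaced by any \<open>p\<close>, in particular by a coevaluation.\<close>

lemma lin_ext:
  assumes F: "lin M A B F" "lin M A B F'" and g: "el A g" "isoE g" "M \<inter> fst g = {}" "F g = F' g"
    and p: "el A p" "M \<inter> fst p = {}"
  shows "F p = F' p"
proof -
  let ?n = "length \<Gamma>"
  obtain Z z f where z: "el Z z" "fst z = M" "f \<in> Arr C" "Dom C f = Z \<otimes>\<^sub>o A" "Cod C f = B"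
    and Fz: "\<And>p. \<lbrakk>el A p; M \<inter> fst p = {}\<rbrakk> \<Longrightarrow> F p = ap f (z \<bowtie> p)"
    using F(1) unfolding lin_def by blast
  obtain Z' z' f' where z': "el Z' z'" "fst z' = M" "f' \<in> Arr C" "Dom C f' = Z' \<otimes>\<^sub>o A" "Cod C f' = B"
    and Fz': "\<And>p. \<lbrakk>el A p; M \<inter> fst p = {}\<rbrakk> \<Longrightarrow> F' p = ap f' (z' \<bowtie> p)"
    using F(2) unfolding lin_def by blast
  have e [simp]: "snd z \<in> Arr C" "Dom C (snd z) = var_tens ?n M" "Cod C (snd z) = Z"
    "snd z' \<in> Arr C" "Dom C (snd z') = var_tens ?n M" "Cod C (snd z') = Z'"
    "snd g \<in> Arr C" "Dom C (snd g) = var_tens ?n (fst g)" "Cod C (snd g) = A" "is_iso C (snd g)"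
    "snd p \<in> Arr C" "Dom C (snd p) = var_tens ?n (fst p)" "Cod C (snd p) = A"
    using z z' g p by (auto simp: el_def isoE_def)
  note [simp] = z(3-5) z'(3-5) g(3) p(2)
  have "(f \<cdot> (snd z \<otimes>\<^sub>a snd g)) \<cdot> separate ?n M (fst g) = (f' \<cdot> (snd z' \<otimes>\<^sub>a snd g)) \<cdot> separate ?n M (fst g)"
    using g(4) Fz[OF g(1,3)] Fz'[OF g(1,3)] z(2) z'(2) by (simp add: ap_def eprod_def)
  then have fg: "f \<cdot> (snd z \<otimes>\<^sub>a snd g) = f' \<cdot> (snd z' \<otimes>\<^sub>a snd g)"
    by (rule iso_cancel_right) simp_all
  \<comment> \<open>Since \<open>g\<close> is invertible, the arrow of \<open>p\<close> factors
    through that of \<open>g\<close>, and the factor touches only the variables being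
    replaced.\<close>
  have sub: "snd y \<otimes>\<^sub>a snd p = (snd y \<otimes>\<^sub>a snd g) \<cdot> (id\<^sub>a (var_tens ?n M) \<otimes>\<^sub>a (inv\<^sub>a (snd g) \<cdot> snd p))"
    if "snd y \<in> Arr C" "Dom C (snd y) = var_tens ?n M" for y
    using that by (simp add: merge)
  have "f \<cdot> (snd z \<otimes>\<^sub>a snd p) = f' \<cdot> (snd z' \<otimes>\<^sub>a snd p)"
    unfolding sub[of z, OF e(1,2)] sub[of z', OF e(4,5)] using Comp_tail[OF fg] fg
    by (subst Comp_tail[OF fg]) simp_all
  then have "(f \<cdot> (snd z \<otimes>\<^sub>a snd p)) \<cdot> separate ?n M (fst p) = (f' \<cdot> (snd z' \<otimes>\<^sub>a snd p)) \<cdot> separate ?n M (fst p)"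
    by (simp only:)
  then show ?thesis
    using Fz[OF p] Fz'[OF p] z(2) z'(2) by (simp add: ap_def eprod_def)
qed

end

section \<open>Exchange of two factors, and products of matrices with values in
  \<open>S\<close>\<close>

context symmetric_monoidal_category
begin

text \<open>Exchanges the second and the fourth of four factors. The same exchange links the inner
  factors of a matrix product to the contracted pair, and redistributes the arguments of a
  bracket.\<close>

definition twist :: "'o \<Rightarrow> 'o \<Rightarrow> 'o \<Rightarrow> 'o \<Rightarrow> 'm" where
  "twist X Y D E = inv\<^sub>a (\<alpha>\<^sub>a X E (D \<otimes>\<^sub>o Y)) \<cdot>
     (id\<^sub>a X \<otimes>\<^sub>a (swap_front C D E Y \<cdot> \<alpha>\<^sub>a D E Y \<cdot> \<sigma>\<^sub>a Y (D \<otimes>\<^sub>o E))) \<cdot> \<alpha>\<^sub>a X Y (D \<otimes>\<^sub>o E)"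

lemma twist_arr [simp]:
  assumes "X \<in> Obj C" "Y \<in> Obj C" "D \<in> Obj C" "E \<in> Obj C"
  shows "twist X Y D E \<in> Arr C" "Dom C (twist X Y D E) = (X \<otimes>\<^sub>o Y) \<otimes>\<^sub>o D \<otimes>\<^sub>o E"
    "Cod C (twist X Y D E) = (X \<otimes>\<^sub>o E) \<otimes>\<^sub>o D \<otimes>\<^sub>o Y"
  using assms by (simp_all add: twist_def)

end

context ctx
begin

lemma ap_twist [simp]:
  assumes "el X a" "el Y b" "el D d" "el E e" "dj a b" "dj a d" "dj a e" "dj b d" "dj b e" "dj d e"
  shows "ap (twist X Y D E) ((a \<bowtie> b) \<bowtie> (d \<bowtie> e)) = (a \<bowtie> e) \<bowtie> (d \<bowtie> b)"
proof -
  note [simp] = assms assms(5-10)[THEN dj_sym] assms(1-4)[THEN el_Obj]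
  show ?thesis by (simp add: twist_def)
qed

end

context free_cm
begin

text \<open>With \<open>P = \<Sum> p \<otimes> p' : \<I> \<rightarrow> D \<otimes> E\<close>, the arrow \<open>mm X Y D E a b P\<close> is the product of
  \<open>S\<close>-valued matrices \<open>x \<otimes> y \<mapsto> \<Sum> a (x \<otimes> p') b (p \<otimes> y)\<close>.\<close>

definition mmh :: "'o \<Rightarrow> 'o \<Rightarrow> 'o \<Rightarrow> 'o \<Rightarrow> 'm \<Rightarrow> 'm \<Rightarrow> 'm" where
  "mmh X Y D E a b = \<mu> \<cdot> (a \<otimes>\<^sub>a b) \<cdot> twist X Y D E"

definition mm :: "'o \<Rightarrow> 'o \<Rightarrow> 'o \<Rightarrow> 'o \<Rightarrow> 'm \<Rightarrow> 'm \<Rightarrow> 'm \<Rightarrow> 'm" where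
  "mm X Y D E a b P = mmh X Y D E a b \<cdot> (id\<^sub>a (X \<otimes>\<^sub>o Y) \<otimes>\<^sub>a P) \<cdot> inv\<^sub>a (\<rho>\<^sub>u (X \<otimes>\<^sub>o Y))"

lemma mm_arr [simp]:
  assumes "X \<in> Obj C" "Y \<in> Obj C" "D \<in> Obj C" "E \<in> Obj C"
    "a \<in> Arr C" "Dom C a = X \<otimes>\<^sub>o E" "Cod C a = S" "b \<in> Arr C" "Dom C b = D \<otimes>\<^sub>o Y" "Cod C b = S"
  shows "mmh X Y D E a b \<in> Arr C" "Dom C (mmh X Y D E a b) = (X \<otimes>\<^sub>o Y) \<otimes>\<^sub>o D \<otimes>\<^sub>o E" "Cod C (mmh X Y D E a b) = S"
    "\<lbrakk>P \<in> Arr C; Dom C P = \<I>; Cod C P = D \<otimes>\<^sub>o E\<rbrakk> \<Longrightarrow> mm X Y D E a b P \<in> Arr C"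
    "\<lbrakk>P \<in> Arr C; Dom C P = \<I>; Cod C P = D \<otimes>\<^sub>o E\<rbrakk> \<Longrightarrow> Dom C (mm X Y D E a b P) = X \<otimes>\<^sub>o Y"
    "\<lbrakk>P \<in> Arr C; Dom C P = \<I>; Cod C P = D \<otimes>\<^sub>o E\<rbrakk> \<Longrightarrow> Cod C (mm X Y D E a b P) = S"
  using assms by (simp_all add: mmh_def mm_def)

end

context fctx
begin

lemma ap_mmh:
  assumes "a \<in> Arr C" "Dom C a = X \<otimes>\<^sub>o E" "Cod C a = S" "b \<in> Arr C" "Dom C b = D \<otimes>\<^sub>o Y" "Cod C b = S"
    "el X x" "el Y y" "el D p" "el E p'" "dj x y" "dj x p" "dj x p'" "dj y p" "dj y p'" "dj p p'"
  shows "ap (mmh X Y D E a b) ((x \<bowtie> y) \<bowtie> (p \<bowtie> p')) = ap a (x \<bowtie> p') \<star> ap b (p \<bowtie> y)"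
  using assms assms(11-16)[THEN dj_sym] by (simp add: mmh_def mul_def el_Obj)

text \<open>As an element, \<open>ap P eunit\<close> is the contracted tensor. Its set of variables
  is empty, so it is disjoint from everything and may be substituted for a pair of fresh
  variables.\<close>

lemma ap_mm:
  assumes "a \<in> Arr C" "Dom C a = X \<otimes>\<^sub>o E" "Cod C a = S" "b \<in> Arr C" "Dom C b = D \<otimes>\<^sub>o Y" "Cod C b = S"
    "P \<in> Arr C" "Dom C P = \<I>" "Cod C P = D \<otimes>\<^sub>o E" "el X x" "el Y y" "dj x y" "D \<in> Obj C" "E \<in> Obj C"
  shows "ap (mm X Y D E a b P) (x \<bowtie> y) = ap (mmh X Y D E a b) ((x \<bowtie> y) \<bowtie> ap P eunit)"
proof -
  note [simp] = assms assms(10,11)[THEN el_Obj]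
  show ?thesis by (simp add: mm_def)
qed

lemma lin_mmh:
  assumes "a \<in> Arr C" "Dom C a = X \<otimes>\<^sub>o E" "Cod C a = S" "b \<in> Arr C" "Dom C b = D \<otimes>\<^sub>o Y" "Cod C b = S"
    "el X x" "el Y y" "dj x y" "D \<in> Obj C" "E \<in> Obj C"
  shows "lin (fst x \<union> fst y) (D \<otimes>\<^sub>o E) S (\<lambda>p. ap (mmh X Y D E a b) ((x \<bowtie> y) \<bowtie> p))"
proof -
  note [simp] = assms assms(7,8)[THEN el_Obj]
  have "lin (fst (x \<bowtie> y) \<union> {}) (D \<otimes>\<^sub>o E) S (\<lambda>p. ap (mmh X Y D E a b) ((x \<bowtie> y) \<bowtie> p))"
    by (rule lin_ap_right[OF lin_id]) simp_all
  then show ?thesis by simp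
qed

lemma lin_mul_right: "\<lbrakk>lin M A S F; el S t; fst t \<inter> M = {}; A \<in> Obj C\<rbrakk> \<Longrightarrow> lin (fst t \<union> M) A S (\<lambda>p. t \<star> F p)"
  unfolding mul_def by (rule lin_ap_right[where B = S and D = S]) simp_all

lemma lin_mul_left: "\<lbrakk>lin M A S F; el S t; fst t \<inter> M = {}; A \<in> Obj C\<rbrakk> \<Longrightarrow> lin (fst t \<union> M) A S (\<lambda>p. F p \<star> t)"
  unfolding mul_def by (rule lin_ap_left[where B = S and D = S]) simp_all

end

context free_cm
begin

text \<open>Both sides arise from the triple product of \<open>a\<close>, \<open>b\<close> and
  \<open>c\<close> linked by two pairs of fresh variables; contracting one pair and then the other
  does not depend on the order.\<close>

lemma mm_assoc:
  assumes a [simp]: "a \<in> Arr C" "Dom C a = X \<otimes>\<^sub>o E" "Cod C a = S"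
    and b [simp]: "b \<in> Arr C" "Dom C b = D \<otimes>\<^sub>o F" "Cod C b = S"
    and c [simp]: "c \<in> Arr C" "Dom C c = G \<otimes>\<^sub>o Y" "Cod C c = S"
    and Q [simp]: "Q \<in> Arr C" "Dom C Q = \<I>" "Cod C Q = D \<otimes>\<^sub>o E"
    and P [simp]: "P \<in> Arr C" "Dom C P = \<I>" "Cod C P = G \<otimes>\<^sub>o F"
    and o [simp]: "X \<in> Obj C" "Y \<in> Obj C" "D \<in> Obj C" "E \<in> Obj C" "F \<in> Obj C" "G \<in> Obj C"
  shows "mm X Y G F (mm X F D E a b Q) c P = mm X Y D E a (mm D Y G F b c P) Q" (is "?l = ?r")
proof -
  have ctx: "ctx C [X, Y, G, F, D, E]" by unfold_locales simp
  interpret K: fctx C R h S \<iota> "[X, Y, G, F, D, E]" by (rule fctxI[OF ctx])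
  let ?x = "K.gen 0" and ?y = "K.gen 1" and ?g = "K.gen 2" and ?f = "K.gen 3" and ?d = "K.gen 4" and ?e = "K.gen 5"
  let ?P = "ap P K.eunit" and ?Q = "ap Q K.eunit"
  let ?p = "K.eprod ?g ?f" and ?q = "K.eprod ?d ?e" and ?xy = "K.eprod ?x ?y"
  have e [simp]: "K.el X ?x" "K.el Y ?y" "K.el G ?g" "K.el F ?f" "K.el D ?d" "K.el E ?e" by simp_all
  have iso: "K.isoE ?p" "K.isoE ?q" "K.isoE ?xy"
    by (rule K.isoE_eprod[OF _ _ e(3,4)] K.isoE_eprod[OF _ _ e(5,6)] K.isoE_eprod[OF _ _ e(1,2)]; simp)+
  let ?L = "mm X F D E a b Q" and ?R = "mm D Y G F b c P"
  \<comment> \<open>One arrow with both contracted tensors still as arguments. The resulting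
    \<open>?N\<close> is linear in each of them separately, so that variables can be replaced by
    \<open>P\<close> and by \<open>Q\<close> independently.\<close>
  let ?\<Phi> = "\<mu> \<cdot> (a \<otimes>\<^sub>a mmh D Y G F b c) \<cdot> \<alpha>\<^sub>a (X \<otimes>\<^sub>o E) (D \<otimes>\<^sub>o Y) (G \<otimes>\<^sub>o F) \<cdot>
      (twist X Y D E \<otimes>\<^sub>a id\<^sub>a (G \<otimes>\<^sub>o F)) \<cdot> inv\<^sub>a (\<alpha>\<^sub>a (X \<otimes>\<^sub>o Y) (D \<otimes>\<^sub>o E) (G \<otimes>\<^sub>o F))"
  let ?N = "\<lambda>q p. ap ?\<Phi> (K.eprod ?xy (K.eprod q p))"
  have Nq: "K.lin ({0, 1} \<union> fst p) (D \<otimes>\<^sub>o E) S (\<lambda>q. ?N q p)" if "K.el (G \<otimes>\<^sub>o F) p" "{0, 1} \<inter> fst p = {}" for p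
  proof -
    have "K.lin (fst p \<union> {}) (D \<otimes>\<^sub>o E) ((D \<otimes>\<^sub>o E) \<otimes>\<^sub>o G \<otimes>\<^sub>o F) (\<lambda>q. ap (id\<^sub>a ((D \<otimes>\<^sub>o E) \<otimes>\<^sub>o G \<otimes>\<^sub>o F)) (K.eprod q p))"
      by (rule K.lin_ap_left[OF K.lin_id]) (use that in simp_all)
    then have "K.lin (fst p) (D \<otimes>\<^sub>o E) ((D \<otimes>\<^sub>o E) \<otimes>\<^sub>o G \<otimes>\<^sub>o F) (\<lambda>q. K.eprod q p)"
      by (rule K.lin_cong) (use that in \<open>simp_all add: dj_def Int_commute\<close>)
    then have "K.lin (fst ?xy \<union> fst p) (D \<otimes>\<^sub>o E) S (\<lambda>q. ?N q p)"
      by (rule K.lin_ap_right) (use that in simp_all)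
    then show ?thesis by (rule K.lin_cong) auto
  qed
  have Np: "K.lin ({0, 1} \<union> fst q) (G \<otimes>\<^sub>o F) S (\<lambda>p. ?N q p)" if "K.el (D \<otimes>\<^sub>o E) q" "{0, 1} \<inter> fst q = {}" for q
  proof -
    have "K.lin (fst q \<union> {}) (G \<otimes>\<^sub>o F) ((D \<otimes>\<^sub>o E) \<otimes>\<^sub>o G \<otimes>\<^sub>o F) (\<lambda>p. ap (id\<^sub>a ((D \<otimes>\<^sub>o E) \<otimes>\<^sub>o G \<otimes>\<^sub>o F)) (K.eprod q p))"
      by (rule K.lin_ap_right[OF K.lin_id]) (use that in simp_all)
    then have "K.lin (fst q) (G \<otimes>\<^sub>o F) ((D \<otimes>\<^sub>o E) \<otimes>\<^sub>o G \<otimes>\<^sub>o F) (\<lambda>p. K.eprod q p)"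
      by (rule K.lin_cong) (use that in \<open>auto simp: dj_def\<close>)
    then have "K.lin (fst ?xy \<union> fst q) (G \<otimes>\<^sub>o F) S (\<lambda>p. ?N q p)"
      by (rule K.lin_ap_right) (use that in simp_all)
    then show ?thesis by (rule K.lin_cong) auto
  qed
  have N: "?N ?q p = K.mul (ap a (K.eprod ?x ?e)) (ap (mmh D Y G F b c) (K.eprod (K.eprod ?d ?y) p))"
    if "K.el (G \<otimes>\<^sub>o F) p" "fst p \<inter> {0, 1, 4, 5} = {}" for p
    using that by (simp add: K.mul_def dj_def)
  have lmm: "K.lin {0, 1} (D \<otimes>\<^sub>o E) S (\<lambda>q. ap (mmh X Y D E a ?R) (K.eprod ?xy q))"
    by (rule K.lin_cong[OF K.lin_mmh]) (simp_all add: insert_commute)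
  have R: "ap ?r ?xy = ?N ?Q ?P"
  proof -
    have "ap (mmh X Y D E a ?R) (K.eprod ?xy ?Q) = ?N ?Q ?P"
    proof (rule K.lin_ext[OF lmm])
      show "K.lin {0, 1} (D \<otimes>\<^sub>o E) S (\<lambda>q. ?N q ?P)" using Nq[of ?P] by simp
      show "ap (mmh X Y D E a ?R) (K.eprod ?xy ?q) = ?N ?q ?P"
        by (subst N) (simp_all add: K.ap_mmh K.ap_mm)
    qed (use iso in simp_all)
    then show ?thesis by (simp add: K.ap_mm)
  qed
  have lmp: "K.lin {0, 1} (G \<otimes>\<^sub>o F) S (\<lambda>p. ap (mmh X Y G F ?L c) (K.eprod ?xy p))"
    by (rule K.lin_cong[OF K.lin_mmh]) (simp_all add: insert_commute)
  have "ap (mmh X Y G F ?L c) (K.eprod ?xy ?P) = ?N ?Q ?P"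
  proof (rule K.lin_ext[OF lmp])
    show "K.lin {0, 1} (G \<otimes>\<^sub>o F) S (\<lambda>p. ?N ?Q p)" using Np[of ?Q] by simp
    have "K.lin {0, 3} (D \<otimes>\<^sub>o E) S (\<lambda>q. ap (mmh X F D E a b) (K.eprod (K.eprod ?x ?f) q))"
      by (rule K.lin_cong[OF K.lin_mmh]) (simp_all add: insert_commute)
    then have "K.lin (fst (ap c (K.eprod ?g ?y)) \<union> {0, 3}) (D \<otimes>\<^sub>o E) S (\<lambda>q. K.mul (ap (mmh X F D E a b) (K.eprod (K.eprod ?x ?f) q)) (ap c (K.eprod ?g ?y)))"
      by (rule K.lin_mul_left) simp_all
    then have li: "K.lin {0, 1, 2, 3} (D \<otimes>\<^sub>o E) S (\<lambda>q. K.mul (ap (mmh X F D E a b) (K.eprod (K.eprod ?x ?f) q)) (ap c (K.eprod ?g ?y)))"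
      by (rule K.lin_cong) auto
    \<comment> \<open>On this side the inner contraction sits inside the outer one: it is evaluated
      while the outer pair is still a pair of variables, and the outer replacement follows.\<close>
    have "K.mul (ap (mmh X F D E a b) (K.eprod (K.eprod ?x ?f) ?Q)) (ap c (K.eprod ?g ?y)) = ?N ?Q ?p"
    proof (rule K.lin_ext[OF li])
      show "K.lin {0, 1, 2, 3} (D \<otimes>\<^sub>o E) S (\<lambda>q. ?N q ?p)"
        by (rule K.lin_cong[OF Nq]) auto
      show "K.mul (ap (mmh X F D E a b) (K.eprod (K.eprod ?x ?f) ?q)) (ap c (K.eprod ?g ?y)) = ?N ?q ?p"
        by (subst N) (simp_all add: K.ap_mmh K.mul_assoc)
    qed (use iso in simp_all)
    then show "ap (mmh X Y G F ?L c) (K.eprod ?xy ?p) = ?N ?Q ?p"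
      by (simp add: K.ap_mmh K.ap_mm)
  qed (use iso in simp_all)
  then have L: "ap ?l ?xy = ?N ?Q ?P" by (simp add: K.ap_mm)
  show ?thesis
    by (rule K.isoE_cancel[OF trans[OF L R[symmetric]] iso(3)]) simp_all
qed

end

section \<open>The bracket on generators\<close>

context bctx
begin

lemma lin_br_right: "\<lbrakk>lin M X S F; el S t; fst t \<inter> M = {}; X \<in> Obj C\<rbrakk> \<Longrightarrow> lin (fst t \<union> M) X S (\<lambda>p. br t (F p))"
  unfolding br_def by (rule lin_ap_right[where B = S and D = S]) simp_all

end

text \<open>Two arrows in involution, freed from the quiver: \<open>A\<close>, \<open>A'\<close>
  stand for the object at the first vertex and its dual, \<open>B\<close>, \<open>B'\<close> for
  those at the second. The pairing is part of \<open>P\<close>, so the formula for the bracket has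
  no scalar.\<close>

locale arrow_pair = free_cm C R h S \<iota>
  for C :: "('r, 'o, 'm, 'x) lsmcat_scheme" (structure) and R :: "('r, 'y) ring_scheme" and h S \<iota> +
  fixes d :: 'm and A A' B B' :: 'o and a b P Q :: 'm
  assumes bider: "bi_derivation C S \<mu> (free_unit \<iota>) d"
    and o [simp]: "A \<in> Obj C" "A' \<in> Obj C" "B \<in> Obj C" "B' \<in> Obj C"
    and a [simp]: "a \<in> Arr C" "Dom C a = A \<otimes>\<^sub>o B'" "Cod C a = S"
    and b [simp]: "b \<in> Arr C" "Dom C b = B \<otimes>\<^sub>o A'" "Cod C b = S"
    and P [simp]: "P \<in> Arr C" "Dom C P = \<I>" "Cod C P = A \<otimes>\<^sub>o A'"
    and Q [simp]: "Q \<in> Arr C" "Dom C Q = \<I>" "Cod C Q = B \<otimes>\<^sub>o B'"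
    and bracket_aa: "d \<cdot> (a \<otimes>\<^sub>a a) = HZero C ((A \<otimes>\<^sub>o B') \<otimes>\<^sub>o (A \<otimes>\<^sub>o B')) S"
    and bracket_ab: "d \<cdot> (a \<otimes>\<^sub>a b) =
      \<mu> \<cdot> (mm A A' B B' a b Q \<otimes>\<^sub>a mm B B' A A' b a P) \<cdot> twist A B' B A'"
begin

abbreviation U :: 'm where "U \<equiv> mm B B' A A' b a P"
abbreviation V :: 'm where "V \<equiv> mm A A' B B' a b Q"
abbreviation W :: 'm where "W \<equiv> mm A B' A A' V a P"

lemma d_arr [simp]: "d \<in> Arr C" "Dom C d = S \<otimes>\<^sub>o S" "Cod C d = S"
  using bi_derivation_arr[OF bider] .

text \<open>The bracket of \<open>a\<close> with \<open>U\<close> produces one bracketing of the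
  triple product of \<open>a\<close>, \<open>b\<close>, \<open>a\<close>, and the bracket with
  \<open>V\<close> produces the other; their equality is what makes the Jacobi identity
  work.\<close>

lemma W_eq: "W = mm A B' B B' a U Q"
  by (rule mm_assoc) simp_all

end

locale arrow_pair_ctx = arrow_pair C R h S \<iota> d A A' B B' a b P Q + bctx C R h S \<iota> \<Gamma> d
  for C :: "('r, 'o, 'm, 'x) lsmcat_scheme" (structure) and R :: "('r, 'y) ring_scheme" and h S \<iota> \<Gamma> d A A' B B' a b P Q
begin

lemma br_aa:
  assumes "el (A \<otimes>\<^sub>o B') x" "el (A \<otimes>\<^sub>o B') y" "dj x y"
  shows "br (ap a x) (ap a y) = ezero S (fst x \<union> fst y)"
proof -
  have "ap (d \<cdot> (a \<otimes>\<^sub>a a)) (x \<bowtie> y) = ap (HZero C ((A \<otimes>\<^sub>o B') \<otimes>\<^sub>o (A \<otimes>\<^sub>o B')) S) (x \<bowtie> y)"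
    by (simp only: bracket_aa)
  then show ?thesis using assms by (simp add: br_def)
qed

lemma br_ab:
  assumes "el A v" "el B' p" "el B w" "el A' q" "dj v p" "dj v w" "dj v q" "dj p w" "dj p q" "dj w q"
  shows "br (ap a (v \<bowtie> p)) (ap b (w \<bowtie> q)) = ap V (v \<bowtie> q) \<star> ap U (w \<bowtie> p)"
proof -
  have "ap (d \<cdot> (a \<otimes>\<^sub>a b)) ((v \<bowtie> p) \<bowtie> (w \<bowtie> q)) = ap (\<mu> \<cdot> (V \<otimes>\<^sub>a U) \<cdot> twist A B' B A') ((v \<bowtie> p) \<bowtie> (w \<bowtie> q))"
    by (simp only: bracket_ab)
  then show ?thesis using assms assms(5-10)[THEN dj_sym] by (simp add: br_def mul_def)
qed

end

context arrow_pair
begin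

lemma arrow_pair_ctxI: "ctx C \<Gamma> \<Longrightarrow> arrow_pair_ctx C R h S \<iota> \<Gamma> d A A' B B' a b P Q"
  by (simp add: arrow_pair_ctx_def arrow_pair_axioms bctxI bider)

text \<open>With a pair of variables e, e' for the contraction, the Leibniz rule gives
  \<open>{a(v,p), b(w,e')} a(e,q)\<close>, as the bracket of \<open>a\<close> with itself vanishes.
  This is \<open>V(v,e') U(w,p) a(e,q)\<close>, and contracting over e, e' turns the outer two
  factors into \<open>W(v,q)\<close>.\<close>

lemma bracket_aU: "d \<cdot> (a \<otimes>\<^sub>a U) = \<mu> \<cdot> (W \<otimes>\<^sub>a U) \<cdot> twist A B' B B'"
proof -
  have ctx: "ctx C [A, B', B, B', A, A']" by unfold_locales simp
  interpret K: arrow_pair_ctx C R h S \<iota> "[A, B', B, B', A, A']" by (rule arrow_pair_ctxI[OF ctx])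
  let ?v = "K.gen 0" and ?p = "K.gen 1" and ?w = "K.gen 2" and ?q = "K.gen 3" and ?e = "K.gen 4" and ?e' = "K.gen 5"
  let ?g = "K.eprod ?e ?e'" and ?a = "ap a (K.eprod ?v ?p)" and ?u = "ap U (K.eprod ?w ?p)"
  have e [simp]: "K.el A ?v" "K.el B' ?p" "K.el B ?w" "K.el B' ?q" "K.el A ?e" "K.el A' ?e'" by simp_all
  have iso: "K.isoE ?g" "K.isoE (K.eprod ?v ?p)" "K.isoE (K.eprod ?w ?q)"
    by (rule K.isoE_eprod[OF _ _ e(1,2)] K.isoE_eprod[OF _ _ e(3,4)] K.isoE_eprod[OF _ _ e(5,6)]; simp)+
  have iso': "K.isoE (K.eprod (K.eprod ?v ?p) (K.eprod ?w ?q))"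
    by (rule K.isoE_eprod[OF iso(2,3) K.el_eprod[OF e(1,2)] K.el_eprod[OF e(3,4)]]) simp_all
  have "K.lin (fst ?a \<union> (fst ?w \<union> fst ?q)) (A \<otimes>\<^sub>o A') S (\<lambda>p. K.br ?a (ap (mmh B B' A A' b a) (K.eprod (K.eprod ?w ?q) p)))"
    by (rule K.lin_br_right[OF K.lin_mmh]) simp_all
  then have l: "K.lin {0, 1, 2, 3} (A \<otimes>\<^sub>o A') S (\<lambda>p. K.br ?a (ap (mmh B B' A A' b a) (K.eprod (K.eprod ?w ?q) p)))"
    by (rule K.lin_cong) auto
  have "K.lin (fst ?u \<union> (fst ?v \<union> fst ?q)) (A \<otimes>\<^sub>o A') S (\<lambda>p. K.mul (ap (mmh A B' A A' V a) (K.eprod (K.eprod ?v ?q) p)) ?u)"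
    by (rule K.lin_mul_left[OF K.lin_mmh]) simp_all
  then have r: "K.lin {0, 1, 2, 3} (A \<otimes>\<^sub>o A') S (\<lambda>p. K.mul (ap (mmh A B' A A' V a) (K.eprod (K.eprod ?v ?q) p)) ?u)"
    by (rule K.lin_cong) auto
  have "K.br ?a (ap (mmh B B' A A' b a) (K.eprod (K.eprod ?w ?q) (ap P K.eunit)))
      = K.mul (ap (mmh A B' A A' V a) (K.eprod (K.eprod ?v ?q) (ap P K.eunit))) ?u"
    by (rule K.lin_ext[OF l r _ iso(1)])
      (simp_all add: K.ap_mmh K.br_mul_right K.br_ab K.br_aa K.mul_ezero K.eadd_ezero K.mul_ac Un_ac insert_commute)
  then have "ap (d \<cdot> (a \<otimes>\<^sub>a U)) (K.eprod (K.eprod ?v ?p) (K.eprod ?w ?q))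
      = ap (\<mu> \<cdot> (W \<otimes>\<^sub>a U) \<cdot> twist A B' B B') (K.eprod (K.eprod ?v ?p) (K.eprod ?w ?q))"
    by (simp add: K.ap_mm K.br_def[symmetric] K.mul_def[symmetric])
  then show ?thesis
    by (rule K.isoE_cancel[OF _ iso']) simp_all
qed

text \<open>Here the Leibniz rule leaves \<open>a(w,f') {a(v,p), b(f,q)}\<close>, which is
  \<open>a(w,f') V(v,q) U(f,p)\<close>. Contraction over f, f' combines the first and last factors
  into the other bracketing of the triple product, which \<open>W_eq\<close> identifies with
  \<open>W\<close>.\<close>

lemma bracket_aV: "d \<cdot> (a \<otimes>\<^sub>a V) = \<mu> \<cdot> (V \<otimes>\<^sub>a W) \<cdot> twist A B' A A'"
proof -
  have ctx: "ctx C [A, B', A, A', B, B']" by unfold_locales simp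
  interpret K: arrow_pair_ctx C R h S \<iota> "[A, B', A, A', B, B']" by (rule arrow_pair_ctxI[OF ctx])
  let ?v = "K.gen 0" and ?p = "K.gen 1" and ?w = "K.gen 2" and ?q = "K.gen 3" and ?f = "K.gen 4" and ?f' = "K.gen 5"
  let ?g = "K.eprod ?f ?f'" and ?a = "ap a (K.eprod ?v ?p)" and ?u = "ap V (K.eprod ?v ?q)"
  have e [simp]: "K.el A ?v" "K.el B' ?p" "K.el A ?w" "K.el A' ?q" "K.el B ?f" "K.el B' ?f'" by simp_all
  have iso: "K.isoE ?g" "K.isoE (K.eprod ?v ?p)" "K.isoE (K.eprod ?w ?q)"
    by (rule K.isoE_eprod[OF _ _ e(1,2)] K.isoE_eprod[OF _ _ e(3,4)] K.isoE_eprod[OF _ _ e(5,6)]; simp)+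
  have iso': "K.isoE (K.eprod (K.eprod ?v ?p) (K.eprod ?w ?q))"
    by (rule K.isoE_eprod[OF iso(2,3) K.el_eprod[OF e(1,2)] K.el_eprod[OF e(3,4)]]) simp_all
  have "K.lin (fst ?a \<union> (fst ?w \<union> fst ?q)) (B \<otimes>\<^sub>o B') S (\<lambda>p. K.br ?a (ap (mmh A A' B B' a b) (K.eprod (K.eprod ?w ?q) p)))"
    by (rule K.lin_br_right[OF K.lin_mmh]) simp_all
  then have l: "K.lin {0, 1, 2, 3} (B \<otimes>\<^sub>o B') S (\<lambda>p. K.br ?a (ap (mmh A A' B B' a b) (K.eprod (K.eprod ?w ?q) p)))"
    by (rule K.lin_cong) auto
  have "K.lin (fst ?u \<union> (fst ?w \<union> fst ?p)) (B \<otimes>\<^sub>o B') S (\<lambda>p. K.mul ?u (ap (mmh A B' B B' a U) (K.eprod (K.eprod ?w ?p) p)))"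
    by (rule K.lin_mul_right[OF K.lin_mmh]) simp_all
  then have r: "K.lin {0, 1, 2, 3} (B \<otimes>\<^sub>o B') S (\<lambda>p. K.mul ?u (ap (mmh A B' B B' a U) (K.eprod (K.eprod ?w ?p) p)))"
    by (rule K.lin_cong) auto
  have "K.br ?a (ap (mmh A A' B B' a b) (K.eprod (K.eprod ?w ?q) (ap Q K.eunit)))
      = K.mul ?u (ap (mmh A B' B B' a U) (K.eprod (K.eprod ?w ?p) (ap Q K.eunit)))"
    by (rule K.lin_ext[OF l r _ iso(1)])
      (simp_all add: K.ap_mmh K.br_mul_right K.br_ab K.br_aa K.mul_ezero K.eadd_ezero K.mul_ac Un_ac insert_commute)
  then have "ap (d \<cdot> (a \<otimes>\<^sub>a V)) (K.eprod (K.eprod ?v ?p) (K.eprod ?w ?q))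
      = ap (\<mu> \<cdot> (V \<otimes>\<^sub>a W) \<cdot> twist A B' A A') (K.eprod (K.eprod ?v ?p) (K.eprod ?w ?q))"
    by (simp add: W_eq K.ap_mm K.br_def[symmetric] K.mul_def[symmetric])
  then show ?thesis
    by (rule K.isoE_cancel[OF _ iso']) simp_all
qed

text \<open>For (v,p) and (v',p') from \<open>a\<close> and (w,q) from \<open>b\<close>, both sides
  are \<open>V(v,q) W(v',p) U(w,p') + V(v',q) W(v,p') U(w,p)\<close>. The two summands are
  interchanged when (v,p) and (v',p') are.\<close>

lemma bracket_aab:
  "d \<cdot> (a \<otimes>\<^sub>a (d \<cdot> (a \<otimes>\<^sub>a b))) = (d \<cdot> (a \<otimes>\<^sub>a (d \<cdot> (a \<otimes>\<^sub>a b)))) \<cdot> swap_front C (A \<otimes>\<^sub>o B') (A \<otimes>\<^sub>o B') (B \<otimes>\<^sub>o A')"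
proof -
  have ctx: "ctx C [A, B', A, B', B, A']" by unfold_locales simp
  interpret K: arrow_pair_ctx C R h S \<iota> "[A, B', A, B', B, A']" by (rule arrow_pair_ctxI[OF ctx])
  let ?v = "K.gen 0" and ?p = "K.gen 1" and ?v' = "K.gen 2" and ?p' = "K.gen 3" and ?w = "K.gen 4" and ?q = "K.gen 5"
  have e [simp]: "K.el A ?v" "K.el B' ?p" "K.el A ?v'" "K.el B' ?p'" "K.el B ?w" "K.el A' ?q" by simp_all
  let ?x = "K.eprod ?v ?p" and ?x' = "K.eprod ?v' ?p'" and ?y = "K.eprod ?w ?q"
  have iso: "K.isoE ?x" "K.isoE ?x'" "K.isoE ?y"
    by (rule K.isoE_eprod[OF _ _ e(1,2)] K.isoE_eprod[OF _ _ e(3,4)] K.isoE_eprod[OF _ _ e(5,6)]; simp)+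
  have ex: "K.el (A \<otimes>\<^sub>o B') ?x" "K.el (A \<otimes>\<^sub>o B') ?x'" "K.el (B \<otimes>\<^sub>o A') ?y" by simp_all
  have "K.isoE (K.eprod ?x' ?y)" "K.el ((A \<otimes>\<^sub>o B') \<otimes>\<^sub>o B \<otimes>\<^sub>o A') (K.eprod ?x' ?y)"
    by (rule K.isoE_eprod[OF iso(2,3) ex(2,3)], simp) simp
  then have iso': "K.isoE (K.eprod ?x (K.eprod ?x' ?y))"
    by (rule K.isoE_eprod[OF iso(1) _ ex(1)]) simp
  have aU: "K.br (ap a (K.eprod v p)) (ap U (K.eprod w p')) = K.mul (ap W (K.eprod v p')) (ap U (K.eprod w p))"
    if "K.el A v" "K.el B' p" "K.el B w" "K.el B' p'" "dj v p" "dj v w" "dj v p'" "dj p w" "dj p p'" "dj w p'" for v p w p'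
  proof -
    have "ap (d \<cdot> (a \<otimes>\<^sub>a U)) (K.eprod (K.eprod v p) (K.eprod w p')) = ap (\<mu> \<cdot> (W \<otimes>\<^sub>a U) \<cdot> twist A B' B B') (K.eprod (K.eprod v p) (K.eprod w p'))"
      by (simp only: bracket_aU)
    then show ?thesis using that that(5-10)[THEN dj_sym] by (simp add: K.br_def K.mul_def)
  qed
  have aV: "K.br (ap a (K.eprod v p)) (ap V (K.eprod v' q)) = K.mul (ap V (K.eprod v q)) (ap W (K.eprod v' p))"
    if "K.el A v" "K.el B' p" "K.el A v'" "K.el A' q" "dj v p" "dj v v'" "dj v q" "dj p v'" "dj p q" "dj v' q" for v p v' q
  proof -
    have "ap (d \<cdot> (a \<otimes>\<^sub>a V)) (K.eprod (K.eprod v p) (K.eprod v' q)) = ap (\<mu> \<cdot> (V \<otimes>\<^sub>a W) \<cdot> twist A B' A A') (K.eprod (K.eprod v p) (K.eprod v' q))"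
      by (simp only: bracket_aV)
    then show ?thesis using that that(5-10)[THEN dj_sym] by (simp add: K.br_def K.mul_def)
  qed
  have "K.br (ap a ?x) (K.br (ap a ?x') (ap b ?y)) = K.br (ap a ?x') (K.br (ap a ?x) (ap b ?y))"
    by (simp add: K.br_ab K.br_mul_right aU aV K.mul_ac K.eadd_ac Un_ac insert_commute)
  then have "ap (d \<cdot> (a \<otimes>\<^sub>a (d \<cdot> (a \<otimes>\<^sub>a b)))) (K.eprod ?x (K.eprod ?x' ?y))
      = ap ((d \<cdot> (a \<otimes>\<^sub>a (d \<cdot> (a \<otimes>\<^sub>a b)))) \<cdot> swap_front C (A \<otimes>\<^sub>o B') (A \<otimes>\<^sub>o B') (B \<otimes>\<^sub>o A')) (K.eprod ?x (K.eprod ?x' ?y))"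
    by (simp add: K.br_def)
  then show ?thesis
    by (rule K.isoE_cancel[OF _ iso']) simp_all
qed

end

subsection \<open>Evaluation of \<open>kappa\<close>\<close>

abbreviation flat :: "('a \<times> 'a) list \<Rightarrow> 'a list" where
  "flat ps \<equiv> concat (map (\<lambda>(u, v). [u, v]) ps)"

context symmetric_monoidal_category
begin

lemma unpair_arr [simp]:
  assumes "set (flat ps) \<subseteq> Obj C"
  shows "unpair C ps \<in> Arr C" "Dom C (unpair C ps) = tens C (map (\<lambda>(u, v). u \<otimes>\<^sub>o v) ps)"
    "Cod C (unpair C ps) = tens C (flat ps)" "is_iso C (unpair C ps)"
proof -
  have "unpair C ps \<in> Arr C \<and> Dom C (unpair C ps) = tens C (map (\<lambda>(u, v). u \<otimes>\<^sub>o v) ps) \<and>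
    Cod C (unpair C ps) = tens C (flat ps) \<and> is_iso C (unpair C ps)"
    using assms
  proof (induction ps)
    case (Cons p ps)
    obtain x y where p: "p = (x, y)" by (cases p)
    have "x \<in> Obj C" "y \<in> Obj C" "set (flat ps) \<subseteq> Obj C" using Cons.prems p by auto
    then show ?case using Cons.IH p by (simp del: set_concat)
  qed simp
  then show "unpair C ps \<in> Arr C" "Dom C (unpair C ps) = tens C (map (\<lambda>(u, v). u \<otimes>\<^sub>o v) ps)"
    "Cod C (unpair C ps) = tens C (flat ps)" "is_iso C (unpair C ps)" by blast+
qed

end

context ctx
begin

lemma els_pairs: "\<lbrakk>els (flat ps) (flat qs); length ps = length qs\<rbrakk>
    \<Longrightarrow> els (map (\<lambda>(u, v). u \<otimes>\<^sub>o v) ps) (map (\<lambda>(u, v). u \<bowtie> v) qs)"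
proof (induction ps arbitrary: qs)
  case (Cons p ps)
  then obtain a b qs' x y where [simp]: "qs = (a, b) # qs'" "p = (x, y)"
    by (cases qs; cases p) auto
  have e: "el x a" "el y b" "dj a b" "\<forall>c \<in> set (flat qs'). dj a c" "\<forall>c \<in> set (flat qs'). dj b c" "els (flat ps) (flat qs')"
    using Cons.prems by auto
  have "\<forall>c \<in> set (map (\<lambda>(u, v). u \<bowtie> v) qs'). dj (a \<bowtie> b) c"
    using e(4,5) by fastforce
  then show ?case using Cons e by simp
qed simp

lemma dj_pairs:
  assumes "\<forall>c \<in> set (flat qs). dj a c"
  shows "dj a (tensE (map (\<lambda>(u, v). u \<bowtie> v) qs))"
  using assms by fastforce

lemma ap_unpair:
  "\<lbrakk>els (flat ps) (flat qs); length ps = length qs\<rbrakk>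
    \<Longrightarrow> ap (unpair C ps) (tensE (map (\<lambda>(u, v). u \<bowtie> v) qs)) = tensE (flat qs)"
proof (induction ps arbitrary: qs)
  case (Cons p ps)
  then obtain a b qs' x y where [simp]: "qs = (a, b) # qs'" "p = (x, y)"
    by (cases qs; cases p) auto
  have e: "el x a" "el y b" "dj a b" "\<forall>c \<in> set (flat qs'). dj a c" "\<forall>c \<in> set (flat qs'). dj b c" "els (flat ps) (flat qs')"
    using Cons.prems by auto
  have l: "length ps = length qs'" using Cons.prems by simp
  note [simp] = el_Obj[OF e(1)] el_Obj[OF e(2)] els_Obj[OF e(6)]
  have "el (tens C (map (\<lambda>(u, v). u \<otimes>\<^sub>o v) ps)) (tensE (map (\<lambda>(u, v). u \<bowtie> v) qs'))"
    by (rule el_tensE[OF els_pairs[OF e(6) l]])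
  moreover have "el (tens C (flat ps)) (tensE (flat qs'))" by (rule el_tensE[OF e(6)])
  moreover have "dj a (tensE (flat qs'))" "dj b (tensE (flat qs'))" using e(4,5) by (simp_all del: set_concat)
  ultimately show ?case
    using e(1-3) dj_pairs[OF e(4)] dj_pairs[OF e(5)] Cons.IH[OF e(6) l]
    by (simp del: dj_tensE set_concat)
qed simp

lemma ap_pair_up:
  assumes "els (flat ps) (flat qs)" "length ps = length qs"
  shows "ap (pair_up C ps) (tensE (flat qs)) = tensE (map (\<lambda>(u, v). u \<bowtie> v) qs)"
  unfolding pair_up_def
  by (rule ap_inv[OF _ ap_unpair[OF assms]])
    (simp_all add: els_Obj[OF assms(1)] el_tensE[OF els_pairs[OF assms]] del: set_concat)

lemma lin_eprod_left:
  assumes "lin M A B F" "el D t" "fst t \<inter> M = {}" "A \<in> Obj C" "B \<in> Obj C"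
  shows "lin (fst t \<union> M) A (D \<otimes>\<^sub>o B) (\<lambda>p. t \<bowtie> F p)"
proof -
  note [simp] = el_Obj[OF assms(2)]
  have "lin (fst t \<union> M) A (D \<otimes>\<^sub>o B) (\<lambda>p. ap (id\<^sub>a (D \<otimes>\<^sub>o B)) (t \<bowtie> F p))"
    by (rule lin_ap_right[OF assms(1-3)]) (use assms in simp_all)
  then show ?thesis
  proof (rule lin_cong[OF _ refl])
    fix p assume p: "el A p" "(fst t \<union> M) \<inter> fst p = {}"
    have F: "el B (F p)" "fst (F p) = M \<union> fst p" using p by (intro lin_el[OF assms(1)]; auto)+
    then have "dj t (F p)" using p assms(3) by (auto simp: dj_def)
    then show "ap (id\<^sub>a (D \<otimes>\<^sub>o B)) (t \<bowtie> F p) = t \<bowtie> F p" using F assms(2) by simp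
  qed
qed

lemma lin_eprod_right:
  assumes "lin M A B F" "el D t" "fst t \<inter> M = {}" "A \<in> Obj C" "B \<in> Obj C"
  shows "lin (fst t \<union> M) A (B \<otimes>\<^sub>o D) (\<lambda>p. F p \<bowtie> t)"
proof -
  note [simp] = el_Obj[OF assms(2)]
  have "lin (fst t \<union> M) A (B \<otimes>\<^sub>o D) (\<lambda>p. ap (id\<^sub>a (B \<otimes>\<^sub>o D)) (F p \<bowtie> t))"
    by (rule lin_ap_left[OF assms(1-3)]) (use assms in simp_all)
  then show ?thesis
  proof (rule lin_cong[OF _ refl])
    fix p assume p: "el A p" "(fst t \<union> M) \<inter> fst p = {}"
    have F: "el B (F p)" "fst (F p) = M \<union> fst p" using p by (intro lin_el[OF assms(1)]; auto)+
    then have "dj (F p) t" using p assms(3) by (auto simp: dj_def)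
    then show "ap (id\<^sub>a (B \<otimes>\<^sub>o D)) (F p \<bowtie> t) = F p \<bowtie> t" using F assms(2) by simp
  qed
qed

lemma lin_ap:
  assumes "lin M A B F" "f \<in> Arr C" "Dom C f = B" "Cod C f = Y" "A \<in> Obj C"
  shows "lin M A Y (\<lambda>p. ap f (F p))"
proof -
  have B [simp]: "B \<in> Obj C" using Dom_Cod_Obj(1)[OF assms(2)] assms(3) by simp
  have "lin (fst eunit \<union> M) A Y (\<lambda>p. ap (f \<cdot> \<lambda>\<^sub>u B) (eunit \<bowtie> F p))"
    by (rule lin_ap_right[OF assms(1)]) (use assms in simp_all)
  then show ?thesis
  proof (rule lin_cong)
    fix p assume p: "el A p" "(fst eunit \<union> M) \<inter> fst p = {}"
    have "el B (F p)" using p by (intro lin_el[OF assms(1)]; auto)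
    then show "ap (f \<cdot> \<lambda>\<^sub>u B) (eunit \<bowtie> F p) = ap f (F p)" using assms by simp
  qed simp
qed

end

context free_cm
begin

text \<open>The arrangement occurring in \<open>kappa\<close>, named so that the composite of eight
  pulls stays folded and only its effect on lists of elements is used. Entries 4 to 7 are the legs
  of the coevaluations, in the order in which they were appended.\<close>

definition kappa_perm :: "nat list" where
  "kappa_perm = [4, 1, 0, 7, 6, 3, 2, 5]"

lemma arrangement_kappa: "length xs = 8 \<Longrightarrow> is_arrangement (length xs) kappa_perm"
  by (auto simp: is_arrangement_def kappa_perm_def)

lemma map_kappa_perm: "map ((!) [x0, x1, x2, x3, x4, x5, x6, x7]) kappa_perm = [x4, x1, x0, x7, x6, x3, x2, x5]"
  by (simp add: kappa_perm_def)

lemma tens_perm_kappa [simp]: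
  assumes "set [x0, x1, x2, x3, x4, x5, x6, x7] \<subseteq> Obj C"
  shows "tens_perm C [x0, x1, x2, x3, x4, x5, x6, x7] kappa_perm \<in> Arr C"
    "Dom C (tens_perm C [x0, x1, x2, x3, x4, x5, x6, x7] kappa_perm) = tens C [x0, x1, x2, x3, x4, x5, x6, x7]"
    "Cod C (tens_perm C [x0, x1, x2, x3, x4, x5, x6, x7] kappa_perm) = tens C [x4, x1, x0, x7, x6, x3, x2, x5]"
  using tens_perm_arr[OF arrangement_kappa assms] by (simp_all only: map_kappa_perm) simp_all

text \<open>\<open>kappa\<close> without the coevaluations, which become two further arguments.\<close>

definition kappa_core :: "'o \<Rightarrow> 'o \<Rightarrow> 'o \<Rightarrow> 'o \<Rightarrow> 'm" where
  "kappa_core A A' B B' = pair_up C [(A, B'), (A, B'), (B, A'), (B, A')] \<cdot>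
     tens_perm C [A, B', B, A', A, A', B, B'] kappa_perm \<cdot>
     unpair C [(A, B'), (B, A'), (A, A'), (B, B')]"

lemma kappa_core_arr [simp]:
  assumes [simp]: "A \<in> Obj C" "A' \<in> Obj C" "B \<in> Obj C" "B' \<in> Obj C"
  shows "kappa_core A A' B B' \<in> Arr C"
    "Dom C (kappa_core A A' B B') = tens C [A \<otimes>\<^sub>o B', B \<otimes>\<^sub>o A', A \<otimes>\<^sub>o A', B \<otimes>\<^sub>o B']"
    "Cod C (kappa_core A A' B B') = tens C [A \<otimes>\<^sub>o B', A \<otimes>\<^sub>o B', B \<otimes>\<^sub>o A', B \<otimes>\<^sub>o A']"
  by (simp_all add: kappa_core_def pair_up_def del: unpair.simps)

end

context fctx
begin

lemma ap_kappa_core: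
  assumes e: "els [A, B', B, A', A, A', B, B'] [v, p, w, q, e, e', f, f']"
  shows "ap (kappa_core A A' B B') (tensE [v \<bowtie> p, w \<bowtie> q, e \<bowtie> e', f \<bowtie> f'])
    = tensE [e \<bowtie> p, v \<bowtie> f', f \<bowtie> q, w \<bowtie> e']"
proof -
  let ?ps = "[(A, B'), (B, A'), (A, A'), (B, B')]" and ?qs = "[(v, p), (w, q), (e, e'), (f, f')]"
  let ?Xs = "[A, B', B, A', A, A', B, B']" and ?as = "[v, p, w, q, e, e', f, f']"
  let ?ps' = "[(A, B'), (A, B'), (B, A'), (B, A')]" and ?qs' = "[(e, p), (v, f'), (f, q), (w, e')]"
  have o [simp]: "A \<in> Obj C" "A' \<in> Obj C" "B \<in> Obj C" "B' \<in> Obj C" using els_Obj[OF e] by auto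
  have u: "ap (unpair C ?ps) (tensE [v \<bowtie> p, w \<bowtie> q, e \<bowtie> e', f \<bowtie> f']) = tensE ?as"
    using ap_unpair[of ?ps ?qs] e by (simp del: unpair.simps tensE_simps)
  have t: "ap (tens_perm C ?Xs kappa_perm) (tensE ?as) = tensE [e, p, v, f', f, q, w, e']"
    using ap_tens_perm[OF e arrangement_kappa] by (simp add: map_kappa_perm del: tensE_simps)
  have e': "els (flat ?ps') (flat ?qs')"
    using els_map_nth[OF e, of kappa_perm] arrangement_kappa[of ?as]
    by (simp add: map_kappa_perm is_arrangement_def del: els_simps)
  have p: "ap (pair_up C ?ps') (tensE [e, p, v, f', f, q, w, e']) = tensE [e \<bowtie> p, v \<bowtie> f', f \<bowtie> q, w \<bowtie> e']"
    using ap_pair_up[OF e'] by (simp del: tensE_simps)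
  have el1: "el (tens C [A \<otimes>\<^sub>o B', B \<otimes>\<^sub>o A', A \<otimes>\<^sub>o A', B \<otimes>\<^sub>o B']) (tensE [v \<bowtie> p, w \<bowtie> q, e \<bowtie> e', f \<bowtie> f'])"
    using el_tensE[OF els_pairs[of ?ps ?qs]] e by simp
  have el2: "el (tens C ?Xs) (tensE ?as)" by (rule el_tensE[OF e])
  have "ap (kappa_core A A' B B') (tensE [v \<bowtie> p, w \<bowtie> q, e \<bowtie> e', f \<bowtie> f']) =
      ap (pair_up C ?ps') (ap (tens_perm C ?Xs kappa_perm) (ap (unpair C ?ps) (tensE [v \<bowtie> p, w \<bowtie> q, e \<bowtie> e', f \<bowtie> f'])))"
    unfolding kappa_core_def using el1 el2 u
    by (simp add: pair_up_def del: unpair.simps tensE_simps tens.simps)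
  then show ?thesis by (simp only: u t p)
qed

lemma ap_kappa:
  assumes [simp]: "A \<in> Obj C" "A' \<in> Obj C" "B \<in> Obj C" "B' \<in> Obj C"
    and [simp]: "P \<in> Arr C" "Dom C P = \<I>" "Cod C P = A \<otimes>\<^sub>o A'" "Q \<in> Arr C" "Dom C Q = \<I>" "Cod C Q = B \<otimes>\<^sub>o B'"
    and e: "el (A \<otimes>\<^sub>o B') x" "el (B \<otimes>\<^sub>o A') y" "dj x y"
  shows "ap (kappa C A A' P B B' Q) (x \<bowtie> y) = ap (kappa_core A A' B B') (tensE [x, y, ap P eunit, ap Q eunit])"
proof -
  let ?ins = "tens_arrow C [P, Q] \<cdot> (id\<^sub>a \<I> \<otimes>\<^sub>a inv\<^sub>a (\<lambda>\<^sub>u \<I>)) \<cdot> inv\<^sub>a (\<lambda>\<^sub>u \<I>)"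
  have k: "kappa C A A' P B B' Q = kappa_core A A' B B' \<cdot> (id\<^sub>a (A \<otimes>\<^sub>o B') \<otimes>\<^sub>a (id\<^sub>a (B \<otimes>\<^sub>o A') \<otimes>\<^sub>a ?ins)) \<cdot>
      (id\<^sub>a (A \<otimes>\<^sub>o B') \<otimes>\<^sub>a inv\<^sub>a (\<rho>\<^sub>u (B \<otimes>\<^sub>o A')))"
    unfolding kappa_def Let_def kappa_core_def kappa_perm_def[symmetric]
    by (simp add: pair_up_def del: unpair.simps)
  show ?thesis unfolding k using e by simp
qed

end

context free_cm
begin

lemma kappa_arr [simp]:
  assumes [simp]: "A \<in> Obj C" "A' \<in> Obj C" "B \<in> Obj C" "B' \<in> Obj C"
    and [simp]: "P \<in> Arr C" "Dom C P = \<I>" "Cod C P = A \<otimes>\<^sub>o A'" "Q \<in> Arr C" "Dom C Q = \<I>" "Cod C Q = B \<otimes>\<^sub>o B'"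
  shows "kappa C A A' P B B' Q \<in> Arr C" "Dom C (kappa C A A' P B B' Q) = (A \<otimes>\<^sub>o B') \<otimes>\<^sub>o B \<otimes>\<^sub>o A'"
    "Cod C (kappa C A A' P B B' Q) = tens C [A \<otimes>\<^sub>o B', A \<otimes>\<^sub>o B', B \<otimes>\<^sub>o A', B \<otimes>\<^sub>o A']"
  unfolding kappa_def Let_def kappa_perm_def[symmetric]
  by (simp_all add: pair_up_def del: unpair.simps)

text \<open>With variables e, e' and f, f' in place of the coevaluations, the four output factors
  are (e,p), (v,f'), (f,q), (w,e'). In the commutative product the second and third combine into the
  contraction over f, f', the fourth and first into the one over e, e'.\<close>

lemma kappa_eq_mm:
  assumes o [simp]: "A \<in> Obj C" "A' \<in> Obj C" "B \<in> Obj C" "B' \<in> Obj C"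
    and P [simp]: "P \<in> Arr C" "Dom C P = \<I>" "Cod C P = A \<otimes>\<^sub>o A'" and Q [simp]: "Q \<in> Arr C" "Dom C Q = \<I>" "Cod C Q = B \<otimes>\<^sub>o B'"
    and i [simp]: "i \<in> Arr C" "Dom C i = A \<otimes>\<^sub>o B'" "Cod C i = h" and j [simp]: "j \<in> Arr C" "Dom C j = B \<otimes>\<^sub>o A'" "Cod C j = h"
  defines "a \<equiv> gencl \<cdot> i" and "b \<equiv> gencl \<cdot> j"
  shows "\<iota> 4 \<cdot> tens_arrow C [i, i, j, j] \<cdot> kappa C A A' P B B' Q
    = \<mu> \<cdot> (mm A A' B B' a b Q \<otimes>\<^sub>a mm B B' A A' b a P) \<cdot> twist A B' B A'" (is "?l = ?r")
proof -
  have ab [simp]: "a \<in> Arr C" "Dom C a = A \<otimes>\<^sub>o B'" "Cod C a = S" "b \<in> Arr C" "Dom C b = B \<otimes>\<^sub>o A'" "Cod C b = S"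
    by (simp_all add: a_def b_def)
  let ?\<Gamma> = "[A, B', B, A', A, A', B, B']"
  have ctx: "ctx C ?\<Gamma>" by unfold_locales simp
  interpret K: fctx C R h S \<iota> ?\<Gamma> by (rule fctxI[OF ctx])
  let ?v = "K.gen 0" and ?p = "K.gen 1" and ?w = "K.gen 2" and ?q = "K.gen 3"
    and ?e = "K.gen 4" and ?e' = "K.gen 5" and ?f = "K.gen 6" and ?f' = "K.gen 7"
  let ?x = "K.eprod ?v ?p" and ?y = "K.eprod ?w ?q" and ?g = "K.eprod ?e ?e'" and ?k = "K.eprod ?f ?f'"
  let ?P = "ap P K.eunit" and ?Q = "ap Q K.eunit"
  have e [simp]: "K.el A ?v" "K.el B' ?p" "K.el B ?w" "K.el A' ?q" "K.el A ?e" "K.el A' ?e'" "K.el B ?f" "K.el B' ?f'" by simp_all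
  have els: "K.els ?\<Gamma> [?v, ?p, ?w, ?q, ?e, ?e', ?f, ?f']" by simp
  have iso: "K.isoE ?x" "K.isoE ?y" "K.isoE ?g" "K.isoE ?k"
    by (rule K.isoE_eprod[OF _ _ e(1,2)] K.isoE_eprod[OF _ _ e(3,4)] K.isoE_eprod[OF _ _ e(5,6)] K.isoE_eprod[OF _ _ e(7,8)]; simp)+
  have ixy: "K.isoE (K.eprod ?x ?y)"
    by (rule K.isoE_eprod[OF iso(1,2) K.el_eprod[OF e(1,2)] K.el_eprod[OF e(3,4)]]) simp_all
  let ?m = "\<iota> 4 \<cdot> tens_arrow C [i, i, j, j] \<cdot> kappa_core A A' B B'"
  have m [simp]: "?m \<in> Arr C" "Dom C ?m = tens C [A \<otimes>\<^sub>o B', B \<otimes>\<^sub>o A', A \<otimes>\<^sub>o A', B \<otimes>\<^sub>o B']" "Cod C ?m = S"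
    by (simp_all add: numeral_eq_Suc)
  let ?G = "\<lambda>p q. ap ?m (K.tensE [?x, ?y, p, q])"
  let ?U = "\<lambda>p. ap (mmh B B' A A' b a) (K.eprod (K.eprod ?w ?p) p)"
  let ?V = "\<lambda>q. ap (mmh A A' B B' a b) (K.eprod (K.eprod ?v ?q) q)"
  have pure: "?G ?g ?k = K.mul (?V ?k) (?U ?g)"
  proof -
    let ?x1 = "ap i (K.eprod ?e ?p)" and ?x2 = "ap i (K.eprod ?v ?f')" and ?y1 = "ap j (K.eprod ?f ?q)" and ?y2 = "ap j (K.eprod ?w ?e')"
    have "?G ?g ?k = ap (\<iota> 4 \<cdot> tens_arrow C [i, i, j, j]) (K.tensE [K.eprod ?e ?p, K.eprod ?v ?f', K.eprod ?f ?q, K.eprod ?w ?e'])"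
      using K.ap_kappa_core[OF els] by (simp add: numeral_eq_Suc)
    also have "\<dots> = ap (\<iota> 4) (K.tensE [?x1, ?x2, ?y1, ?y2])"
      by (simp add: numeral_eq_Suc)
    also have "\<dots> = K.mon [?x1, ?x2, ?y1, ?y2]"
      by (rule K.ap_\<iota>) simp
    also have "\<dots> = K.mul (K.mul (K.mon [?x2]) (K.mon [?y1])) (K.mul (K.mon [?y2]) (K.mon [?x1]))"
      by (simp, rule K.mon_mset) simp_all
    also have "\<dots> = K.mul (?V ?k) (?U ?g)"
      by (simp add: K.ap_mmh a_def b_def K.ap_gencl)
    finally show ?thesis .
  qed
  have Gq: "K.lin ({0, 1, 2, 3} \<union> fst p) (B \<otimes>\<^sub>o B') S (?G p)" if "K.el (A \<otimes>\<^sub>o A') p" "{0, 1, 2, 3} \<inter> fst p = {}" for p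
  proof -
    have "K.lin (fst ?x \<union> (fst ?y \<union> (fst p \<union> (fst K.eunit \<union> {})))) (B \<otimes>\<^sub>o B') S (\<lambda>q. ap ?m (K.eprod ?x (K.eprod ?y (K.eprod p (K.eprod q K.eunit)))))"
      by (rule K.lin_ap[OF K.lin_eprod_left[OF K.lin_eprod_left[OF K.lin_eprod_left[OF K.lin_eprod_right[OF K.lin_id]]]]])
        (use that m in \<open>simp_all del: kappa_core_arr\<close>)
    then show ?thesis by (rule K.lin_cong) auto
  qed
  have Gp: "K.lin ({0, 1, 2, 3} \<union> fst q) (A \<otimes>\<^sub>o A') S (\<lambda>p. ?G p q)" if "K.el (B \<otimes>\<^sub>o B') q" "{0, 1, 2, 3} \<inter> fst q = {}" for q
  proof -
    have "K.lin (fst ?x \<union> (fst ?y \<union> (fst (K.eprod q K.eunit) \<union> {}))) (A \<otimes>\<^sub>o A') S (\<lambda>p. ap ?m (K.eprod ?x (K.eprod ?y (K.eprod p (K.eprod q K.eunit)))))"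
      by (rule K.lin_ap[OF K.lin_eprod_left[OF K.lin_eprod_left[OF K.lin_eprod_right[OF K.lin_id]]]])
        (use that m in \<open>simp_all del: kappa_core_arr\<close>)
    then show ?thesis by (rule K.lin_cong) auto
  qed
  have VU: "K.lin ({0, 1, 2, 3} \<union> fst p) (B \<otimes>\<^sub>o B') S (\<lambda>q. K.mul (?V q) (?U p))" if "K.el (A \<otimes>\<^sub>o A') p" "{0, 1, 2, 3} \<inter> fst p = {}" for p
  proof -
    have "K.lin (fst (?U p) \<union> (fst ?v \<union> fst ?q)) (B \<otimes>\<^sub>o B') S (\<lambda>q. K.mul (?V q) (?U p))"
      by (rule K.lin_mul_left[OF K.lin_mmh]) (use that in \<open>simp_all add: dj_def\<close>)
    then show ?thesis by (rule K.lin_cong) auto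
  qed
  have UV: "K.lin {0, 1, 2, 3} (A \<otimes>\<^sub>o A') S (\<lambda>p. K.mul (?V ?Q) (?U p))"
  proof -
    have "K.lin (fst (?V ?Q) \<union> (fst ?w \<union> fst ?p)) (A \<otimes>\<^sub>o A') S (\<lambda>p. K.mul (?V ?Q) (?U p))"
      by (rule K.lin_mul_right[OF K.lin_mmh]) simp_all
    then show ?thesis by (rule K.lin_cong) auto
  qed
  \<comment> \<open>The coevaluations are substituted one at a time, each by linearity in the
    corresponding argument while the other is held fixed.\<close>
  have gQ: "?G ?g ?Q = K.mul (?V ?Q) (?U ?g)"
    by (rule K.lin_ext[OF Gq[of ?g] VU[of ?g] _ iso(4) _ pure]) simp_all
  have GQ: "K.lin {0, 1, 2, 3} (A \<otimes>\<^sub>o A') S (\<lambda>p. ?G p ?Q)" using Gp[of ?Q] by simp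
  have PQ: "?G ?P ?Q = K.mul (?V ?Q) (?U ?P)"
    by (rule K.lin_ext[OF GQ UV _ iso(3) _ gQ]) simp_all
  have "ap ?l (K.eprod ?x ?y) = ap ?m (K.tensE [?x, ?y, ?P, ?Q])"
  proof -
    have "ap ?l (K.eprod ?x ?y) = ap (\<iota> 4 \<cdot> tens_arrow C [i, i, j, j]) (ap (kappa C A A' P B B' Q) (K.eprod ?x ?y))"
      by (simp add: numeral_eq_Suc)
    also have "\<dots> = ap (\<iota> 4 \<cdot> tens_arrow C [i, i, j, j]) (ap (kappa_core A A' B B') (K.tensE [?x, ?y, ?P, ?Q]))"
      by (subst K.ap_kappa) simp_all
    also have "\<dots> = ap ?m (K.tensE [?x, ?y, ?P, ?Q])"
      by (simp add: numeral_eq_Suc)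
    finally show ?thesis .
  qed
  also have "\<dots> = ap ?r (K.eprod ?x ?y)"
    unfolding PQ by (simp add: K.ap_mm K.mul_def)
  finally show ?thesis
    by (rule K.isoE_cancel[OF _ ixy]) (simp_all add: numeral_eq_Suc)
qed

end

section \<open>Coproducts and jointly epic families\<close>

context symmetric_monoidal_category
begin

lemma coproductD:
  assumes "is_coproduct C I X H j"
  shows "H \<in> Obj C" "i \<in> I \<Longrightarrow> j i \<in> hom_set C (X i) H"
    "\<lbrakk>Y \<in> Obj C; \<And>i. i \<in> I \<Longrightarrow> g i \<in> hom_set C (X i) Y\<rbrakk> \<Longrightarrow> \<exists>!f. f \<in> hom_set C H Y \<and> (\<forall>i \<in> I. f \<cdot> j i = g i)"
  using assms unfolding is_coproduct_def by auto

text \<open>A finite coproduct, once its index set is enumerated, is a universal family without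
  endomorphisms; so the preservation result for such families applies.\<close>

lemma coproduct_TensO:
  assumes inf: "infinite (UNIV :: 'i set)" and cc: "tensor_cocomplete TYPE('i) C"
    and cop: "is_coproduct C I X H j" and I: "finite I" and Z [simp]: "Z \<in> Obj C"
  shows "is_coproduct C I (\<lambda>i. X i \<otimes>\<^sub>o Z) (H \<otimes>\<^sub>o Z) (\<lambda>i. j i \<otimes>\<^sub>a id\<^sub>a Z)"
proof -
  obtain e where e: "bij_betw e {0..<card I} I" using ex_bij_betw_nat_finite[OF I] by blast
  let ?J = "{0..<card I}"
  have H [simp]: "H \<in> Obj C" and j: "\<And>i. i \<in> I \<Longrightarrow> j i \<in> hom_set C (X i) H"
    and ex: "\<And>Y g. \<lbrakk>Y \<in> Obj C; \<forall>i \<in> I. g i \<in> hom_set C (X i) Y\<rbrakk> \<Longrightarrow> \<exists>!f. f \<in> hom_set C H Y \<and> (\<forall>i \<in> I. f \<cdot> j i = g i)"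
    using cop by (auto simp: is_coproduct_def)
  have reindex: "(\<forall>i \<in> I. P i) \<longleftrightarrow> (\<forall>k \<in> ?J. P (e k))" for P
    by (subst bij_betw_imp_surj_on[OF e, symmetric]) simp
  have inv: "inv_into ?J e (e k) = k" if "k \<in> ?J" for k
    using e that by (simp add: bij_betw_def)
  have X: "X i \<in> Obj C" if "i \<in> I" for i using j[OF that] Dom_Cod_Obj(1)[of "j i"] by (auto simp: hom_set_def)
  \<comment> \<open>All sets of endomorphism labels are empty, so the family \<open>r\<close> is
    never evaluated.\<close>
  have "univ_family C ?J (X \<circ> e) (\<lambda>_. {}) (\<lambda>_ _. undefined) H (j \<circ> e)"
    unfolding univ_family_def
  proof (intro conjI allI impI ballI)
    fix Y g
    assume g: "Y \<in> Obj C \<and> (\<forall>k \<in> ?J. g k \<in> hom_set C ((X \<circ> e) k) Y \<and> (\<forall>k' \<in> {}. g k \<cdot> undefined = g k))"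
    have "\<exists>!f. f \<in> hom_set C H Y \<and> (\<forall>i \<in> I. f \<cdot> j i = g (inv_into ?J e i))"
      by (rule ex) (use g in \<open>auto simp: reindex inv\<close>)
    moreover have "(\<forall>i \<in> I. f \<cdot> j i = g (inv_into ?J e i)) \<longleftrightarrow> (\<forall>k \<in> ?J. f \<cdot> (j \<circ> e) k = g k)" for f
      unfolding reindex using inv by auto
    ultimately show "\<exists>!f. f \<in> hom_set C H Y \<and> (\<forall>k \<in> ?J. f \<cdot> (j \<circ> e) k = g k)" by simp
  qed (use j X bij_betwE[OF e] in auto)
  from univ_family_TensO[OF inf cc this Z]
  have u: "\<exists>!f. f \<in> hom_set C (H \<otimes>\<^sub>o Z) Y \<and> (\<forall>k \<in> ?J. f \<cdot> (j (e k) \<otimes>\<^sub>a id\<^sub>a Z) = g k)"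
    if "Y \<in> Obj C" "\<forall>k \<in> ?J. g k \<in> hom_set C (X (e k) \<otimes>\<^sub>o Z) Y" for Y g
    using that unfolding univ_family_def by simp
  show ?thesis unfolding is_coproduct_def
  proof (intro conjI allI impI ballI)
    fix Y g
    assume "Y \<in> Obj C \<and> (\<forall>i \<in> I. g i \<in> hom_set C (X i \<otimes>\<^sub>o Z) Y)"
    then show "\<exists>!f. f \<in> hom_set C (H \<otimes>\<^sub>o Z) Y \<and> (\<forall>i \<in> I. f \<cdot> (j i \<otimes>\<^sub>a id\<^sub>a Z) = g i)"
      using u[of Y "\<lambda>k. g (e k)"] by (simp add: reindex)
  next
    fix i assume "i \<in> I"
    then show "j i \<otimes>\<^sub>a id\<^sub>a Z \<in> hom_set C (X i \<otimes>\<^sub>o Z) (H \<otimes>\<^sub>o Z)"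
      using j[of i] by (auto simp: hom_set_def)
  qed simp
qed

text \<open>Joint epimorphicity in the presence of a further factor \<open>Z\<close>. Quantifying
  over \<open>Z\<close> makes the property pass to tensor products of families.\<close>

definition stable_epi :: "'m set \<Rightarrow> 'o \<Rightarrow> bool" where
  "stable_epi F H \<longleftrightarrow> H \<in> Obj C \<and> (\<forall>i \<in> F. i \<in> Arr C \<and> Cod C i = H) \<and>
     (\<forall>Z f g. Z \<in> Obj C \<and> f \<in> Arr C \<and> g \<in> Arr C \<and> Dom C f = H \<otimes>\<^sub>o Z \<and> Dom C g = H \<otimes>\<^sub>o Z \<and> Cod C f = Cod C g \<and>
       (\<forall>i \<in> F. f \<cdot> (i \<otimes>\<^sub>a id\<^sub>a Z) = g \<cdot> (i \<otimes>\<^sub>a id\<^sub>a Z)) \<longrightarrow> f = g)"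

lemma stable_epiD:
  assumes "stable_epi F H"
  shows "H \<in> Obj C" "i \<in> F \<Longrightarrow> i \<in> Arr C" "i \<in> F \<Longrightarrow> Cod C i = H"
    "\<lbrakk>\<And>i. i \<in> F \<Longrightarrow> f \<cdot> (i \<otimes>\<^sub>a id\<^sub>a Z) = g \<cdot> (i \<otimes>\<^sub>a id\<^sub>a Z); Z \<in> Obj C; f \<in> Arr C; g \<in> Arr C;
      Dom C f = H \<otimes>\<^sub>o Z; Dom C g = H \<otimes>\<^sub>o Z; Cod C f = Cod C g\<rbrakk> \<Longrightarrow> f = g"
  using assms unfolding stable_epi_def by blast+

lemma stable_epi_ext:
  assumes F: "stable_epi F H" and eq: "\<And>i. i \<in> F \<Longrightarrow> f \<cdot> i = g \<cdot> i"
    and [simp]: "f \<in> Arr C" "g \<in> Arr C" "Dom C f = H" "Dom C g = H" "Cod C f = Cod C g"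
  shows "f = g"
proof -
  note [simp] = stable_epiD(1-3)[OF F]
  have nat: "(k \<cdot> \<rho>\<^sub>u H) \<cdot> (i \<otimes>\<^sub>a id\<^sub>a \<I>) = (k \<cdot> i) \<cdot> \<rho>\<^sub>u (Dom C i)" if "i \<in> F" "k \<in> Arr C" "Dom C k = H" for k i
    using that by (simp add: RUnit_nat)
  have "f \<cdot> \<rho>\<^sub>u H = g \<cdot> \<rho>\<^sub>u H"
  proof (rule stable_epiD(4)[OF F, where Z = \<I>])
    fix i assume i: "i \<in> F"
    show "(f \<cdot> \<rho>\<^sub>u H) \<cdot> (i \<otimes>\<^sub>a id\<^sub>a \<I>) = (g \<cdot> \<rho>\<^sub>u H) \<cdot> (i \<otimes>\<^sub>a id\<^sub>a \<I>)"
      by (simp only: nat[OF i assms(3,5)] nat[OF i assms(4,6)] eq[OF i])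
  qed simp_all
  then show ?thesis by (rule iso_cancel_right) simp_all
qed

text \<open>The first family is cancelled with \<open>K\<close> and \<open>Z\<close> as its
  parameter; then \<open>K\<close> is moved to the front, and the second family is cancelled with
  the domain of the first map and \<open>Z\<close> as its parameter.\<close>

lemma stable_epi_TensA:
  assumes F: "stable_epi F H" and G: "stable_epi G K"
  shows "stable_epi {i \<otimes>\<^sub>a j |i j. i \<in> F \<and> j \<in> G} (H \<otimes>\<^sub>o K)"
  unfolding stable_epi_def
proof (intro conjI allI impI ballI)
  note [simp] = stable_epiD(1-3)[OF F] stable_epiD(1-3)[OF G]
  show "H \<otimes>\<^sub>o K \<in> Obj C" by simp
  show "k \<in> Arr C" "Cod C k = H \<otimes>\<^sub>o K" if "k \<in> {i \<otimes>\<^sub>a j |i j. i \<in> F \<and> j \<in> G}" for k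
    using that by auto
  fix Z f g
  assume a: "Z \<in> Obj C \<and> f \<in> Arr C \<and> g \<in> Arr C \<and> Dom C f = (H \<otimes>\<^sub>o K) \<otimes>\<^sub>o Z \<and> Dom C g = (H \<otimes>\<^sub>o K) \<otimes>\<^sub>o Z \<and>
    Cod C f = Cod C g \<and> (\<forall>k \<in> {i \<otimes>\<^sub>a j |i j. i \<in> F \<and> j \<in> G}. f \<cdot> (k \<otimes>\<^sub>a id\<^sub>a Z) = g \<cdot> (k \<otimes>\<^sub>a id\<^sub>a Z))"
  then have [simp]: "Z \<in> Obj C" "f \<in> Arr C" "g \<in> Arr C" "Dom C f = (H \<otimes>\<^sub>o K) \<otimes>\<^sub>o Z" "Dom C g = (H \<otimes>\<^sub>o K) \<otimes>\<^sub>o Z"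
    "Cod C f = Cod C g" by auto
  have eq: "f \<cdot> ((i \<otimes>\<^sub>a j) \<otimes>\<^sub>a id\<^sub>a Z) = g \<cdot> ((i \<otimes>\<^sub>a j) \<otimes>\<^sub>a id\<^sub>a Z)" if "i \<in> F" "j \<in> G" for i j
    using a that by blast
  let ?\<alpha> = "inv\<^sub>a (\<alpha>\<^sub>a H K Z)"
  have "f \<cdot> ?\<alpha> = g \<cdot> ?\<alpha>"
  proof (rule stable_epiD(4)[OF F, where Z = "K \<otimes>\<^sub>o Z"])
    fix i assume i [simp]: "i \<in> F"
    let ?X = "Dom C i"
    have nat: "((k \<cdot> ?\<alpha>) \<cdot> (i \<otimes>\<^sub>a id\<^sub>a (K \<otimes>\<^sub>o Z)) \<cdot> swap_front C K ?X Z) \<cdot> (j \<otimes>\<^sub>a id\<^sub>a (?X \<otimes>\<^sub>o Z)) =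
        (k \<cdot> ((i \<otimes>\<^sub>a j) \<otimes>\<^sub>a id\<^sub>a Z)) \<cdot> inv\<^sub>a (\<alpha>\<^sub>a ?X (Dom C j) Z) \<cdot> swap_front C (Dom C j) ?X Z"
      if [simp]: "j \<in> G" "k \<in> Arr C" "Dom C k = (H \<otimes>\<^sub>o K) \<otimes>\<^sub>o Z" for j k
    proof -
      have "swap_front C K ?X Z \<cdot> (j \<otimes>\<^sub>a id\<^sub>a (?X \<otimes>\<^sub>o Z)) = (id\<^sub>a ?X \<otimes>\<^sub>a j \<otimes>\<^sub>a id\<^sub>a Z) \<cdot> swap_front C (Dom C j) ?X Z"
        using swap_front_nat[of j "id\<^sub>a ?X" "id\<^sub>a Z" K ?X Z] by simp
      moreover have "?\<alpha> \<cdot> (i \<otimes>\<^sub>a j \<otimes>\<^sub>a id\<^sub>a Z) = ((i \<otimes>\<^sub>a j) \<otimes>\<^sub>a id\<^sub>a Z) \<cdot> inv\<^sub>a (\<alpha>\<^sub>a ?X (Dom C j) Z)"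
        by (simp add: Assoc_inv_nat)
      ultimately show ?thesis by (simp add: merge Assoc_inv_nat_tail)
    qed
    have "(f \<cdot> ?\<alpha>) \<cdot> (i \<otimes>\<^sub>a id\<^sub>a (K \<otimes>\<^sub>o Z)) \<cdot> swap_front C K ?X Z = (g \<cdot> ?\<alpha>) \<cdot> (i \<otimes>\<^sub>a id\<^sub>a (K \<otimes>\<^sub>o Z)) \<cdot> swap_front C K ?X Z"
    proof (rule stable_epiD(4)[OF G, where Z = "?X \<otimes>\<^sub>o Z"])
      fix j assume "j \<in> G"
      then show "((f \<cdot> ?\<alpha>) \<cdot> (i \<otimes>\<^sub>a id\<^sub>a (K \<otimes>\<^sub>o Z)) \<cdot> swap_front C K ?X Z) \<cdot> (j \<otimes>\<^sub>a id\<^sub>a (?X \<otimes>\<^sub>o Z)) =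
          ((g \<cdot> ?\<alpha>) \<cdot> (i \<otimes>\<^sub>a id\<^sub>a (K \<otimes>\<^sub>o Z)) \<cdot> swap_front C K ?X Z) \<cdot> (j \<otimes>\<^sub>a id\<^sub>a (?X \<otimes>\<^sub>o Z))"
        using eq[OF i] by (simp only: nat \<open>f \<in> Arr C\<close> \<open>g \<in> Arr C\<close> \<open>Dom C f = (H \<otimes>\<^sub>o K) \<otimes>\<^sub>o Z\<close> \<open>Dom C g = (H \<otimes>\<^sub>o K) \<otimes>\<^sub>o Z\<close>)
    qed simp_all
    then have "((f \<cdot> ?\<alpha>) \<cdot> (i \<otimes>\<^sub>a id\<^sub>a (K \<otimes>\<^sub>o Z))) \<cdot> swap_front C K ?X Z = ((g \<cdot> ?\<alpha>) \<cdot> (i \<otimes>\<^sub>a id\<^sub>a (K \<otimes>\<^sub>o Z))) \<cdot> swap_front C K ?X Z"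
      by simp
    then show "(f \<cdot> ?\<alpha>) \<cdot> (i \<otimes>\<^sub>a id\<^sub>a (K \<otimes>\<^sub>o Z)) = (g \<cdot> ?\<alpha>) \<cdot> (i \<otimes>\<^sub>a id\<^sub>a (K \<otimes>\<^sub>o Z))"
      by (rule iso_cancel_right) simp_all
  qed simp_all
  then show "f = g" by (rule iso_cancel_right) simp_all
qed

lemma stable_epi_coproduct:
  assumes "infinite (UNIV :: 'i set)" "tensor_cocomplete TYPE('i) C" and cop: "is_coproduct C I X H j" and "finite I"
  shows "stable_epi (j ` I) H"
  unfolding stable_epi_def
proof (intro conjI allI impI)
  have H: "H \<in> Obj C" and j: "\<And>i. i \<in> I \<Longrightarrow> j i \<in> hom_set C (X i) H"
    using cop by (auto simp: is_coproduct_def)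
  show "H \<in> Obj C" by (fact H)
  show "\<forall>i \<in> j ` I. i \<in> Arr C \<and> Cod C i = H" using j by (auto simp: hom_set_def)
  fix Z f g
  assume a: "Z \<in> Obj C \<and> f \<in> Arr C \<and> g \<in> Arr C \<and> Dom C f = H \<otimes>\<^sub>o Z \<and> Dom C g = H \<otimes>\<^sub>o Z \<and> Cod C f = Cod C g \<and>
       (\<forall>i \<in> j ` I. f \<cdot> (i \<otimes>\<^sub>a id\<^sub>a Z) = g \<cdot> (i \<otimes>\<^sub>a id\<^sub>a Z))"
  then have "is_coproduct C I (\<lambda>i. X i \<otimes>\<^sub>o Z) (H \<otimes>\<^sub>o Z) (\<lambda>i. j i \<otimes>\<^sub>a id\<^sub>a Z)"
    by (intro coproduct_TensO[OF assms]) simp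
  then have "\<exists>!k. k \<in> hom_set C (H \<otimes>\<^sub>o Z) (Cod C f) \<and> (\<forall>i \<in> I. k \<cdot> (j i \<otimes>\<^sub>a id\<^sub>a Z) = f \<cdot> (j i \<otimes>\<^sub>a id\<^sub>a Z))"
    by (rule coproductD(3)) (use a j in \<open>auto simp: hom_set_def\<close>)
  then show "f = g" using a by (auto simp: hom_set_def)
qed

text \<open>The components are glued in the first index for each fixed second one. The results are
  then glued in the second index after a symmetry, as for the multiplication of
  \<open>S\<close>.\<close>

lemma coproduct_TensO_ex:
  assumes ax: "infinite (UNIV :: 'i set)" "tensor_cocomplete TYPE('i) C" "is_coproduct C I X H j" "finite I"
    and m: "\<And>a b. \<lbrakk>a \<in> I; b \<in> I\<rbrakk> \<Longrightarrow> m a b \<in> hom_set C (X a \<otimes>\<^sub>o X b) Y" and Y: "Y \<in> Obj C"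
  shows "\<exists>f. f \<in> hom_set C (H \<otimes>\<^sub>o H) Y \<and> (\<forall>a \<in> I. \<forall>b \<in> I. f \<cdot> (j a \<otimes>\<^sub>a j b) = m a b)"
proof -
  have H [simp]: "H \<in> Obj C" and j: "\<And>i. i \<in> I \<Longrightarrow> j i \<in> hom_set C (X i) H"
    using ax(3) by (auto simp: is_coproduct_def)
  have arr [simp]: "j i \<in> Arr C" "Dom C (j i) = X i" "Cod C (j i) = H" "X i \<in> Obj C" if "i \<in> I" for i
    using j[OF that] Dom_Cod_Obj(1)[of "j i"] by (auto simp: hom_set_def)
  have "\<exists>f. f \<in> hom_set C (H \<otimes>\<^sub>o X b) Y \<and> (\<forall>a \<in> I. f \<cdot> (j a \<otimes>\<^sub>a id\<^sub>a (X b)) = m a b)" if "b \<in> I" for b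
    using coproductD(3)[OF coproduct_TensO[OF ax, of "X b"] Y, of "\<lambda>a. m a b"] that m by auto
  then obtain k where k: "\<And>b. b \<in> I \<Longrightarrow> k b \<in> hom_set C (H \<otimes>\<^sub>o X b) Y"
    "\<And>a b. \<lbrakk>a \<in> I; b \<in> I\<rbrakk> \<Longrightarrow> k b \<cdot> (j a \<otimes>\<^sub>a id\<^sub>a (X b)) = m a b" by metis
  have k' [simp]: "k b \<in> Arr C" "Dom C (k b) = H \<otimes>\<^sub>o X b" "Cod C (k b) = Y" if "b \<in> I" for b
    using k(1)[OF that] by (auto simp: hom_set_def)
  obtain F where F: "F \<in> hom_set C (H \<otimes>\<^sub>o H) Y" "\<And>b. b \<in> I \<Longrightarrow> F \<cdot> (j b \<otimes>\<^sub>a id\<^sub>a H) = k b \<cdot> \<sigma>\<^sub>a (X b) H"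
    using coproductD(3)[OF coproduct_TensO[OF ax H] Y, of "\<lambda>b. k b \<cdot> \<sigma>\<^sub>a (X b) H"] by (auto simp: hom_set_def)
  have F' [simp]: "F \<in> Arr C" "Dom C F = H \<otimes>\<^sub>o H" "Cod C F = Y" using F(1) by (auto simp: hom_set_def)
  have "(F \<cdot> \<sigma>\<^sub>a H H) \<cdot> (j a \<otimes>\<^sub>a j b) = m a b" if [simp]: "a \<in> I" "b \<in> I" for a b
  proof -
    have "(F \<cdot> \<sigma>\<^sub>a H H) \<cdot> (j a \<otimes>\<^sub>a j b) = (F \<cdot> (j b \<otimes>\<^sub>a id\<^sub>a H)) \<cdot> (id\<^sub>a (X b) \<otimes>\<^sub>a j a) \<cdot> \<sigma>\<^sub>a (X a) (X b)"
      by (simp add: Symm_nat merge)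
    also have "\<dots> = k b \<cdot> \<sigma>\<^sub>a (X b) H \<cdot> (id\<^sub>a (X b) \<otimes>\<^sub>a j a) \<cdot> \<sigma>\<^sub>a (X a) (X b)"
      by (simp add: F(2))
    also have "\<dots> = k b \<cdot> (j a \<otimes>\<^sub>a id\<^sub>a (X b)) \<cdot> \<sigma>\<^sub>a (X b) (X a) \<cdot> \<sigma>\<^sub>a (X a) (X b)"
      by (simp add: Symm_nat_tail)
    also have "\<dots> = m a b" by (simp add: Symm_Symm k(2))
    finally show ?thesis .
  qed
  then show ?thesis by (intro exI[of _ "F \<cdot> \<sigma>\<^sub>a H H"]) (simp add: hom_set_def)
qed

end

text \<open>Two universal properties, coinvariants and coproduct, are merged into one: the tensor
  powers with all their permutations form a single universal family over \<open>S\<close>. The extra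
  factor \<open>Z\<close> is then supplied by preservation of the associated colimit.\<close>

lemma free_cm_of_cocomplete:
  fixes C :: "('r, 'o, 'm, 'x) lsmcat_scheme" (structure)
  assumes lin: "linear_symmetric_monoidal_category R C"
    and cc: "infinite (UNIV :: 'i set)" "tensor_cocomplete TYPE('i) C"
    and free: "is_free_comm_monoid C h S \<iota>"
  shows "free_cm C R h S \<iota>"
proof -
  interpret lsmc C R unfolding lsmc_def by (fact lin)
  obtain P q u where P: "\<And>n. is_coinvariants C h n (P n) (q n)" and u: "is_coproduct C UNIV P S u"
    and \<iota>: "\<And>n. \<iota> n = u n \<cdot> q n" and h: "h \<in> Obj C"
    using free unfolding is_free_comm_monoid_def by blast
  have arrangements: "p \<in> permutations_of_set {..<n} \<longleftrightarrow> is_arrangement n p" for n p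
    by (auto simp: permutations_of_set_def is_arrangement_def)
  let ?T = "\<lambda>n. tens C (replicate n h)"
  \<comment> \<open>Arrangements are coded by natural numbers, the labels that
    \<open>univ_family\<close> uses for endomorphisms; lists of naturals are countable.\<close>
  let ?K = "\<lambda>n. to_nat ` {p. is_arrangement n p}" and ?r = "\<lambda>n k. tens_perm C (replicate n h) (from_nat k)"
  have q: "q n \<in> hom_set C (?T n) (P n)" "P n \<in> Obj C"
    "is_arrangement n p \<Longrightarrow> q n \<cdot> tens_perm C (replicate n h) p = q n" for n p
    using P[of n] by (auto simp: is_coinvariants_def arrangements)
  have q_ex: "\<exists>!f. f \<in> hom_set C (P n) Y \<and> f \<cdot> q n = g"
    if "g \<in> hom_set C (?T n) Y" "\<And>p. is_arrangement n p \<Longrightarrow> g \<cdot> tens_perm C (replicate n h) p = g" for n Y g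
    using P[of n] that by (auto simp: is_coinvariants_def arrangements)
  have S: "S \<in> Obj C" "\<And>n. u n \<in> hom_set C (P n) S"
    "\<And>Y g. \<lbrakk>Y \<in> Obj C; \<forall>n. g n \<in> hom_set C (P n) Y\<rbrakk> \<Longrightarrow> \<exists>!f. f \<in> hom_set C S Y \<and> (\<forall>n. f \<cdot> u n = g n)"
    using u by (auto simp: is_coproduct_def)
  have a [simp]: "q n \<in> Arr C" "Dom C (q n) = ?T n" "Cod C (q n) = P n" "u n \<in> Arr C" "Dom C (u n) = P n" "Cod C (u n) = S" for n
    using q(1)[of n] S(2)[of n] by (auto simp: hom_set_def)
  have rep [simp]: "set (replicate n h) \<subseteq> Obj C" for n using h by (auto simp: set_replicate_conv_if)
  have perm: "tens_perm C (replicate n h) p \<in> hom_set C (?T n) (?T n)" if "is_arrangement n p" for n p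
  proof -
    have "map ((!) (replicate n h)) p = map (\<lambda>_. h) p"
      using that by (intro map_cong) (auto simp: is_arrangement_def)
    then have "map ((!) (replicate n h)) p = replicate n h"
      by (simp add: map_replicate_const is_arrangement_length[OF that])
    then show ?thesis using that tens_perm_arr[of "replicate n h" p] by (simp add: hom_set_def)
  qed
  have \<iota>_hom: "\<iota> n \<in> hom_set C (?T n) S" for n by (simp add: \<iota> hom_set_def)
  have \<iota>_perm: "\<iota> n \<cdot> tens_perm C (replicate n h) p = \<iota> n" if "is_arrangement n p" for n p
    using perm[OF that] q(3)[OF that] by (simp add: \<iota> hom_set_def)
  have "univ_family C UNIV ?T ?K ?r S \<iota>"
    unfolding univ_family_def
  proof (intro conjI allI impI ballI)
    fix n k
    assume "k \<in> ?K n"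
    then show "?r n k \<in> hom_set C (?T n) (?T n)" "\<iota> n \<cdot> ?r n k = \<iota> n" using perm \<iota>_perm by auto
  next
    fix Y g
    assume g: "Y \<in> Obj C \<and> (\<forall>n \<in> UNIV. g n \<in> hom_set C (?T n) Y \<and> (\<forall>k \<in> ?K n. g n \<cdot> ?r n k = g n))"
    have "\<exists>!f. f \<in> hom_set C (P n) Y \<and> f \<cdot> q n = g n" for n
      by (rule q_ex) (use g in auto)
    then obtain k where k: "\<And>n. k n \<in> hom_set C (P n) Y" "\<And>n. k n \<cdot> q n = g n"
      and k_unique: "\<And>n f. \<lbrakk>f \<in> hom_set C (P n) Y; f \<cdot> q n = g n\<rbrakk> \<Longrightarrow> f = k n" by metis
    \<comment> \<open>By uniqueness of factorisations through the coinvariants, a condition on the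
      coinvariants is equivalent to the same condition on the tensor power.\<close>
    have "f \<cdot> u n = k n \<longleftrightarrow> f \<cdot> \<iota> n = g n" if "f \<in> hom_set C S Y" for f n
    proof
      assume "f \<cdot> u n = k n"
      then have "(f \<cdot> u n) \<cdot> q n = g n" using k(2) by simp
      then show "f \<cdot> \<iota> n = g n" using that by (simp add: \<iota> hom_set_def)
    next
      assume "f \<cdot> \<iota> n = g n"
      then show "f \<cdot> u n = k n" using that by (intro k_unique) (auto simp: \<iota> hom_set_def)
    qed
    then show "\<exists>!f. f \<in> hom_set C S Y \<and> (\<forall>n \<in> UNIV. f \<cdot> \<iota> n = g n)"
      using S(3)[of Y k] g k(1) by (auto cong: conj_cong)
  qed (use S \<iota>_hom in auto)
  note uf = univ_family_TensO[OF cc this]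
  show ?thesis
  proof
    show "h \<in> Obj C" "\<iota> n \<in> hom_set C (?T n) S" for n by fact+
    show "\<iota> n \<cdot> tens_perm C (replicate n h) p = \<iota> n" if "is_arrangement n p" for n p by (rule \<iota>_perm[OF that])
    show "\<exists>!f. f \<in> hom_set C (S \<otimes>\<^sub>o Z) Y \<and> (\<forall>n. f \<cdot> (\<iota> n \<otimes>\<^sub>a id\<^sub>a Z) = g n)"
      if "Z \<in> Obj C" "Y \<in> Obj C" "\<And>n. g n \<in> hom_set C (?T n \<otimes>\<^sub>o Z) Y"
        "\<And>n p. is_arrangement n p \<Longrightarrow> g n \<cdot> (tens_perm C (replicate n h) p \<otimes>\<^sub>a id\<^sub>a Z) = g n" for Z Y g
      using uf[OF that(1)] that(2-) unfolding univ_family_def by auto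
  qed
qed

section \<open>The bracket of the double quiver\<close>

context free_cm
begin

lemma HSmult_HZero:
  assumes "A \<in> Obj C" "B \<in> Obj C" "r \<in> carrier R"
  shows "HSmult C r (HZero C A B) = HZero C A B"
proof -
  interpret M: Module.module R "hom_module C A B" by (rule hom_module[OF assms(1,2)])
  show ?thesis using M.smult_r_null[OF assms(3)] by (simp add: hom_module_simps)
qed

lemma mm_HSmult:
  assumes "X \<in> Obj C" "Y \<in> Obj C" "D \<in> Obj C" "E \<in> Obj C"
    "a \<in> Arr C" "Dom C a = X \<otimes>\<^sub>o E" "Cod C a = S" "b \<in> Arr C" "Dom C b = D \<otimes>\<^sub>o Y" "Cod C b = S"
    "P \<in> Arr C" "Dom C P = \<I>" "Cod C P = D \<otimes>\<^sub>o E" "r \<in> carrier R"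
  shows "mm X Y D E a b (HSmult C r P) = HSmult C r (mm X Y D E a b P)"
  using assms by (simp add: mm_def)

text \<open>Exchanging the arguments of the bracket exchanges its two factors, which commute in
  \<open>S\<close>. Antisymmetry is thereby left to the sign of the pairing.\<close>

lemma twist_swap:
  assumes [simp]: "X \<in> Obj C" "Y \<in> Obj C" "D \<in> Obj C" "E \<in> Obj C"
    "V \<in> Arr C" "Dom C V = X \<otimes>\<^sub>o E" "Cod C V = S" "U \<in> Arr C" "Dom C U = D \<otimes>\<^sub>o Y" "Cod C U = S"
  shows "\<mu> \<cdot> (U \<otimes>\<^sub>a V) \<cdot> twist D E X Y \<cdot> \<sigma>\<^sub>a (X \<otimes>\<^sub>o Y) (D \<otimes>\<^sub>o E) = \<mu> \<cdot> (V \<otimes>\<^sub>a U) \<cdot> twist X Y D E" (is "?l = ?r")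
proof -
  have ctx: "ctx C [X, Y, D, E]" by unfold_locales simp
  interpret K: fctx C R h S \<iota> "[X, Y, D, E]" by (rule fctxI[OF ctx])
  let ?x = "K.gen 0" and ?y = "K.gen 1" and ?p = "K.gen 2" and ?q = "K.gen 3"
  have e [simp]: "K.el X ?x" "K.el Y ?y" "K.el D ?p" "K.el E ?q" by simp_all
  have iso: "K.isoE (K.eprod ?x ?y)" "K.isoE (K.eprod ?p ?q)"
    by (rule K.isoE_eprod[OF _ _ e(1,2)] K.isoE_eprod[OF _ _ e(3,4)]; simp)+
  have iso': "K.isoE (K.eprod (K.eprod ?x ?y) (K.eprod ?p ?q))"
    by (rule K.isoE_eprod[OF iso K.el_eprod[OF e(1,2)] K.el_eprod[OF e(3,4)]]) simp_all
  have "K.mul (ap U (K.eprod ?p ?y)) (ap V (K.eprod ?x ?q)) = K.mul (ap V (K.eprod ?x ?q)) (ap U (K.eprod ?p ?y))"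
    by (simp add: K.mul_ac)
  then have "ap ?l (K.eprod (K.eprod ?x ?y) (K.eprod ?p ?q)) = ap ?r (K.eprod (K.eprod ?x ?y) (K.eprod ?p ?q))"
    by (simp add: K.mul_def)
  then show ?thesis
    by (rule K.isoE_cancel[OF _ iso']) simp_all
qed

text \<open>By the Leibniz rule an element whose brackets with \<open>a\<close> and \<open>b\<close>
  vanish also brackets to zero with every product of entries of \<open>a\<close> and
  \<open>b\<close>, hence with their contraction.\<close>

lemma bracket_mm_zero:
  assumes d: "bi_derivation C S \<mu> (free_unit \<iota>) d"
    and o [simp]: "X \<in> Obj C" "Y \<in> Obj C" "D \<in> Obj C" "E \<in> Obj C" "G \<in> Obj C"
    and a [simp]: "a \<in> Arr C" "Dom C a = X \<otimes>\<^sub>o E" "Cod C a = S" and b [simp]: "b \<in> Arr C" "Dom C b = D \<otimes>\<^sub>o Y" "Cod C b = S"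
    and c [simp]: "c \<in> Arr C" "Dom C c = G" "Cod C c = S"
    and P [simp]: "P \<in> Arr C" "Dom C P = \<I>" "Cod C P = D \<otimes>\<^sub>o E"
    and ca: "d \<cdot> (c \<otimes>\<^sub>a a) = HZero C (G \<otimes>\<^sub>o X \<otimes>\<^sub>o E) S" and cb: "d \<cdot> (c \<otimes>\<^sub>a b) = HZero C (G \<otimes>\<^sub>o D \<otimes>\<^sub>o Y) S"
  shows "d \<cdot> (c \<otimes>\<^sub>a mm X Y D E a b P) = HZero C (G \<otimes>\<^sub>o X \<otimes>\<^sub>o Y) S" (is "?l = ?r")
proof -
  have ctx: "ctx C [G, X, Y, D, E]" by unfold_locales simp
  interpret K: bctx C R h S \<iota> "[G, X, Y, D, E]" d by (rule bctxI[OF ctx d])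
  let ?z = "K.gen 0" and ?x = "K.gen 1" and ?y = "K.gen 2" and ?p = "K.gen 3" and ?q = "K.gen 4"
  let ?F = "\<lambda>p. K.br (ap c ?z) (ap (mmh X Y D E a b) (K.eprod (K.eprod ?x ?y) p))"
  have e [simp]: "K.el G ?z" "K.el X ?x" "K.el Y ?y" "K.el D ?p" "K.el E ?q" by simp_all
  have iso: "K.isoE ?z" "K.isoE (K.eprod ?x ?y)" "K.isoE (K.eprod ?p ?q)"
    by (simp, (rule K.isoE_eprod[OF _ _ e(2,3)] K.isoE_eprod[OF _ _ e(4,5)]; simp)+)
  have iso': "K.isoE (K.eprod ?z (K.eprod ?x ?y))"
    by (rule K.isoE_eprod[OF iso(1,2) e(1) K.el_eprod[OF e(2,3)]]) simp_all
  have br: "K.br (ap c s) (ap a t) = K.ezero S (fst s \<union> fst t)" if "K.el G s" "K.el (X \<otimes>\<^sub>o E) t" "dj s t" for s t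
  proof -
    have "ap (d \<cdot> (c \<otimes>\<^sub>a a)) (K.eprod s t) = ap (HZero C (G \<otimes>\<^sub>o X \<otimes>\<^sub>o E) S) (K.eprod s t)" by (simp only: ca)
    then show ?thesis using that by (simp add: K.br_def)
  qed
  have br': "K.br (ap c s) (ap b t) = K.ezero S (fst s \<union> fst t)" if "K.el G s" "K.el (D \<otimes>\<^sub>o Y) t" "dj s t" for s t
  proof -
    have "ap (d \<cdot> (c \<otimes>\<^sub>a b)) (K.eprod s t) = ap (HZero C (G \<otimes>\<^sub>o D \<otimes>\<^sub>o Y) S) (K.eprod s t)" by (simp only: cb)
    then show ?thesis using that by (simp add: K.br_def)
  qed
  have lin: "K.lin (fst (ap c ?z) \<union> (fst ?x \<union> fst ?y)) (D \<otimes>\<^sub>o E) S ?F"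
    by (rule K.lin_br_right[OF K.lin_mmh]) simp_all
  \<comment> \<open>The zero function has to be exhibited as linear with the same parameter
    variables; composing \<open>?F\<close> with a zero arrow achieves this.\<close>
  have lin0: "K.lin (fst (ap c ?z) \<union> (fst ?x \<union> fst ?y)) (D \<otimes>\<^sub>o E) S (\<lambda>p. ap (HZero C S S) (?F p))"
    by (rule K.lin_ap[OF lin]) simp_all
  have gen: "?F (K.eprod ?p ?q) = ap (HZero C S S) (?F (K.eprod ?p ?q))"
    by (simp add: K.ap_mmh K.br_mul_right br br' K.mul_ezero K.eadd_ezero Un_ac insert_commute)
  have "?F (ap P K.eunit) = ap (HZero C S S) (?F (ap P K.eunit))"
    by (rule K.lin_ext[OF lin lin0 _ iso(3) _ gen]) simp_all
  then have "ap ?l (K.eprod ?z (K.eprod ?x ?y)) = ap ?r (K.eprod ?z (K.eprod ?x ?y))"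
    by (simp add: K.ap_mm K.br_def)
  then show ?thesis
    by (rule K.isoE_cancel[OF _ iso']) simp_all
qed

end

section \<open>Antisymmetry and the Jacobi identity for the arrows of the double quiver\<close>

lemma in_involution_sym: "in_involution a b \<Longrightarrow> in_involution b a"
  by (auto simp: in_involution_def)

lemma in_involution_unique: "\<lbrakk>in_involution a b; in_involution b a'\<rbrakk> \<Longrightarrow> a' = a"
  by (auto simp: in_involution_def)

lemma in_involution_irrefl: "\<not> in_involution a a"
  by (auto simp: in_involution_def)

lemma in_involution_ends:
  assumes "in_involution a b"
  shows "tail (double_quiver Q) b = head (double_quiver Q) a" "head (double_quiver Q) b = tail (double_quiver Q) a"
  using assms by (auto simp: in_involution_def double_quiver_def)

text \<open>The condition \<open>epi\<close> expresses that an arrow out of tensor products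
  involving \<open>h\<close> is determined by its values on the objects of the arrows; equations are
  thereby reduced to those objects.\<close>

locale quiver_bracket = free_cm C R h S \<iota> + wf_digraph Q
  for C :: "('r, 'o, 'm, 'x) lsmcat_scheme" (structure) and R :: "('r, 'y) ring_scheme" and h S \<iota>
    and Q :: "('v, 'e) pre_digraph" +
  fixes c cd :: "'v \<Rightarrow> 'o" and coev :: "'v \<Rightarrow> 'm" and inc :: "'e + 'e \<Rightarrow> 'm" and d :: 'm
  assumes dual: "v \<in> verts Q \<Longrightarrow> c v \<in> Obj C" "v \<in> verts Q \<Longrightarrow> cd v \<in> Obj C"
      "v \<in> verts Q \<Longrightarrow> coev v \<in> hom_set C \<I> (c v \<otimes>\<^sub>o cd v)"
    and inc: "a \<in> arcs (double_quiver Q) \<Longrightarrow> inc a \<in> hom_set C (arrow_object C Q c cd a) h"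
    and epi: "stable_epi (inc ` arcs (double_quiver Q)) h"
    and plus: "is_plus_bracket R C Q c cd coev h inc S \<iota> d"
begin

abbreviation "E \<equiv> arcs (double_quiver Q)"
abbreviation "src \<equiv> tail (double_quiver Q)"
abbreviation "tgt \<equiv> head (double_quiver Q)"
abbreviation "X \<equiv> arrow_object C Q c cd"
abbreviation "scal \<equiv> arrow_pairing R"

definition e :: "'e + 'e \<Rightarrow> 'm" where
  "e a = gencl \<cdot> inc a"

lemma ends [simp]: "a \<in> E \<Longrightarrow> src a \<in> verts Q" "a \<in> E \<Longrightarrow> tgt a \<in> verts Q"
  by (auto simp: double_quiver_def)

lemma dual_Obj [simp]: "v \<in> verts Q \<Longrightarrow> c v \<in> Obj C" "v \<in> verts Q \<Longrightarrow> cd v \<in> Obj C"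
  and coev_arr [simp]: "v \<in> verts Q \<Longrightarrow> coev v \<in> Arr C" "v \<in> verts Q \<Longrightarrow> Dom C (coev v) = \<I>"
    "v \<in> verts Q \<Longrightarrow> Cod C (coev v) = c v \<otimes>\<^sub>o cd v"
  using dual[of v] by (auto simp: hom_set_def)

lemma X_Obj [simp]: "a \<in> E \<Longrightarrow> X a \<in> Obj C"
  by (simp add: arrow_object_def)

lemma inc_arr [simp]:
  assumes "a \<in> E"
  shows "inc a \<in> Arr C" "Dom C (inc a) = X a" "Cod C (inc a) = h"
  using inc[OF assms] by (auto simp: hom_set_def)

lemma e_arr [simp]:
  assumes "a \<in> E"
  shows "e a \<in> Arr C" "Dom C (e a) = X a" "Cod C (e a) = S"
  using assms by (simp_all add: e_def)

lemma scal_carrier [simp]: "scal a b \<in> carrier R"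
  by (simp add: arrow_pairing_def)

lemma scal_cancel: "in_involution a b \<Longrightarrow> scal a b \<oplus>\<^bsub>R\<^esub> scal b a = \<zero>\<^bsub>R\<^esub>"
  by (auto simp: in_involution_def arrow_pairing_def r_neg l_neg)

lemma bider: "bi_derivation C S \<mu> (free_unit \<iota>) d"
  using plus by (simp add: is_plus_bracket_def)

lemma d_arr [simp]: "d \<in> Arr C" "Dom C d = S \<otimes>\<^sub>o S" "Cod C d = S"
  using bi_derivation_arr[OF bider] .

lemma bracket_zero:
  assumes "a \<in> E" "b \<in> E" "\<not> in_involution a b"
  shows "d \<cdot> (e a \<otimes>\<^sub>a e b) = HZero C (X a \<otimes>\<^sub>o X b) S"
proof -
  have "d \<cdot> (e a \<otimes>\<^sub>a e b) = \<iota> 4 \<cdot> tens_arrow C [inc a, inc a, inc b, inc b] \<cdot> kappa_component R C Q c cd coev a b"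
    using plus assms by (simp add: is_plus_bracket_def e_def)
  then show ?thesis using assms by (simp add: kappa_component_def Let_def numeral_eq_Suc)
qed

lemma bracket_involution:
  assumes ab: "a \<in> E" "b \<in> E" "in_involution a b"
  defines "A \<equiv> c (src a)" and "A' \<equiv> cd (src a)" and "B \<equiv> c (tgt a)" and "B' \<equiv> cd (tgt a)"
  shows "d \<cdot> (e a \<otimes>\<^sub>a e b) = HSmult C (scal a b) (\<mu> \<cdot>
    (mm A A' B B' (e a) (e b) (coev (tgt a)) \<otimes>\<^sub>a mm B B' A A' (e b) (e a) (coev (src a))) \<cdot> twist A B' B A')"
proof -
  have X: "X a = A \<otimes>\<^sub>o B'" "X b = B \<otimes>\<^sub>o A'"
    by (simp_all add: arrow_object_def assms in_involution_ends[OF ab(3)])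
  have o [simp]: "A \<in> Obj C" "A' \<in> Obj C" "B \<in> Obj C" "B' \<in> Obj C" using ab by (simp_all add: assms)
  have "d \<cdot> (e a \<otimes>\<^sub>a e b) = \<iota> 4 \<cdot> tens_arrow C [inc a, inc a, inc b, inc b] \<cdot> kappa_component R C Q c cd coev a b"
    using plus ab by (simp add: is_plus_bracket_def e_def)
  also have "\<dots> = \<iota> 4 \<cdot> tens_arrow C [inc a, inc a, inc b, inc b] \<cdot>
      HSmult C (scal a b) (kappa C A A' (coev (src a)) B B' (coev (tgt a)))"
    using ab by (simp add: kappa_component_def Let_def assms)
  also have "\<dots> = HSmult C (scal a b)
      (\<iota> 4 \<cdot> tens_arrow C [inc a, inc a, inc b, inc b] \<cdot> kappa C A A' (coev (src a)) B B' (coev (tgt a)))"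
    using ab X by (simp add: numeral_eq_Suc A_def[symmetric] A'_def[symmetric] B_def[symmetric] B'_def[symmetric])
  also have "\<iota> 4 \<cdot> tens_arrow C [inc a, inc a, inc b, inc b] \<cdot> kappa C A A' (coev (src a)) B B' (coev (tgt a)) = \<mu> \<cdot>
    (mm A A' B B' (e a) (e b) (coev (tgt a)) \<otimes>\<^sub>a mm B B' A A' (e b) (e a) (coev (src a))) \<cdot> twist A B' B A'"
    unfolding e_def by (rule kappa_eq_mm) (use ab X in \<open>simp_all add: A_def[symmetric] A'_def[symmetric] B_def[symmetric] B'_def[symmetric]\<close>)
  finally show ?thesis .
qed

text \<open>A contraction is linear in the contracted tensor, so the pairing moves from the front of
  the bracket into the coevaluation at the source of \<open>a\<close>.\<close>

lemma arrow_pair_involution: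
  assumes ab: "a \<in> E" "b \<in> E" "in_involution a b"
  shows "arrow_pair C R h S \<iota> d (c (src a)) (cd (src a)) (c (tgt a)) (cd (tgt a)) (e a) (e b)
    (HSmult C (scal a b) (coev (src a))) (coev (tgt a))"
proof
  have X: "X a = c (src a) \<otimes>\<^sub>o cd (tgt a)" "X b = c (tgt a) \<otimes>\<^sub>o cd (src a)"
    by (simp_all add: arrow_object_def in_involution_ends[OF ab(3)])
  note [simp] = X[symmetric]
  show "d \<cdot> (e a \<otimes>\<^sub>a e a) = HZero C ((c (src a) \<otimes>\<^sub>o cd (tgt a)) \<otimes>\<^sub>o c (src a) \<otimes>\<^sub>o cd (tgt a)) S"
    using bracket_zero[OF ab(1,1) in_involution_irrefl] by simp
  show "d \<cdot> (e a \<otimes>\<^sub>a e b) = \<mu> \<cdot> (mm (c (src a)) (cd (src a)) (c (tgt a)) (cd (tgt a)) (e a) (e b) (coev (tgt a)) \<otimes>\<^sub>a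
      mm (c (tgt a)) (cd (tgt a)) (c (src a)) (cd (src a)) (e b) (e a) (HSmult C (scal a b) (coev (src a)))) \<cdot>
      twist (c (src a)) (cd (tgt a)) (c (tgt a)) (cd (src a))"
    unfolding bracket_involution[OF ab] using ab by (simp add: mm_HSmult)
qed (use ab bider in \<open>simp_all add: in_involution_ends arrow_object_def\<close>)

text \<open>For arrows in involution both brackets are multiples of the same product of two
  contractions, by \<open>twist_swap\<close>, and the two pairings add up to zero.\<close>

lemma bracket_antisymmetric_gens:
  assumes ab [simp]: "a \<in> E" "b \<in> E"
  shows "d \<cdot> (e a \<otimes>\<^sub>a e b) +\<^sub>a d \<cdot> (e b \<otimes>\<^sub>a e a) \<cdot> \<sigma>\<^sub>a (X a) (X b) = HZero C (X a \<otimes>\<^sub>o X b) S"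
proof (cases "in_involution a b")
  case False
  then have "\<not> in_involution b a" using in_involution_sym by blast
  then have "d \<cdot> (e b \<otimes>\<^sub>a e a) \<cdot> \<sigma>\<^sub>a (X a) (X b) = HZero C (X a \<otimes>\<^sub>o X b) S"
    using Comp_tail[OF bracket_zero, of b a "\<sigma>\<^sub>a (X a) (X b)"] by simp
  with False show ?thesis by (simp add: bracket_zero HAdd_HZero)
next
  case True
  let ?A = "c (src a)" and ?A' = "cd (src a)" and ?B = "c (tgt a)" and ?B' = "cd (tgt a)"
  let ?V = "mm ?A ?A' ?B ?B' (e a) (e b) (coev (tgt a))" and ?U = "mm ?B ?B' ?A ?A' (e b) (e a) (coev (src a))"
  let ?M = "\<mu> \<cdot> (?V \<otimes>\<^sub>a ?U) \<cdot> twist ?A ?B' ?B ?A'"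
  note ends = in_involution_ends[OF True]
  have X: "X a = ?A \<otimes>\<^sub>o ?B'" "X b = ?B \<otimes>\<^sub>o ?A'"
    by (simp_all add: arrow_object_def ends)
  have ba: "d \<cdot> (e b \<otimes>\<^sub>a e a) = HSmult C (scal b a) (\<mu> \<cdot> (?U \<otimes>\<^sub>a ?V) \<cdot> twist ?B ?A' ?A ?B')"
    using bracket_involution[OF ab(2,1) in_involution_sym[OF True]] by (simp add: ends)
  have "d \<cdot> (e b \<otimes>\<^sub>a e a) \<cdot> \<sigma>\<^sub>a (X a) (X b) =
      HSmult C (scal b a) (\<mu> \<cdot> (?U \<otimes>\<^sub>a ?V) \<cdot> twist ?B ?A' ?A ?B') \<cdot> \<sigma>\<^sub>a (X a) (X b)"
    by (rule Comp_tail[OF ba]) simp_all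
  also have "\<dots> = HSmult C (scal b a) ?M"
    unfolding X by (simp add: X twist_swap)
  finally have "d \<cdot> (e a \<otimes>\<^sub>a e b) +\<^sub>a d \<cdot> (e b \<otimes>\<^sub>a e a) \<cdot> \<sigma>\<^sub>a (X a) (X b) = HSmult C (scal a b) ?M +\<^sub>a HSmult C (scal b a) ?M"
    using bracket_involution[OF ab True] by simp
  also have "\<dots> = HZero C (X a \<otimes>\<^sub>o X b) S"
    by (simp add: HSmult_add[symmetric] scal_cancel[OF True] HSmult_zero X)
  finally show ?thesis .
qed

lemma antisymmetric: "d +\<^sub>a d \<cdot> \<sigma>\<^sub>a S S = HZero C (S \<otimes>\<^sub>o S) S"
proof (rule antisymmetric_from_generators[OF bider])
  show "(d +\<^sub>a d \<cdot> \<sigma>\<^sub>a S S) \<cdot> (gencl \<otimes>\<^sub>a gencl) = HZero C (h \<otimes>\<^sub>o h) S"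
  proof (rule stable_epi_ext[OF stable_epi_TensA[OF epi epi]])
    fix k
    assume "k \<in> {i \<otimes>\<^sub>a j |i j. i \<in> inc ` E \<and> j \<in> inc ` E}"
    then obtain a b where k: "k = inc a \<otimes>\<^sub>a inc b" and [simp]: "a \<in> E" "b \<in> E" by blast
    have "((d +\<^sub>a d \<cdot> \<sigma>\<^sub>a S S) \<cdot> (gencl \<otimes>\<^sub>a gencl)) \<cdot> (inc a \<otimes>\<^sub>a inc b) =
        d \<cdot> (e a \<otimes>\<^sub>a e b) +\<^sub>a d \<cdot> \<sigma>\<^sub>a S S \<cdot> (e a \<otimes>\<^sub>a e b)"
      by (simp add: merge e_def)
    also have "\<dots> = HZero C (h \<otimes>\<^sub>o h) S \<cdot> (inc a \<otimes>\<^sub>a inc b)"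
      by (simp add: Symm_nat bracket_antisymmetric_gens)
    finally show "((d +\<^sub>a d \<cdot> \<sigma>\<^sub>a S S) \<cdot> (gencl \<otimes>\<^sub>a gencl)) \<cdot> k = HZero C (h \<otimes>\<^sub>o h) S \<cdot> k" by (simp only: k)
  qed simp_all
qed

text \<open>Either the inner bracket vanishes, or it is a product of contractions of
  \<open>e b\<close> with \<open>e f\<close>. In the second case \<open>e a\<close> brackets to zero
  with both ingredients, so \<open>bracket_mm_zero\<close> and the Leibniz rule apply.\<close>

lemma bracket_bracket_zero:
  assumes abc [simp]: "a \<in> E" "b \<in> E" "f \<in> E" and "\<not> (in_involution b f \<and> (in_involution a b \<or> in_involution a f))"
  shows "d \<cdot> (e a \<otimes>\<^sub>a (d \<cdot> (e b \<otimes>\<^sub>a e f))) = HZero C (X a \<otimes>\<^sub>o X b \<otimes>\<^sub>o X f) S"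
proof (cases "in_involution b f")
  case False
  then show ?thesis by (simp add: bracket_zero)
next
  case True
  then have zero: "d \<cdot> (e a \<otimes>\<^sub>a e b) = HZero C (X a \<otimes>\<^sub>o X b) S" "d \<cdot> (e a \<otimes>\<^sub>a e f) = HZero C (X a \<otimes>\<^sub>o X f) S"
    using assms by (auto intro: bracket_zero)
  let ?A = "c (src b)" and ?A' = "cd (src b)" and ?B = "c (tgt b)" and ?B' = "cd (tgt b)"
  let ?V = "mm ?A ?A' ?B ?B' (e b) (e f) (coev (tgt b))" and ?U = "mm ?B ?B' ?A ?A' (e f) (e b) (coev (src b))"
  have X: "X b = ?A \<otimes>\<^sub>o ?B'" "X f = ?B \<otimes>\<^sub>o ?A'"
    by (simp_all add: arrow_object_def in_involution_ends[OF True])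
  have U: "d \<cdot> (e a \<otimes>\<^sub>a ?U) = HZero C (X a \<otimes>\<^sub>o ?B \<otimes>\<^sub>o ?B') S" and V: "d \<cdot> (e a \<otimes>\<^sub>a ?V) = HZero C (X a \<otimes>\<^sub>o ?A \<otimes>\<^sub>o ?A') S"
    by (rule bracket_mm_zero[OF bider]; use zero X in simp)+
  have M: "?U \<in> Arr C" "Dom C ?U = ?B \<otimes>\<^sub>o ?B'" "Cod C ?U = S" "?V \<in> Arr C" "Dom C ?V = ?A \<otimes>\<^sub>o ?A'" "Cod C ?V = S"
    using X by simp_all
  have "d \<cdot> (e a \<otimes>\<^sub>a (\<mu> \<cdot> (?V \<otimes>\<^sub>a ?U))) = HZero C (X a \<otimes>\<^sub>o (?A \<otimes>\<^sub>o ?A') \<otimes>\<^sub>o ?B \<otimes>\<^sub>o ?B') S"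
  proof (rule ext_el3)
    fix \<Gamma> x v u
    assume el: "ctx C \<Gamma>" "ctx.el C \<Gamma> (X a) x" "ctx.el C \<Gamma> (?A \<otimes>\<^sub>o ?A') v" "ctx.el C \<Gamma> (?B \<otimes>\<^sub>o ?B') u" and dj: "dj x v" "dj x u" "dj v u"
    interpret K: bctx C R h S \<iota> \<Gamma> d by (rule bctxI[OF el(1) bider])
    have "ap (d \<cdot> (e a \<otimes>\<^sub>a ?U)) (K.eprod x u) = ap (HZero C (X a \<otimes>\<^sub>o ?B \<otimes>\<^sub>o ?B') S) (K.eprod x u)"
      "ap (d \<cdot> (e a \<otimes>\<^sub>a ?V)) (K.eprod x v) = ap (HZero C (X a \<otimes>\<^sub>o ?A \<otimes>\<^sub>o ?A') S) (K.eprod x v)"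
      by (simp_all only: U V)
    then have "K.br (ap (e a) x) (ap ?U u) = K.ezero S (fst x \<union> fst u)" "K.br (ap (e a) x) (ap ?V v) = K.ezero S (fst x \<union> fst v)"
      using el dj M by (simp_all add: K.br_def)
    then have "K.br (ap (e a) x) (K.mul (ap ?V v) (ap ?U u)) = K.ezero S (fst x \<union> (fst v \<union> fst u))"
      using el dj dj[THEN dj_sym] M dj[unfolded dj_def] dj[THEN dj_sym, unfolded dj_def]
      by (simp add: K.br_mul_right Int_Un_distrib Int_Un_distrib2 K.mul_ezero K.eadd_ezero Un_ac)
    then show "ap (d \<cdot> (e a \<otimes>\<^sub>a (\<mu> \<cdot> (?V \<otimes>\<^sub>a ?U)))) (K.eprod x (K.eprod v u)) =
        ap (HZero C (X a \<otimes>\<^sub>o (?A \<otimes>\<^sub>o ?A') \<otimes>\<^sub>o ?B \<otimes>\<^sub>o ?B') S) (K.eprod x (K.eprod v u))"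
      using el dj M by (simp add: K.br_def K.mul_def)
  qed (use M in simp_all)
  from Comp_tail[OF this, of "id\<^sub>a (X a) \<otimes>\<^sub>a twist ?A ?B' ?B ?A'"]
  have "d \<cdot> (e a \<otimes>\<^sub>a (\<mu> \<cdot> (?V \<otimes>\<^sub>a ?U) \<cdot> twist ?A ?B' ?B ?A')) = HZero C (X a \<otimes>\<^sub>o X b \<otimes>\<^sub>o X f) S"
    using M by (simp add: merge X)
  then show ?thesis
    unfolding bracket_involution[OF abc(2,3) True] using M by (simp add: X HSmult_HZero)
qed

lemma jacobi_gens:
  assumes d: "bctx C R h S \<iota> \<Gamma> d" and abf: "a \<in> E" "b \<in> E" "f \<in> E"
    and xyz: "ctx.el C \<Gamma> (X a) x" "ctx.el C \<Gamma> (X b) y" "ctx.el C \<Gamma> (X f) z" and dj: "dj x y" "dj x z" "dj y z"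
  shows "bctx.jac C \<Gamma> d (ap (e a) x) (ap (e b) y) (ap (e f) z) = lctx.ezero C \<Gamma> S (fst x \<union> fst y \<union> fst z)"
proof -
  interpret K: bctx C R h S \<iota> \<Gamma> d by (rule d)
  have zero: "K.br (ap (e a) x) (K.br (ap (e b) y) (ap (e f) z)) = K.ezero S (fst x \<union> (fst y \<union> fst z))"
    if "a \<in> E" "b \<in> E" "f \<in> E" "K.el (X a) x" "K.el (X b) y" "K.el (X f) z" "dj x y" "dj x z" "dj y z"
      "\<not> (in_involution b f \<and> (in_involution a b \<or> in_involution a f))" for a b f x y z
  proof -
    have "ap (d \<cdot> (e a \<otimes>\<^sub>a (d \<cdot> (e b \<otimes>\<^sub>a e f)))) (K.eprod x (K.eprod y z))
        = ap (HZero C (X a \<otimes>\<^sub>o X b \<otimes>\<^sub>o X f) S) (K.eprod x (K.eprod y z))"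
      by (simp only: bracket_bracket_zero[OF that(1-3,10)])
    then show ?thesis using that by (simp add: K.br_def)
  qed
  have anti: "K.br s t \<boxplus> K.br t s = K.ezero S (fst s \<union> fst t)" if "K.el S s" "K.el S t" "dj s t" for s t
  proof -
    have "ap (d +\<^sub>a d \<cdot> \<sigma>\<^sub>a S S) (K.eprod s t) = ap (HZero C (S \<otimes>\<^sub>o S) S) (K.eprod s t)" by (simp only: antisymmetric)
    then show ?thesis using that by (simp add: K.br_def dj_sym)
  qed
  \<comment> \<open>The term in which the two elements from the same arrow are bracketed first is
    zero. Of the other two, \<open>bracket_aab\<close> rewrites one so that they share the outer
    argument, and then antisymmetry applies inside.\<close>
  have aba: "K.jac (ap (e a) x) (ap (e b) y) (ap (e a) z) = K.ezero S (fst x \<union> fst y \<union> fst z)"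
    if ab: "a \<in> E" "b \<in> E" "in_involution a b" and el: "K.el (X a) x" "K.el (X b) y" "K.el (X a) z" and dj: "dj x y" "dj x z" "dj y z"
    for a b x y z
  proof -
    note [simp] = ab el dj dj[THEN dj_sym]
    have X: "c (src a) \<otimes>\<^sub>o cd (tgt a) = X a" "c (tgt a) \<otimes>\<^sub>o cd (src a) = X b"
      by (simp_all add: arrow_object_def in_involution_ends[OF ab(3)])
    let ?x = "ap (e a) x" and ?y = "ap (e b) y" and ?z = "ap (e a) z"
    have "ap (d \<cdot> (e a \<otimes>\<^sub>a (d \<cdot> (e a \<otimes>\<^sub>a e b)))) (K.eprod x (K.eprod z y)) =
        ap ((d \<cdot> (e a \<otimes>\<^sub>a (d \<cdot> (e a \<otimes>\<^sub>a e b)))) \<cdot> swap_front C (X a) (X a) (X b)) (K.eprod x (K.eprod z y))"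
      by (rule arg_cong[where f = "\<lambda>k. ap k (K.eprod x (K.eprod z y))", OF arrow_pair.bracket_aab[OF arrow_pair_involution[OF ab], unfolded X]])
    then have "K.br ?x (K.br ?z ?y) = K.br ?z (K.br ?x ?y)"
      by (simp add: K.br_def)
    moreover have "K.br ?y (K.br ?z ?x) = K.ezero S (fst x \<union> fst y \<union> fst z)"
      using zero[of b a a y z x] by (simp add: Un_ac in_involution_irrefl)
    ultimately have "K.jac ?x ?y ?z = K.br ?x (K.br ?y ?z) \<boxplus> K.br ?x (K.br ?z ?y)"
      by (simp add: K.jac_def K.eadd_ezero Un_ac)
    also have "\<dots> = K.br ?x (K.br ?y ?z \<boxplus> K.br ?z ?y)"
      by (simp add: K.br_eadd Un_ac)
    also have "\<dots> = K.ezero S (fst x \<union> fst y \<union> fst z)"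
      using dj[unfolded dj_def] dj[THEN dj_sym, unfolded dj_def]
      by (simp add: anti K.br_ezero Int_Un_distrib Int_Un_distrib2 Un_ac)
    finally show ?thesis .
  qed
  note [simp] = abf xyz dj dj[THEN dj_sym]
  \<comment> \<open>A nonvanishing term needs two of the three cyclically adjacent pairs to be in
    involution. As partners are unique, the first and last arrow of such a chain then coincide, and
    each of the first three cases is a rotation of the pattern in \<open>aba\<close>.\<close>
  consider "in_involution a b" "in_involution b f" | "in_involution b f" "in_involution f a" | "in_involution f a" "in_involution a b"
    | "\<not> (in_involution b f \<and> (in_involution a b \<or> in_involution a f))"
      "\<not> (in_involution f a \<and> (in_involution b f \<or> in_involution b a))"
      "\<not> (in_involution a b \<and> (in_involution f a \<or> in_involution f b))"
    using in_involution_sym by blast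
  then show ?thesis
  proof cases
    case 1
    then have "f = a" by (rule in_involution_unique)
    then show ?thesis using aba[of a b x y z] 1 xyz by simp
  next
    case 2
    then have "a = b" by (rule in_involution_unique)
    then show ?thesis using aba[of b f y z x] 2 xyz K.jac_rotate[of "ap (e a) x" "ap (e b) y" "ap (e f) z"] by (simp add: Un_ac)
  next
    case 3
    then have "b = f" by (rule in_involution_unique)
    then show ?thesis using aba[of f a z x y] 3 xyz K.jac_rotate[of "ap (e f) z" "ap (e a) x" "ap (e b) y"] by (simp add: Un_ac)
  next
    case 4
    then show ?thesis
      by (simp add: K.jac_def zero K.eadd_ezero Un_ac)
  qed
qed

lemma jacobi: "d \<cdot> (id\<^sub>a S \<otimes>\<^sub>a d) \<cdot> cyclic_sum C S = HZero C (S \<otimes>\<^sub>o S \<otimes>\<^sub>o S) S"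
proof (rule jacobi_from_generators[OF bider antisymmetric])
  have cyc [simp]: "cyclic_sum C S \<in> Arr C" "Dom C (cyclic_sum C S) = S \<otimes>\<^sub>o S \<otimes>\<^sub>o S" "Cod C (cyclic_sum C S) = S \<otimes>\<^sub>o S \<otimes>\<^sub>o S"
    by (simp_all add: cyclic_sum_def cyclic_perm_def)
  show "(d \<cdot> (id\<^sub>a S \<otimes>\<^sub>a d) \<cdot> cyclic_sum C S) \<cdot> (gencl \<otimes>\<^sub>a gencl \<otimes>\<^sub>a gencl) = HZero C (h \<otimes>\<^sub>o h \<otimes>\<^sub>o h) S"
  proof (rule stable_epi_ext[OF stable_epi_TensA[OF epi stable_epi_TensA[OF epi epi]]])
    fix k
    assume "k \<in> {i \<otimes>\<^sub>a j |i j. i \<in> inc ` E \<and> j \<in> {i \<otimes>\<^sub>a j |i j. i \<in> inc ` E \<and> j \<in> inc ` E}}"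
    then obtain a b f where k: "k = inc a \<otimes>\<^sub>a inc b \<otimes>\<^sub>a inc f" and [simp]: "a \<in> E" "b \<in> E" "f \<in> E" by blast
    have "(d \<cdot> (id\<^sub>a S \<otimes>\<^sub>a d) \<cdot> cyclic_sum C S) \<cdot> (e a \<otimes>\<^sub>a e b \<otimes>\<^sub>a e f) = HZero C (X a \<otimes>\<^sub>o X b \<otimes>\<^sub>o X f) S" (is "?l = ?r")
    proof (rule ext_el3)
      fix \<Gamma> x y z
      assume el: "ctx C \<Gamma>" "ctx.el C \<Gamma> (X a) x" "ctx.el C \<Gamma> (X b) y" "ctx.el C \<Gamma> (X f) z" and dj: "dj x y" "dj x z" "dj y z"
      interpret K: bctx C R h S \<iota> \<Gamma> d by (rule bctxI[OF el(1) bider])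
      have "ap ?l (K.eprod x (K.eprod y z)) =
          ap (d \<cdot> (id\<^sub>a S \<otimes>\<^sub>a d) \<cdot> cyclic_sum C S) (K.eprod (ap (e a) x) (K.eprod (ap (e b) y) (ap (e f) z)))"
        using el dj by simp
      also have "\<dots> = K.jac (ap (e a) x) (ap (e b) y) (ap (e f) z)"
        by (rule K.ap_jac) (use el dj in simp_all)
      also have "\<dots> = K.ezero S (fst x \<union> fst y \<union> fst z)"
        by (rule jacobi_gens[OF K.bctx_axioms]) (use el dj in simp_all)
      finally show "ap ?l (K.eprod x (K.eprod y z)) = ap ?r (K.eprod x (K.eprod y z))"
        using el dj by (simp add: Un_ac)
    qed simp_all
    then show "((d \<cdot> (id\<^sub>a S \<otimes>\<^sub>a d) \<cdot> cyclic_sum C S) \<cdot> (gencl \<otimes>\<^sub>a gencl \<otimes>\<^sub>a gencl)) \<cdot> k = HZero C (h \<otimes>\<^sub>o h \<otimes>\<^sub>o h) S \<cdot> k"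
      by (simp add: k merge e_def)
  qed simp_all
qed

lemma poisson: "poisson_algebra C S \<mu> (free_unit \<iota>) d"
  unfolding poisson_algebra_def
  using commutative_monoid_S bider jacobi antisymmetric
  by (auto intro!: eq_minusI simp: hom_set_def HAdd_comm[of "d \<cdot> \<sigma>\<^sub>a S S" d])

end

text \<open>For existence, the prescribed components are glued to one arrow on two copies of
  \<open>h\<close>, as tensoring preserves the coproduct, and \<open>bider\<close> extends it to
  \<open>S\<close>. For uniqueness, the inclusions are jointly epic and a bi-derivation is
  determined on generators. The second claim makes the results on \<open>quiver_bracket\<close>
  available for any such bracket.\<close>

lemma (in free_cm) ex1_plus_bracket:
  fixes Q :: "('v, 'e) pre_digraph"
  assumes Q: "fin_digraph Q" and cc: "infinite (UNIV :: 'i set)" "tensor_cocomplete TYPE('i) C"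
    and dual: "\<forall>i \<in> verts (double_quiver Q). duality_data C (c i) (cd i) (ev i) (coev i)"
    and cop: "is_coproduct C (arcs (double_quiver Q)) (arrow_object C Q c cd) h inc"
  shows "\<exists>!d. is_plus_bracket R C Q c cd coev h inc S \<iota> d"
    and "is_plus_bracket R C Q c cd coev h inc S \<iota> d \<Longrightarrow> quiver_bracket C R h S \<iota> Q c cd coev inc d"
proof -
  interpret Q: fin_digraph Q by (rule Q)
  let ?E = "arcs (double_quiver Q)" and ?X = "arrow_object C Q c cd"
  let ?m = "\<lambda>a b. \<iota> 4 \<cdot> tens_arrow C [inc a, inc a, inc b, inc b] \<cdot> kappa_component R C Q c cd coev a b"
  have fin: "finite ?E" by (simp add: double_quiver_def)
  have ends: "tail (double_quiver Q) a \<in> verts Q" "head (double_quiver Q) a \<in> verts Q" if "a \<in> ?E" for a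
    using that by (auto simp: double_quiver_def)
  have c: "c v \<in> Obj C" "cd v \<in> Obj C" "coev v \<in> hom_set C \<I> (c v \<otimes>\<^sub>o cd v)" if "v \<in> verts Q" for v
    using dual that by (auto simp: duality_data_def double_quiver_def)
  have coev [simp]: "coev v \<in> Arr C" "Dom C (coev v) = \<I>" "Cod C (coev v) = c v \<otimes>\<^sub>o cd v" if "v \<in> verts Q" for v
    using c(3)[OF that] by (auto simp: hom_set_def)
  have inc: "inc a \<in> hom_set C (?X a) h" if "a \<in> ?E" for a using coproductD(2)[OF cop that] .
  then have inc' [simp]: "inc a \<in> Arr C" "Dom C (inc a) = ?X a" "Cod C (inc a) = h" if "a \<in> ?E" for a
    using that by (auto simp: hom_set_def)
  have X [simp]: "?X a \<in> Obj C" if "a \<in> ?E" for a using ends[OF that] c by (simp add: arrow_object_def)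
  have epi: "stable_epi (inc ` ?E) h" by (rule stable_epi_coproduct[OF cc cop fin])
  show "quiver_bracket C R h S \<iota> Q c cd coev inc d" if "is_plus_bracket R C Q c cd coev h inc S \<iota> d"
    by unfold_locales (use c inc epi that in auto)
  have scal: "arrow_pairing R a b \<in> carrier R" for a b :: "'e + 'e" by (simp add: arrow_pairing_def)
  have kap: "kappa_component R C Q c cd coev a b \<in> Arr C" "Dom C (kappa_component R C Q c cd coev a b) = ?X a \<otimes>\<^sub>o ?X b"
    "Cod C (kappa_component R C Q c cd coev a b) = tens C [?X a, ?X a, ?X b, ?X b]" if "a \<in> ?E" "b \<in> ?E" for a b
    using that ends[OF that(1)] ends[OF that(2)] c scal
    by (simp_all add: kappa_component_def Let_def arrow_object_def in_involution_ends del: tens.simps)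
  have "?m a b \<in> hom_set C (?X a \<otimes>\<^sub>o ?X b) S" if "a \<in> ?E" "b \<in> ?E" for a b
    using that by (simp add: hom_set_def kap numeral_eq_Suc)
  then obtain \<beta> where \<beta>: "\<beta> \<in> hom_set C (h \<otimes>\<^sub>o h) S" "\<And>a b. \<lbrakk>a \<in> ?E; b \<in> ?E\<rbrakk> \<Longrightarrow> \<beta> \<cdot> (inc a \<otimes>\<^sub>a inc b) = ?m a b"
    using coproduct_TensO_ex[OF cc cop fin, of ?m S] by auto
  have \<beta>' [simp]: "\<beta> \<in> Arr C" "Dom C \<beta> = h \<otimes>\<^sub>o h" "Cod C \<beta> = S" using \<beta>(1) by (auto simp: hom_set_def)
  have gens: "d \<cdot> ((gencl \<cdot> inc a) \<otimes>\<^sub>a (gencl \<cdot> inc b)) = (d \<cdot> (gencl \<otimes>\<^sub>a gencl)) \<cdot> (inc a \<otimes>\<^sub>a inc b)"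
    if "a \<in> ?E" "b \<in> ?E" "bi_derivation C S \<mu> (free_unit \<iota>) d" for a b d
    using that bi_derivation_arr[OF that(3)] by (simp add: merge)
  show "\<exists>!d. is_plus_bracket R C Q c cd coev h inc S \<iota> d"
  proof (rule ex1I)
    note bd = bi_derivation_bider[OF \<beta>']
    show "is_plus_bracket R C Q c cd coev h inc S \<iota> (bider \<beta>)"
      unfolding is_plus_bracket_def
    proof (intro conjI ballI)
      fix a b
      assume ab: "a \<in> ?E" "b \<in> ?E"
      show "bider \<beta> \<cdot> ((gencl \<cdot> inc a) \<otimes>\<^sub>a (gencl \<cdot> inc b)) = ?m a b"
        by (simp only: gens[OF ab bd(1)] bd(2) \<beta>(2)[OF ab])
    qed (fact bd(1))
    fix d
    assume d: "is_plus_bracket R C Q c cd coev h inc S \<iota> d"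
    then have bd': "bi_derivation C S \<mu> (free_unit \<iota>) d" by (simp add: is_plus_bracket_def)
    note [simp] = bi_derivation_arr[OF bd']
    have "d \<cdot> (gencl \<otimes>\<^sub>a gencl) = \<beta>"
    proof (rule stable_epi_ext[OF stable_epi_TensA[OF epi epi]])
      fix k
      assume "k \<in> {i \<otimes>\<^sub>a j |i j. i \<in> inc ` ?E \<and> j \<in> inc ` ?E}"
      then obtain a b where k: "k = inc a \<otimes>\<^sub>a inc b" and ab: "a \<in> ?E" "b \<in> ?E" by blast
      have "(d \<cdot> (gencl \<otimes>\<^sub>a gencl)) \<cdot> (inc a \<otimes>\<^sub>a inc b) = ?m a b"
        using d ab by (simp only: gens[OF ab bd', symmetric] is_plus_bracket_def)
      then show "(d \<cdot> (gencl \<otimes>\<^sub>a gencl)) \<cdot> k = \<beta> \<cdot> k" by (simp only: k \<beta>(2)[OF ab])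
    qed simp_all
    then show "d = bider \<beta>"
      by (intro bi_derivation_unique[OF bd' bd(1)]) (simp add: bd(2))
  qed
qed

theorem proposition3p10:
  fixes R :: "('r, 'y) ring_scheme"
    and Q :: "('v, 'e) pre_digraph"
    and C :: "('r, 'o, 'm, 'x) lsmcat_scheme"
    and c cd :: "'v \<Rightarrow> 'o" and ev coev :: "'v \<Rightarrow> 'm"
    and h S :: 'o and inc :: "'e + 'e \<Rightarrow> 'm" and \<iota> :: "nat \<Rightarrow> 'm"
  assumes "cring R"
    and "fin_digraph Q"
    and "linear_symmetric_monoidal_category R C"
    and "infinite (UNIV :: 'i set)" and "tensor_cocomplete TYPE('i) C"
    and "\<forall>i \<in> verts (double_quiver Q). duality_data C (c i) (cd i) (ev i) (coev i)"
    and "is_coproduct C (arcs (double_quiver Q)) (arrow_object C Q c cd) h inc"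
    and "is_free_comm_monoid C h S \<iota>"
  shows "(\<exists>!d. is_plus_bracket R C Q c cd coev h inc S \<iota> d) \<and>
    poisson_algebra C S (free_mult C h S \<iota>) (free_unit \<iota>) (plus_bracket R C Q c cd coev h inc S \<iota>)"
proof -
  interpret free_cm C R h S \<iota> by (rule free_cm_of_cocomplete[OF assms(3-5,8)])
  note ex1 = ex1_plus_bracket(1)[OF assms(2,4-7)]
  have "is_plus_bracket R C Q c cd coev h inc S \<iota> (plus_bracket R C Q c cd coev h inc S \<iota>)"
    unfolding plus_bracket_def by (rule theI'[OF ex1])
  then interpret quiver_bracket C R h S \<iota> Q c cd coev inc "plus_bracket R C Q c cd coev h inc S \<iota>"
    by (rule ex1_plus_bracket(2)[OF assms(2,4-7)])
  show ?thesis using ex1 poisson by blast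
qed

end
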